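(* Let $n\ge2$, $0\le\alpha<1$, $0<p,q\le\infty$, $s_p=(n-1)\big(\tfrac{1}{p\wedge1}-1\big)$, and let $s<\alpha(n-1)/q+\alpha s_p$. Let $\varepsilon>0$ be arbitrary and put $$\sigma_{\alpha,p,q}=\begin{cases}\dfrac{\alpha}{p}+(1-\alpha)\Big[\dfrac{\alpha(n-1)}{q}+\alpha s_p-s\Big], & qs+(n-1)(1-\alpha)-q\alpha s_p>0,\\[2mm] \dfrac{\alpha}{p}+\alpha s_p-s+\varepsilon, & qs+(n-1)(1-\alpha)-q\alpha s_p=0,\\[2mm] \dfrac{\alpha}{p}+\alpha s_p-s, & qs+(n-1)(1-\alpha)-q\alpha s_p<0.\end{cases}$$ Then the trace operator $\mathrm{Tr}: f(x)\mapsto f(\bar x,0)$, $\bar x=(x_1,\dots,x_{n-1})$, is bounded $$\mathrm{Tr}:\ M^{s+\sigma_{\alpha,p,q},\,\alpha}_{p,\,p\wedge q\wedge1}(\mathbb{R}^n)\to M^{s,\alpha}_{p,q}(\mathbb{R}^{n-1}),$$ i.e. it maps the first space into the second and there is a constant $C>0$ such that $\|\mathrm{Tr}f\|_{M^{s,\alpha}_{p,q}(\mathbb{R}^{n-1})}\le C\|f\|_{M^{s+\sigma_{\alpha,p,q},\alpha}_{p,p\wedge q\wedge1}(\mathbb{R}^n)}$ for all $f$ in the first space.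
   Context: Notation: $a\wedge b=\min(a,b)$, $\langle x\rangle=(1+|x|^2)^{1/2}$; $\mathscr{F},\mathscr{F}^{-1}$ are the Fourier transform and its inverse. When $q=\infty$, the sign of $qs+(n-1)(1-\alpha)-q\alpha s_p$ is understood as the sign of $s+(n-1)(1-\alpha)/q-\alpha s_p=s-\alpha s_p$. $\alpha$-modulation spaces: let $0\le\alpha<1$ and let $\eta:\mathbb{R}\to[0,1]$ be smooth with $\eta(t)=1$ for $|t|\le1$ and $\eta(t)=0$ for $|t|\ge2$. In dimension $d$, for $k\in\mathbb{Z}^d$ put $$\Phi_k(\xi)=\prod_{i=1}^d\eta\Big(\frac{\xi_i-|k|^{\alpha/(1-\alpha)}k_i}{\rho\langle k\rangle^{\alpha/(1-\alpha)}}\Big),\qquad \psi_k=\frac{\Phi_k}{\sum_{m\in\mathbb{Z}^d}\Phi_m},\qquad \Box^\alpha_k=\mathscr{F}^{-1}\psi_k\mathscr{F},$$ where $\rho>0$ is a fixed constant, sufficiently large depending on $d$ and $\alpha$, so that the cubes with center $|k|^{\alpha/(1-\alpha)}k$ and side-length $2\rho\langle k\rangle^{\alpha/(1-\alpha)}$, $k\in\mathbb{Z}^d$, cover $\mathbb{R}^d$. The space $M^{s,\alpha}_{p,q}(\mathbb{R}^d)$ ($0<p,q\le\infty$, $s\in\mathbb{R}$) consists of all tempered distributions $f$ with $$\|f\|_{M^{s,\alpha}_{p,q}}=\Big(\sum_{k\in\mathbb{Z}^d}\langle k\rangle^{\frac{qs}{1-\alpha}}\|\Box^\alpha_kf\|^q_{L^p(\mathbb{R}^d)}\Big)^{1/q}<\infty$$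 (supremum if $q=\infty$). Different admissible choices of $\eta,\rho$ give equivalent quasi-norms. Trace: each $\Box^\alpha_kf$ is a smooth function, and for a tempered distribution $f$ on $\mathbb{R}^n$ the trace $f(\bar x,0)$ is understood as $\sum_{k\in\mathbb{Z}^n}(\Box^\alpha_kf)(\bar x,0)$, with convergence in $\mathscr{S}'(\mathbb{R}^{n-1})$. *)

theory Defs
  imports "HOL-Analysis.Analysis" "HOL-Probability.Essential_Supremum"
begin

section \<open>Schwartz functions and tempered distributions\<close>

text \<open>
  Everything is set up on an arbitrary Euclidean space, whose coordinates are the inner products
  with the elements of \<open>Basis\<close>.
\<close>

definition partial_deriv ::
    "'a::euclidean_space \<Rightarrow> ('a \<Rightarrow> 'b::real_normed_vector) \<Rightarrow> 'a \<Rightarrow> 'b" where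
  "partial_deriv b f x = vector_derivative (\<lambda>t. f (x + t *\<^sub>R b)) (at 0)"

definition iter_partial_deriv ::
    "'a::euclidean_space list \<Rightarrow> ('a \<Rightarrow> 'b::real_normed_vector) \<Rightarrow> 'a \<Rightarrow> 'b" where
  "iter_partial_deriv bs f = foldr partial_deriv bs f"

text \<open>Differentiability of all iterated partial derivatives makes all of them continuous.\<close>

definition smooth_fun :: "('a::euclidean_space \<Rightarrow> 'b::real_normed_vector) \<Rightarrow> bool" where
  "smooth_fun f \<longleftrightarrow>
     (\<forall>bs x. set bs \<subseteq> Basis \<longrightarrow> iter_partial_deriv bs f differentiable (at x))"

definition schwartz_values :: "nat \<Rightarrow> ('a::euclidean_space \<Rightarrow> complex) \<Rightarrow> real set" where
  "schwartz_values N \<phi> =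
     {(1 + norm x) ^ N * norm (iter_partial_deriv bs \<phi> x) |bs x. set bs \<subseteq> Basis \<and> length bs \<le> N}"

definition schwartz :: "('a::euclidean_space \<Rightarrow> complex) set" where
  "schwartz = {\<phi>. smooth_fun \<phi> \<and> (\<forall>N. bdd_above (schwartz_values N \<phi>))}"

definition schwartz_seminorm :: "nat \<Rightarrow> ('a::euclidean_space \<Rightarrow> complex) \<Rightarrow> real" where
  "schwartz_seminorm N \<phi> = Sup (schwartz_values N \<phi>)"

text \<open>
  A distribution is a functional on all functions of which only the values on \<open>schwartz\<close> matter.
  The seminorms increase with \<open>N\<close>, so continuity means domination by one of them.
\<close>

type_synonym 'a distr = "('a \<Rightarrow> complex) \<Rightarrow> complex"

definition tempered_distribution :: "'a::euclidean_space distr \<Rightarrow> bool" where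
  "tempered_distribution T \<longleftrightarrow>
     (\<forall>\<phi>\<in>schwartz. \<forall>\<psi>\<in>schwartz. T (\<lambda>x. \<phi> x + \<psi> x) = T \<phi> + T \<psi>) \<and>
     (\<forall>c. \<forall>\<phi>\<in>schwartz. T (\<lambda>x. c * \<phi> x) = c * T \<phi>) \<and>
     (\<exists>N C. \<forall>\<phi>\<in>schwartz. norm (T \<phi>) \<le> C * schwartz_seminorm N \<phi>)"

definition represents :: "('a::euclidean_space \<Rightarrow> complex) \<Rightarrow> 'a distr \<Rightarrow> bool" where
  "represents g T \<longleftrightarrow>
     (\<forall>\<phi>\<in>schwartz. integrable lborel (\<lambda>x. g x * \<phi> x) \<and> T \<phi> = (LINT x|lborel. g x * \<phi> x))"

text \<open>There is at most one smooth function representing a given distribution.\<close>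

definition smooth_representative :: "'a::euclidean_space distr \<Rightarrow> 'a \<Rightarrow> complex" where
  "smooth_representative T = (THE g. smooth_fun g \<and> represents g T)"


section \<open>Fourier transform\<close>

definition fourier :: "('a::euclidean_space \<Rightarrow> complex) \<Rightarrow> 'a \<Rightarrow> complex" where
  "fourier \<phi> \<xi> = (2 * pi) powr (- real DIM('a) / 2) *\<^sub>R (LINT x|lborel. cis (- (x \<bullet> \<xi>)) * \<phi> x)"

definition inverse_fourier :: "('a::euclidean_space \<Rightarrow> complex) \<Rightarrow> 'a \<Rightarrow> complex" where
  "inverse_fourier \<phi> x = (2 * pi) powr (- real DIM('a) / 2) *\<^sub>R (LINT \<xi>|lborel. cis (x \<bullet> \<xi>) * \<phi> \<xi>)"

definition fourier_distr :: "'a::euclidean_space distr \<Rightarrow> 'a distr" where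
  "fourier_distr T = (\<lambda>\<phi>. T (fourier \<phi>))"

definition inverse_fourier_distr :: "'a::euclidean_space distr \<Rightarrow> 'a distr" where
  "inverse_fourier_distr T = (\<lambda>\<phi>. T (inverse_fourier \<phi>))"

definition multiply_distr :: "('a::euclidean_space \<Rightarrow> real) \<Rightarrow> 'a distr \<Rightarrow> 'a distr" where
  "multiply_distr m T = (\<lambda>\<phi>. T (\<lambda>\<xi>. of_real (m \<xi>) * \<phi> \<xi>))"


section \<open>Quasi-norms with values in the extended nonnegative reals\<close>

text \<open>Only meant for positive exponents.\<close>

definition ennreal_powr :: "ennreal \<Rightarrow> real \<Rightarrow> ennreal" where
  "ennreal_powr x r = (if x = \<infinity> then \<infinity> else ennreal (enn2real x powr r))"

definition Lp_norm :: "ennreal \<Rightarrow> ('a::euclidean_space \<Rightarrow> complex) \<Rightarrow> ennreal" where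
  "Lp_norm p g =
     (if p = \<infinity> then esssup lborel (\<lambda>x. ennreal (norm (g x)))
      else ennreal_powr (\<integral>\<^sup>+x. ennreal (norm (g x) powr enn2real p) \<partial>lborel) (1 / enn2real p))"


section \<open>Alpha-modulation spaces\<close>

definition jbracket :: "'a::real_normed_vector \<Rightarrow> real" where
  "jbracket x = sqrt (1 + (norm x)\<^sup>2)"

definition int_lattice :: "'a::euclidean_space set" where
  "int_lattice = {k. \<forall>b\<in>Basis. k \<bullet> b \<in> \<int>}"

definition cutoff :: "(real \<Rightarrow> real) \<Rightarrow> bool" where
  "cutoff \<eta> \<longleftrightarrow> smooth_fun \<eta> \<and> range \<eta> \<subseteq> {0..1} \<and>
     (\<forall>t. \<bar>t\<bar> \<le> 1 \<longrightarrow> \<eta> t = 1) \<and> (\<forall>t. \<bar>t\<bar> \<ge> 2 \<longrightarrow> \<eta> t = 0)"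

definition alpha_center :: "real \<Rightarrow> 'a::euclidean_space \<Rightarrow> 'a" where
  "alpha_center \<alpha> k = (norm k powr (\<alpha> / (1 - \<alpha>))) *\<^sub>R k"

definition alpha_radius :: "real \<Rightarrow> real \<Rightarrow> 'a::euclidean_space \<Rightarrow> real" where
  "alpha_radius \<rho> \<alpha> k = \<rho> * jbracket k powr (\<alpha> / (1 - \<alpha>))"

definition admissible_radius :: "'a::euclidean_space itself \<Rightarrow> real \<Rightarrow> real \<Rightarrow> bool" where
  "admissible_radius _ \<rho> \<alpha> \<longleftrightarrow> \<rho> > 0 \<and>
     (\<Union>k\<in>int_lattice. cbox (alpha_center \<alpha> k - alpha_radius \<rho> \<alpha> k *\<^sub>R One)
                         (alpha_center \<alpha> k + alpha_radius \<rho> \<alpha> k *\<^sub>R One)) = (UNIV :: 'a set)"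

definition alpha_bump ::
    "(real \<Rightarrow> real) \<Rightarrow> real \<Rightarrow> real \<Rightarrow> 'a::euclidean_space \<Rightarrow> 'a \<Rightarrow> real" where
  "alpha_bump \<eta> \<rho> \<alpha> k \<xi> = (\<Prod>b\<in>Basis. \<eta> ((\<xi> \<bullet> b - alpha_center \<alpha> k \<bullet> b) / alpha_radius \<rho> \<alpha> k))"

definition alpha_partition ::
    "(real \<Rightarrow> real) \<Rightarrow> real \<Rightarrow> real \<Rightarrow> 'a::euclidean_space \<Rightarrow> 'a \<Rightarrow> real" where
  "alpha_partition \<eta> \<rho> \<alpha> k \<xi> =
     alpha_bump \<eta> \<rho> \<alpha> k \<xi> / (\<Sum>\<^sub>\<infinity>m\<in>int_lattice. alpha_bump \<eta> \<rho> \<alpha> m \<xi>)"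

definition alpha_box ::
    "(real \<Rightarrow> real) \<Rightarrow> real \<Rightarrow> real \<Rightarrow> 'a::euclidean_space \<Rightarrow> 'a distr \<Rightarrow> 'a \<Rightarrow> complex" where
  "alpha_box \<eta> \<rho> \<alpha> k f =
     smooth_representative
       (inverse_fourier_distr (multiply_distr (alpha_partition \<eta> \<rho> \<alpha> k) (fourier_distr f)))"

definition modulation_norm ::
    "(real \<Rightarrow> real) \<Rightarrow> real \<Rightarrow> real \<Rightarrow> real \<Rightarrow> ennreal \<Rightarrow> ennreal \<Rightarrow>
     'a::euclidean_space distr \<Rightarrow> ennreal" where
  "modulation_norm \<eta> \<rho> \<alpha> s p q f =
     (if q = \<infinity>
      then (SUP k\<in>int_lattice.
              ennreal (jbracket k powr (s / (1 - \<alpha>))) * Lp_norm p (alpha_box \<eta> \<rho> \<alpha> k f))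
      else ennreal_powr
             (\<Sum>\<^sub>\<infinity>k\<in>int_lattice.
                ennreal (jbracket k powr (enn2real q * s / (1 - \<alpha>))) *
                ennreal_powr (Lp_norm p (alpha_box \<eta> \<rho> \<alpha> k f)) (enn2real q))
             (1 / enn2real q))"

definition modulation_space ::
    "(real \<Rightarrow> real) \<Rightarrow> real \<Rightarrow> real \<Rightarrow> real \<Rightarrow> ennreal \<Rightarrow> ennreal \<Rightarrow>
     'a::euclidean_space distr set" where
  "modulation_space \<eta> \<rho> \<alpha> s p q =
     {f. tempered_distribution f \<and> modulation_norm \<eta> \<rho> \<alpha> s p q f < \<infinity>}"


section \<open>Trace on the hyperplane where the last coordinate vanishes\<close>

text \<open>
  The last coordinate is split off as the second component of \<open>'a \<times> real\<close>. The series defining the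
  trace has no preferred order of summation; its convergence in the space of tempered
  distributions is unconditional convergence after pairing with each Schwartz function.
\<close>

definition trace_term ::
    "(real \<Rightarrow> real) \<Rightarrow> real \<Rightarrow> real \<Rightarrow> ('a::euclidean_space \<times> real) distr \<Rightarrow>
     'a \<times> real \<Rightarrow> 'a \<Rightarrow> complex" where
  "trace_term \<eta> \<rho> \<alpha> f k x = alpha_box \<eta> \<rho> \<alpha> k f (x, 0)"

definition trace_converges ::
    "(real \<Rightarrow> real) \<Rightarrow> real \<Rightarrow> real \<Rightarrow> ('a::euclidean_space \<times> real) distr \<Rightarrow> bool" where
  "trace_converges \<eta> \<rho> \<alpha> f \<longleftrightarrow>
     (\<forall>\<phi>\<in>schwartz.
        (\<forall>k\<in>int_lattice. integrable lborel (\<lambda>x. trace_term \<eta> \<rho> \<alpha> f k x * \<phi> x)) \<and>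
        (\<lambda>k. LINT x|lborel. trace_term \<eta> \<rho> \<alpha> f k x * \<phi> x) summable_on int_lattice)"

definition trace_distr ::
    "(real \<Rightarrow> real) \<Rightarrow> real \<Rightarrow> real \<Rightarrow> ('a::euclidean_space \<times> real) distr \<Rightarrow> 'a distr" where
  "trace_distr \<eta> \<rho> \<alpha> f =
     (\<lambda>\<phi>. \<Sum>\<^sub>\<infinity>k\<in>int_lattice. LINT x|lborel. trace_term \<eta> \<rho> \<alpha> f k x * \<phi> x)"


section \<open>Exponents\<close>

text \<open>
  The terms \<open>1 / p\<close> and \<open>1 / q\<close> are formed in \<open>ennreal\<close>, where \<open>1 / \<infinity> = 0\<close>, before the conversion
  to \<open>real\<close>; the conversion itself would send \<open>\<infinity>\<close> to \<open>0\<close>.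
\<close>

definition s_crit :: "nat \<Rightarrow> ennreal \<Rightarrow> real" where
  "s_crit n p = (real n - 1) * (1 / enn2real (min p 1) - 1)"

definition trace_sign :: "nat \<Rightarrow> real \<Rightarrow> ennreal \<Rightarrow> ennreal \<Rightarrow> real \<Rightarrow> real" where
  "trace_sign n \<alpha> p q s =
     (if q = \<infinity> then s - \<alpha> * s_crit n p
      else enn2real q * s + (real n - 1) * (1 - \<alpha>) - enn2real q * \<alpha> * s_crit n p)"

definition trace_loss :: "nat \<Rightarrow> real \<Rightarrow> ennreal \<Rightarrow> ennreal \<Rightarrow> real \<Rightarrow> real \<Rightarrow> real" where
  "trace_loss n \<alpha> p q s \<epsilon> =
     (if trace_sign n \<alpha> p q s > 0 then
        \<alpha> * enn2real (1 / p) +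
        (1 - \<alpha>) * (\<alpha> * (real n - 1) * enn2real (1 / q) + \<alpha> * s_crit n p - s)
      else if trace_sign n \<alpha> p q s = 0 then
        \<alpha> * enn2real (1 / p) + \<alpha> * s_crit n p - s + \<epsilon>
      else
        \<alpha> * enn2real (1 / p) + \<alpha> * s_crit n p - s)"

end

theory Submission
  imports Defs "HOL-Probability.Characteristic_Functions"
begin

text \<open>
  The frequency piece \<open>g\<^sub>k\<close> of \<open>f\<close> lives in a cube of size \<open>R\<^sub>k \<sim> \<langle>k\<rangle>\<^bsup>\<beta>\<^esup>\<close>, \<open>\<beta> = \<alpha>/(1-\<alpha>)\<close>, so a rescaled bump
  reproduces it by convolution, up to a nonzero constant. Bootstrapping this from polynomial growth
  as in Peetre's maximal inequality gives mean value inequalities for \<open>|g\<^sub>k|\<^bsup>p\<^esup>\<close> with every \<open>p > 0\<close>, and from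
  these, with the kernel \<open>\<kappa>\<^sub>l\<close> of the \<open>l\<close>-th piece on the hyperplane, the \<open>L\<^bsup>p\<^esup>\<close> norm of \<open>\<kappa>\<^sub>l * g\<^sub>k(\<cdot>,0)\<close> is at
  most a constant times \<open>R\<^sub>k\<^bsup>1/p\<^esup> (R\<^sub>k/R\<^sub>l)\<^bsup>s_p\<^esup>\<close> times that of \<open>g\<^sub>k\<close>. The convolution vanishes unless the \<open>l\<close>-th
  cube meets the projection of the \<open>k\<close>-th one, which forces \<open>\<langle>l\<rangle> \<lesssim> \<langle>k\<rangle>\<close>.

  The \<open>r\<close>-triangle inequality with \<open>r = min p (min q 1)\<close> leaves the sums of \<open>\<langle>l\<rangle>\<^bsup>a\<^esup>\<close>, \<open>a = q(s/(1-\<alpha>) - \<beta> s_p)\<close>,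
  over the \<open>l\<close> whose cubes meet a fixed projection. They behave like \<open>\<langle>k\<rangle>\<^bsup>\<alpha>(a+n-1)\<^esup>\<close>, like a logarithm, or stay
  bounded according to the sign of \<open>a + n - 1\<close>; these are the three cases of the loss.
\<close>

section \<open>Calculus: uniformly smooth families, oscillatory integrals, Fourier inversion\<close>

section \<open>Smooth functions\<close>

text \<open>The obstacle is uniformity: each cube has a multiplier of its own shape, yet every
  constant must be common to all cubes. Moved to unit size, the multipliers form one
  \<open>test_family\<close>, because only a fixed finite set of index offsets enters the
  normalising sum and neighbouring radii are comparable. All pieces are written as
  \<open>distr_synth\<close>, the distribution applied to translates of an oscillatory integral; the
  analytic fact behind them is that a distribution may be moved inside an integral over such
  translates, in particular over translates along the hyperplane.

  The factor R_k^{1/p} is the price of replacing an average along a normal line by a point value.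
  The factor (R_k/R_l)^{s_p} differs from 1 only for p < 1: passing from integrals of p-th powers
  back to a plain integral costs R_k^{d(1-p)}, against R_l^{d(p-1)} from height and width of the
  kernel. This uses that the kernel varies slowly at scale 1/R_k, that is, R_l is at most a multiple
  of R_k.

  In the summation the source coefficients serve as Jensen weights, so that for each k only the sum
  over l has to be estimated.\<close>

lemma partial_deriv_eq:
  assumes "(f has_derivative D) (at x)"
  shows "partial_deriv b f x = D b"
proof -
  have "((\<lambda>t. f (x + t *\<^sub>R b)) has_derivative (\<lambda>t. D (t *\<^sub>R b))) (at 0)"
    by (rule has_derivative_compose[of "\<lambda>t. x + t *\<^sub>R b"])
       (use assms in \<open>auto intro!: derivative_eq_intros\<close>)
  moreover have "D (t *\<^sub>R b) = t *\<^sub>R D b" for t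
    using linear_scale[OF has_derivative_linear[OF assms]] .
  ultimately have "((\<lambda>t. f (x + t *\<^sub>R b)) has_vector_derivative D b) (at 0)"
    by (simp add: has_vector_derivative_def)
  then show ?thesis
    by (simp add: partial_deriv_def vector_derivative_at)
qed

lemma partial_deriv_frechet:
  "f differentiable (at x) ==> partial_deriv b f x = frechet_derivative f (at x) b"
  by (rule partial_deriv_eq) (simp add: frechet_derivative_works)

lemma partial_deriv_add:
  assumes "f differentiable (at x)" "g differentiable (at x)"
  shows "partial_deriv b (\<lambda>x. f x + g x) x = partial_deriv b f x + partial_deriv b g x"
  using assms by (subst partial_deriv_eq[OF has_derivative_add])
    (auto simp: frechet_derivative_works partial_deriv_frechet)

lemma partial_deriv_mult:
  fixes f g :: "'a::euclidean_space => 'b::real_normed_field"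
  assumes "f differentiable (at x)" "g differentiable (at x)"
  shows "partial_deriv b (\<lambda>x. f x * g x) x = partial_deriv b f x * g x + f x * partial_deriv b g x"
  using assms by (subst partial_deriv_eq[OF has_derivative_mult])
    (auto simp: frechet_derivative_works partial_deriv_frechet)

lemma partial_deriv_inverse:
  fixes f :: "'a::euclidean_space => 'b::real_normed_field"
  assumes "f differentiable (at x)" "f x ~= 0"
  shows "partial_deriv b (\<lambda>x. inverse (f x)) x = (- 1) * (inverse (f x) * (inverse (f x) * partial_deriv b f x))"
  using partial_deriv_eq[OF Deriv.has_derivative_inverse[OF assms(2) frechet_derivative_works[THEN iffD1, OF assms(1)]]] assms
  by (simp add: partial_deriv_frechet)

lemma partial_deriv_const [simp]: "partial_deriv b (\<lambda>x. c) x = 0"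
  by (rule partial_deriv_eq) simp

lemma partial_deriv_cmult:
  fixes f :: "'a::euclidean_space => 'b::real_normed_field"
  assumes "f differentiable (at x)"
  shows "partial_deriv b (\<lambda>x. c * f x) x = c * partial_deriv b f x"
  using assms by (simp add: partial_deriv_mult)

lemma partial_deriv_of_real:
  fixes f :: "'a::euclidean_space => real"
  assumes "f differentiable (at x)"
  shows "partial_deriv b (\<lambda>x. of_real (f x) :: 'b::real_normed_field) x = of_real (partial_deriv b f x)"
  using assms by (subst partial_deriv_eq[OF has_derivative_of_real])
    (auto simp: frechet_derivative_works partial_deriv_frechet)

lemma partial_deriv_affine:
  fixes f :: "'a::euclidean_space => 'b::real_normed_field"
  assumes "f differentiable (at (A *\<^sub>R x + v))"
  shows "(\<lambda>x. f (A *\<^sub>R x + v)) differentiable (at x)"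
    and "partial_deriv b (\<lambda>x. f (A *\<^sub>R x + v)) x = of_real A * partial_deriv b f (A *\<^sub>R x + v)"
proof -
  let ?D = "frechet_derivative f (at (A *\<^sub>R x + v))"
  have D: "(f has_derivative ?D) (at (A *\<^sub>R x + v))"
    using assms by (simp add: frechet_derivative_works)
  have "((\<lambda>x. f (A *\<^sub>R x + v)) has_derivative (\<lambda>h. ?D (A *\<^sub>R h))) (at x)"
    by (rule has_derivative_compose[of "\<lambda>x. A *\<^sub>R x + v", OF _ D])
       (auto intro!: derivative_eq_intros)
  from partial_deriv_eq[OF this] this show "(\<lambda>x. f (A *\<^sub>R x + v)) differentiable (at x)"
    "partial_deriv b (\<lambda>x. f (A *\<^sub>R x + v)) x = of_real A * partial_deriv b f (A *\<^sub>R x + v)"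
    using linear_scale[OF has_derivative_linear[OF D]] partial_deriv_eq[OF D]
    by (auto simp: differentiable_def scaleR_conv_of_real)
qed

lemma partial_deriv_coordinate:
  fixes f :: "real => 'b::real_normed_field" and e :: "'a::euclidean_space"
  assumes "f differentiable (at (A * (x \<bullet> e) + B))"
  shows "(\<lambda>x. f (A * (x \<bullet> e) + B)) differentiable (at x)"
    and "partial_deriv b (\<lambda>x. f (A * (x \<bullet> e) + B)) x
         = of_real (A * (b \<bullet> e)) * partial_deriv 1 f (A * (x \<bullet> e) + B)"
proof -
  let ?D = "frechet_derivative f (at (A * (x \<bullet> e) + B))"
  have D: "(f has_derivative ?D) (at (A * (x \<bullet> e) + B))"
    using assms by (simp add: frechet_derivative_works)
  have "((\<lambda>x. f (A * (x \<bullet> e) + B)) has_derivative (\<lambda>h. ?D (A * (h \<bullet> e)))) (at x)"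
    by (rule has_derivative_compose[of "\<lambda>x. A * (x \<bullet> e) + B", OF _ D])
       (auto intro!: derivative_eq_intros)
  moreover have "?D (A * (b \<bullet> e)) = of_real (A * (b \<bullet> e)) * ?D 1"
    using linear_scale[OF has_derivative_linear[OF D], of "A * (b \<bullet> e)" 1]
    by (simp add: scaleR_conv_of_real)
  ultimately show "(\<lambda>x. f (A * (x \<bullet> e) + B)) differentiable (at x)"
    "partial_deriv b (\<lambda>x. f (A * (x \<bullet> e) + B)) x
         = of_real (A * (b \<bullet> e)) * partial_deriv 1 f (A * (x \<bullet> e) + B)"
    using partial_deriv_eq[of "\<lambda>x. f (A * (x \<bullet> e) + B)"] partial_deriv_eq[OF D]
    by (auto simp: differentiable_def)
qed

lemma iter_partial_deriv_simps [simp]: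
  "iter_partial_deriv [] f = f"
  "iter_partial_deriv (b # bs) f = partial_deriv b (iter_partial_deriv bs f)"
  "iter_partial_deriv (bs @ [b]) f = iter_partial_deriv bs (partial_deriv b f)"
  by (simp_all add: iter_partial_deriv_def)

lemma smooth_fun_differentiable: "smooth_fun f ==> f differentiable (at x)"
  unfolding smooth_fun_def by (metis empty_set empty_subsetI iter_partial_deriv_simps(1))

lemma smooth_fun_continuous: "smooth_fun f ==> continuous_on S f"
  by (simp add: continuous_at_imp_continuous_on differentiable_imp_continuous_within
      smooth_fun_differentiable)

lemma smooth_fun_partial_deriv:
  fixes f :: "'a::euclidean_space => 'b::real_normed_vector"
  shows "smooth_fun f ==> b \<in> Basis ==> smooth_fun (partial_deriv b f)"
  unfolding smooth_fun_def
proof (intro allI impI)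
  fix bs :: "'a list" and x :: 'a assume "\<forall>bs x. set bs \<subseteq> Basis --> iter_partial_deriv bs f differentiable at x"
    "b \<in> Basis" "set bs \<subseteq> Basis"
  then show "iter_partial_deriv bs (partial_deriv b f) differentiable at x"
    by (metis iter_partial_deriv_simps(3) set_append set_simps(1) list.simps(15) Un_subset_iff
        insert_subset empty_subsetI)
qed

text \<open>Later classes of functions are described by their symbols and are visibly closed under
  differentiation; this turns such a closure into smoothness without writing out iterated
  derivatives.\<close>

lemma smooth_fun_coinduct:
  assumes "X f"
    and "\<And>f x. X f ==> f differentiable (at x)"
    and "\<And>f b. X f ==> b \<in> Basis ==> X (partial_deriv b f)"
  shows "smooth_fun f"
proof -
  have "X f ==> set bs \<subseteq> Basis ==> X (iter_partial_deriv bs f)" for bs f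
    by (induction bs arbitrary: f rule: rev_induct) (auto intro: assms(3))
  then show ?thesis
    unfolding smooth_fun_def using assms(1,2) by blast
qed

text \<open>The bounds may depend on the order m but not on the index i; this is the uniformity that
  gives the kernels of all cubes the same decay constants. Recursion through first partial
  derivatives fits the product and chain rules, so closure properties are inductions on m.\<close>

primrec usmooth ::
    "nat => 'i set => ('i => 'a::euclidean_space => 'b::real_normed_field) => bool" where
  "usmooth 0 I F \<longleftrightarrow> (\<exists>C. \<forall>i\<in>I. \<forall>x. norm (F i x) <= C) \<and> (\<forall>i\<in>I. \<forall>x. F i differentiable (at x))"
| "usmooth (Suc m) I F \<longleftrightarrow>
     (\<exists>C. \<forall>i\<in>I. \<forall>x. norm (F i x) <= C) \<and> (\<forall>i\<in>I. \<forall>x. F i differentiable (at x)) \<and>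
     (\<forall>b\<in>Basis. usmooth m I (\<lambda>i. partial_deriv b (F i)))"

lemma usmooth_cong:
  assumes "\<And>i. i \<in> I ==> F i = G i" shows "usmooth m I F \<longleftrightarrow> usmooth m I G"
  using assms
proof (induction m arbitrary: F G)
  case (Suc m F G)
  have "usmooth m I (\<lambda>i. partial_deriv b (F i)) \<longleftrightarrow> usmooth m I (\<lambda>i. partial_deriv b (G i))" for b
    by (rule Suc.IH) (simp add: Suc.prems)
  then show ?case by (simp add: Suc.prems)
qed simp

lemma usmooth_lower: "usmooth (Suc m) I F ==> usmooth m I F"
  by (induction m arbitrary: F) auto

lemma usmooth_bounded:
  assumes "usmooth m I F" obtains C where "C > 0" "\<And>i x. i \<in> I ==> norm (F i x) <= C"
proof -
  have "\<exists>C. \<forall>i\<in>I. \<forall>x. norm (F i x) <= C"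
    using assms by (cases m) auto
  then obtain C where "\<And>i x. i \<in> I ==> norm (F i x) <= C" by blast
  then show thesis by (intro that[of "max C 1"]) (auto intro: max.coboundedI1)
qed

lemma usmooth_differentiable: "usmooth m I F ==> i \<in> I ==> F i differentiable (at x)"
  by (cases m) auto

lemma usmooth_add:
  "usmooth m I F ==> usmooth m I G ==> usmooth m I (\<lambda>i x. F i x + G i x)"
proof (induction m arbitrary: F G)
  case (0 F G)
  then obtain C D where "\<And>i x. i \<in> I ==> norm (F i x) <= C" "\<And>i x. i \<in> I ==> norm (G i x) <= D"
    by (metis usmooth_bounded)
  then have "\<forall>i\<in>I. \<forall>x. norm (F i x + G i x) <= C + D"
    by (meson norm_triangle_mono)
  with 0 show ?case by (auto intro!: differentiable_add)
next
  case (Suc m F G)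
  have 0: "usmooth 0 I F" "usmooth 0 I G" using Suc.prems by auto
  then obtain C D where "\<And>i x. i \<in> I ==> norm (F i x) <= C" "\<And>i x. i \<in> I ==> norm (G i x) <= D"
    by (metis usmooth_bounded)
  then have "\<forall>i\<in>I. \<forall>x. norm (F i x + G i x) <= C + D"
    by (meson norm_triangle_mono)
  moreover have "usmooth m I (\<lambda>i. partial_deriv b (\<lambda>x. F i x + G i x))" if "b \<in> Basis" for b
  proof -
    have "usmooth m I (\<lambda>i x. partial_deriv b (F i) x + partial_deriv b (G i) x)"
      using Suc that by auto
    then show ?thesis
      by (rule iffD2[OF usmooth_cong, rotated])
         (use Suc.prems in \<open>auto simp: fun_eq_iff intro!: partial_deriv_add\<close>)
  qed
  ultimately show ?case using 0 by (auto intro!: differentiable_add)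
qed

lemma usmooth_mult:
  "usmooth m I F ==> usmooth m I G ==> usmooth m I (\<lambda>i x. F i x * G i x)"
proof (induction m arbitrary: F G)
  case (0 F G)
  then obtain C D where "\<And>i x. i \<in> I ==> norm (F i x) <= C" "\<And>i x. i \<in> I ==> norm (G i x) <= D"
    by (metis usmooth_bounded)
  then have "\<forall>i\<in>I. \<forall>x. norm (F i x * G i x) <= C * D"
    by (auto simp: norm_mult intro!: mult_mono intro: order_trans[OF norm_ge_zero])
  with 0 show ?case by (auto intro!: differentiable_mult)
next
  case (Suc m F G)
  have 0: "usmooth 0 I F" "usmooth 0 I G" "usmooth m I F" "usmooth m I G"
    using Suc.prems usmooth_lower by auto
  then obtain C D where "\<And>i x. i \<in> I ==> norm (F i x) <= C" "\<And>i x. i \<in> I ==> norm (G i x) <= D"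
    by (metis usmooth_bounded)
  then have "\<forall>i\<in>I. \<forall>x. norm (F i x * G i x) <= C * D"
    by (auto simp: norm_mult intro!: mult_mono intro: order_trans[OF norm_ge_zero])
  moreover have "usmooth m I (\<lambda>i. partial_deriv b (\<lambda>x. F i x * G i x))" if "b \<in> Basis" for b
  proof -
    have "usmooth m I (\<lambda>i x. partial_deriv b (F i) x * G i x + F i x * partial_deriv b (G i) x)"
      using Suc that 0 by (intro usmooth_add) auto
    then show ?thesis
      by (rule iffD2[OF usmooth_cong, rotated])
         (use Suc.prems in \<open>auto simp: fun_eq_iff intro!: partial_deriv_mult\<close>)
  qed
  ultimately show ?case using 0 by (auto intro!: differentiable_mult)
qed

lemma usmooth_const:
  fixes c :: "'i => 'b::real_normed_field"
  assumes "\<And>i. i \<in> I ==> norm (c i) <= C"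
  shows "usmooth m I (\<lambda>i (x::'a::euclidean_space). c i)"
  using assms
proof (induction m arbitrary: c C)
  case (Suc m)
  have *: "partial_deriv b (\<lambda>x. c i) = (\<lambda>x. 0)" for b :: 'a and i
    by (simp add: fun_eq_iff)
  have "usmooth m I (\<lambda>i (x::'a). 0 :: 'b)"
    by (rule Suc.IH[of "\<lambda>_. 0" 0]) simp
  then show ?case using Suc.prems by (auto simp: *)
qed auto

lemma usmooth_sum:
  assumes "finite J" "\<And>j. j \<in> J ==> usmooth m I (F j)"
  shows "usmooth m I (\<lambda>i x. \<Sum>j\<in>J. F j i x)"
  using assms by (induction J rule: finite_induct)
    (auto intro!: usmooth_add usmooth_const[where C=0])

lemma usmooth_prod:
  assumes "finite J" "\<And>j. j \<in> J ==> usmooth m I (F j)"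
  shows "usmooth m I (\<lambda>i x. \<Prod>j\<in>J. F j i x)"
  using assms by (induction J rule: finite_induct)
    (auto intro!: usmooth_mult usmooth_const[where C=1])

text \<open>The derivative of 1/F is, up to sign, F' times two factors 1/F, which the induction
  already controls to order m. The common lower bound c supplies the bound at order 0.\<close>

lemma usmooth_inverse:
  assumes "c > 0"
  shows "usmooth m I F ==> (\<And>i x. i \<in> I ==> norm (F i x) >= c)
    ==> usmooth m I (\<lambda>i x. inverse (F i x))"
proof (induction m)
  case 0
  have "norm (inverse (F i x)) <= inverse c" if "i \<in> I" for i x
    using 0(2)[OF that, of x] assms by (simp add: norm_inverse le_imp_inverse_le)
  moreover have "F i x ~= 0" if "i \<in> I" for i x
    using 0(2)[OF that, of x] assms by auto
  ultimately show ?case using 0 by (auto intro!: differentiable_inverse)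
next
  case (Suc m)
  have "norm (inverse (F i x)) <= inverse c" if "i \<in> I" for i x
    using Suc(3)[OF that, of x] assms by (simp add: norm_inverse le_imp_inverse_le)
  moreover have nz: "F i x ~= 0" if "i \<in> I" for i x
    using Suc(3)[OF that, of x] assms by auto
  moreover have m: "usmooth m I (\<lambda>i x. inverse (F i x))"
    using Suc usmooth_lower by blast
  have "usmooth m I (\<lambda>i. partial_deriv b (\<lambda>x. inverse (F i x)))" if "b \<in> Basis" for b
  proof -
    have "usmooth m I (\<lambda>i x. (-1) * (inverse (F i x) * (inverse (F i x) * partial_deriv b (F i) x)))"
      using Suc.prems that m by (intro usmooth_mult usmooth_const[where C=1]) auto
    then show ?thesis
      by (rule iffD2[OF usmooth_cong, rotated])
         (use Suc.prems nz in \<open>auto simp: fun_eq_iff partial_deriv_inverse\<close>)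
  qed
  ultimately show ?case using Suc by (auto intro!: differentiable_inverse)
qed

lemma differentiable_of_real:
  "f differentiable F ==> (\<lambda>x. of_real (f x) :: 'b::real_normed_field) differentiable F"
  unfolding differentiable_def using has_derivative_of_real by blast

lemma usmooth_of_real:
  "usmooth m I F ==> usmooth m I (\<lambda>i x. of_real (F i x) :: 'b::real_normed_field)"
proof (induction m arbitrary: F)
  case 0
  then show ?case unfolding usmooth.simps norm_of_real
    by (auto intro!: differentiable_of_real)
next
  case (Suc m F)
  have "usmooth m I (\<lambda>i. partial_deriv b (\<lambda>x. of_real (F i x) :: 'b::real_normed_field))" if "b \<in> Basis" for b
  proof -
    have "usmooth m I (\<lambda>i x. of_real (partial_deriv b (F i) x) :: 'b)"
      using Suc that by auto
    then show ?thesis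
      by (rule iffD2[OF usmooth_cong, rotated])
         (use Suc.prems in \<open>auto simp: fun_eq_iff intro!: partial_deriv_of_real\<close>)
  qed
  with Suc.prems show ?case unfolding usmooth.simps norm_of_real
    by (auto intro!: differentiable_of_real)
qed

text \<open>Each derivative brings out a factor A i, so the dilations have to be bounded over the
  family, while the translations are free.\<close>

lemma usmooth_affine:
  assumes "\<And>i. i \<in> I ==> \<bar>A i\<bar> <= M"
  shows "usmooth m I F ==> usmooth m I (\<lambda>i x. F i (A i *\<^sub>R x + v i))"
proof (induction m arbitrary: F)
  case 0
  then obtain C where "\<And>i x. i \<in> I ==> norm (F i x) <= C" by (metis usmooth_bounded)
  then have "\<exists>C. \<forall>i\<in>I. \<forall>x. norm (F i (A i *\<^sub>R x + v i)) <= C" by blast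
  with 0 show ?case by (auto intro!: partial_deriv_affine)
next
  case (Suc m F)
  have "usmooth m I (\<lambda>i. partial_deriv b (\<lambda>x. F i (A i *\<^sub>R x + v i)))" if "b \<in> Basis" for b
  proof -
    have "usmooth m I (\<lambda>i x. of_real (A i) * partial_deriv b (F i) (A i *\<^sub>R x + v i))"
      using Suc.IH[of "\<lambda>i. partial_deriv b (F i)"] Suc.prems that assms
      by (intro usmooth_mult usmooth_const[where C=M]) auto
    then show ?thesis
      by (rule iffD2[OF usmooth_cong, rotated])
         (use Suc.prems in \<open>auto simp: fun_eq_iff intro!: partial_deriv_affine(2)\<close>)
  qed
  moreover obtain C where "\<And>i x. i \<in> I ==> norm (F i x) <= C" using Suc.prems by (metis usmooth_bounded)
  then have "\<exists>C. \<forall>i\<in>I. \<forall>x. norm (F i (A i *\<^sub>R x + v i)) <= C" by blast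
  ultimately show ?case using Suc.prems by (auto intro!: partial_deriv_affine)
qed

lemma usmooth_coordinate:
  fixes g :: "real => 'b::real_normed_field" and e :: "'a::euclidean_space"
  assumes "\<And>i. i \<in> I ==> \<bar>A i\<bar> <= M"
  shows "usmooth m UNIV (\<lambda>_::unit. g) ==> usmooth m I (\<lambda>i x. g (A i * (x \<bullet> e) + B i))"
proof (induction m arbitrary: g)
  case 0
  then obtain C where "\<And>x. norm (g x) <= C" by auto
  then have "\<exists>C. \<forall>i\<in>I. \<forall>x. norm (g (A i * (x \<bullet> e) + B i)) <= C" by blast
  with 0 show ?case by (auto intro!: partial_deriv_coordinate)
next
  case (Suc m g)
  have "usmooth m I (\<lambda>i. partial_deriv b (\<lambda>x. g (A i * (x \<bullet> e) + B i)))" if "b \<in> Basis" for b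
  proof -
    have "norm (of_real (A i * (b \<bullet> e)) :: 'b) <= M * \<bar>b \<bullet> e\<bar>" if "i \<in> I" for i
      using assms[OF that] by (auto simp: norm_mult abs_mult intro!: mult_right_mono)
    then have "usmooth m I (\<lambda>i x. of_real (A i * (b \<bullet> e)) * partial_deriv 1 g (A i * (x \<bullet> e) + B i))"
      using Suc that by (intro usmooth_mult usmooth_const[where C="M * \<bar>b \<bullet> e\<bar>"]) auto
    then show ?thesis
      by (rule iffD2[OF usmooth_cong, rotated])
         (use Suc.prems in \<open>auto simp: fun_eq_iff partial_deriv_coordinate(2)\<close>)
  qed
  moreover obtain C where "\<And>x. norm (g x) <= C" using Suc.prems by auto
  then have "\<exists>C. \<forall>i\<in>I. \<forall>x. norm (g (A i * (x \<bullet> e) + B i)) <= C" by blast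
  ultimately show ?case using Suc.prems by (auto intro!: partial_deriv_coordinate)
qed

section \<open>Oscillatory integrals of compactly supported functions\<close>

text \<open>Densities that are only measurable must be allowed, since superpositions multiply a
  symbol by a bounded factor of which only measurability is recorded. Compact support makes every
  polynomial weight integrable.\<close>

definition cbounded :: "('a::euclidean_space => complex) => bool" where
  "cbounded c \<longleftrightarrow> c \<in> borel_measurable borel \<and>
     (\<exists>C L. \<forall>x. norm (c x) <= C \<and> (norm x > L --> c x = 0))"

lemma cbounded_integrable:
  assumes "cbounded c" shows "integrable lborel c"
proof -
  from assms obtain C L where "\<And>x. norm (c x) <= C" "\<And>x. norm x > L ==> c x = 0"
    and m: "c \<in> borel_measurable borel"
    unfolding cbounded_def by blast
  then have le: "norm (c x) <= norm (C * indicator (cball 0 L) x :: real)" for x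
    using order_trans[OF _ abs_ge_self] by (cases "norm x > L") (auto simp: indicator_def)
  have "integrable lborel (\<lambda>x::'a. C * indicator (cball 0 L) x :: real)"
    by (intro integrable_mult_right integrable_real_indicator) (auto intro!: emeasure_bounded_finite[unfolded infinity_ennreal_def])
  then show ?thesis
    by (rule Bochner_Integration.integrable_bound) (use m le in auto)
qed

lemma cbounded_mult:
  assumes "cbounded c" "d \<in> borel_measurable borel"
    and "\<And>L. \<exists>C. \<forall>x. norm x <= L --> norm (d x) <= C"
  shows "cbounded (\<lambda>x. d x * c x)"
proof -
  from assms(1) obtain C L where *: "\<And>x. norm (c x) <= C" "\<And>x. norm x > L ==> c x = 0"
    and m: "c \<in> borel_measurable borel"
    unfolding cbounded_def by blast
  from assms(3) obtain D where D: "\<And>x. norm x <= L ==> norm (d x) <= D" by meson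
  have "0 <= C" using order_trans[OF norm_ge_zero *(1)] by blast
  have "norm (d x * c x) <= max 0 (D * C)" for x
  proof (cases "norm x > L")
    case False
    then have "norm (d x) <= D" using D by simp
    then have "norm (d x * c x) <= D * C"
      unfolding norm_mult using *(1) \<open>0 <= C\<close> by (intro mult_mono) (auto intro: order_trans[OF norm_ge_zero])
    then show ?thesis by simp
  qed (simp add: *)
  with * m assms(2) show ?thesis
    unfolding cbounded_def by (intro conjI exI[of _ "max 0 (D * C)"] exI[of _ L] allI) auto
qed

lemma cbounded_coordinate:
  assumes "cbounded c" shows "cbounded (\<lambda>x. k * of_real (x \<bullet> b) * c x)"
proof (rule cbounded_mult[OF assms])
  fix L
  have "norm (k * of_real (x \<bullet> b)) <= norm k * (\<bar>L\<bar> * norm b)" if "norm x <= L" for x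
    using that by (auto simp: norm_mult intro!: mult_left_mono order_trans[OF Cauchy_Schwarz_ineq2] mult_right_mono)
  then show "\<exists>C. \<forall>x. norm x <= L --> norm (k * of_real (x \<bullet> b)) <= C" by blast
qed measurable

lemma cbounded_cis:
  assumes "cbounded c" shows "cbounded (\<lambda>x. cis (w \<bullet> x) * c x)"
  by (rule cbounded_mult[OF assms])
    (auto intro!: borel_measurable_continuous_onI continuous_intros exI[of _ 1])

text \<open>The inverse Fourier transform without its normalising factor. Such factors are collected
  in \<open>fourier_norm\<close> and \<open>inversion_const\<close>.\<close>

definition synth :: "('a::euclidean_space => complex) => 'a => complex" where
  "synth c x = (LINT \<xi>|lborel. cis (x \<bullet> \<xi>) * c \<xi>)"

text \<open>A quadratic remainder is the form of differentiability that survives the application of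
  a distribution, being an estimate and not a limit.\<close>

lemma has_derivative_quadratic:
  fixes f :: "'a::real_normed_vector => 'b::real_normed_vector"
  assumes "bounded_linear D" "\<And>h. norm h <= 1 ==> norm (f (x + h) - f x - D h) <= C * (norm h)\<^sup>2"
  shows "(f has_derivative D) (at x)"
proof -
  have "((\<lambda>h. norm (f (x + h) - f x - D h) / norm h) \<longlongrightarrow> 0) (at 0)"
  proof (rule Lim_null_comparison)
    show "\<forall>\<^sub>F h in at 0. norm (norm (f (x + h) - f x - D h) / norm h) <= C * norm h"
      unfolding eventually_at
    proof (intro exI[of _ 1] conjI ballI impI)
      fix h :: 'a assume "h ~= 0 \<and> dist h 0 < 1"
      then show "norm (norm (f (x + h) - f x - D h) / norm h) <= C * norm h"
        using assms(2)[of h] by (simp add: divide_le_eq power2_eq_square mult.assoc)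
    qed simp
    have "((\<lambda>h::'a. C * norm h) \<longlongrightarrow> C * norm (0::'a)) (at 0)" by (intro tendsto_intros)
    then show "((\<lambda>h::'a. C * norm h) \<longlongrightarrow> 0) (at 0)" by simp
  qed
  with assms(1) show ?thesis by (simp add: has_derivative_at)
qed

lemma cis_taylor: "cmod (cis v - 1 - \<i> * of_real v) <= v\<^sup>2"
proof -
  have "cmod (cis v - 1 - \<i> * of_real v) <= \<bar>v\<bar>\<^sup>2 / 2"
    using iexp_approx1[of v 1] by (simp add: cis_conv_exp numeral_2_eq_2 algebra_simps)
  also have "... <= v\<^sup>2" by simp
  finally show ?thesis .
qed

text \<open>The first-order remainder of the exponential is at most (h . \<xi>)^2, which is
  integrable against a compactly supported symbol. Writing the derivative as a sum over coordinates
  makes every partial derivative again a \<open>synth\<close>.\<close>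

lemma synth_has_derivative:
  fixes c :: "'a::euclidean_space => complex"
  assumes c: "cbounded c"
  shows "(synth c has_derivative
           (\<lambda>h. \<Sum>b\<in>Basis. (h \<bullet> b) *\<^sub>R synth (\<lambda>\<xi>. \<i> * of_real (\<xi> \<bullet> b) * c \<xi>) x)) (at x)"
proof -
  let ?c = "\<lambda>b \<xi>. cis (x \<bullet> \<xi>) * (\<i> * of_real (\<xi> \<bullet> b) * c \<xi>)"
  let ?D = "\<lambda>h. \<Sum>b\<in>Basis. (h \<bullet> b) *\<^sub>R synth (\<lambda>\<xi>. \<i> * of_real (\<xi> \<bullet> b) * c \<xi>) x"
  let ?Q = "LINT \<xi>|lborel. (norm \<xi>)\<^sup>2 * norm (c \<xi>)"
  have int: "integrable lborel (?c b)" for b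
    by (intro cbounded_integrable cbounded_cis cbounded_coordinate c)
  have int0: "integrable lborel (\<lambda>\<xi>. cis (y \<bullet> \<xi>) * c \<xi>)" for y
    by (intro cbounded_integrable cbounded_cis c)
  have "cbounded (\<lambda>\<xi>. of_real ((norm \<xi>)\<^sup>2) * c \<xi>)"
  proof (rule cbounded_mult[OF c])
    show "\<exists>C. \<forall>x::'a. norm x <= L --> norm (complex_of_real ((norm x)\<^sup>2)) <= C" for L
      by (intro exI[of _ "L\<^sup>2"]) (simp add: norm_power power_mono)
  qed measurable
  from integrable_norm[OF cbounded_integrable[OF this]]
  have intq: "integrable lborel (\<lambda>\<xi>. (norm \<xi>)\<^sup>2 * norm (c \<xi>))"
    by (simp add: norm_mult norm_power)
  have D: "?D h = (LINT \<xi>|lborel. cis (x \<bullet> \<xi>) * (\<i> * of_real (\<xi> \<bullet> h) * c \<xi>))" for h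
  proof -
    have "?D h = (LINT \<xi>|lborel. (\<Sum>b\<in>Basis. (h \<bullet> b) *\<^sub>R ?c b \<xi>))"
      using int by (simp add: synth_def Bochner_Integration.integral_sum)
    also have "... = (LINT \<xi>|lborel. cis (x \<bullet> \<xi>) * (\<i> * of_real (\<xi> \<bullet> h) * c \<xi>))"
      by (intro Bochner_Integration.integral_cong)
         (auto simp: euclidean_inner[of _ h] sum_distrib_left sum_distrib_right scaleR_conv_of_real algebra_simps)
    finally show ?thesis .
  qed
  show ?thesis
  proof (rule has_derivative_quadratic[where C = ?Q])
    show "bounded_linear ?D"
      by (intro bounded_linear_sum bounded_linear_scaleR_const bounded_linear_inner_left)
    fix h :: 'a
    have inth: "integrable lborel (\<lambda>\<xi>. cis (x \<bullet> \<xi>) * (\<i> * of_real (\<xi> \<bullet> h) * c \<xi>))"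
      by (intro cbounded_integrable cbounded_cis cbounded_coordinate c)
    have "synth c (x + h) - synth c x - ?D h
      = (LINT \<xi>|lborel. cis (x \<bullet> \<xi>) * (cis (h \<bullet> \<xi>) - 1 - \<i> * of_real (h \<bullet> \<xi>)) * c \<xi>)"
      unfolding D unfolding synth_def Bochner_Integration.integral_diff[OF int0 int0, symmetric]
        Bochner_Integration.integral_diff[OF Bochner_Integration.integrable_diff[OF int0 int0] inth, symmetric]
      by (rule Bochner_Integration.integral_cong)
         (auto simp: algebra_simps cis_mult[symmetric] inner_commute)
    also have "norm ... <= (LINT \<xi>|lborel. (norm h)\<^sup>2 * ((norm \<xi>)\<^sup>2 * norm (c \<xi>)))"
    proof (rule Bochner_Integration.integral_norm_bound_integral)
      show "integrable lborel (\<lambda>\<xi>. (norm h)\<^sup>2 * ((norm \<xi>)\<^sup>2 * norm (c \<xi>)))"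
        using intq by simp
      show "integrable lborel (\<lambda>\<xi>. cis (x \<bullet> \<xi>) * (cis (h \<bullet> \<xi>) - 1 - \<i> * of_real (h \<bullet> \<xi>)) * c \<xi>)"
        using Bochner_Integration.integrable_diff[OF Bochner_Integration.integrable_diff[OF int0[of "x+h"] int0[of x]] inth]
        by (rule Bochner_Integration.integrable_cong[THEN iffD1, rotated -1])
           (auto simp: algebra_simps cis_mult[symmetric] inner_commute)
      fix \<xi> :: 'a
      have "norm (cis (h \<bullet> \<xi>) - 1 - \<i> * of_real (h \<bullet> \<xi>)) <= (norm h * norm \<xi>)\<^sup>2"
        by (rule order_trans[OF cis_taylor]) (metis Cauchy_Schwarz_ineq2 abs_ge_zero power2_abs power_mono)
      from mult_right_mono[OF this norm_ge_zero[of "c \<xi>"]]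
      show "norm (cis (x \<bullet> \<xi>) * (cis (h \<bullet> \<xi>) - 1 - \<i> * of_real (h \<bullet> \<xi>)) * c \<xi>)
         <= (norm h)\<^sup>2 * ((norm \<xi>)\<^sup>2 * norm (c \<xi>))"
        by (simp add: norm_mult power_mult_distrib mult.assoc)
    qed
    also have "... = ?Q * (norm h)\<^sup>2" by simp
    finally show "norm (synth c (x + h) - synth c x - ?D h) <= ?Q * (norm h)\<^sup>2" .
  qed
qed

text \<open>Difference quotients in direction b integrate to 0 by translation invariance. The mean
  value inequality bounds them by B and they vanish outside one ball, so dominated convergence
  carries the 0 over to the derivative. This is integration by parts without boundary terms.\<close>

lemma integral_partial_deriv_0:
  fixes h :: "'a::euclidean_space => complex"
  assumes diff: "\<And>x. h differentiable (at x)" and L: "\<And>x. norm x > L ==> h x = 0"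
    and B: "\<And>x. norm (partial_deriv b h x) <= B"
  shows "(LINT x|lborel. partial_deriv b h x) = 0"
proof -
  have cont: "continuous_on UNIV h"
    by (simp add: continuous_at_imp_continuous_on differentiable_imp_continuous_within diff)
  have meas [measurable]: "h \<in> borel_measurable borel"
    by (rule borel_measurable_continuous_onI[OF cont])
  define q where "q n x = of_nat (Suc n) * (h (x + (1 / real (Suc n)) *\<^sub>R b) - h x)" for n x
  have der: "((\<lambda>t. h (x + t *\<^sub>R b)) has_vector_derivative partial_deriv b h (x + t *\<^sub>R b)) (at t)" for x t
  proof -
    have "((\<lambda>t. h (x + t *\<^sub>R b)) has_derivative (\<lambda>s. frechet_derivative h (at (x + t *\<^sub>R b)) (s *\<^sub>R b))) (at t)"
      by (rule has_derivative_compose[of "\<lambda>t. x + t *\<^sub>R b"])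
         (use diff in \<open>auto intro!: derivative_eq_intros simp: frechet_derivative_works[symmetric]\<close>)
    moreover have "frechet_derivative h (at (x + t *\<^sub>R b)) (s *\<^sub>R b) = s *\<^sub>R partial_deriv b h (x + t *\<^sub>R b)" for s
      using linear_scale[OF linear_frechet_derivative[OF diff]] by (simp add: partial_deriv_frechet diff)
    ultimately show ?thesis by (simp add: has_vector_derivative_def)
  qed
  have lim: "(\<lambda>n. q n x) \<longlonglongrightarrow> partial_deriv b h x" for x
  proof -
    have "((\<lambda>t. (h (x + t *\<^sub>R b) - h x) /\<^sub>R t) \<longlongrightarrow> partial_deriv b h x) (at 0)"
    proof (rule LIM_zero_cancel[OF tendsto_norm_zero_cancel], rule Lim_transform_eventually)
      show "((\<lambda>t. norm (h (x + t *\<^sub>R b) - h x - t *\<^sub>R partial_deriv b h x) / norm t) \<longlongrightarrow> 0) (at 0)"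
        using der[of x 0] by (simp add: has_vector_derivative_def has_derivative_at)
      show "\<forall>\<^sub>F t in at 0. norm (h (x + t *\<^sub>R b) - h x - t *\<^sub>R partial_deriv b h x) / norm t
          = norm ((h (x + t *\<^sub>R b) - h x) /\<^sub>R t - partial_deriv b h x)"
        unfolding eventually_at
      proof (intro exI[of _ 1] conjI ballI impI)
        fix t :: real assume "t ~= 0 \<and> dist t 0 < 1"
        then have "(h (x + t *\<^sub>R b) - h x) /\<^sub>R t - partial_deriv b h x
            = (h (x + t *\<^sub>R b) - h x - t *\<^sub>R partial_deriv b h x) /\<^sub>R t"
          by (simp add: scaleR_diff_right)
        then show "norm (h (x + t *\<^sub>R b) - h x - t *\<^sub>R partial_deriv b h x) / norm t
          = norm ((h (x + t *\<^sub>R b) - h x) /\<^sub>R t - partial_deriv b h x)"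
          by (simp add: divide_inverse mult.commute)
      qed simp
    qed
    moreover have "filterlim (\<lambda>n. 1 / real (Suc n)) (at 0) sequentially"
      unfolding filterlim_at using LIMSEQ_inverse_real_of_nat by (auto simp: inverse_eq_divide)
    ultimately have "(\<lambda>n. (h (x + (1 / real (Suc n)) *\<^sub>R b) - h x) /\<^sub>R (1 / real (Suc n))) \<longlonglongrightarrow> partial_deriv b h x"
      by (rule filterlim_compose)
    then show ?thesis
      by (simp add: q_def scaleR_conv_of_real)
  qed
  have qB: "norm (q n x) <= B" for n x
  proof -
    have "norm (h (x + (1 / real (Suc n)) *\<^sub>R b) - h (x + 0 *\<^sub>R b)) <= B * norm (1 / real (Suc n) - 0)"
    proof (rule differentiable_bound[of UNIV])
      show "onorm (\<lambda>s. s *\<^sub>R partial_deriv b h (x + t *\<^sub>R b)) <= B" for t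
        by (intro onorm_le) (simp add: mult.commute[of B] mult_left_mono B)
    qed (use der in \<open>auto simp: has_vector_derivative_def\<close>)
    moreover have "norm (q n x) = real (Suc n) * norm (h (x + (1 / real (Suc n)) *\<^sub>R b) - h x)"
      unfolding q_def norm_mult norm_of_nat ..
    ultimately show ?thesis
      by (simp add: pos_le_divide_eq mult.commute del: of_nat_Suc)
  qed
  have q0: "q n x = 0" if "norm x > \<bar>L\<bar> + norm b" for n x
  proof -
    have "norm ((1 / real (Suc n)) *\<^sub>R b) <= norm b"
      by (simp add: divide_le_eq algebra_simps)
    then have "norm (x + (1 / real (Suc n)) *\<^sub>R b) > \<bar>L\<bar>"
      using that norm_triangle_ineq4[of "x + (1 / real (Suc n)) *\<^sub>R b" "(1 / real (Suc n)) *\<^sub>R b"]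
      by (simp del: of_nat_Suc)
    moreover have "norm x > L" using that norm_ge_zero[of b] by linarith
    ultimately show ?thesis by (simp add: q_def L)
  qed
  have inth: "integrable lborel h"
  proof (rule cbounded_integrable)
    have "bounded (h ` cball 0 \<bar>L\<bar>)"
      by (intro compact_imp_bounded compact_continuous_image continuous_on_subset[OF cont]) auto
    then obtain C where C: "\<forall>y\<in>h ` cball 0 \<bar>L\<bar>. norm y <= C"
      unfolding bounded_iff by blast
    have "norm (h x) <= C" if "norm x <= \<bar>L\<bar>" for x
      using C that by simp
    then have "norm (h x) <= max C 0" for x
      using L by (cases "norm x <= \<bar>L\<bar>") force+
    with L meas show "cbounded h" unfolding cbounded_def by blast
  qed
  have "(\<lambda>n. LINT x|lborel. q n x) \<longlonglongrightarrow> (LINT x|lborel. partial_deriv b h x)"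
  proof (rule integral_dominated_convergence)
    show "partial_deriv b h \<in> borel_measurable lborel"
      by (rule borel_measurable_LIMSEQ_metric[OF _ lim]) (simp add: q_def)
    show "integrable lborel (\<lambda>x::'a. B * indicator (cball 0 (\<bar>L\<bar> + norm b)) x :: real)"
      by (intro integrable_mult_right integrable_real_indicator) (auto intro!: emeasure_bounded_finite[unfolded infinity_ennreal_def])
    show "AE x in lborel. norm (q i x) <= B * indicator (cball 0 (\<bar>L\<bar> + norm b)) x" for i
      using qB q0 by (auto simp: indicator_def not_le)
  qed (use lim in \<open>auto simp: q_def\<close>)
  moreover have "(LINT x|lborel. q n x) = 0" for n
  proof -
    have *: "integrable lborel (\<lambda>x. h (x + v))" "(LINT x|lborel. h (x + v)) = (LINT x|lborel. h x)" for v
    proof -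
      have "integrable (distr lborel borel (\<lambda>x. v + x)) h"
        using inth by (simp add: lborel_distr_plus)
      then show "integrable lborel (\<lambda>x. h (x + v))"
        by (subst (asm) integrable_distr_eq) (auto simp: add.commute)
      have "(LINT x|lborel. h x) = integral\<^sup>L (distr lborel borel (\<lambda>x. v + x)) h"
        by (simp add: lborel_distr_plus)
      also have "... = (LINT x|lborel. h (x + v))"
        by (subst integral_distr) (auto simp: add.commute)
      finally show "(LINT x|lborel. h (x + v)) = (LINT x|lborel. h x)" by simp
    qed
    show ?thesis unfolding q_def
      by (simp add: * inth del: of_nat_Suc)
  qed
  ultimately show ?thesis by (simp add: LIMSEQ_const_iff)
qed

section \<open>Families of test functions\<close>

definition test_family :: "'i set => ('i => 'a::euclidean_space => complex) => bool" where
  "test_family I F \<longleftrightarrow> (\<forall>m. usmooth m I F) \<and> (\<exists>L. \<forall>i\<in>I. \<forall>x. norm x > L --> F i x = 0)"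

text \<open>Single symbols are one-member families, so that every uniform result applies to them
  directly.\<close>

definition test_fun :: "('a::euclidean_space => complex) => bool" where
  "test_fun a \<longleftrightarrow> test_family UNIV (\<lambda>_::unit. a)"

lemma usmooth_reindex:
  "usmooth m I F ==> (\<And>j. j \<in> J ==> k j \<in> I) ==> usmooth m J (\<lambda>j. F (k j))"
proof (induction m arbitrary: F)
  case 0
  then obtain C where "\<And>i x. i \<in> I ==> norm (F i x) <= C" by (metis usmooth_bounded)
  with 0(2) have "\<exists>C. \<forall>j\<in>J. \<forall>x. norm (F (k j) x) <= C" by blast
  with 0 show ?case by auto
next
  case (Suc m F)
  have "usmooth m J (\<lambda>j. partial_deriv b (F (k j)))" if "b \<in> Basis" for b
    by (rule Suc.IH[of "\<lambda>i. partial_deriv b (F i)"]) (use Suc.prems that in auto)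
  moreover obtain C where "\<And>i x. i \<in> I ==> norm (F i x) <= C"
    using Suc.prems by (metis usmooth_bounded)
  with Suc.prems(2) have "\<exists>C. \<forall>j\<in>J. \<forall>x. norm (F (k j) x) <= C" by blast
  ultimately show ?case using Suc.prems by auto
qed

lemma test_family_reindex:
  "test_family I F ==> (\<And>j. j \<in> J ==> k j \<in> I) ==> test_family J (\<lambda>j. F (k j))"
  unfolding test_family_def by (metis usmooth_reindex)

lemma test_family_member: "test_family I F ==> i \<in> I ==> test_fun (F i)"
  unfolding test_fun_def by (rule test_family_reindex) auto

lemma test_family_differentiable: "test_family I F ==> i \<in> I ==> F i differentiable (at x)"
  unfolding test_family_def by (auto intro: usmooth_differentiable[of 0])

lemma test_fun_differentiable: "test_fun a ==> a differentiable (at x)"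
  using test_family_differentiable[of UNIV "\<lambda>_. a" "()"] by (simp add: test_fun_def)

lemma test_fun_continuous: "test_fun a ==> continuous_on S a"
  by (simp add: continuous_at_imp_continuous_on differentiable_imp_continuous_within
      test_fun_differentiable)

lemma test_family_partial_deriv:
  fixes F :: "'i => 'a::euclidean_space => complex"
  assumes "test_family I F" "b \<in> Basis"
  shows "test_family I (\<lambda>i. partial_deriv b (F i))"
proof -
  from assms obtain L where L: "\<And>i x. i \<in> I ==> norm x > L ==> F i x = 0"
    unfolding test_family_def by blast
  have "usmooth m I (\<lambda>i. partial_deriv b (F i))" for m
    using assms unfolding test_family_def by (metis usmooth.simps(2))
  moreover have "partial_deriv b (F i) x = 0" if "i \<in> I" "norm x > L" for i x
  proof -
    have "open {x::'a. norm x > L}" by (intro open_Collect_less continuous_intros)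
    then have "(F i has_derivative (\<lambda>_. 0)) (at x)"
      by (intro has_derivative_transform_within_open[OF has_derivative_const[of 0 "at x"]])
         (use that L in auto)
    then show ?thesis by (rule partial_deriv_eq)
  qed
  ultimately show ?thesis unfolding test_family_def by blast
qed

lemma test_family_mult:
  assumes "test_family I F" "\<And>m. usmooth m I G"
  shows "test_family I (\<lambda>i x. F i x * G i x)" "test_family I (\<lambda>i x. G i x * F i x)"
  using assms unfolding test_family_def by (auto intro!: usmooth_mult) (metis mult_zero_left mult_zero_right)+

lemma test_family_scale:
  assumes "test_family I F" "\<And>i. i \<in> I ==> norm (c i) <= C"
  shows "test_family I (\<lambda>i x. c i * F i x)"
  by (intro test_family_mult assms usmooth_const[of I c C])

text \<open>A coordinate function is unbounded, hence not \<open>usmooth\<close>, and the product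
  rule for families does not cover it. The common support of F bounds it where it counts, and the
  Leibniz rule reproduces a term of the same kind, which drives a separate induction.\<close>

lemma test_family_coordinate:
  fixes F :: "'i => 'a::euclidean_space => complex"
  assumes "test_family I F"
  shows "test_family I (\<lambda>i x. of_real (x \<bullet> b) * F i x)"
proof -
  from assms obtain L where L: "\<And>i x. i \<in> I ==> norm x > L ==> F i x = 0"
    unfolding test_family_def by blast
  have d: "(\<lambda>x. complex_of_real (x \<bullet> b)) differentiable (at x)" for x :: 'a
    unfolding differentiable_def by (auto intro!: derivative_eq_intros)
  have p: "partial_deriv e (\<lambda>x. complex_of_real (x \<bullet> b)) x = of_real (e \<bullet> b)" for e and x :: 'a
    by (rule partial_deriv_eq) (auto intro!: derivative_eq_intros)
  have "usmooth m I (\<lambda>i x. of_real (x \<bullet> b) * F i x)" if "test_family I F" for m F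
    using that
  proof (induction m arbitrary: F)
    case (0 F)
    then obtain L where L: "\<And>i x. i \<in> I ==> norm x > L ==> F i x = 0"
      unfolding test_family_def by blast
    obtain C where C: "C > 0" "\<And>i x. i \<in> I ==> norm (F i x) <= C"
      using 0 usmooth_bounded unfolding test_family_def by metis
    have "norm (of_real (x \<bullet> b) * F i x) <= (\<bar>L\<bar> * norm b) * C" if "i \<in> I" for i x
    proof (cases "norm x > L")
      case False
      then have "\<bar>x \<bullet> b\<bar> <= \<bar>L\<bar> * norm b"
        by (intro order_trans[OF Cauchy_Schwarz_ineq2] mult_right_mono) auto
      then show ?thesis unfolding norm_mult using C(2)[OF that, of x] by (intro mult_mono) auto
    qed (use L that C in simp)
    moreover have "(\<lambda>x. of_real (x \<bullet> b) * F i x) differentiable (at x)" if "i \<in> I" for i x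
      by (intro differentiable_mult d test_family_differentiable[OF 0 that])
    ultimately show ?case by auto
  next
    case (Suc m F)
    have "usmooth 0 I (\<lambda>i x. of_real (x \<bullet> b) * F i x)"
    proof -
      have "usmooth m I (\<lambda>i x. of_real (x \<bullet> b) * F i x)" by (rule Suc.IH[OF Suc.prems])
      then show ?thesis by (cases m) auto
    qed
    moreover have "usmooth m I (\<lambda>i. partial_deriv e (\<lambda>x. of_real (x \<bullet> b) * F i x))" if "e \<in> Basis" for e
    proof -
      have "usmooth m I (\<lambda>i x. of_real (e \<bullet> b) * F i x + of_real (x \<bullet> b) * partial_deriv e (F i) x)"
        using Suc.IH[OF test_family_partial_deriv[OF Suc.prems that]] Suc.prems
        by (intro usmooth_add usmooth_mult[of _ _ "\<lambda>_ _. complex_of_real (e \<bullet> b)"]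
            usmooth_const[where C="\<bar>e \<bullet> b\<bar>"]) (auto simp: test_family_def)
      then show ?thesis
        by (rule iffD2[OF usmooth_cong, rotated])
           (use test_family_differentiable[OF Suc.prems] d in \<open>auto simp: fun_eq_iff partial_deriv_mult p\<close>)
    qed
    ultimately show ?case by simp
  qed
  with assms L show ?thesis unfolding test_family_def by (metis mult_zero_right)
qed

lemma test_fun_cbounded: "test_fun a ==> cbounded a"
proof -
  assume a: "test_fun a"
  then have "a \<in> borel_measurable borel"
    by (intro borel_measurable_continuous_onI test_fun_continuous)
  moreover obtain C where "\<And>x. norm (a x) <= C"
    using a usmooth_bounded unfolding test_fun_def test_family_def by (metis UNIV_I)
  ultimately show ?thesis
    using a unfolding test_fun_def test_family_def cbounded_def by blast
qed

text \<open>The product of exponential and symbol has derivatives of integral 0; the product rule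
  then trades a derivative of the symbol for a coordinate of x.\<close>

lemma synth_partial_deriv:
  assumes a: "test_fun a" and b: "b \<in> Basis"
  shows "synth (partial_deriv b a) x = - (\<i> * of_real (x \<bullet> b) * synth a x)"
proof -
  have d: "a differentiable (at y)" for y
    by (rule test_fun_differentiable[OF a])
  have a': "test_fun (partial_deriv b a)"
    using test_family_partial_deriv[OF _ b] a unfolding test_fun_def by blast
  have cis: "((\<lambda>\<xi>. cis (x \<bullet> \<xi>)) has_derivative (\<lambda>h. of_real (x \<bullet> h) * (\<i> * cis (x \<bullet> y)))) (at y)" for y
  proof -
    have "((\<lambda>\<xi>. cis (x \<bullet> \<xi>)) has_derivative (\<lambda>h. (x \<bullet> h) *\<^sub>R (\<i> * cis (x \<bullet> y)))) (at y)"
      by (intro has_derivative_cis has_derivative_inner_right has_derivative_ident)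
    then show ?thesis by (simp add: scaleR_conv_of_real)
  qed
  let ?h = "\<lambda>\<xi>. cis (x \<bullet> \<xi>) * a \<xi>"
  have ph: "partial_deriv b ?h y = \<i> * of_real (x \<bullet> b) * (cis (x \<bullet> y) * a y) + cis (x \<bullet> y) * partial_deriv b a y" for y
  proof -
    have "(\<lambda>\<xi>. cis (x \<bullet> \<xi>)) differentiable (at y)"
      using cis unfolding differentiable_def by blast
    from partial_deriv_mult[OF this d[of y], of b] show ?thesis
      by (simp add: partial_deriv_eq[OF cis])
  qed
  obtain C L where C: "\<And>y. norm (a y) <= C" and L: "\<And>y. norm y > L ==> a y = 0"
    using test_fun_cbounded[OF a] unfolding cbounded_def by blast
  obtain C' where C': "\<And>y. norm (partial_deriv b a y) <= C'"
    using test_fun_cbounded[OF a'] unfolding cbounded_def by blast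
  have "(LINT y|lborel. partial_deriv b ?h y) = 0"
  proof (rule integral_partial_deriv_0[of _ L])
    show "?h differentiable (at y)" for y
      by (intro differentiable_mult d) (use cis in \<open>auto simp: differentiable_def\<close>)
    show "norm (partial_deriv b ?h y) <= \<bar>x \<bullet> b\<bar> * C + C'" for y
      unfolding ph by (rule norm_triangle_mono) (auto simp: norm_mult C C' intro!: mult_left_mono)
  qed (simp add: L)
  moreover have "(LINT y|lborel. partial_deriv b ?h y)
      = \<i> * of_real (x \<bullet> b) * synth a x + synth (partial_deriv b a) x"
    unfolding ph synth_def
    using cbounded_integrable[OF cbounded_cis[OF test_fun_cbounded[OF a]], of x]
      cbounded_integrable[OF cbounded_cis[OF test_fun_cbounded[OF a']], of x]
    by (subst Bochner_Integration.integral_add) auto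
  ultimately show ?thesis by (simp add: add_eq_0_iff)
qed

text \<open>Each further power of 1 + norm x is bought with one more derivative of the symbol: norm
  x is at most the sum of the absolute coordinates, and a coordinate times \<open>synth\<close> has
  the modulus of the \<open>synth\<close> of a partial derivative. The constant stays uniform
  because partial derivatives of a \<open>test_family\<close> form a
  \<open>test_family\<close>.\<close>

lemma synth_decay:
  fixes F :: "'i => 'a::euclidean_space => complex"
  assumes "test_family I F"
  shows "\<exists>C. \<forall>i\<in>I. \<forall>x. (1 + norm x) ^ N * norm (synth (F i) x) <= C"
  using assms
proof (induction N arbitrary: F)
  case (0 F)
  then obtain L where L: "\<And>i x. i \<in> I ==> norm x > L ==> F i x = 0"
    unfolding test_family_def by blast
  obtain C where C: "C > 0" "\<And>i x. i \<in> I ==> norm (F i x) <= C"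
    using 0 usmooth_bounded unfolding test_family_def by metis
  have "norm (synth (F i) x) <= (LINT y|lborel. C * indicator (cball (0::'a) L) y)" if "i \<in> I" for i x
    unfolding synth_def
  proof (rule Bochner_Integration.integral_norm_bound_integral)
    show "integrable lborel (\<lambda>\<xi>. cis (x \<bullet> \<xi>) * F i \<xi>)"
      by (intro cbounded_integrable cbounded_cis test_fun_cbounded test_family_member[OF 0 that])
    show "integrable lborel (\<lambda>x::'a. C * indicator (cball 0 L) x :: real)"
      by (intro integrable_mult_right integrable_real_indicator) (auto intro!: emeasure_bounded_finite[unfolded infinity_ennreal_def])
    show "norm (cis (x \<bullet> \<xi>) * F i \<xi>) <= C * indicator (cball 0 L) \<xi>" for \<xi>
      using C(2)[OF that, of \<xi>] L[OF that, of \<xi>] by (auto simp: norm_mult indicator_def)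
  qed
  then show ?case by auto
next
  case (Suc N F)
  obtain C where C: "\<And>i x. i \<in> I ==> (1 + norm x) ^ N * norm (synth (F i) x) <= C"
    using Suc.IH[OF Suc.prems] by blast
  have "\<exists>C. \<forall>i\<in>I. \<forall>x. (1 + norm x) ^ N * norm (synth (partial_deriv b (F i)) x) <= C" if "b \<in> Basis" for b
    by (rule Suc.IH[OF test_family_partial_deriv[OF Suc.prems that]])
  then obtain D where D: "\<And>b i x. b \<in> Basis ==> i \<in> I ==>
      (1 + norm x) ^ N * norm (synth (partial_deriv b (F i)) x) <= D b"
    by metis
  have "(1 + norm x) ^ Suc N * norm (synth (F i) x) <= C + (\<Sum>b\<in>Basis. D b)" if i: "i \<in> I" for i x
  proof -
    have "(1 + norm x) ^ Suc N * norm (synth (F i) x)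
      <= (1 + norm x) ^ N * ((1 + (\<Sum>b\<in>Basis. \<bar>x \<bullet> b\<bar>)) * norm (synth (F i) x))"
      using norm_le_l1[of x] by (simp add: mult.assoc mult.left_commute[of "1 + norm x"] mult_left_mono mult_right_mono)
    also have "... = (1 + norm x) ^ N * norm (synth (F i) x) +
        (\<Sum>b\<in>Basis. (1 + norm x) ^ N * norm (synth (partial_deriv b (F i)) x))"
      by (simp add: synth_partial_deriv[OF test_family_member[OF Suc.prems i]] norm_mult
          algebra_simps sum_distrib_left sum_distrib_right)
    also have "... <= C + (\<Sum>b\<in>Basis. D b)"
      by (intro add_mono sum_mono C D i)
    finally show ?thesis .
  qed
  then show ?case by blast
qed

section \<open>Integrals of decaying functions\<close>

abbreviation decay :: "real => real => 'a::real_normed_vector => real" where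
  "decay M R z \<equiv> (1 + R * norm z) powr (- M)"

text \<open>C is a function of the decay exponent, so one C records decay of every order at length
  scale 1/r, with the height r^d of an L1-normalised kernel.\<close>

abbreviation kernel_bound :: "(real => real) => real => ('a::euclidean_space => complex) => bool" where
  "kernel_bound C r \<kappa> \<equiv> \<forall>M x. norm (\<kappa> x) <= C M * r ^ DIM('a) * decay M r x"

text \<open>The exponent s_p with n - 1 read off from the type of the hyperplane; it is 0 for p >=
  1.\<close>

abbreviation crit_gap :: "'a::euclidean_space itself => ennreal => real" where
  "crit_gap _ p \<equiv> real DIM('a) * (1 / enn2real (min p 1) - 1)"

abbreviation Lp_mass :: "real => ('a::euclidean_space => 'b::real_normed_vector) => ennreal" where
  "Lp_mass p g \<equiv> \<integral>\<^sup>+x. ennreal (norm (g x) powr p) \<partial>lborel"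

abbreviation L1_mass :: "('a::euclidean_space => 'b::real_normed_vector) => ennreal" where
  "L1_mass g \<equiv> \<integral>\<^sup>+y. ennreal (norm (g y)) \<partial>lborel"

abbreviation trace_pair :: "('a::euclidean_space \<times> real => complex) => ('a => complex) => ennreal" where
  "trace_pair g \<phi> \<equiv> \<integral>\<^sup>+y. ennreal (norm (g (y, 0)) * norm (\<phi> y)) \<partial>lborel"

abbreviation trace_conv :: "('a::euclidean_space \<times> real => complex) => ('a => complex) => 'a => ennreal" where
  "trace_conv g \<kappa> x \<equiv> \<integral>\<^sup>+y. ennreal (norm (g (y, 0)) * norm (\<kappa> (x - y))) \<partial>lborel"

text \<open>Dyadic shells: where 1 + norm x lies between 2^j and 2^(j+1), the integrand is at most
  2^(-Mj) and x lies in the ball of radius 2^(j+1). The volumes turn this into a geometric series of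
  ratio 2^(d-M) < 1.\<close>

lemma nn_integral_decay_finite:
  assumes "M > real DIM('a::euclidean_space)"
  shows "(\<integral>\<^sup>+(x::'a). ennreal ((1 + norm x) powr (-M)) \<partial>lborel) < \<infinity>"
proof -
  define d where "d = DIM('a)"
  define c where "c = unit_ball_vol (real d)"
  have c: "c >= 0" unfolding c_def by simp
  have le: "ennreal ((1 + norm x) powr (-M))
      <= (\<Sum>j. ennreal (2 powr (- M * real j)) * indicator (cball 0 (2 ^ Suc j)) x)" for x :: 'a
  proof -
    define j where "j = nat \<lfloor>log 2 (1 + norm x)\<rfloor>"
    have l0: "log 2 (1 + norm x) >= 0"
      by (subst zero_le_log_cancel_iff) (auto simp: add_pos_nonneg)
    then have j: "real j <= log 2 (1 + norm x)" "log 2 (1 + norm x) < real j + 1"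
      unfolding j_def by linarith+
    have 1: "2 powr real j <= 1 + norm x"
      using j(1) by (simp add: le_log_iff add_pos_nonneg)
    have 2: "1 + norm x < 2 powr (real j + 1)"
      using j(2) by (simp add: log_less_iff add_pos_nonneg)
    then have x: "x \<in> cball 0 (2 ^ Suc j)"
      by (simp add: powr_add powr_realpow mult.commute)
    have "(1 + norm x) powr (-M) <= (2 powr real j) powr (-M)"
      using 1 assms by (intro powr_mono2') auto
    also have "... = 2 powr (- M * real j)" by (simp add: powr_powr mult.commute)
    finally have "ennreal ((1 + norm x) powr (-M))
        <= (\<lambda>j. ennreal (2 powr (- M * real j)) * indicator (cball 0 (2 ^ Suc j)) x) j"
      using x by (simp add: ennreal_leI)
    also have "... <= (\<Sum>j. ennreal (2 powr (- M * real j)) * indicator (cball 0 (2 ^ Suc j)) x)"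
      by (rule order_trans[OF _ sum_le_suminf[OF summableI, of "{j}"]]) (auto simp del: sum_mult_indicator power_Suc)
    finally show ?thesis .
  qed
  have em: "emeasure lborel (cball (0::'a) r) = ennreal (c * r ^ d)" if "r >= 0" for r
    using emeasure_cball[OF that, of "0::'a"] by (simp add: c_def d_def)
  have "(\<integral>\<^sup>+(x::'a). ennreal ((1 + norm x) powr (-M)) \<partial>lborel)
      <= (\<integral>\<^sup>+(x::'a). (\<Sum>j. ennreal (2 powr (- M * real j)) * indicator (cball 0 (2 ^ Suc j)) x) \<partial>lborel)"
    by (intro nn_integral_mono le)
  also have "... = (\<Sum>j. ennreal (2 powr (- M * real j)) * emeasure lborel (cball (0::'a) (2 ^ Suc j)))"
  proof (subst nn_integral_suminf)
    show "(\<lambda>x::'a. ennreal (2 powr (- M * real j)) * indicator (cball 0 (2 ^ Suc j)) x) \<in> borel_measurable lborel" for j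
      by (intro borel_measurable_times_ennreal borel_measurable_const borel_measurable_indicator) simp
    show "(\<Sum>j. \<integral>\<^sup>+(x::'a). ennreal (2 powr (- M * real j)) * indicator (cball 0 (2 ^ Suc j)) x \<partial>lborel)
        = (\<Sum>j. ennreal (2 powr (- M * real j)) * emeasure lborel (cball (0::'a) (2 ^ Suc j)))"
      by (intro suminf_cong nn_integral_cmult_indicator) simp
  qed
  also have "... = (\<Sum>j. ennreal (c * 2 ^ d * (2 powr (real d - M)) ^ j))"
  proof (intro suminf_cong)
    fix j
    have "2 powr (- M * real j) * (2 ^ Suc j) ^ d = 2 ^ d * (2 powr (real d - M)) ^ j"
    proof -
      have "((2::real) ^ Suc j) ^ d = 2 ^ d * 2 powr (real d * real j)"
        using powr_realpow[of 2 "d * j"]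
        by (simp add: power_mult_distrib power_mult[symmetric] mult.commute)
      moreover have "(2 powr (real d - M)) ^ j = 2 powr ((real d - M) * real j)"
        by (simp add: powr_realpow[symmetric] powr_powr)
      moreover have "2 powr (- M * real j) * 2 powr (real d * real j) = 2 powr ((real d - M) * real j)"
        by (simp add: powr_add[symmetric] algebra_simps)
      ultimately show ?thesis by (simp add: mult.left_commute del: power_Suc)
    qed
    then have "2 powr (- M * real j) * (c * (2 ^ Suc j) ^ d) = c * 2 ^ d * (2 powr (real d - M)) ^ j"
      by (metis mult.assoc mult.left_commute)
    then show "ennreal (2 powr (- M * real j)) * emeasure lborel (cball (0::'a) (2 ^ Suc j))
        = ennreal (c * 2 ^ d * (2 powr (real d - M)) ^ j)"
      using c by (subst em) (auto simp: ennreal_mult[symmetric] simp del: power_Suc)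
  qed
  also have "... < \<infinity>"
  proof -
    have "summable (\<lambda>j. c * 2 ^ d * (2 powr (real d - M)) ^ j)"
      using assms by (intro summable_mult summable_geometric) (simp add: d_def powr_less_one)
    then show ?thesis
      using c by (subst suminf_ennreal2) auto
  qed
  finally show ?thesis .
qed

lemma nn_integral_affine:
  fixes f :: "'a::euclidean_space => ennreal"
  assumes [measurable]: "f \<in> borel_measurable borel" and c: "c ~= 0"
  shows "(\<integral>\<^sup>+x. f x \<partial>lborel) = ennreal (\<bar>c\<bar> ^ DIM('a)) * (\<integral>\<^sup>+x. f (t + c *\<^sub>R x) \<partial>lborel)"
  by (subst lborel_affine[OF c, of t])
     (simp add: nn_integral_density nn_integral_distr nn_integral_cmult)

lemma integrable_affine:
  fixes f :: "'a::euclidean_space => 'b :: {banach, second_countable_topology}"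
  assumes f: "integrable lborel f"
  shows "c ~= 0 ==> integrable lborel (\<lambda>x. f (t + c *\<^sub>R x))"
  using f f[THEN borel_measurable_integrable] unfolding integrable_iff_bounded
  by (subst (asm) nn_integral_affine[where c=c and t=t]) (auto simp: ennreal_mult_less_top)

lemma integral_affine:
  fixes f :: "'a::euclidean_space => 'b :: {banach, second_countable_topology}"
  assumes f[measurable]: "f \<in> borel_measurable borel" and c: "c ~= 0"
  shows "(LINT x|lborel. f x) = \<bar>c\<bar> ^ DIM('a) *\<^sub>R (LINT x|lborel. f (t + c *\<^sub>R x))"
  by (subst lborel_affine[OF c, of t])
     (simp add: integral_density integral_distr)

lemma integrable_lborel_translate:
  fixes f :: "'a::euclidean_space => 'b :: {banach, second_countable_topology}"
  assumes "integrable lborel f" shows "integrable lborel (\<lambda>x. f (x + t))" "integrable lborel (\<lambda>x. f (t - x))"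
  using integrable_affine[OF assms, of 1 t] integrable_affine[OF assms, of "-1" t] by (auto simp: add.commute)

lemma integral_lborel_reflect:
  fixes f :: "'a::euclidean_space => 'b :: {banach, second_countable_topology}"
  assumes f: "f \<in> borel_measurable borel"
  shows "(LINT x|lborel. f (t - x)) = (LINT x|lborel. f x)"
  using integral_affine[OF f, of "-1" t] by simp

lemma integrable_decay:
  fixes f :: "'a::euclidean_space => complex"
  assumes m: "f \<in> borel_measurable borel" and M: "M > DIM('a)"
    and f: "\<And>x. (1 + norm x) ^ M * norm (f x) <= C"
  shows "integrable lborel f"
proof (rule integrableI_bounded)
  have "norm (f x) <= \<bar>C\<bar> * (1 + norm x) powr (-real M)" for x
  proof -
    have "(1 + norm x) ^ M > 0" by (simp add: add_pos_nonneg)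
    then have "norm (f x) <= C / (1 + norm x) ^ M"
      using f[of x] by (simp add: field_simps)
    also have "... <= \<bar>C\<bar> / (1 + norm x) ^ M" by (intro divide_right_mono) auto
    finally show ?thesis by (simp add: powr_minus powr_realpow add_pos_nonneg divide_inverse)
  qed
  then have le: "ennreal (norm (f x)) <= ennreal \<bar>C\<bar> * ennreal ((1 + norm x) powr (-real M))" for x
    by (auto simp: ennreal_mult[symmetric] intro!: ennreal_leI)
  have "(\<integral>\<^sup>+x. ennreal (norm (f x)) \<partial>lborel)
     <= (\<integral>\<^sup>+(x::'a). ennreal \<bar>C\<bar> * ennreal ((1 + norm x) powr (-real M)) \<partial>lborel)"
    by (intro nn_integral_mono le)
  also have "... = ennreal \<bar>C\<bar> * (\<integral>\<^sup>+(x::'a). ennreal ((1 + norm x) powr (-real M)) \<partial>lborel)"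
    by (rule nn_integral_cmult) simp
  also have "... < \<infinity>"
    using nn_integral_decay_finite[where 'a='a, of "real M"] M by (simp add: ennreal_mult_less_top)
  finally show "(\<integral>\<^sup>+x. ennreal (norm (f x)) \<partial>lborel) < \<infinity>" .
qed (use m in simp)

lemma integrable_pair_mult:
  fixes f :: "'a::euclidean_space => complex" and g :: "'b::euclidean_space => complex"
  assumes f: "integrable lborel f" and g: "integrable lborel g"
    and k: "k \<in> borel_measurable (lborel \<Otimes>\<^sub>M lborel)" "\<And>z. norm (k z) <= B"
  shows "integrable (lborel \<Otimes>\<^sub>M lborel) (\<lambda>(x, y). k (x, y) * f x * g y)"
proof -
  have [measurable]: "f \<in> borel_measurable borel" "g \<in> borel_measurable borel"
    using f g by auto
  have "integrable (lborel \<Otimes>\<^sub>M lborel) (\<lambda>z. of_real B * (f (fst z) * g (snd z)))"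
  proof (intro integrable_mult_right lborel_pair.Fubini_integrable)
    show "integrable lborel (\<lambda>x. LINT y|lborel. norm (f (fst (x, y)) * g (snd (x, y))))"
      using f g by (simp add: norm_mult)
    show "AE x in lborel. integrable lborel (\<lambda>y. f (fst (x, y)) * g (snd (x, y)))"
      using g by simp
  qed measurable
  then show ?thesis
  proof (rule Bochner_Integration.integrable_bound)
    show "(\<lambda>(x, y). k (x, y) * f x * g y) \<in> borel_measurable (lborel \<Otimes>\<^sub>M lborel)"
      using k(1) by measurable
    have "norm (k z * f (fst z) * g (snd z)) <= norm (of_real B * (f (fst z) * g (snd z)))" for z
      using k(2)[of z] by (auto simp: norm_mult mult.assoc intro!: mult_right_mono)
    then show "AE z in lborel \<Otimes>\<^sub>M lborel. norm (case z of (x, y) => k (x, y) * f x * g y)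
        <= norm (of_real B * (f (fst z) * g (snd z)))"
      by (auto simp: case_prod_beta)
  qed
qed

lemma measurable_cis_pair:
  fixes j :: "'a::euclidean_space => 'b::euclidean_space"
  assumes [measurable]: "j \<in> borel_measurable borel"
  shows "(\<lambda>(x, y). cis (j x \<bullet> y)) \<in> borel_measurable (lborel \<Otimes>\<^sub>M lborel)"
proof -
  have "cis \<in> borel_measurable borel"
    by (intro borel_measurable_continuous_onI continuous_intros)
  then show ?thesis by measurable
qed

text \<open>Fubini for the oscillatory kernel. The map j may go between spaces of different
  dimension: the identity gives the multiplication formula behind inversion, the embedding of the
  hyperplane gives the trace.\<close>

lemma synth_exchange:
  fixes f :: "'b::euclidean_space => complex" and g :: "'a::euclidean_space => complex"
  assumes f: "integrable lborel f" and g: "integrable lborel g" and j: "j \<in> borel_measurable borel"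
  shows "(LINT y|lborel. f y * synth g (j y)) = (LINT \<xi>|lborel. (LINT y|lborel. cis (j y \<bullet> \<xi>) * f y) * g \<xi>)"
proof -
  have "(LINT y|lborel. f y * synth g (j y)) = (LINT y|lborel. LINT \<xi>|lborel. cis (j y \<bullet> \<xi>) * f y * g \<xi>)"
    unfolding synth_def by (intro Bochner_Integration.integral_cong refl)
      (simp flip: integral_mult_right_zero add: mult.assoc mult.left_commute)
  also have "... = (LINT \<xi>|lborel. LINT y|lborel. cis (j y \<bullet> \<xi>) * f y * g \<xi>)"
    using integrable_pair_mult[OF f g measurable_cis_pair[OF j], of 1]
    by (intro lborel_pair.Fubini_integral[symmetric]) (simp add: case_prod_beta)
  finally show ?thesis by simp
qed

lemma test_fun_partial_deriv: "test_fun a ==> b \<in> Basis ==> test_fun (partial_deriv b a)"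
  unfolding test_fun_def by (rule test_family_partial_deriv)

lemma synth_continuous: "cbounded c ==> continuous_on S (synth c)"
  by (meson continuous_at_imp_continuous_on has_derivative_continuous synth_has_derivative)

lemma synth_measurable: "cbounded c ==> synth c \<in> borel_measurable borel"
  by (intro borel_measurable_continuous_onI synth_continuous)

lemma test_fun_synth_decay:
  assumes "test_fun a" obtains C where "C > 0" "\<And>x. (1 + norm x) ^ N * norm (synth a x) <= C"
proof -
  obtain C where "\<And>x. (1 + norm x) ^ N * norm (synth a x) <= C"
    using synth_decay[OF assms[unfolded test_fun_def], of N] by auto
  then show thesis by (intro that[of "max C 1"]) (auto intro: max.coboundedI1)
qed

lemma test_fun_synth_integrable:
  fixes a :: "'a::euclidean_space => complex"
  assumes a: "test_fun a" shows "integrable lborel (synth a)"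
proof -
  obtain C where "\<And>x. (1 + norm x) ^ Suc DIM('a) * norm (synth a x) <= C"
    using test_fun_synth_decay[OF a] by metis
  then show ?thesis
    by (intro integrable_decay[of _ "Suc DIM('a)" C] synth_measurable test_fun_cbounded a) auto
qed

section \<open>Cutoff functions\<close>

lemma cutoff_usmooth:
  assumes "cutoff \<eta>" shows "usmooth m UNIV (\<lambda>_::unit. \<eta>)"
proof -
  have "smooth_fun g ==> (\<And>t. \<bar>t\<bar> > 2 ==> g t = 0) ==> usmooth m UNIV (\<lambda>_::unit. g)"
    for g :: "real => real"
  proof (induction m arbitrary: g)
    have bd: "\<exists>C. \<forall>x. norm (g x) <= C" if "smooth_fun g" "\<And>t. \<bar>t\<bar> > 2 ==> g t = 0"
      for g :: "real => real"
    proof -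
      have "bounded (g ` {-2..2})"
        by (intro compact_imp_bounded compact_continuous_image smooth_fun_continuous that) simp
      then obtain C where "\<forall>y\<in>g ` {-2..2}. norm y <= C"
        unfolding bounded_iff by blast
      then have C: "norm (g t) <= C" if "t \<in> {-2..2}" for t using that by blast
      have "norm (g t) <= max C 0" for t
        using C[of t] that(2)[of t] by (cases "t \<in> {-2..2}") (auto simp: le_max_iff_disj)
      then show ?thesis by blast
    qed
    {
      case 0
      with bd[OF this] show ?case by (auto intro: smooth_fun_differentiable)
    next
      case (Suc m g)
      have "partial_deriv 1 g t = 0" if "\<bar>t\<bar> > 2" for t
      proof -
        have "open {t::real. \<bar>t\<bar> > 2}" by (intro open_Collect_less continuous_intros)
        then have "(g has_derivative (\<lambda>_. 0)) (at t)"
          by (intro has_derivative_transform_within_open[OF has_derivative_const[of 0 "at t"]])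
             (use that Suc.prems in auto)
        then show ?thesis by (rule partial_deriv_eq)
      qed
      then have "usmooth m UNIV (\<lambda>_::unit. partial_deriv 1 g)"
        by (intro Suc.IH smooth_fun_partial_deriv Suc.prems) auto
      with bd[OF Suc.prems] Suc.prems(1) show ?case by (auto intro: smooth_fun_differentiable)
    }
  qed
  with assms show ?thesis unfolding cutoff_def by auto
qed

lemma cutoff_range: "cutoff \<eta> ==> 0 <= \<eta> t" "cutoff \<eta> ==> \<eta> t <= 1"
  unfolding cutoff_def by (auto simp: image_subset_iff)

lemma cutoff_eq_1: "cutoff \<eta> ==> \<bar>t\<bar> <= 1 ==> \<eta> t = 1"
  and cutoff_eq_0: "cutoff \<eta> ==> \<bar>t\<bar> >= 2 ==> \<eta> t = 0"
  unfolding cutoff_def by auto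

text \<open>Common normal form of all bumps that occur, after any translation and rescaling. Uniform
  smoothness of a family of them depends only on a bound for A.\<close>

definition box_bump :: "(real => real) => real => 'a::euclidean_space => 'a => complex" where
  "box_bump \<eta> A v x = of_real (\<Prod>b\<in>Basis. \<eta> (A * (x \<bullet> b) + v \<bullet> b))"

lemma usmooth_box_bump:
  assumes "cutoff \<eta>" "\<And>i. i \<in> I ==> \<bar>A i\<bar> <= M"
  shows "usmooth m I (\<lambda>i. box_bump \<eta> (A i) (v i))"
  unfolding box_bump_def
  by (intro usmooth_of_real usmooth_prod usmooth_coordinate[where M=M] cutoff_usmooth assms) auto

lemma box_bump_eq_0:
  assumes "cutoff \<eta>" "b \<in> Basis" "\<bar>A * (x \<bullet> b) + v \<bullet> b\<bar> >= 2" shows "box_bump \<eta> A v x = 0"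
  unfolding box_bump_def using assms cutoff_eq_0 by (auto intro!: prod_zero)

lemma box_bump_eq_1:
  assumes "cutoff \<eta>" "\<And>b. b \<in> Basis ==> \<bar>A * (x \<bullet> b) + v \<bullet> b\<bar> <= 1" shows "box_bump \<eta> A v x = 1"
  unfolding box_bump_def using assms cutoff_eq_1 by (auto intro!: prod.neutral)

lemma test_fun_box_bump:
  fixes v :: "'a::euclidean_space"
  assumes "cutoff \<eta>" "A ~= 0" shows "test_fun (box_bump \<eta> A v)"
proof -
  define L where "L = (\<Sum>b\<in>(Basis::'a set). (2 + \<bar>v \<bullet> b\<bar>) / \<bar>A\<bar>)"
  have "box_bump \<eta> A v x = 0" if "norm x > L" for x
  proof (rule ccontr)
    assume nz: "box_bump \<eta> A v x ~= 0"
    have "\<bar>x \<bullet> b\<bar> <= (2 + \<bar>v \<bullet> b\<bar>) / \<bar>A\<bar>" if "b \<in> Basis" for b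
    proof -
      have "\<bar>A * (x \<bullet> b) + v \<bullet> b\<bar> < 2"
        using box_bump_eq_0[OF assms(1) that, of A x v] nz by fastforce
      then have "\<bar>A\<bar> * \<bar>x \<bullet> b\<bar> <= 2 + \<bar>v \<bullet> b\<bar>" unfolding abs_mult[symmetric] by linarith
      then show ?thesis using assms(2) by (simp add: field_simps)
    qed
    then have "norm x <= L"
      unfolding L_def by (intro order_trans[OF norm_le_l1] sum_mono)
    with that show False by simp
  qed
  moreover have "usmooth m UNIV (\<lambda>_::unit. box_bump \<eta> A v)" for m
    using usmooth_box_bump[OF assms(1), of UNIV "\<lambda>_. A" "\<bar>A\<bar>"] by simp
  ultimately show ?thesis unfolding test_fun_def test_family_def by blast
qed

section \<open>Fourier inversion up to a constant\<close>

lemma continuous_AE_zero: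
  fixes f :: "'a::euclidean_space => complex"
  assumes "continuous_on UNIV f" "AE x in lborel. f x = 0"
  shows "f x = 0"
proof -
  have "open {x. f x ~= 0}"
    by (intro open_Collect_neq assms continuous_intros)
  moreover have "{x. f x ~= 0} \<in> null_sets lebesgue"
    using AE_iff_null[of lborel "\<lambda>x. f x = 0"] assms(2) borel_open[OF calculation] null_sets_completionI
    by auto
  ultimately show ?thesis
    using open_not_negligible[of "{x. f x ~= 0}"] by (auto simp: negligible_iff_null_sets)
qed

text \<open>Insert \<theta>(\<epsilon> x) with \<epsilon> tending to 0. As \<theta> 0 = 1, the left
  side is recovered by dominated convergence; after the exchange of integrals,
  \<open>synth \<theta>\<close> acts as an approximate identity on a and produces a \<xi> times its
  total integral.\<close>

lemma inversion_aux:
  fixes a \<theta> :: "'a::euclidean_space => complex"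
  assumes a: "test_fun a" and \<theta>: "test_fun \<theta>" "\<theta> 0 = 1"
  shows "(LINT x|lborel. cis (- (x \<bullet> \<xi>)) * synth a x) = (LINT x|lborel. synth \<theta> x) * a \<xi>"
proof -
  note ca = test_fun_cbounded[OF a] and c\<theta> = test_fun_cbounded[OF \<theta>(1)]
  have [measurable]: "a \<in> borel_measurable borel" "\<theta> \<in> borel_measurable borel"
    "synth a \<in> borel_measurable borel" "synth \<theta> \<in> borel_measurable borel" "cis \<in> borel_measurable borel"
    using ca c\<theta> synth_measurable[OF ca] synth_measurable[OF c\<theta>]
    by (auto simp: cbounded_def intro!: borel_measurable_continuous_onI continuous_intros)
  obtain A where A: "\<And>x. norm (a x) <= A" using ca unfolding cbounded_def by blast
  obtain T where T: "\<And>x. norm (\<theta> x) <= T" using c\<theta> unfolding cbounded_def by blast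
  have ia: "integrable lborel (synth a)" and i\<theta>: "integrable lborel (synth \<theta>)"
    by (intro test_fun_synth_integrable a \<theta>)+
  let ?e = "\<lambda>n. 1 / real (Suc n)"
  let ?f = "\<lambda>n x. \<theta> (?e n *\<^sub>R x) * cis (- (x \<bullet> \<xi>))"
  \<comment> \<open>Exchange the integrals, then substitute \<zeta> = \<xi> + \<epsilon> u; the
    Jacobian cancels the power of \<epsilon> that comes from rescaling \<theta>.\<close>
  have eq: "(LINT x|lborel. ?f n x * synth a x) = (LINT u|lborel. synth \<theta> u * a (\<xi> + ?e n *\<^sub>R u))" for n
  proof -
    let ?\<epsilon> = "?e n"
    have \<epsilon>: "?\<epsilon> ~= 0" "?\<epsilon> > 0" by auto
    have it: "integrable lborel (\<lambda>x. \<theta> (?\<epsilon> *\<^sub>R x))"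
      using integrable_affine[OF cbounded_integrable[OF c\<theta>] \<epsilon>(1), of 0] by simp
    have f: "integrable lborel (?f n)"
      by (rule Bochner_Integration.integrable_bound[OF it]) (auto simp: norm_mult)
    have "(LINT x|lborel. ?f n x * synth a (id x)) = (LINT \<zeta>|lborel. (LINT x|lborel. cis (id x \<bullet> \<zeta>) * ?f n x) * a \<zeta>)"
      by (rule synth_exchange[OF f cbounded_integrable[OF ca]]) simp
    also have "... = (LINT \<zeta>|lborel. (?\<epsilon> powr (-real DIM('a))) *\<^sub>R (synth \<theta> ((1 / ?\<epsilon>) *\<^sub>R (\<zeta> - \<xi>)) * a \<zeta>))"
    proof (rule Bochner_Integration.integral_cong[OF refl])
      fix \<zeta> :: 'a
      have "(LINT x|lborel. cis (id x \<bullet> \<zeta>) * ?f n x)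
        = (LINT x|lborel. cis (x \<bullet> (\<zeta> - \<xi>)) * \<theta> (?\<epsilon> *\<^sub>R x))"
        by (intro Bochner_Integration.integral_cong) (auto simp: cis_mult inner_diff_right algebra_simps)
      also have "... = \<bar>1 / ?\<epsilon>\<bar> ^ DIM('a) *\<^sub>R
          (LINT x|lborel. cis ((0 + (1 / ?\<epsilon>) *\<^sub>R x) \<bullet> (\<zeta> - \<xi>)) * \<theta> (?\<epsilon> *\<^sub>R (0 + (1 / ?\<epsilon>) *\<^sub>R x)))"
        by (rule integral_affine) (use \<epsilon> in auto)
      also have "... = \<bar>1 / ?\<epsilon>\<bar> ^ DIM('a) *\<^sub>R synth \<theta> ((1 / ?\<epsilon>) *\<^sub>R (\<zeta> - \<xi>))"
        unfolding synth_def by (simp add: inner_commute del: of_nat_Suc)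
      also have "\<bar>1 / ?\<epsilon>\<bar> ^ DIM('a) = ?\<epsilon> powr (-real DIM('a))"
        using \<epsilon> by (simp add: powr_minus powr_realpow power_divide divide_inverse power_inverse del: of_nat_Suc)
      finally show "(LINT x|lborel. cis (id x \<bullet> \<zeta>) * ?f n x) * a \<zeta>
          = (?\<epsilon> powr (-real DIM('a))) *\<^sub>R (synth \<theta> ((1 / ?\<epsilon>) *\<^sub>R (\<zeta> - \<xi>)) * a \<zeta>)"
        by simp
    qed
    also have "... = \<bar>?\<epsilon>\<bar> ^ DIM('a) *\<^sub>R
       (LINT u|lborel. (?\<epsilon> powr (-real DIM('a))) *\<^sub>R (synth \<theta> ((1 / ?\<epsilon>) *\<^sub>R (\<xi> + ?\<epsilon> *\<^sub>R u - \<xi>)) * a (\<xi> + ?\<epsilon> *\<^sub>R u)))"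
      by (rule integral_affine[OF _ \<epsilon>(1)]) simp
    also have "... = (LINT u|lborel. synth \<theta> u * a (\<xi> + ?\<epsilon> *\<^sub>R u))"
      using \<epsilon> by (simp add: powr_minus powr_realpow del: of_nat_Suc)
    finally show ?thesis by simp
  qed
  have e0: "(\<lambda>n. ?e n *\<^sub>R x) \<longlonglongrightarrow> 0" for x :: 'a
    using tendsto_scaleR[OF LIMSEQ_inverse_real_of_nat tendsto_const[of x]]
    by (simp add: inverse_eq_divide del: of_nat_Suc)
  have "(\<lambda>n. LINT x|lborel. ?f n x * synth a x) \<longlonglongrightarrow> (LINT x|lborel. cis (- (x \<bullet> \<xi>)) * synth a x)"
  proof (rule integral_dominated_convergence)
    show "integrable lborel (\<lambda>x. T * norm (synth a x))" using ia by simp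
    show "AE x in lborel. norm (?f n x * synth a x) <= T * norm (synth a x)" for n
      using T by (auto simp: norm_mult intro!: mult_right_mono)
    have "(\<lambda>n. ?f n x * synth a x) \<longlonglongrightarrow> \<theta> 0 * cis (- (x \<bullet> \<xi>)) * synth a x" for x
      by (intro tendsto_intros isCont_tendsto_compose[OF _ e0])
         (use test_fun_continuous[OF \<theta>(1), of UNIV] in \<open>auto simp: continuous_on_eq_continuous_at\<close>)
    then show "AE x in lborel. (\<lambda>n. ?f n x * synth a x) \<longlonglongrightarrow> cis (- (x \<bullet> \<xi>)) * synth a x"
      by (simp add: \<theta>)
  qed auto
  moreover have "(\<lambda>n. LINT u|lborel. synth \<theta> u * a (\<xi> + ?e n *\<^sub>R u)) \<longlonglongrightarrow> (LINT u|lborel. synth \<theta> u * a \<xi>)"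
  proof (rule integral_dominated_convergence)
    show "integrable lborel (\<lambda>x. A * norm (synth \<theta> x))" using i\<theta> by simp
    show "AE u in lborel. norm (synth \<theta> u * a (\<xi> + ?e n *\<^sub>R u)) <= A * norm (synth \<theta> u)" for n
      using A by (auto simp: norm_mult mult.commute[of A] intro!: mult_left_mono)
    have "(\<lambda>n. synth \<theta> u * a (\<xi> + ?e n *\<^sub>R u)) \<longlonglongrightarrow> synth \<theta> u * a (\<xi> + 0)" for u
      by (intro tendsto_intros isCont_tendsto_compose[of _ a] e0)
         (use test_fun_continuous[OF a, of UNIV] in \<open>auto simp: continuous_on_eq_continuous_at\<close>)
    then show "AE u in lborel. (\<lambda>n. synth \<theta> u * a (\<xi> + ?e n *\<^sub>R u)) \<longlonglongrightarrow> synth \<theta> u * a \<xi>"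
      by simp
  qed auto
  ultimately show ?thesis
    unfolding eq by (simp add: LIMSEQ_unique)
qed

text \<open>The constant in Fourier inversion need not be identified: only that it does not vanish matters.\<close>

lemma inversion_constant_nonzero:
  fixes \<theta> :: "'a::euclidean_space => complex"
  assumes \<eta>: "cutoff \<eta>" and \<theta>_def: "\<theta> = box_bump \<eta> 1 0"
  shows "(LINT x|lborel. synth \<theta> x) ~= 0"
proof
  assume 0: "(LINT x|lborel. synth \<theta> x) = 0"
  have \<theta>: "test_fun \<theta>" unfolding \<theta>_def by (rule test_fun_box_bump[OF \<eta>]) simp
  have \<theta>0: "\<theta> 0 = 1" unfolding \<theta>_def by (rule box_bump_eq_1[OF \<eta>]) simp
  have real: "cnj (\<theta> x) = \<theta> x" for x unfolding \<theta>_def box_bump_def by simp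
  note c\<theta> = test_fun_cbounded[OF \<theta>]
  have int: "integrable lborel \<theta>" by (rule cbounded_integrable[OF c\<theta>])
  have [measurable]: "\<theta> \<in> borel_measurable borel" "cis \<in> borel_measurable borel"
    using c\<theta> by (auto simp: cbounded_def intro!: borel_measurable_continuous_onI continuous_intros)
  have int': "integrable lborel (\<lambda>x. \<theta> (- x))"
    using integrable_lborel_translate(2)[OF int, of 0] by simp
  have cs: "cnj (synth \<theta> x) = synth (\<lambda>x. \<theta> (- x)) x" for x
  proof -
    have "cnj (synth \<theta> x) = (LINT \<xi>|lborel. cis (- (x \<bullet> \<xi>)) * \<theta> \<xi>)"
      unfolding synth_def Bochner_Integration.integral_cnj[symmetric]
      by (rule Bochner_Integration.integral_cong) (auto simp: real cis_cnj)
    also have "... = synth (\<lambda>x. \<theta> (- x)) x"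
      unfolding synth_def
      using integral_lborel_reflect[of "\<lambda>\<xi>. cis (- (x \<bullet> \<xi>)) * \<theta> \<xi>" 0]
      by simp
    finally show ?thesis .
  qed
  have i\<theta>: "integrable lborel (synth \<theta>)" by (rule test_fun_synth_integrable[OF \<theta>])
  \<comment> \<open>The second factor is the complex conjugate of \<open>synth \<theta>\<close>. If
    the constant were 0, inversion would kill the inner integral, and the L2 norm of
    \<open>synth \<theta>\<close> would vanish.\<close>
  have "(LINT x|lborel. synth \<theta> x * synth (\<lambda>x. \<theta> (- x)) (id x))
     = (LINT \<xi>|lborel. (LINT x|lborel. cis (id x \<bullet> \<xi>) * synth \<theta> x) * \<theta> (- \<xi>))"
    by (rule synth_exchange[OF i\<theta> int']) simp
  also have "... = 0"
    using inversion_aux[OF \<theta> \<theta> \<theta>0, of "- \<xi>" for \<xi>] 0 by simp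
  finally have z: "(LINT x|lborel. synth \<theta> x * cnj (synth \<theta> x)) = 0"
    by (simp add: cs)
  have "(LINT x|lborel. (norm (synth \<theta> x))\<^sup>2) = 0"
  proof -
    have "complex_of_real (LINT x|lborel. (norm (synth \<theta> x))\<^sup>2) = (LINT x|lborel. synth \<theta> x * cnj (synth \<theta> x))"
      unfolding integral_complex_of_real[symmetric] complex_norm_square ..
    with z show ?thesis by simp
  qed
  moreover have "integrable lborel (\<lambda>x. (norm (synth \<theta> x))\<^sup>2)"
  proof -
    obtain C where C: "\<And>x. norm (synth \<theta> x) <= C"
      using test_fun_synth_decay[OF \<theta>, of 0] by auto
    have [measurable]: "synth \<theta> \<in> borel_measurable borel" by (rule synth_measurable[OF c\<theta>])
    show ?thesis
      by (rule Bochner_Integration.integrable_bound[of _ "\<lambda>x. C * norm (synth \<theta> x)"])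
         (use i\<theta> C in \<open>auto simp: power2_eq_square abs_mult intro!: mult_right_mono order_trans[OF C abs_ge_self]\<close>)
  qed
  ultimately have "AE x in lborel. synth \<theta> x = 0"
    by (subst (asm) integral_nonneg_eq_0_iff_AE) auto
  then have "synth \<theta> 0 = 0"
    by (rule continuous_AE_zero[OF synth_continuous[OF c\<theta>]])
  \<comment> \<open>The value at 0 of \<open>synth \<theta>\<close> is the integral of \<theta>,
    which cannot vanish for a nonnegative continuous function with \<theta> 0 = 1.\<close>
  then have "(LINT x|lborel. \<theta> x) = 0" by (simp add: synth_def)
  moreover have re: "\<theta> x = of_real (Re (\<theta> x))" "Re (\<theta> x) >= 0" for x
    using cutoff_range(1)[OF \<eta>]
    by (auto simp: \<theta>_def box_bump_def simp del: of_real_prod intro!: prod_nonneg)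
  ultimately have "(LINT x|lborel. Re (\<theta> x)) = 0"
    using int by (simp add: integral_Re)
  then have "AE x in lborel. Re (\<theta> x) = 0"
    using int re by (subst (asm) integral_nonneg_eq_0_iff_AE) auto
  then have "AE x in lborel. \<theta> x = 0" using re(1) by (metis (mono_tags, lifting) eventually_mono of_real_0)
  from continuous_AE_zero[OF test_fun_continuous[OF \<theta>] this] \<theta>0 show False by simp
qed

section \<open>Tempered distributions and their frequency-localized parts\<close>

section \<open>Tempered distributions\<close>

lemma smooth_fun_add:
  fixes \<phi> \<psi> :: "'a::euclidean_space => complex"
  assumes "smooth_fun \<phi>" "smooth_fun \<psi>" "set bs \<subseteq> Basis"
  shows "iter_partial_deriv bs (\<lambda>x. c * \<phi> x + d * \<psi> x)
    = (\<lambda>x. c * iter_partial_deriv bs \<phi> x + d * iter_partial_deriv bs \<psi> x)"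
  using assms(3)
proof (induction bs)
  case (Cons b bs)
  have "iter_partial_deriv bs \<phi> differentiable (at x)" "iter_partial_deriv bs \<psi> differentiable (at x)" for x
    using assms Cons.prems unfolding smooth_fun_def by auto
  then have "partial_deriv b (\<lambda>x. c * iter_partial_deriv bs \<phi> x + d * iter_partial_deriv bs \<psi> x) x
      = c * partial_deriv b (iter_partial_deriv bs \<phi>) x + d * partial_deriv b (iter_partial_deriv bs \<psi>) x" for x
    by (simp add: partial_deriv_add partial_deriv_cmult)
  with Cons show ?case by simp
qed simp

lemma schwartzI:
  assumes "smooth_fun \<phi>"
    and "\<And>bs N. set bs \<subseteq> Basis ==> \<exists>B. \<forall>x. (1 + norm x) ^ N * norm (iter_partial_deriv bs \<phi> x) <= B"
  shows "\<phi> \<in> schwartz"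
proof -
  have "bdd_above (schwartz_values N \<phi>)" for N
  proof -
    obtain B where B: "\<And>bs x. set bs \<subseteq> Basis ==> (1 + norm x) ^ N * norm (iter_partial_deriv bs \<phi> x) <= B bs"
      using assms(2)[of _ N] by metis
    let ?L = "{bs. set bs \<subseteq> (Basis::'a set) \<and> length bs <= N}"
    have fin: "finite ?L" by (rule finite_lists_length_le) simp
    have "v <= (\<Sum>bs\<in>?L. max 0 (B bs))" if v: "v \<in> schwartz_values N \<phi>" for v
    proof -
      obtain bs x where *: "bs \<in> ?L" "v = (1 + norm x) ^ N * norm (iter_partial_deriv bs \<phi> x)"
        using v unfolding schwartz_values_def by auto
      then have "v <= max 0 (B bs)" using B[of bs x] by auto
      also have "... <= (\<Sum>bs\<in>?L. max 0 (B bs))"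
        using *(1) by (intro member_le_sum fin) auto
      finally show ?thesis .
    qed
    then show ?thesis unfolding bdd_above_def by blast
  qed
  with assms(1) show ?thesis unfolding schwartz_def by blast
qed

lemma schwartzD:
  assumes "\<phi> \<in> schwartz" "set bs \<subseteq> Basis"
  obtains B where "B > 0" "\<And>x. (1 + norm x) ^ N * norm (iter_partial_deriv bs \<phi> x) <= B"
proof -
  let ?M = "max N (length bs)"
  obtain B where B: "\<And>v. v \<in> schwartz_values ?M \<phi> ==> v <= B"
    using assms unfolding schwartz_def bdd_above_def by blast
  have "(1 + norm x) ^ N * norm (iter_partial_deriv bs \<phi> x) <= max 1 B" for x
  proof -
    have "(1 + norm x) ^ N * norm (iter_partial_deriv bs \<phi> x)
        <= (1 + norm x) ^ ?M * norm (iter_partial_deriv bs \<phi> x)"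
      by (intro mult_right_mono power_increasing) auto
    also have "... <= B"
      using assms(2) by (intro B) (auto simp: schwartz_values_def)
    finally show ?thesis by simp
  qed
  then show thesis using that[of "max 1 B"] by auto
qed

lemma schwartz_smooth: "\<phi> \<in> schwartz ==> smooth_fun \<phi>"
  by (simp add: schwartz_def)

lemma schwartz_lincomb:
  assumes "\<phi> \<in> schwartz" "\<psi> \<in> schwartz"
  shows "(\<lambda>x. c * \<phi> x + d * \<psi> x) \<in> schwartz"
proof (rule schwartzI)
  note sm = assms[THEN schwartz_smooth]
  show "smooth_fun (\<lambda>x. c * \<phi> x + d * \<psi> x)"
    using sm unfolding smooth_fun_def
    by (auto simp: smooth_fun_add[OF sm] intro!: differentiable_add differentiable_mult)
  fix bs :: "'a list" and N assume bs: "set bs \<subseteq> Basis"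
  obtain A where A: "\<And>x. (1 + norm x) ^ N * norm (iter_partial_deriv bs \<phi> x) <= A"
    using schwartzD[OF assms(1) bs] by metis
  obtain B where B: "\<And>x. (1 + norm x) ^ N * norm (iter_partial_deriv bs \<psi> x) <= B"
    using schwartzD[OF assms(2) bs] by metis
  have "(1 + norm x) ^ N * norm (c * iter_partial_deriv bs \<phi> x + d * iter_partial_deriv bs \<psi> x)
      <= norm c * A + norm d * B" for x
  proof -
    have "(1 + norm x) ^ N * norm (c * iter_partial_deriv bs \<phi> x + d * iter_partial_deriv bs \<psi> x)
      <= (1 + norm x) ^ N * (norm (c * iter_partial_deriv bs \<phi> x) + norm (d * iter_partial_deriv bs \<psi> x))"
      by (intro mult_left_mono norm_triangle_ineq) auto
    also have "... = norm c * ((1 + norm x) ^ N * norm (iter_partial_deriv bs \<phi> x))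
        + norm d * ((1 + norm x) ^ N * norm (iter_partial_deriv bs \<psi> x))"
      by (simp add: norm_mult algebra_simps)
    also have "... <= norm c * A + norm d * B"
      by (intro add_mono mult_left_mono A B) auto
    finally show ?thesis .
  qed
  then show "\<exists>B. \<forall>x. (1 + norm x) ^ N * norm (iter_partial_deriv bs (\<lambda>x. c * \<phi> x + d * \<psi> x) x) <= B"
    by (auto simp: smooth_fun_add[OF sm bs])
qed

lemma schwartz_seminorm_le:
  fixes \<phi> :: "'a::euclidean_space => complex"
  assumes "\<And>bs x. set bs \<subseteq> Basis ==> length bs <= N ==> (1 + norm x) ^ N * norm (iter_partial_deriv bs \<phi> x) <= B"
  shows "schwartz_seminorm N \<phi> <= B"
  unfolding schwartz_seminorm_def
proof (rule cSup_least)
  have "(1 + norm (0::'a)) ^ N * norm (iter_partial_deriv [] \<phi> 0) \<in> schwartz_values N \<phi>"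
    unfolding schwartz_values_def by (intro CollectI exI[of _ 0] exI[of _ "[]"]) auto
  then show "schwartz_values N \<phi> ~= {}" by blast
qed (use assms in \<open>auto simp: schwartz_values_def\<close>)

lemma le_schwartz_seminorm:
  assumes "\<phi> \<in> schwartz" "set bs \<subseteq> Basis" "length bs <= N"
  shows "(1 + norm x) ^ N * norm (iter_partial_deriv bs \<phi> x) <= schwartz_seminorm N \<phi>"
  unfolding schwartz_seminorm_def
  by (rule cSup_upper) (use assms in \<open>auto simp: schwartz_values_def schwartz_def\<close>)

lemma tempered_lincomb:
  assumes f: "tempered_distribution f" and "\<phi> \<in> schwartz" "\<psi> \<in> schwartz"
  shows "f (\<lambda>x. c * \<phi> x + d * \<psi> x) = c * f \<phi> + d * f \<psi>"
proof -
  have s: "(\<lambda>x. c * \<phi> x) \<in> schwartz" "(\<lambda>x. d * \<psi> x) \<in> schwartz"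
    using schwartz_lincomb[OF assms(2,3), of c 0] schwartz_lincomb[OF assms(2,3), of 0 d] by auto
  have "f (\<lambda>x. c * \<phi> x + d * \<psi> x) = f (\<lambda>x. c * \<phi> x) + f (\<lambda>x. d * \<psi> x)"
    using f[unfolded tempered_distribution_def, THEN conjunct1] s by simp
  also have "... = c * f \<phi> + d * f \<psi>"
    using f assms(2,3) unfolding tempered_distribution_def by auto
  finally show ?thesis .
qed

lemma zero_schwartz:
  fixes \<phi> :: "'a::euclidean_space => complex"
  shows "\<phi> \<in> schwartz ==> (\<lambda>x::'a. 0) \<in> schwartz"
  using schwartz_lincomb[of \<phi> \<phi> 0 0] by simp

lemma tempered_zero:
  fixes \<phi> :: "'a::euclidean_space => complex" and f :: "'a distr"
  shows "tempered_distribution f ==> \<phi> \<in> schwartz ==> f (\<lambda>x. 0) = 0"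
  using tempered_lincomb[of f \<phi> \<phi> 0 0] by simp

lemma tempered_sum:
  fixes f :: "'a::euclidean_space distr" and \<psi> :: "'a => complex"
  assumes f: "tempered_distribution f" and "finite I" "\<And>i. i \<in> I ==> \<phi> i \<in> schwartz" "\<psi> \<in> schwartz"
  shows "(\<lambda>x. \<Sum>i\<in>I. c i * \<phi> i x) \<in> schwartz \<and> f (\<lambda>x. \<Sum>i\<in>I. c i * \<phi> i x) = (\<Sum>i\<in>I. c i * f (\<phi> i))"
  using assms(2,3)
proof (induction I rule: finite_induct)
  case empty
  then show ?case using zero_schwartz[OF assms(4)] tempered_zero[OF f assms(4)] by simp
next
  case (insert i I)
  from schwartz_lincomb[of "\<phi> i" "\<lambda>x. \<Sum>i\<in>I. c i * \<phi> i x" "c i" 1]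
    tempered_lincomb[OF f, of "\<phi> i" "\<lambda>x. \<Sum>i\<in>I. c i * \<phi> i x" "c i" 1]
  show ?case using insert by simp
qed

text \<open>Continuity repackaged: an estimate for \<open>f \<phi>\<close> now asks for one
  pointwise inequality per derivative of order at most N, and the suprema of the seminorms stay out
  of sight.\<close>

lemma tempered_bound:
  assumes "tempered_distribution f"
  obtains N C where "C > 0" "\<And>\<phi> B. \<phi> \<in> schwartz ==>
    (\<And>bs x. set bs \<subseteq> Basis ==> length bs <= N ==> (1 + norm x) ^ N * norm (iter_partial_deriv bs \<phi> x) <= B)
    ==> norm (f \<phi>) <= C * B"
proof -
  obtain N C where NC: "\<And>\<phi>. \<phi> \<in> schwartz ==> norm (f \<phi>) <= C * schwartz_seminorm N \<phi>"
    using assms unfolding tempered_distribution_def by blast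
  have "norm (f \<phi>) <= max 1 C * B" if "\<phi> \<in> schwartz"
    "\<And>bs x. set bs \<subseteq> Basis ==> length bs <= N ==> (1 + norm x) ^ N * norm (iter_partial_deriv bs \<phi> x) <= B"
    for \<phi> B
  proof -
    have "0 <= schwartz_seminorm N \<phi>"
      using le_schwartz_seminorm[OF that(1), of "[]" N 0] by (auto intro: order_trans[rotated])
    have "norm (f \<phi>) <= C * schwartz_seminorm N \<phi>" by (rule NC[OF that(1)])
    also have "... <= max 1 C * schwartz_seminorm N \<phi>"
      using \<open>0 <= schwartz_seminorm N \<phi>\<close> by (intro mult_right_mono) auto
    also have "... <= max 1 C * B"
      by (intro mult_left_mono schwartz_seminorm_le that(2)) auto
    finally show ?thesis .
  qed
  then show thesis using that[of "max 1 C" N] by auto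
qed

lemma test_fun_schwartz:
  assumes "test_fun a" shows "a \<in> schwartz"
proof (rule schwartzI)
  show "smooth_fun a"
    by (rule smooth_fun_coinduct[of test_fun])
       (use assms in \<open>auto intro: test_fun_differentiable test_fun_partial_deriv\<close>)
  fix bs :: "'a list" and N assume "set bs \<subseteq> Basis"
  then have "test_fun (iter_partial_deriv bs a)"
    by (induction bs) (auto intro: test_fun_partial_deriv assms)
  from test_fun_cbounded[OF this] obtain C L where
    C: "\<And>x. norm (iter_partial_deriv bs a x) <= C" and L: "\<And>x. norm x > L ==> iter_partial_deriv bs a x = 0"
    unfolding cbounded_def by blast
  have "(1 + norm x) ^ N * norm (iter_partial_deriv bs a x) <= (1 + \<bar>L\<bar>) ^ N * \<bar>C\<bar>" for x
  proof (cases "norm x > L")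
    case False
    then show ?thesis using order_trans[OF C abs_ge_self]
      by (intro mult_mono power_mono) auto
  qed (simp add: L)
  then show "\<exists>B. \<forall>x. (1 + norm x) ^ N * norm (iter_partial_deriv bs a x) <= B" by blast
qed

subsection \<open>Reflected translates of oscillatory integrals\<close>

text \<open>The symbol of the iterated derivative of the reflected translate
  \<open>synth c (w - z)\<close> in z: each derivative brings out the factor -i times a coordinate,
  the minus sign coming from the reflection.\<close>

primrec freq_mult :: "'a::euclidean_space list => ('a => complex) => 'a => complex" where
  "freq_mult [] c = c"
| "freq_mult (b # bs) c = (\<lambda>\<xi>. - \<i> * of_real (\<xi> \<bullet> b) * freq_mult bs c \<xi>)"

lemma cbounded_freq_mult: "cbounded c ==> cbounded (freq_mult bs c)"
  by (induction bs) (use cbounded_coordinate[of _ "- \<i>"] in auto)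

lemma test_fun_coordinate: "test_fun a ==> test_fun (\<lambda>\<xi>. k * of_real (\<xi> \<bullet> b) * a \<xi>)"
  unfolding test_fun_def
  using test_family_scale[OF test_family_coordinate, of UNIV "\<lambda>_::unit. a" "\<lambda>_. k" "norm k" b]
  by (simp add: mult.assoc)

lemma test_fun_freq_mult: "test_fun a ==> test_fun (freq_mult bs a)"
  by (induction bs) (use test_fun_coordinate[of _ "- \<i>"] in auto)

lemma freq_mult_mult: "freq_mult bs (\<lambda>\<xi>. d \<xi> * c \<xi>) = (\<lambda>\<xi>. d \<xi> * freq_mult bs c \<xi>)"
  by (induction bs) auto

lemma synth_cmult: "synth (\<lambda>\<xi>. k * c \<xi>) x = k * synth c x"
  unfolding synth_def by (subst mult.left_commute) simp

lemma reflected_synth_deriv: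
  assumes c: "cbounded c"
  shows "(\<lambda>z. synth c (w - z)) differentiable (at z)"
    and "b \<in> Basis ==> partial_deriv b (\<lambda>z. synth c (w - z)) z = synth (freq_mult [b] c) (w - z)"
proof -
  let ?D = "\<lambda>h. \<Sum>b\<in>Basis. (h \<bullet> b) *\<^sub>R synth (\<lambda>\<xi>. \<i> * of_real (\<xi> \<bullet> b) * c \<xi>) (w - z)"
  have D: "((\<lambda>z. synth c (w - z)) has_derivative (\<lambda>h. ?D (- h))) (at z)"
    by (rule has_derivative_compose[of "\<lambda>z. w - z", OF _ synth_has_derivative[OF c]])
       (auto intro!: derivative_eq_intros)
  then show "(\<lambda>z. synth c (w - z)) differentiable (at z)" unfolding differentiable_def by blast
  assume b: "b \<in> Basis"
  have "?D (- b) = (\<Sum>b'\<in>Basis. if b' = b then - synth (\<lambda>\<xi>. \<i> * of_real (\<xi> \<bullet> b) * c \<xi>) (w - z) else 0)"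
    by (intro sum.cong) (auto simp: inner_Basis b)
  also have "... = synth (freq_mult [b] c) (w - z)"
    using b synth_cmult[of "-1" "\<lambda>\<xi>. \<i> * of_real (\<xi> \<bullet> b) * c \<xi>" "w - z"] by (simp add: mult.assoc)
  finally show "partial_deriv b (\<lambda>z. synth c (w - z)) z = synth (freq_mult [b] c) (w - z)"
    using partial_deriv_eq[OF D] by simp
qed

lemma reflected_synth_iter:
  assumes c: "cbounded c" and bs: "set bs \<subseteq> Basis"
  shows "iter_partial_deriv bs (\<lambda>z. synth c (w - z)) = (\<lambda>z. synth (freq_mult bs c) (w - z))"
  using bs
proof (induction bs)
  case (Cons b bs)
  then have "iter_partial_deriv (b # bs) (\<lambda>z. synth c (w - z)) = partial_deriv b (\<lambda>z. synth (freq_mult bs c) (w - z))"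
    by simp
  also have "... = (\<lambda>z. synth (freq_mult [b] (freq_mult bs c)) (w - z))"
    using Cons.prems by (intro ext reflected_synth_deriv(2) cbounded_freq_mult c) auto
  finally show ?case by simp
qed simp

lemma reflected_synth_smooth:
  assumes c: "cbounded c" shows "smooth_fun (\<lambda>z. synth c (w - z))"
  unfolding smooth_fun_def
  by (auto simp: reflected_synth_iter[OF c] intro!: reflected_synth_deriv cbounded_freq_mult c)

text \<open>Submultiplicativity of 1 + norm x; it moves a weight in z to the translation parameter w
  and the argument w - z.\<close>

lemma shift_weight:
  fixes w z :: "'a::real_normed_vector"
  shows "(1 + norm z) ^ N <= (1 + norm w) ^ N * (1 + norm (w - z)) ^ N"
proof -
  have "norm z <= norm w + norm (w - z)" using norm_triangle_ineq4[of w "w - z"] by simp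
  also have "... <= norm w + norm (w - z) + norm w * norm (w - z)" by simp
  finally have "1 + norm z <= (1 + norm w) * (1 + norm (w - z))" by (simp add: algebra_simps)
  then show ?thesis by (metis add_nonneg_nonneg norm_ge_zero power_mono power_mult_distrib zero_le_one)
qed

lemma reflected_synth_bound:
  assumes a: "test_fun a"
  obtains C where "C > 0" "\<And>w z. (1 + norm z) ^ N * norm (synth a (w - z)) <= C * (1 + norm w) ^ N"
proof -
  obtain C where C: "C > 0" "\<And>x. (1 + norm x) ^ N * norm (synth a x) <= C"
    using test_fun_synth_decay[OF a] by metis
  have "(1 + norm z) ^ N * norm (synth a (w - z)) <= C * (1 + norm w) ^ N" for w z
  proof -
    have "(1 + norm z) ^ N * norm (synth a (w - z))
      <= (1 + norm w) ^ N * ((1 + norm (w - z)) ^ N * norm (synth a (w - z)))"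
      using mult_right_mono[OF shift_weight[of z N w] norm_ge_zero] by (simp add: mult.assoc)
    also have "... <= (1 + norm w) ^ N * C" by (intro mult_left_mono C) auto
    finally show ?thesis by (simp add: mult.commute)
  qed
  with C(1) show thesis using that by blast
qed

text \<open>These are the test functions on which every distribution is evaluated later, and the
  reason why \<open>distr_synth\<close> has a meaning.\<close>

lemma reflected_synth_schwartz:
  assumes a: "test_fun a" shows "(\<lambda>z. synth a (w - z)) \<in> schwartz"
proof (rule schwartzI[OF reflected_synth_smooth[OF test_fun_cbounded[OF a]]])
  fix bs :: "'a list" and N assume bs: "set bs \<subseteq> Basis"
  obtain C where "\<And>w z. (1 + norm z) ^ N * norm (synth (freq_mult bs a) (w - z)) <= C * (1 + norm w) ^ N"
    using reflected_synth_bound[OF test_fun_freq_mult[OF a]] by metis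
  then show "\<exists>B. \<forall>x. (1 + norm x) ^ N * norm (iter_partial_deriv bs (\<lambda>z. synth a (w - z)) x) <= B"
    by (auto simp: reflected_synth_iter[OF test_fun_cbounded[OF a] bs])
qed

text \<open>Only finitely many lists of basis vectors have length at most N, so bounds for the
  single derivatives merge into one constant, as a seminorm estimate demands.\<close>

lemma finite_lists_bound:
  assumes "\<And>bs. \<exists>C. P bs C" "\<And>bs C C'. P bs C ==> C <= C' ==> P bs (C'::real)"
  obtains C where "C > 0" "\<And>bs. set bs \<subseteq> (Basis::'a::euclidean_space set) ==> length bs <= N ==> P bs C"
proof -
  obtain c where c: "\<And>bs. P bs (c bs)" using assms(1) by metis
  let ?L = "{bs. set bs \<subseteq> (Basis::'a set) \<and> length bs <= N}"
  have fin: "finite ?L" by (rule finite_lists_length_le) simp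
  have "c bs <= 1 + (\<Sum>bs\<in>?L. \<bar>c bs\<bar>)" if "bs \<in> ?L" for bs
    using member_le_sum[of bs ?L "\<lambda>bs. \<bar>c bs\<bar>"] that fin by auto
  then show thesis
    using assms(2)[OF c] by (intro that[of "1 + (\<Sum>bs\<in>?L. \<bar>c bs\<bar>)"]) (auto intro!: add_pos_nonneg sum_nonneg)
qed

text \<open>Mean value inequality on the segment between the two arguments. On it, 1 + norm z is at
  most (1 + norm w + norm w') times 1 + norm v, and the decay of the first derivatives at v pays for
  the second factor.\<close>

lemma synth_lipschitz:
  assumes a: "test_fun a"
  obtains C where "C > 0"
    "\<And>w w' z. (1 + norm z) ^ N * norm (synth a (w - z) - synth a (w' - z)) <= C * norm (w - w') * (1 + norm w + norm w') ^ N"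
proof -
  let ?a = "\<lambda>b \<xi>. \<i> * of_real (\<xi> \<bullet> b) * a \<xi>"
  have "\<exists>C. \<forall>x. (1 + norm x) ^ N * norm (synth (?a b) x) <= C" for b
    using test_fun_synth_decay[OF test_fun_coordinate[OF a]] by metis
  then obtain C where C: "\<And>b x. (1 + norm x) ^ N * norm (synth (?a b) x) <= C b" by metis
  define K where "K = 1 + (\<Sum>b\<in>Basis. \<bar>C b\<bar>)"
  have K: "K > 0" unfolding K_def by (auto intro!: add_pos_nonneg sum_nonneg)
  have "(1 + norm z) ^ N * norm (synth a (w - z) - synth a (w' - z)) <= K * norm (w - w') * (1 + norm w + norm w') ^ N"
    for w w' z
  proof -
    let ?B = "K * (1 + norm w + norm w') ^ N / (1 + norm z) ^ N"
    have pos: "(1 + norm z) ^ N > 0" by (simp add: add_pos_nonneg)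
    have "norm (synth a (w - z) - synth a (w' - z)) <= ?B * norm ((w - z) - (w' - z))"
    proof (rule differentiable_bound[of "closed_segment (w' - z) (w - z)"])
      fix v assume v: "v \<in> closed_segment (w' - z) (w - z)"
      show "(synth a has_derivative (\<lambda>h. \<Sum>b\<in>Basis. (h \<bullet> b) *\<^sub>R synth (?a b) v)) (at v within closed_segment (w' - z) (w - z))"
        by (rule has_derivative_at_withinI[OF synth_has_derivative[OF test_fun_cbounded[OF a]]])
      obtain t where t: "0 <= t" "t <= 1" "v = (1 - t) *\<^sub>R (w' - z) + t *\<^sub>R (w - z)"
        using v unfolding closed_segment_def by blast
      then have "z = (1 - t) *\<^sub>R w' + t *\<^sub>R w - v" by (simp add: algebra_simps)
      moreover have "norm ((1 - t) *\<^sub>R w' + t *\<^sub>R w - v) <= norm ((1 - t) *\<^sub>R w') + norm (t *\<^sub>R w) + norm v"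
        using norm_triangle_ineq4[of "(1 - t) *\<^sub>R w' + t *\<^sub>R w" v] norm_triangle_ineq[of "(1 - t) *\<^sub>R w'" "t *\<^sub>R w"] by simp
      moreover have "norm ((1 - t) *\<^sub>R w') <= norm w'" "norm (t *\<^sub>R w) <= norm w"
        using t by (auto intro!: mult_left_le_one_le)
      ultimately have "norm z <= (norm w + norm w') + norm v" by simp
      also have "... <= (norm w + norm w') + norm v + (norm w + norm w') * norm v" by simp
      finally have "1 + norm z <= (1 + norm w + norm w') * (1 + norm v)" by (simp add: algebra_simps)
      then have zv: "(1 + norm z) ^ N <= (1 + norm w + norm w') ^ N * (1 + norm v) ^ N"
        by (metis add_nonneg_nonneg norm_ge_zero power_mono power_mult_distrib zero_le_one)
      show "onorm (\<lambda>h. \<Sum>b\<in>Basis. (h \<bullet> b) *\<^sub>R synth (?a b) v) <= ?B"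
      proof (rule onorm_le)
        fix h
        have "norm (\<Sum>b\<in>Basis. (h \<bullet> b) *\<^sub>R synth (?a b) v) <= (\<Sum>b\<in>Basis. norm h * norm (synth (?a b) v))"
          by (intro sum_norm_le) (auto intro!: mult_right_mono Basis_le_norm)
        then have "(1 + norm z) ^ N * norm (\<Sum>b\<in>Basis. (h \<bullet> b) *\<^sub>R synth (?a b) v)
            <= (1 + norm w + norm w') ^ N * (1 + norm v) ^ N * (\<Sum>b\<in>Basis. norm h * norm (synth (?a b) v))"
          by (intro mult_mono zv) (auto intro!: sum_nonneg)
        also have "... = (1 + norm w + norm w') ^ N * norm h * (\<Sum>b\<in>Basis. (1 + norm v) ^ N * norm (synth (?a b) v))"
          by (simp add: sum_distrib_left algebra_simps)
        also have "... <= (1 + norm w + norm w') ^ N * norm h * K"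
        proof (intro mult_left_mono)
          have "(\<Sum>b\<in>Basis. (1 + norm v) ^ N * norm (synth (?a b) v)) <= (\<Sum>b\<in>Basis. \<bar>C b\<bar>)"
            by (intro sum_mono order_trans[OF C abs_ge_self])
          then show "(\<Sum>b\<in>Basis. (1 + norm v) ^ N * norm (synth (?a b) v)) <= K" unfolding K_def by simp
        qed auto
        finally show "norm (\<Sum>b\<in>Basis. (h \<bullet> b) *\<^sub>R synth (?a b) v) <= ?B * norm h"
          using pos by (simp add: field_simps)
      qed
    qed (auto simp: convex_closed_segment)
    then show ?thesis using pos by (simp add: field_simps)
  qed
  with K show thesis using that by blast
qed

section \<open>Interchanging distributions and integrals\<close>

text \<open>What the interchange of a distribution with an integral asks of the density. Schwartz
  functions and reflected translates of kernels both qualify.\<close>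

definition rapid :: "('a::euclidean_space => complex) => bool" where
  "rapid \<phi> \<longleftrightarrow> \<phi> \<in> borel_measurable borel \<and> (\<forall>N. integrable lborel (\<lambda>y. (1 + norm y) ^ N * norm (\<phi> y)))"

lemma rapid_integrable: "rapid \<phi> ==> integrable lborel \<phi>"
proof -
  assume r: "rapid \<phi>"
  then have "integrable lborel (\<lambda>y. (1 + norm y) ^ 0 * norm (\<phi> y))" unfolding rapid_def by blast
  moreover have "\<phi> \<in> borel_measurable borel" using r unfolding rapid_def by blast
  ultimately show ?thesis by (intro integrable_norm_cancel[of lborel \<phi>]) simp_all
qed

lemma rapid_dominated:
  fixes g :: "'a::euclidean_space => complex"
  assumes r: "rapid \<phi>" and g: "g \<in> borel_measurable borel" "\<And>y. norm (g y) <= C * (1 + norm y) ^ N"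
  shows "integrable lborel (\<lambda>y. \<phi> y * g y)"
    and "norm (LINT y|lborel. \<phi> y * g y) <= C * (LINT y|lborel. (1 + norm y) ^ N * norm (\<phi> y))"
proof -
  have m: "\<phi> \<in> borel_measurable borel" and i: "integrable lborel (\<lambda>y. (1 + norm y) ^ N * norm (\<phi> y))"
    using r unfolding rapid_def by auto
  have le: "norm (\<phi> y * g y) <= C * ((1 + norm y) ^ N * norm (\<phi> y))" for y
    using mult_right_mono[OF g(2)[of y] norm_ge_zero[of "\<phi> y"]] by (simp add: norm_mult mult.commute mult.assoc mult.left_commute)
  show int: "integrable lborel (\<lambda>y. \<phi> y * g y)"
    by (rule Bochner_Integration.integrable_bound[OF integrable_mult_right[OF i, of C]])
       (use m g(1) le in \<open>auto intro: order_trans[OF _ abs_ge_self]\<close>)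
  have "norm (LINT y|lborel. \<phi> y * g y) <= (LINT y|lborel. C * ((1 + norm y) ^ N * norm (\<phi> y)))"
    by (rule Bochner_Integration.integral_norm_bound_integral[OF int integrable_mult_right[OF i]]) (rule le)
  then show "norm (LINT y|lborel. \<phi> y * g y) <= C * (LINT y|lborel. (1 + norm y) ^ N * norm (\<phi> y))" by simp
qed

lemma schwartz_rapid:
  fixes \<phi> :: "'a::euclidean_space => complex"
  assumes "\<phi> \<in> schwartz" shows "rapid \<phi>"
  unfolding rapid_def
proof (intro conjI allI)
  show m: "\<phi> \<in> borel_measurable borel"
    by (intro borel_measurable_continuous_onI smooth_fun_continuous schwartz_smooth assms)
  fix N
  obtain B where "\<And>x. (1 + norm x) ^ (N + Suc DIM('a)) * norm (\<phi> x) <= B"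
    using schwartzD[OF assms, of "[]" "N + Suc DIM('a)"]
    by (metis iter_partial_deriv_simps(1) empty_set empty_subsetI)
  then have "integrable lborel (\<lambda>y. of_real ((1 + norm y) ^ N) * \<phi> y)"
    using m by (intro integrable_decay[of _ "Suc DIM('a)" B])
      (auto simp: norm_mult norm_power power_add mult_ac simp flip: of_real_power of_real_add)
  from integrable_norm[OF this] show "integrable lborel (\<lambda>y. (1 + norm y) ^ N * norm (\<phi> y))"
    by (simp add: norm_mult norm_power del: of_real_power of_real_add)
qed

text \<open>The map \<open>S\<close> is only measurable because simple functions will be substituted for it.\<close>

lemma superposition_synth:
  fixes \<phi> :: "'e::euclidean_space => complex" and S :: "'e => 'a::euclidean_space"
  assumes r: "rapid \<phi>" and a: "cbounded a" and S: "S \<in> borel_measurable borel"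
  defines "B \<equiv> \<lambda>\<xi>. LINT y|lborel. cis (S y \<bullet> \<xi>) * \<phi> y"
  shows "cbounded (\<lambda>\<xi>. B \<xi> * a \<xi>)"
    and "(LINT y|lborel. \<phi> y * synth a (S y - z)) = synth (\<lambda>\<xi>. B \<xi> * a \<xi>) (0 - z)"
proof -
  note [measurable] = S
  have [measurable]: "\<phi> \<in> borel_measurable borel" "cis \<in> borel_measurable borel"
    using r by (auto simp: rapid_def intro!: borel_measurable_continuous_onI continuous_intros)
  note int = rapid_integrable[OF r]
  have "norm (B \<xi>) <= (LINT y|lborel. norm (\<phi> y))" for \<xi>
    unfolding B_def
    by (rule Bochner_Integration.integral_norm_bound_integral)
       (auto intro!: Bochner_Integration.integrable_bound[OF int] int simp: norm_mult)
  moreover have "B \<in> borel_measurable borel" unfolding B_def by measurable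
  ultimately show "cbounded (\<lambda>\<xi>. B \<xi> * a \<xi>)"
    by (intro cbounded_mult[OF a]) auto
  have eq: "synth a (S y - z) = synth (\<lambda>\<xi>. cis ((0 - z) \<bullet> \<xi>) * a \<xi>) (S y)" for y
    unfolding synth_def by (auto intro!: Bochner_Integration.integral_cong simp: cis_mult inner_diff_left mult.assoc[symmetric])
  have "(LINT y|lborel. \<phi> y * synth a (S y - z))
      = (LINT \<xi>|lborel. B \<xi> * (cis ((0 - z) \<bullet> \<xi>) * a \<xi>))"
    unfolding eq B_def
    by (rule synth_exchange[OF int cbounded_integrable[OF cbounded_cis[OF a]] S])
  then show "(LINT y|lborel. \<phi> y * synth a (S y - z)) = synth (\<lambda>\<xi>. B \<xi> * a \<xi>) (0 - z)"
    by (simp add: synth_def mult.left_commute)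
qed

text \<open>A superposition of translates is itself one reflected \<open>synth\<close>, at w = 0 and
  with the symbol multiplied by B; its derivatives are therefore already known.\<close>

lemma superposition_iter:
  fixes \<phi> :: "'e::euclidean_space => complex" and S :: "'e => 'a::euclidean_space"
  assumes r: "rapid \<phi>" and a: "cbounded a" and S: "S \<in> borel_measurable borel"
  shows "smooth_fun (\<lambda>z. LINT y|lborel. \<phi> y * synth a (S y - z))"
    and "set bs \<subseteq> Basis ==> iter_partial_deriv bs (\<lambda>z. LINT y|lborel. \<phi> y * synth a (S y - z))
       = (\<lambda>z. LINT y|lborel. \<phi> y * synth (freq_mult bs a) (S y - z))"
  using reflected_synth_smooth[OF superposition_synth(1)[OF r a S], of 0]
    reflected_synth_iter[OF superposition_synth(1)[OF r a S], of bs 0]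
  by (simp_all add: superposition_synth(2)[OF r _ S] a cbounded_freq_mult freq_mult_mult)

text \<open>The bound with the factor 2 anticipates the simple functions substituted for S, whose
  values are at most twice as large as their argument. It makes the polynomial growth in S y
  harmless against a rapidly decaying density.\<close>

lemma superposition_schwartz:
  fixes \<phi> :: "'e::euclidean_space => complex" and S :: "'e => 'a::euclidean_space"
  assumes r: "rapid \<phi>" and a: "test_fun a" and S: "S \<in> borel_measurable borel"
    and S2: "\<And>y. norm (S y) <= 2 * norm y"
  shows "(\<lambda>z. LINT y|lborel. \<phi> y * synth a (S y - z)) \<in> schwartz"
proof (rule schwartzI[OF superposition_iter(1)[OF r test_fun_cbounded[OF a] S]])
  fix bs :: "'a list" and N assume bs: "set bs \<subseteq> Basis"
  let ?a = "freq_mult bs a"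
  have ta: "test_fun ?a" by (rule test_fun_freq_mult[OF a])
  note [measurable] = S synth_measurable[OF test_fun_cbounded[OF ta]]
  have meas: "(\<lambda>y. synth ?a (S y - z)) \<in> borel_measurable borel" for z
    by measurable
  obtain C where C: "C > 0" "\<And>w z. (1 + norm z) ^ N * norm (synth ?a (w - z)) <= C * (1 + norm w) ^ N"
    using reflected_synth_bound[OF ta] by metis
  let ?I = "LINT y|lborel. (1 + norm y) ^ N * norm (\<phi> y)"
  have "(1 + norm z) ^ N * norm (LINT y|lborel. \<phi> y * synth ?a (S y - z)) <= C * 2 ^ N * ?I" for z
  proof -
    let ?w = "complex_of_real ((1 + norm z) ^ N)"
    have nw: "norm ?w = (1 + norm z) ^ N" by (simp only: norm_of_real) simp
    have "norm (LINT y|lborel. \<phi> y * (?w * synth ?a (S y - z))) <= C * 2 ^ N * ?I"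
    proof (rule rapid_dominated(2)[OF r])
      show "(\<lambda>y. ?w * synth ?a (S y - z)) \<in> borel_measurable borel" using meas by measurable
      fix y
      have "norm (?w * synth ?a (S y - z)) <= C * (1 + norm (S y)) ^ N"
        unfolding norm_mult nw by (rule C)
      also have "... <= C * (2 * (1 + norm y)) ^ N"
        using S2[of y] C(1) by (intro mult_left_mono power_mono) auto
      finally show "norm (?w * synth ?a (S y - z)) <= C * 2 ^ N * (1 + norm y) ^ N"
        by (simp only: power_mult_distrib mult.assoc)
    qed
    also have "(LINT y|lborel. \<phi> y * (?w * synth ?a (S y - z))) = ?w * (LINT y|lborel. \<phi> y * synth ?a (S y - z))"
      by (subst mult.left_commute) (rule integral_mult_right_zero)
    finally show ?thesis unfolding norm_mult nw .
  qed
  then show "\<exists>B. \<forall>x. (1 + norm x) ^ N * norm (iter_partial_deriv bs (\<lambda>z. LINT y|lborel. \<phi> y * synth a (S y - z)) x) <= B"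
    by (auto simp: superposition_iter(2)[OF r test_fun_cbounded[OF a] S bs])
qed

text \<open>The convolution of f with \<open>synth a\<close>, that is, up to a constant, the part of
  f with frequencies cut by a. It is defined at every point, so its restriction to a hyperplane
  makes sense.\<close>

definition distr_synth :: "'a::euclidean_space distr => ('a => complex) => 'a => complex" where
  "distr_synth f a x = f (\<lambda>z. synth a (x - z))"

lemma distr_synth_growth:
  assumes f: "tempered_distribution f" and a: "test_fun a"
  obtains C N where "C > 0" "\<And>w. norm (distr_synth f a w) <= C * (1 + norm w) ^ N"
proof -
  obtain N D where D: "D > 0" and f_le: "\<And>\<phi> B. \<phi> \<in> schwartz ==>
    (\<And>bs x. set bs \<subseteq> Basis ==> length bs <= N ==> (1 + norm x) ^ N * norm (iter_partial_deriv bs \<phi> x) <= B)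
    ==> norm (f \<phi>) <= D * B"
    using tempered_bound[OF f] by metis
  let ?P = "\<lambda>bs C. \<forall>w z. (1 + norm z) ^ N * norm (synth (freq_mult bs a) (w - z)) <= C * (1 + norm w) ^ N"
  obtain C where C: "C > 0" "\<And>bs. set bs \<subseteq> (Basis::'a set) ==> length bs <= N ==> ?P bs C"
  proof (rule finite_lists_bound[of ?P N])
    show "\<exists>C. ?P bs C" for bs
      using reflected_synth_bound[OF test_fun_freq_mult[OF a]] by metis
    show "?P bs C ==> C <= C' ==> ?P bs C'" for bs C C'
      by (meson mult_right_mono norm_ge_zero order_trans zero_le_power add_nonneg_nonneg zero_le_one)
  qed metis
  have "norm (distr_synth f a w) <= D * (C * (1 + norm w) ^ N)" for w
    unfolding distr_synth_def
    by (intro f_le reflected_synth_schwartz a)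
       (use C in \<open>auto simp: reflected_synth_iter[OF test_fun_cbounded[OF a]]\<close>)
  then show thesis using that[of "D * C" N] C(1) D by (simp add: mult.assoc)
qed

lemma weight_sum_le: "0 <= c ==> a <= 2 * c ==> b <= 2 * c ==> 1 + a + b <= 5 * (1 + c)" for a b c :: real
  by (simp add: algebra_simps)

text \<open>The continuity of f is spent once, on differences of translates. The second estimate
  measures two superpositions by a weighted L1 distance of S and S', which tends to 0 along an
  approximation by simple functions.\<close>

lemma distr_synth_lipschitz:
  assumes f: "tempered_distribution f" and a: "test_fun a"
  shows "\<exists>C N. C > 0 \<and>
    (\<forall>w w'. norm (distr_synth f a w - distr_synth f a w') <= C * norm (w - w') * (1 + norm w + norm w') ^ N) \<and>
    (\<forall>(\<phi>::'e::euclidean_space => complex) S S'. rapid \<phi> --> S \<in> borel_measurable borel --> S' \<in> borel_measurable borel -->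
      (\<forall>y. norm (S y) <= 2 * norm y) --> (\<forall>y. norm (S' y) <= 2 * norm y) -->
      norm (f (\<lambda>z. LINT y|lborel. \<phi> y * synth a (S y - z)) - f (\<lambda>z. LINT y|lborel. \<phi> y * synth a (S' y - z)))
       <= C * (LINT y|lborel. norm (\<phi> y) * (norm (S y - S' y) * (1 + norm (S y) + norm (S' y)) ^ N)))"
proof -
  obtain N D where D: "D > 0" and f_le: "\<And>\<phi> B. \<phi> \<in> schwartz ==>
    (\<And>bs x. set bs \<subseteq> Basis ==> length bs <= N ==> (1 + norm x) ^ N * norm (iter_partial_deriv bs \<phi> x) <= B)
    ==> norm (f \<phi>) <= D * B"
    using tempered_bound[OF f] by metis
  let ?P = "\<lambda>bs C. \<forall>w w' z. (1 + norm z) ^ N * norm (synth (freq_mult bs a) (w - z) - synth (freq_mult bs a) (w' - z))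
     <= C * norm (w - w') * (1 + norm w + norm w') ^ N"
  obtain C where C: "C > 0" "\<And>bs. set bs \<subseteq> (Basis::'a set) ==> length bs <= N ==> ?P bs C"
  proof (rule finite_lists_bound[of ?P N])
    show "\<exists>C. ?P bs C" for bs
      using synth_lipschitz[OF test_fun_freq_mult[OF a]] by metis
    show "?P bs C'" if "?P bs C" "C <= C'" for bs C C'
    proof (intro allI)
      fix w w' z :: 'a
      have "C * norm (w - w') * (1 + norm w + norm w') ^ N <= C' * norm (w - w') * (1 + norm w + norm w') ^ N"
        using that(2) by (intro mult_right_mono) auto
      with that(1) show "(1 + norm z) ^ N * norm (synth (freq_mult bs a) (w - z) - synth (freq_mult bs a) (w' - z))
         <= C' * norm (w - w') * (1 + norm w + norm w') ^ N"
        using order_trans by blast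
    qed
  qed metis
  note ca = test_fun_cbounded[OF a]
  have 1: "norm (distr_synth f a w - distr_synth f a w') <= D * (C * norm (w - w') * (1 + norm w + norm w') ^ N)" for w w'
  proof -
    note s = reflected_synth_schwartz[OF a, of w] reflected_synth_schwartz[OF a, of w']
    have "distr_synth f a w - distr_synth f a w' = f (\<lambda>z. 1 * synth a (w - z) + (-1) * synth a (w' - z))"
      by (subst tempered_lincomb[OF f s]) (simp add: distr_synth_def)
    also have "norm ... <= D * (C * norm (w - w') * (1 + norm w + norm w') ^ N)"
      by (intro f_le schwartz_lincomb s)
         (use C in \<open>simp add: smooth_fun_add[OF s[THEN schwartz_smooth], of _ 1 "-1", simplified] reflected_synth_iter[OF ca]\<close>)
    finally show ?thesis .
  qed
  have 2: "norm (f (\<lambda>z. LINT y|lborel. \<phi> y * synth a (S y - z)) - f (\<lambda>z. LINT y|lborel. \<phi> y * synth a (S' y - z)))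
       <= D * (C * (LINT y|lborel. norm (\<phi> y) * (norm (S y - S' y) * (1 + norm (S y) + norm (S' y)) ^ N)))"
    if r: "rapid \<phi>" and S: "S \<in> borel_measurable borel" "\<And>y. norm (S y) <= 2 * norm y"
      and S': "S' \<in> borel_measurable borel" "\<And>y. norm (S' y) <= 2 * norm y"
    for \<phi> :: "'e => complex" and S S'
  proof -
    let ?H = "\<lambda>S z. LINT y|lborel. \<phi> y * synth a (S y - z)"
    let ?g = "\<lambda>y. norm (S y - S' y) * (1 + norm (S y) + norm (S' y)) ^ N"
    note s = superposition_schwartz[OF r a S] superposition_schwartz[OF r a S']
    have m [measurable]: "S \<in> borel_measurable borel" "S' \<in> borel_measurable borel" "\<phi> \<in> borel_measurable borel"
      using S S' r by (auto simp: rapid_def)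
    have intg: "integrable lborel (\<lambda>y. norm (\<phi> y) * ?g y)"
    proof -
      have "norm (complex_of_real (?g y)) <= 4 * 5 ^ N * (1 + norm y) ^ Suc N" for y
      proof -
        have "norm (S y - S' y) <= 4 * norm y"
          using norm_triangle_ineq4[of "S y" "S' y"] S(2)[of y] S'(2)[of y] by simp
        moreover have "(1 + norm (S y) + norm (S' y)) ^ N <= (5 * (1 + norm y)) ^ N"
        proof (rule power_mono)
          show "1 + norm (S y) + norm (S' y) <= 5 * (1 + norm y)"
            by (rule weight_sum_le[OF norm_ge_zero S(2) S'(2)])
        qed simp
        ultimately have "?g y <= (4 * (1 + norm y)) * (5 * (1 + norm y)) ^ N"
          by (intro mult_mono) (auto intro: order_trans)
        moreover have "0 <= ?g y" by simp
        ultimately show ?thesis unfolding norm_of_real real_norm_def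
          by (simp only: power_mult_distrib power_Suc abs_of_nonneg mult_ac)
      qed
      from rapid_dominated(1)[OF r _ this] have "integrable lborel (\<lambda>y. \<phi> y * complex_of_real (?g y))" by simp
      from integrable_norm[OF this] show ?thesis
        unfolding norm_mult norm_of_real by (simp add: abs_mult)
    qed
    have le: "(1 + norm z) ^ N * norm (iter_partial_deriv bs (\<lambda>z. 1 * ?H S z + (-1) * ?H S' z) z) <= C * (LINT y|lborel. norm (\<phi> y) * ?g y)"
      if bs: "set bs \<subseteq> Basis" "length bs <= N" for bs z
    proof -
      let ?a = "freq_mult bs a"
      let ?w = "complex_of_real ((1 + norm z) ^ N)"
      have nw: "norm ?w = (1 + norm z) ^ N" by (simp only: norm_of_real) simp
      have ta: "test_fun ?a" by (rule test_fun_freq_mult[OF a])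
      obtain K where K: "\<And>x. norm (synth ?a x) <= K"
        using test_fun_synth_decay[OF ta, of 0] by auto
      have [measurable]: "synth ?a \<in> borel_measurable borel"
        by (intro synth_measurable test_fun_cbounded ta)
      have i: "integrable lborel (\<lambda>y. \<phi> y * synth ?a (T y - z))" if [measurable]: "T \<in> borel_measurable borel" for T
        by (rule rapid_dominated(1)[OF r, of _ K 0]) (use K in auto)
      have "iter_partial_deriv bs (\<lambda>z. 1 * ?H S z + (-1) * ?H S' z) z
          = (LINT y|lborel. \<phi> y * synth ?a (S y - z)) - (LINT y|lborel. \<phi> y * synth ?a (S' y - z))"
        by (simp add: smooth_fun_add[OF s[THEN schwartz_smooth] bs(1), of 1 "-1", simplified]
            superposition_iter(2)[OF r ca _ bs(1)] S S')
      also have "... = (LINT y|lborel. \<phi> y * synth ?a (S y - z) - \<phi> y * synth ?a (S' y - z))"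
        by (simp add: i S S')
      finally have "(1 + norm z) ^ N * norm (iter_partial_deriv bs (\<lambda>z. 1 * ?H S z + (-1) * ?H S' z) z)
         = norm (LINT y|lborel. ?w * (\<phi> y * synth ?a (S y - z) - \<phi> y * synth ?a (S' y - z)))"
        by (simp only: integral_mult_right_zero norm_mult nw)
      also have "... <= (LINT y|lborel. C * (norm (\<phi> y) * ?g y))"
      proof (rule Bochner_Integration.integral_norm_bound_integral)
        show "integrable lborel (\<lambda>y. ?w * (\<phi> y * synth ?a (S y - z) - \<phi> y * synth ?a (S' y - z)))"
          by (intro integrable_mult_right Bochner_Integration.integrable_diff i S S')
        show "integrable lborel (\<lambda>y. C * (norm (\<phi> y) * ?g y))" by (intro integrable_mult_right intg)
        fix y
        have "norm (?w * (\<phi> y * synth ?a (S y - z) - \<phi> y * synth ?a (S' y - z)))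
            = norm (\<phi> y) * ((1 + norm z) ^ N * norm (synth ?a (S y - z) - synth ?a (S' y - z)))"
          unfolding right_diff_distrib[symmetric] norm_mult nw by simp
        also have "... <= norm (\<phi> y) * (C * norm (S y - S' y) * (1 + norm (S y) + norm (S' y)) ^ N)"
          using C(2)[OF bs] by (intro mult_left_mono) auto
        finally show "norm (?w * (\<phi> y * synth ?a (S y - z) - \<phi> y * synth ?a (S' y - z))) <= C * (norm (\<phi> y) * ?g y)"
          by (simp add: mult_ac)
      qed
      finally show ?thesis by simp
    qed
    have "f (?H S) - f (?H S') = f (\<lambda>z. 1 * ?H S z + (-1) * ?H S' z)"
      by (subst tempered_lincomb[OF f s]) simp
    also have "norm ... <= D * (C * (LINT y|lborel. norm (\<phi> y) * ?g y))"
      by (intro f_le schwartz_lincomb s le)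
    finally show ?thesis .
  qed
  show ?thesis
    by (rule exI[of _ "D * C"], rule exI[of _ N]) (use 1 2 C(1) D in \<open>simp add: mult.assoc\<close>)
qed

lemma distr_synth_continuous:
  assumes f: "tempered_distribution f" and a: "test_fun a"
  shows "continuous_on UNIV (distr_synth f a)"
proof -
  obtain C N where C: "C > 0" "\<And>w w'. norm (distr_synth f a w - distr_synth f a w') <= C * norm (w - w') * (1 + norm w + norm w') ^ N"
    using distr_synth_lipschitz[OF f a, where 'e='a] by metis
  have "isCont (distr_synth f a) x" for x
    unfolding isCont_def
  proof (rule LIM_zero_cancel[OF Lim_null_comparison])
    show "\<forall>\<^sub>F w in at x. norm (distr_synth f a w - distr_synth f a x) <= C * norm (w - x) * (1 + norm w + norm x) ^ N"
      using C(2) by simp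
    have "((\<lambda>w. C * norm (w - x) * (1 + norm w + norm x) ^ N) \<longlongrightarrow> C * norm (x - x) * (1 + norm x + norm x) ^ N) (at x)"
      by (intro tendsto_intros)
    then show "((\<lambda>w. C * norm (w - x) * (1 + norm w + norm x) ^ N) \<longlongrightarrow> 0) (at x)" by simp
  qed
  then show ?thesis by (simp add: continuous_on_eq_continuous_at)
qed

text \<open>
  For a simple function in place of \<open>\<iota>\<close> the identity is the linearity of \<open>f\<close>; the general case is a limit of
  such functions, controlled by the Lipschitz bound above.
\<close>

lemma distr_synth_interchange:
  fixes \<phi> :: "'e::euclidean_space => complex" and \<iota> :: "'e => 'a::euclidean_space"
  assumes f: "tempered_distribution f" and a: "test_fun a" and r: "rapid \<phi>"
    and \<iota>: "continuous_on UNIV \<iota>" "\<And>y. norm (\<iota> y) <= norm y"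
  shows "integrable lborel (\<lambda>y. \<phi> y * distr_synth f a (\<iota> y))"
    and "f (\<lambda>z. LINT y|lborel. \<phi> y * synth a (\<iota> y - z)) = (LINT y|lborel. \<phi> y * distr_synth f a (\<iota> y))"
proof -
  obtain C N where C: "C > 0" and lip: "\<forall>(\<phi>::'e => complex) S S'. rapid \<phi> --> S \<in> borel_measurable borel --> S' \<in> borel_measurable borel -->
      (\<forall>y. norm (S y) <= 2 * norm y) --> (\<forall>y. norm (S' y) <= 2 * norm y) -->
      norm (f (\<lambda>z. LINT y|lborel. \<phi> y * synth a (S y - z)) - f (\<lambda>z. LINT y|lborel. \<phi> y * synth a (S' y - z)))
       <= C * (LINT y|lborel. norm (\<phi> y) * (norm (S y - S' y) * (1 + norm (S y) + norm (S' y)) ^ N))"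
    using distr_synth_lipschitz[OF f a, where 'e='e] by blast
  obtain K M where K: "K > 0" "\<And>w. norm (distr_synth f a w) <= K * (1 + norm w) ^ M"
    using distr_synth_growth[OF f a] by metis
  note gc = distr_synth_continuous[OF f a]
  have [measurable]: "\<iota> \<in> borel_measurable borel" "distr_synth f a \<in> borel_measurable borel" "\<phi> \<in> borel_measurable borel"
    using \<iota>(1) gc r by (auto simp: rapid_def intro: borel_measurable_continuous_onI)
  have gle: "norm (distr_synth f a (\<iota> w)) <= (K * 2 ^ M) * (1 + norm y) ^ M" if "norm w <= 2 * norm y" for w y
  proof -
    have "norm (distr_synth f a (\<iota> w)) <= K * (1 + norm (\<iota> w)) ^ M" by (rule K)
    also have "... <= K * (2 * (1 + norm y)) ^ M"
      using that \<iota>(2)[of w] K(1) by (intro mult_left_mono power_mono) auto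
    finally show ?thesis by (simp only: power_mult_distrib mult.assoc)
  qed
  show int: "integrable lborel (\<lambda>y. \<phi> y * distr_synth f a (\<iota> y))"
    by (rule rapid_dominated(1)[OF r, of _ "K * 2 ^ M" M]) (auto intro!: gle)
  \<comment> \<open>Simple functions approximating the identity, so that \<iota> composed with them
    takes finitely many values; they also obey the factor 2 of the growth condition.\<close>
  obtain F :: "nat => 'e => 'e" where F: "\<And>i. simple_function lborel (F i)"
    "\<And>x. (\<lambda>i. F i x) \<longlonglongrightarrow> x" "\<And>i x. dist (F i x) 0 <= 2 * dist x 0"
    using borel_measurable_implies_sequence_metric[of "\<lambda>x::'e. x" lborel 0] by auto
  have [measurable]: "F i \<in> borel_measurable borel" for i
    using borel_measurable_simple_function[OF F(1)] by simp
  have F2: "norm (F i y) <= 2 * norm y" "norm (\<iota> (F i y)) <= 2 * norm y" for i y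
    using F(3)[of i y] \<iota>(2)[of "F i y"] by auto
  let ?H = "\<lambda>S z. LINT y|lborel. \<phi> y * synth a (S y - z)"
  have fin: "finite (range (F i))" for i
    using F(1)[of i] unfolding simple_function_def by simp
  have split: "(LINT y|lborel. \<phi> y * G (F i y)) = (\<Sum>v\<in>range (F i). (LINT y|lborel. indicator {y. F i y = v} y * \<phi> y) * G v)"
    for G :: "'e => complex" and i
  proof -
    have ind: "integrable lborel (\<lambda>y. indicator {y. F i y = v} y * \<phi> y)" for v
    proof (rule Bochner_Integration.integrable_bound[OF rapid_integrable[OF r]])
      show "(\<lambda>y. indicator {y. F i y = v} y * \<phi> y) \<in> borel_measurable lborel" by measurable
    qed (auto simp: indicator_def)
    have "\<phi> y * G (F i y) = (\<Sum>v\<in>range (F i). indicator {y. F i y = v} y * \<phi> y * G v)" for y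
    proof -
      have "(\<Sum>v\<in>range (F i). indicator {y. F i y = v} y * \<phi> y * G v)
          = (\<Sum>v\<in>range (F i). if v = F i y then \<phi> y * G (F i y) else 0)"
        by (intro sum.cong) (auto simp: indicator_def)
      then show ?thesis using fin[of i] by simp
    qed
    then show ?thesis using ind by (simp add: Bochner_Integration.integral_sum)
  qed
  have fH: "f (?H (\<lambda>y. \<iota> (F i y))) = (LINT y|lborel. \<phi> y * distr_synth f a (\<iota> (F i y)))" for i
  proof -
    have "?H (\<lambda>y. \<iota> (F i y)) = (\<lambda>z. \<Sum>v\<in>range (F i). (LINT y|lborel. indicator {y. F i y = v} y * \<phi> y) * synth a (\<iota> v - z))"
      by (rule ext) (rule split[of "\<lambda>v. synth a (\<iota> v - _)"])
    then have "f (?H (\<lambda>y. \<iota> (F i y))) = (\<Sum>v\<in>range (F i). (LINT y|lborel. indicator {y. F i y = v} y * \<phi> y) * f (\<lambda>z. synth a (\<iota> v - z)))"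
      using tempered_sum[OF f fin[of i], of "\<lambda>v z. synth a (\<iota> v - z)",
          OF reflected_synth_schwartz[OF a] reflected_synth_schwartz[OF a, of 0]] by simp
    also have "... = (LINT y|lborel. \<phi> y * distr_synth f a (\<iota> (F i y)))"
      unfolding split[of "\<lambda>v. distr_synth f a (\<iota> v)"] by (simp add: distr_synth_def)
    finally show ?thesis .
  qed
  have \<iota>F: "(\<lambda>i. \<iota> (F i y)) \<longlonglongrightarrow> \<iota> y" for y
    using \<iota>(1) F(2)[of y] by (auto simp: continuous_on_eq_continuous_at intro: isCont_tendsto_compose)
  have "(\<lambda>i. LINT y|lborel. \<phi> y * distr_synth f a (\<iota> (F i y))) \<longlonglongrightarrow> (LINT y|lborel. \<phi> y * distr_synth f a (\<iota> y))"
  proof (rule integral_dominated_convergence)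
    show "integrable lborel (\<lambda>y. (K * 2 ^ M) * ((1 + norm y) ^ M * norm (\<phi> y)))"
      using r by (intro integrable_mult_right) (auto simp: rapid_def)
    show "AE y in lborel. norm (\<phi> y * distr_synth f a (\<iota> (F i y))) <= (K * 2 ^ M) * ((1 + norm y) ^ M * norm (\<phi> y))" for i
    proof (intro AE_I2)
      fix y show "norm (\<phi> y * distr_synth f a (\<iota> (F i y))) <= (K * 2 ^ M) * ((1 + norm y) ^ M * norm (\<phi> y))"
        using mult_left_mono[OF gle[OF F2(1)[of i y]] norm_ge_zero[of "\<phi> y"]] by (simp add: norm_mult mult_ac)
    qed
    have "(\<lambda>i. \<phi> y * distr_synth f a (\<iota> (F i y))) \<longlonglongrightarrow> \<phi> y * distr_synth f a (\<iota> y)" for y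
      using gc by (intro tendsto_intros isCont_tendsto_compose[OF _ \<iota>F]) (simp add: continuous_on_eq_continuous_at)
    then show "AE y in lborel. (\<lambda>i. \<phi> y * distr_synth f a (\<iota> (F i y))) \<longlonglongrightarrow> \<phi> y * distr_synth f a (\<iota> y)" by simp
  qed auto
  moreover have "(\<lambda>i. f (?H (\<lambda>y. \<iota> (F i y)))) \<longlonglongrightarrow> f (?H \<iota>)"
  proof -
    let ?g = "\<lambda>i y. norm (\<phi> y) * (norm (\<iota> (F i y) - \<iota> y) * (1 + norm (\<iota> (F i y)) + norm (\<iota> y)) ^ N)"
    have "(\<lambda>i. LINT y|lborel. ?g i y) \<longlonglongrightarrow> (LINT (y::'e)|lborel. (0::real))"
    proof (rule integral_dominated_convergence)
      show "integrable lborel (\<lambda>y. (4 * 5 ^ N) * ((1 + norm y) ^ Suc N * norm (\<phi> y)))"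
        using r by (intro integrable_mult_right) (auto simp: rapid_def simp del: power_Suc)
      show "AE y in lborel. norm (?g i y) <= (4 * 5 ^ N) * ((1 + norm y) ^ Suc N * norm (\<phi> y))" for i
      proof (intro AE_I2)
        fix y
        have i2: "norm (\<iota> y) <= 2 * norm y" by (rule order_trans[OF \<iota>(2)]) simp
        have "norm (\<iota> (F i y) - \<iota> y) <= 4 * norm y"
          using norm_triangle_ineq4[of "\<iota> (F i y)" "\<iota> y"] F2(2)[of i y] i2 by simp
        moreover have "(1 + norm (\<iota> (F i y)) + norm (\<iota> y)) ^ N <= (5 * (1 + norm y)) ^ N"
        proof (rule power_mono)
          show "1 + norm (\<iota> (F i y)) + norm (\<iota> y) <= 5 * (1 + norm y)"
            by (rule weight_sum_le[OF norm_ge_zero F2(2) i2])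
        qed simp
        ultimately have "norm (\<iota> (F i y) - \<iota> y) * (1 + norm (\<iota> (F i y)) + norm (\<iota> y)) ^ N
            <= (4 * (1 + norm y)) * (5 * (1 + norm y)) ^ N"
          by (intro mult_mono) (auto intro: order_trans)
        from mult_left_mono[OF this norm_ge_zero[of "\<phi> y"]]
        have "?g i y <= (4 * 5 ^ N) * ((1 + norm y) ^ Suc N * norm (\<phi> y))"
          by (simp only: power_mult_distrib power_Suc mult_ac)
        then show "norm (?g i y) <= (4 * 5 ^ N) * ((1 + norm y) ^ Suc N * norm (\<phi> y))"
          by (simp del: power_Suc)
      qed
      have "(\<lambda>i. ?g i y) \<longlonglongrightarrow> norm (\<phi> y) * (norm (\<iota> y - \<iota> y) * (1 + norm (\<iota> y) + norm (\<iota> y)) ^ N)" for y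
        by (intro tendsto_intros \<iota>F)
      then show "AE y in lborel. (\<lambda>i. ?g i y) \<longlonglongrightarrow> 0" by simp
    qed auto
    then have lim: "(\<lambda>i. C * (LINT y|lborel. ?g i y)) \<longlonglongrightarrow> 0"
      using tendsto_mult_left[of _ 0 sequentially C] by simp
    show ?thesis
    proof (rule LIM_zero_cancel[OF Lim_null_comparison[OF _ lim]])
      have "norm (f (?H (\<lambda>y. \<iota> (F i y))) - f (?H \<iota>)) <= C * (LINT y|lborel. ?g i y)" for i
      proof (rule lip[rule_format, OF r])
        show "norm (\<iota> y) <= 2 * norm y" for y by (rule order_trans[OF \<iota>(2)]) simp
      qed (simp_all add: F2)
      then show "\<forall>\<^sub>F i in sequentially. norm (f (?H (\<lambda>y. \<iota> (F i y))) - f (?H \<iota>)) <= C * (LINT y|lborel. ?g i y)"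
        by simp
    qed
  qed
  ultimately show "f (?H \<iota>) = (LINT y|lborel. \<phi> y * distr_synth f a (\<iota> y))"
    unfolding fH using LIMSEQ_unique by blast
qed

section \<open>Band-limited parts of a distribution\<close>

text \<open>The remainder is again a \<open>synth\<close>, with an explicit symbol, so that its
  iterated derivatives in the translation variable follow from \<open>freq_mult\<close>.\<close>

lemma synth_taylor_remainder:
  assumes a: "cbounded a"
  shows "synth a (x + h) - synth a x - (\<Sum>b\<in>Basis. (h \<bullet> b) *\<^sub>R synth (\<lambda>\<xi>. \<i> * of_real (\<xi> \<bullet> b) * a \<xi>) x)
    = synth (\<lambda>\<xi>. (cis (h \<bullet> \<xi>) - 1 - \<i> * of_real (h \<bullet> \<xi>)) * a \<xi>) x"
proof -
  let ?c = "\<lambda>b \<xi>. cis (x \<bullet> \<xi>) * (\<i> * of_real (\<xi> \<bullet> b) * a \<xi>)"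
  have int: "integrable lborel (?c b)" for b
    by (intro cbounded_integrable cbounded_cis cbounded_coordinate a)
  have int0: "integrable lborel (\<lambda>\<xi>. cis (y \<bullet> \<xi>) * a \<xi>)" for y
    by (intro cbounded_integrable cbounded_cis a)
  have inth: "integrable lborel (\<lambda>\<xi>. \<Sum>b\<in>Basis. (h \<bullet> b) *\<^sub>R ?c b \<xi>)"
    using int by simp
  have s: "(\<Sum>b\<in>Basis. (h \<bullet> b) *\<^sub>R ?c b \<xi>) = cis (x \<bullet> \<xi>) * (\<i> * of_real (\<xi> \<bullet> h) * a \<xi>)" for \<xi>
    by (auto simp: euclidean_inner[of _ h] sum_distrib_left sum_distrib_right scaleR_conv_of_real algebra_simps)
  have "(\<Sum>b\<in>Basis. (h \<bullet> b) *\<^sub>R synth (\<lambda>\<xi>. \<i> * of_real (\<xi> \<bullet> b) * a \<xi>) x) = (LINT \<xi>|lborel. (\<Sum>b\<in>Basis. (h \<bullet> b) *\<^sub>R ?c b \<xi>))"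
    using int by (simp add: synth_def Bochner_Integration.integral_sum)
  then show ?thesis
    unfolding synth_def Bochner_Integration.integral_diff[OF int0 int0, symmetric]
    by (simp only: Bochner_Integration.integral_diff[OF Bochner_Integration.integrable_diff[OF int0 int0] inth, symmetric])
       (auto intro!: Bochner_Integration.integral_cong simp only: s cis_mult[symmetric] inner_add_left inner_commute[of _ h],
        auto simp: algebra_simps)
qed

lemma finite_lists_bound_ex:
  assumes "\<And>bs. \<exists>C. P bs C" "\<And>bs C C'. P bs C ==> C <= C' ==> P bs (C'::real)"
  shows "\<exists>C>0. \<forall>bs. set bs \<subseteq> (Basis::'a::euclidean_space set) --> length bs <= N --> P bs C"
  by (rule finite_lists_bound[of P N]) (use assms in blast)+

lemma synth_lipschitz_ex:
  assumes "test_fun a"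
  shows "\<exists>C. \<forall>w w' z. (1 + norm z) ^ N * norm (synth a (w - z) - synth a (w' - z))
    <= C * norm (w - w') * (1 + norm w + norm w') ^ N"
  using synth_lipschitz[OF assms] by metis

text \<open>The remainder as a function of h has as derivative a difference of first derivatives,
  which is Lipschitz by \<open>synth_lipschitz\<close>; the mean value inequality then yields the
  second factor norm h. The base 2 + 2 * norm x bounds 1 + norm (x + k) + norm x for norm k at most
  1.\<close>

lemma synth_taylor_decay:
  assumes a: "test_fun a"
  shows "\<exists>C. \<forall>x h z. norm h <= 1 -->
    (1 + norm z) ^ N * norm (synth a (x + h - z) - synth a (x - z)
       - (\<Sum>b\<in>Basis. (h \<bullet> b) *\<^sub>R synth (\<lambda>\<xi>. \<i> * of_real (\<xi> \<bullet> b) * a \<xi>) (x - z)))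
    <= C * (2 + 2 * norm x) ^ N * (norm h)\<^sup>2"
proof -
  let ?a = "\<lambda>b \<xi>. \<i> * of_real (\<xi> \<bullet> b) * a \<xi>"
  have "\<forall>b. \<exists>C. \<forall>w w' z. (1 + norm z) ^ N * norm (synth (?a b) (w - z) - synth (?a b) (w' - z))
      <= C * norm (w - w') * (1 + norm w + norm w') ^ N"
  proof
    fix b
    show "\<exists>C. \<forall>w w' z. (1 + norm z) ^ N * norm (synth (?a b) (w - z) - synth (?a b) (w' - z))
      <= C * norm (w - w') * (1 + norm w + norm w') ^ N"
      by (rule synth_lipschitz_ex[OF test_fun_coordinate[OF a]])
  qed
  from choice[OF this] obtain C where
    C': "\<forall>b w w' z. (1 + norm z) ^ N * norm (synth (?a b) (w - z) - synth (?a b) (w' - z))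
      <= C b * norm (w - w') * (1 + norm w + norm w') ^ N" by blast
  note C = C'[rule_format]
  define K where "K = 1 + (\<Sum>b\<in>Basis. \<bar>C b\<bar>)"
  have K: "K > 0" unfolding K_def by (auto intro!: add_pos_nonneg sum_nonneg)
  have "(1 + norm z) ^ N * norm (synth a (x + h - z) - synth a (x - z) - (\<Sum>b\<in>Basis. (h \<bullet> b) *\<^sub>R synth (?a b) (x - z)))
    <= K * (2 + 2 * norm x) ^ N * (norm h)\<^sup>2" if h: "norm h <= 1" for x h z
  proof -
    have pos: "(1 + norm z) ^ N > 0" by (simp add: add_pos_nonneg)
    define B where "B = K * norm h * (2 + 2 * norm x) ^ N / (1 + norm z) ^ N"
    let ?f = "\<lambda>k. synth a (x + k - z) - (\<Sum>b\<in>Basis. (k \<bullet> b) *\<^sub>R synth (?a b) (x - z))"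
    have "norm (?f h - ?f 0) <= B * norm (h - 0)"
    proof (rule differentiable_bound[of "closed_segment 0 h"])
      fix k assume k: "k \<in> closed_segment 0 h"
      then have kh: "norm k <= norm h" using segment_bound1[of k 0 h] by simp
      have d1: "((\<lambda>k. synth a (x + k - z)) has_derivative (\<lambda>l. \<Sum>b\<in>Basis. (l \<bullet> b) *\<^sub>R synth (?a b) (x + k - z))) (at k)"
        by (rule has_derivative_compose[of "\<lambda>k. x + k - z", OF _ synth_has_derivative[OF test_fun_cbounded[OF a]]])
           (auto intro!: derivative_eq_intros)
      have d2: "((\<lambda>k. \<Sum>b\<in>Basis. (k \<bullet> b) *\<^sub>R synth (?a b) (x - z)) has_derivative
          (\<lambda>l. \<Sum>b\<in>Basis. (l \<bullet> b) *\<^sub>R synth (?a b) (x - z))) (at k)"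
        by (auto intro!: derivative_eq_intros)
      show "(?f has_derivative (\<lambda>l. (\<Sum>b\<in>Basis. (l \<bullet> b) *\<^sub>R synth (?a b) (x + k - z))
          - (\<Sum>b\<in>Basis. (l \<bullet> b) *\<^sub>R synth (?a b) (x - z)))) (at k within closed_segment 0 h)"
        by (rule has_derivative_at_withinI[OF has_derivative_diff[OF d1 d2]])
      show "onorm (\<lambda>l. (\<Sum>b\<in>Basis. (l \<bullet> b) *\<^sub>R synth (?a b) (x + k - z)) - (\<Sum>b\<in>Basis. (l \<bullet> b) *\<^sub>R synth (?a b) (x - z))) <= B"
      proof (rule onorm_le)
        fix l
        let ?d = "\<lambda>b. synth (?a b) (x + k - z) - synth (?a b) (x - z)"
        have d: "(1 + norm z) ^ N * norm (?d b) <= \<bar>C b\<bar> * norm h * (2 + 2 * norm x) ^ N" for b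
        proof -
          have n: "1 + norm (x + k) + norm x <= 2 + 2 * norm x"
            using norm_triangle_ineq[of x k] kh h by linarith
          have "(1 + norm z) ^ N * norm (?d b) <= C b * norm k * (1 + norm (x + k) + norm x) ^ N"
            using C[of z b "x + k" x] by simp
          also have "... <= \<bar>C b\<bar> * norm h * (2 + 2 * norm x) ^ N"
            using n kh by (intro mult_mono power_mono) auto
          finally show ?thesis .
        qed
        have "norm (\<Sum>b\<in>Basis. (l \<bullet> b) *\<^sub>R ?d b) <= (\<Sum>b\<in>Basis. norm l * norm (?d b))"
          by (intro sum_norm_le) (auto intro!: mult_right_mono Basis_le_norm)
        then have "(1 + norm z) ^ N * norm (\<Sum>b\<in>Basis. (l \<bullet> b) *\<^sub>R ?d b)
           <= (1 + norm z) ^ N * (\<Sum>b\<in>Basis. norm l * norm (?d b))"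
          by (intro mult_left_mono) auto
        also have "... = norm l * (\<Sum>b\<in>Basis. (1 + norm z) ^ N * norm (?d b))"
          by (simp add: sum_distrib_left algebra_simps)
        also have "... <= norm l * (\<Sum>b\<in>Basis. \<bar>C b\<bar> * norm h * (2 + 2 * norm x) ^ N)"
          by (intro mult_left_mono sum_mono d) auto
        also have "... = norm l * ((\<Sum>b\<in>Basis. \<bar>C b\<bar>) * norm h * (2 + 2 * norm x) ^ N)"
          by (simp add: sum_distrib_right)
        also have "... <= norm l * (K * norm h * (2 + 2 * norm x) ^ N)"
          unfolding K_def by (intro mult_left_mono mult_right_mono) auto
        finally have "norm (\<Sum>b\<in>Basis. (l \<bullet> b) *\<^sub>R ?d b) <= B * norm l"
          using pos unfolding B_def by (simp add: pos_le_divide_eq mult_ac)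
        then show "norm ((\<Sum>b\<in>Basis. (l \<bullet> b) *\<^sub>R synth (?a b) (x + k - z)) - (\<Sum>b\<in>Basis. (l \<bullet> b) *\<^sub>R synth (?a b) (x - z))) <= B * norm l"
          by (simp add: sum_subtractf[symmetric] scaleR_diff_right)
      qed
    qed auto
    then have "norm (synth a (x + h - z) - synth a (x - z) - (\<Sum>b\<in>Basis. (h \<bullet> b) *\<^sub>R synth (?a b) (x - z))) <= B * norm h"
      by (simp add: algebra_simps)
    then show ?thesis
      using pos unfolding B_def by (simp add: pos_le_divide_eq power2_eq_square mult_ac)
  qed
  then show ?thesis by blast
qed

text \<open>The Taylor remainder of the translates is quadratic in h in every seminorm, and f
  transports this bound. The derivative is found by applying f to the linear term.\<close>

lemma distr_synth_has_derivative:
  assumes f: "tempered_distribution f" and a: "test_fun a"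
  shows "(distr_synth f a has_derivative
     (\<lambda>h. \<Sum>b\<in>Basis. (h \<bullet> b) *\<^sub>R distr_synth f (\<lambda>\<xi>. \<i> * of_real (\<xi> \<bullet> b) * a \<xi>) x)) (at x)"
proof -
  obtain N D where D: "D > 0" and f_le: "\<And>\<phi> B. \<phi> \<in> schwartz ==>
    (\<And>bs x. set bs \<subseteq> Basis ==> length bs <= N ==> (1 + norm x) ^ N * norm (iter_partial_deriv bs \<phi> x) <= B)
    ==> norm (f \<phi>) <= D * B"
    using tempered_bound[OF f] by metis
  let ?R = "\<lambda>a h z. synth a (x + h - z) - synth a (x - z) - (\<Sum>b\<in>Basis. (h \<bullet> b) *\<^sub>R synth (\<lambda>\<xi>. \<i> * of_real (\<xi> \<bullet> b) * a \<xi>) (x - z))"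
  let ?P = "\<lambda>bs C. \<forall>h z. norm h <= 1 --> (1 + norm z) ^ N * norm (?R (freq_mult bs a) h z) <= C * (2 + 2 * norm x) ^ N * (norm h)\<^sup>2"
  have "\<exists>C>0. \<forall>bs. set bs \<subseteq> (Basis::'a set) --> length bs <= N --> ?P bs C"
  proof (rule finite_lists_bound_ex[of ?P N])
    show "\<exists>C. ?P bs C" for bs
    proof -
      from synth_taylor_decay[OF test_fun_freq_mult[OF a, of bs], of N] show ?thesis by blast
    qed
    show "?P bs C'" if "?P bs C" "C <= C'" for bs C C'
    proof (intro allI impI)
      fix h z :: 'a assume "norm h <= 1"
      with that(1) have "(1 + norm z) ^ N * norm (?R (freq_mult bs a) h z) <= C * (2 + 2 * norm x) ^ N * (norm h)\<^sup>2" by blast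
      also have "... <= C' * (2 + 2 * norm x) ^ N * (norm h)\<^sup>2"
        using that(2) by (intro mult_right_mono) auto
      finally show "(1 + norm z) ^ N * norm (?R (freq_mult bs a) h z) <= C' * (2 + 2 * norm x) ^ N * (norm h)\<^sup>2" .
    qed
  qed
  then obtain C where C: "C > 0" and C2: "\<forall>bs. set bs \<subseteq> (Basis::'a set) --> length bs <= N --> ?P bs C"
    by (elim exE conjE)
  let ?a = "\<lambda>b \<xi>. \<i> * of_real (\<xi> \<bullet> b) * a \<xi>"
  let ?D = "\<lambda>h. \<Sum>b\<in>Basis. (h \<bullet> b) *\<^sub>R distr_synth f (?a b) x"
  show ?thesis
  proof (rule has_derivative_quadratic[where C = "D * (C * (2 + 2 * norm x) ^ N)"])
    show "bounded_linear ?D"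
      by (intro bounded_linear_sum bounded_linear_scaleR_const bounded_linear_inner_left)
    fix h :: 'a assume h: "norm h <= 1"
    note s = reflected_synth_schwartz[OF a]
    have sb: "(\<lambda>z. synth (?a b) (x - z)) \<in> schwartz" for b
      by (rule reflected_synth_schwartz[OF test_fun_coordinate[OF a]])
    let ?S = "\<lambda>z. \<Sum>b\<in>Basis. of_real (h \<bullet> b) * synth (?a b) (x - z)"
    have S: "?S \<in> schwartz" "f ?S = ?D h"
      using tempered_sum[OF f finite_Basis, of "\<lambda>b z. synth (?a b) (x - z)", OF sb sb]
      by (auto simp: distr_synth_def scaleR_conv_of_real)
    let ?\<phi> = "\<lambda>z. 1 * (1 * synth a (x + h - z) + (-1) * synth a (x - z)) + (-1) * ?S z"
    have \<phi>s: "?\<phi> \<in> schwartz" by (intro schwartz_lincomb s S)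
    have \<phi>R: "?\<phi> = ?R a h" by (simp add: fun_eq_iff scaleR_conv_of_real)
    have ca: "cbounded a" by (rule test_fun_cbounded[OF a])
    have cr: "cbounded (\<lambda>\<xi>. (cis (h \<bullet> \<xi>) - 1 - \<i> * of_real (h \<bullet> \<xi>)) * a \<xi>)"
    proof (rule cbounded_mult[OF ca])
      show "(\<lambda>\<xi>. cis (h \<bullet> \<xi>) - 1 - \<i> * of_real (h \<bullet> \<xi>)) \<in> borel_measurable borel"
        by (intro borel_measurable_continuous_onI continuous_intros)
      fix L
      have "norm (cis (h \<bullet> \<xi>) - 1 - \<i> * of_real (h \<bullet> \<xi>)) <= L\<^sup>2" if "norm \<xi> <= L" for \<xi>
      proof -
        have "\<bar>h \<bullet> \<xi>\<bar> <= norm h * norm \<xi>" by (rule Cauchy_Schwarz_ineq2)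
        also have "... <= 1 * L" using h that by (intro mult_mono) auto
        finally show ?thesis by (intro order_trans[OF cis_taylor]) (simp add: abs_le_square_iff[symmetric])
      qed
      then show "\<exists>C. \<forall>\<xi>. norm \<xi> <= L --> norm (cis (h \<bullet> \<xi>) - 1 - \<i> * of_real (h \<bullet> \<xi>)) <= C" by blast
    qed
    have sh: "x - z + h = x + h - z" for z by simp
    have R: "?R c h z = synth (\<lambda>\<xi>. (cis (h \<bullet> \<xi>) - 1 - \<i> * of_real (h \<bullet> \<xi>)) * c \<xi>) (x - z)"
      if "cbounded c" for c z
      using synth_taylor_remainder[OF that, of "x - z" h] unfolding sh .
    have "distr_synth f a (x + h) - distr_synth f a x - ?D h = f ?\<phi>"
      by (subst tempered_lincomb[OF f schwartz_lincomb[OF s s] S(1)])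
         (subst tempered_lincomb[OF f s s], simp add: distr_synth_def S(2))
    also have "norm ... <= D * (C * (2 + 2 * norm x) ^ N * (norm h)\<^sup>2)"
    proof (rule f_le[OF \<phi>s])
      fix bs :: "'a list" and z assume bs: "set bs \<subseteq> Basis" "length bs <= N"
      have "iter_partial_deriv bs ?\<phi> z = ?R (freq_mult bs a) h z"
        unfolding \<phi>R R[OF ca] R[OF cbounded_freq_mult[OF ca]]
        by (simp add: reflected_synth_iter[OF cr bs(1)] freq_mult_mult)
      then show "(1 + norm z) ^ N * norm (iter_partial_deriv bs ?\<phi> z) <= C * (2 + 2 * norm x) ^ N * (norm h)\<^sup>2"
        using C2[rule_format, OF bs h] by simp
    qed
    finally show "norm (distr_synth f a (x + h) - distr_synth f a x - ?D h) <= D * (C * (2 + 2 * norm x) ^ N) * (norm h)\<^sup>2"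
      by (simp add: mult.assoc)
  qed
qed

text \<open>A partial derivative only multiplies the symbol by i times a coordinate, so the
  functions \<open>distr_synth f a\<close> with varying a form a class closed under
  differentiation.\<close>

lemma distr_synth_smooth:
  assumes f: "tempered_distribution f" and a: "test_fun a"
  shows "smooth_fun (distr_synth f a)"
proof (rule smooth_fun_coinduct[of "\<lambda>g. \<exists>a. test_fun a \<and> g = distr_synth f a"])
  show "\<exists>a'. test_fun a' \<and> distr_synth f a = distr_synth f a'" using a by blast
  show "g differentiable (at x)" if "\<exists>a. test_fun a \<and> g = distr_synth f a" for g x
    using that distr_synth_has_derivative[OF f] unfolding differentiable_def by blast
  fix g b assume "\<exists>a. test_fun a \<and> g = distr_synth f a" and b: "(b::'a) \<in> Basis"
  then obtain a where a: "test_fun a" "g = distr_synth f a" by blast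
  let ?d = "\<lambda>b. distr_synth f (\<lambda>\<xi>. \<i> * of_real (\<xi> \<bullet> b) * a \<xi>)"
  have "partial_deriv b g x = ?d b x" for x
  proof -
    have "partial_deriv b g x = (\<Sum>b'\<in>Basis. (b \<bullet> b') *\<^sub>R ?d b' x)"
      unfolding a(2) by (rule partial_deriv_eq[OF distr_synth_has_derivative[OF f a(1)]])
    also have "... = (\<Sum>b'\<in>Basis. if b' = b then ?d b x else 0)"
      by (intro sum.cong) (auto simp: inner_Basis b)
    finally show ?thesis using b by simp
  qed
  then show "\<exists>a. test_fun a \<and> partial_deriv b g = distr_synth f a"
    using test_fun_coordinate[OF a(1)] by blast
qed

text \<open>Uniqueness by testing: if two representatives differ at x0, their difference h has Re
  (cnj (h x0) * h) > 0 on a ball around x0, and a nonnegative bump supported there contradicts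
  equality of the integrals. The cutoff \<eta> supplies the bump.\<close>

lemma smooth_representative_eq:
  fixes g :: "'a::euclidean_space => complex"
  assumes \<eta>: "cutoff \<eta>" and g: "smooth_fun g" "represents g T"
  shows "smooth_representative T = g"
  unfolding smooth_representative_def
proof (rule the_equality)
  show "smooth_fun g \<and> represents g T" using g by blast
  fix g' assume g': "smooth_fun g' \<and> represents g' T"
  define h where "h x = g' x - g x" for x
  have hc: "continuous_on UNIV h"
    unfolding h_def using g g' by (intro continuous_intros smooth_fun_continuous) auto
  have "h x0 = 0" for x0
  proof (rule ccontr)
    assume nz: "h x0 ~= 0"
    define u where "u x = Re (cnj (h x0) * h x)" for x
    have uc: "continuous_on UNIV u" unfolding u_def by (intro continuous_intros hc)
    have "u x0 > 0" using nz by (simp add: u_def complex_norm_square[symmetric] mult.commute[of "cnj (h x0)"])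
    then have "open {x. u x > 0}" "x0 \<in> {x. u x > 0}"
      by (auto intro!: open_Collect_less continuous_intros uc)
    then obtain \<delta> where \<delta>: "\<delta> > 0" "ball x0 \<delta> \<subseteq> {x. u x > 0}" unfolding open_contains_ball by blast
    \<comment> \<open>The bump lives where every coordinate of x - x0 is at most 2 / A; with this A
      the l1 norm there is at most d \<delta> / (d + 1), so the support fits into the ball of radius
      \<delta>.\<close>
    define A where "A = 2 * (real DIM('a) + 1) / \<delta>"
    have A: "A > 0" unfolding A_def using \<delta> by simp
    define \<phi> where "\<phi> = box_bump \<eta> A (- A *\<^sub>R x0)"
    have \<phi>t: "test_fun \<phi>" unfolding \<phi>_def using A by (intro test_fun_box_bump \<eta>) simp
    have \<phi>1: "\<phi> x0 = 1" unfolding \<phi>_def by (rule box_bump_eq_1[OF \<eta>]) simp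
    have \<phi>0: "\<phi> x = 0" if "x \<notin> ball x0 \<delta>" for x
    proof (rule ccontr)
      assume p: "\<phi> x ~= 0"
      have "\<bar>(x - x0) \<bullet> b\<bar> <= 2 / A" if b: "b \<in> Basis" for b
      proof -
        have "\<bar>A * (x \<bullet> b) + (- A *\<^sub>R x0) \<bullet> b\<bar> < 2"
          using box_bump_eq_0[OF \<eta> b, of A x "- A *\<^sub>R x0"] p unfolding \<phi>_def by fastforce
        then have "A * \<bar>(x - x0) \<bullet> b\<bar> <= 2" using A
          by (simp add: inner_diff_left abs_mult[symmetric, of A, simplified abs_of_pos[OF A]] algebra_simps flip: abs_mult_pos[OF less_imp_le[OF A]])
        then show ?thesis using A by (simp add: field_simps)
      qed
      then have "norm (x - x0) <= (\<Sum>b\<in>(Basis::'a set). 2 / A)"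
        by (intro order_trans[OF norm_le_l1] sum_mono)
      also have "... < \<delta>" using \<delta>(1) by (simp add: A_def field_simps)
      finally show False using that by (simp add: dist_norm norm_minus_commute)
    qed
    have re: "\<phi> x = of_real (Re (\<phi> x))" "Re (\<phi> x) >= 0" for x
      using cutoff_range(1)[OF \<eta>]
      by (auto simp: \<phi>_def box_bump_def simp del: of_real_prod intro!: prod_nonneg)
    have rep: "integrable lborel (\<lambda>x. h x * \<phi> x)" "(LINT x|lborel. h x * \<phi> x) = 0"
    proof -
      have "integrable lborel (\<lambda>x. g x * \<phi> x)" "integrable lborel (\<lambda>x. g' x * \<phi> x)"
        "(LINT x|lborel. g x * \<phi> x) = (LINT x|lborel. g' x * \<phi> x)"
        using g(2) g' test_fun_schwartz[OF \<phi>t] unfolding represents_def by auto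
      then show "integrable lborel (\<lambda>x. h x * \<phi> x)" "(LINT x|lborel. h x * \<phi> x) = 0"
        unfolding h_def left_diff_distrib by auto
    qed
    have eq: "cnj (h x0) * (h x * \<phi> x) = of_real (Re (\<phi> x)) * (cnj (h x0) * h x)" for x
      using re(1)[of x] by (metis mult.commute mult.assoc)
    have "integrable lborel (\<lambda>x. cnj (h x0) * (h x * \<phi> x))"
      using rep(1) by (rule integrable_mult_right)
    from integrable_Re[OF this] have int: "integrable lborel (\<lambda>x. Re (\<phi> x) * u x)"
      unfolding eq by (simp add: u_def)
    have "(LINT x|lborel. Re (\<phi> x) * u x) = Re (LINT x|lborel. cnj (h x0) * (h x * \<phi> x))"
      using \<open>integrable lborel (\<lambda>x. cnj (h x0) * (h x * \<phi> x))\<close> unfolding eq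
      by (subst integral_Re[symmetric]) (auto simp: u_def)
    also have "... = 0" using rep(2) by simp
    finally have "(LINT x|lborel. Re (\<phi> x) * u x) = 0" .
    moreover have nn: "Re (\<phi> x) * u x >= 0" for x
    proof (cases "x \<in> ball x0 \<delta>")
      case True
      then have "u x > 0" using \<delta> by auto
      then show ?thesis using re(2)[of x] by simp
    qed (simp add: \<phi>0)
    ultimately have "AE x in lborel. Re (\<phi> x) * u x = 0"
      using int by (subst (asm) integral_nonneg_eq_0_iff_AE) auto
    then have "AE x in lborel. complex_of_real (Re (\<phi> x) * u x) = 0" by simp
    moreover have "continuous_on UNIV (\<lambda>x. complex_of_real (Re (\<phi> x) * u x))"
      using test_fun_continuous[OF \<phi>t, of UNIV] uc by (auto intro!: continuous_intros simp del: of_real_mult)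
    ultimately have "complex_of_real (Re (\<phi> x0) * u x0) = 0"
      using continuous_AE_zero by blast
    then have "Re (\<phi> x0) * u x0 = 0" by (simp only: of_real_eq_0_iff)
    with \<phi>1 \<open>u x0 > 0\<close> show False by simp
  qed
  then show "g' = g" unfolding h_def by auto
qed

lemma represents_distr_synth:
  assumes f: "tempered_distribution f" and a: "test_fun a"
    and T: "\<And>\<phi>. \<phi> \<in> schwartz ==> T \<phi> = f (\<lambda>z. LINT y|lborel. \<phi> y * synth a (y - z))"
  shows "represents (distr_synth f a) T"
  unfolding represents_def
  using distr_synth_interchange[OF f a schwartz_rapid, of _ "\<lambda>y. y"]
  by (auto simp: T mult.commute continuous_on_id)

text \<open>One factor \<open>(2\<pi>)\<^bsup>-d/2\<^esup>\<close> for each of the two Fourier transforms in the definition of a frequency piece.\<close>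

definition fourier_norm :: "'a::euclidean_space itself => real" where
  "fourier_norm _ = ((2 * pi) powr (- real DIM('a) / 2))\<^sup>2"

lemma fourier_norm_pos: "fourier_norm TYPE('a::euclidean_space) > 0"
  unfolding fourier_norm_def by simp

text \<open>Move all three operations to the test function: transforming, multiplying by m and
  transforming back gives a superposition of reflected translates of one kernel, with the two
  normalising factors absorbed in its symbol. The interchange then represents the result by
  \<open>distr_synth\<close>.\<close>

lemma frequency_localization:
  fixes f :: "'a::euclidean_space distr"
  assumes \<eta>: "cutoff \<eta>" and f: "tempered_distribution f" and m: "test_fun (\<lambda>\<xi>. of_real (m \<xi>))"
  shows "smooth_representative (inverse_fourier_distr (multiply_distr m (fourier_distr f)))
    = distr_synth f (\<lambda>\<xi>. of_real (fourier_norm TYPE('a)) * of_real (m \<xi>))"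
proof -
  define c where "c = (2 * pi) powr (- real DIM('a) / 2)"
  have fn: "fourier_norm TYPE('a) = c * c"
    by (simp add: fourier_norm_def c_def power2_eq_square)
  let ?a = "\<lambda>\<xi>. of_real (fourier_norm TYPE('a)) * of_real (m \<xi>) :: complex"
  have a: "test_fun ?a"
    using test_family_scale[of UNIV "\<lambda>_::unit. \<lambda>\<xi>. complex_of_real (m \<xi>)" "\<lambda>_. of_real (fourier_norm TYPE('a))" "fourier_norm TYPE('a)"] m
    fourier_norm_pos[where 'a='a] unfolding test_fun_def by simp
  have "inverse_fourier_distr (multiply_distr m (fourier_distr f)) \<phi> = f (\<lambda>z. LINT y|lborel. \<phi> y * synth ?a (y - z))"
    if \<phi>: "\<phi> \<in> schwartz" for \<phi>
  proof -
    have "fourier (\<lambda>\<xi>. of_real (m \<xi>) * inverse_fourier \<phi> \<xi>) z = (LINT y|lborel. \<phi> y * synth ?a (y - z))" for z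
    proof -
      have "fourier (\<lambda>\<xi>. of_real (m \<xi>) * inverse_fourier \<phi> \<xi>) z
        = c *\<^sub>R (LINT \<xi>|lborel. cis (- (\<xi> \<bullet> z)) * (of_real (m \<xi>) * (c *\<^sub>R (LINT y|lborel. cis (\<xi> \<bullet> y) * \<phi> y))))"
        by (simp add: fourier_def inverse_fourier_def c_def)
      also have "... = (LINT \<xi>|lborel. c *\<^sub>R (cis (- (\<xi> \<bullet> z)) * (of_real (m \<xi>) * (c *\<^sub>R (LINT y|lborel. cis (\<xi> \<bullet> y) * \<phi> y)))))"
        by simp
      also have "... = (LINT \<xi>|lborel. cis ((0 - z) \<bullet> \<xi>) * ((LINT y|lborel. cis (y \<bullet> \<xi>) * \<phi> y) * ?a \<xi>))"
        by (intro Bochner_Integration.integral_cong refl)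
           (simp add: fn scaleR_conv_of_real inner_commute mult_ac)
      also have "... = (LINT y|lborel. \<phi> y * synth ?a (y - z))"
        using superposition_synth(2)[OF schwartz_rapid[OF \<phi>] test_fun_cbounded[OF a], of "\<lambda>y. y" z]
        by (simp add: synth_def)
      finally show ?thesis .
    qed
    then have "fourier (\<lambda>\<xi>. of_real (m \<xi>) * inverse_fourier \<phi> \<xi>) = (\<lambda>z. LINT y|lborel. \<phi> y * synth ?a (y - z))"
      by (rule ext)
    then show ?thesis
      by (simp add: inverse_fourier_distr_def multiply_distr_def fourier_distr_def)
  qed
  then show ?thesis
    by (intro smooth_representative_eq[OF \<eta>] distr_synth_smooth f a represents_distr_synth)
qed

lemma alpha_box_eq:
  fixes f :: "'a::euclidean_space distr"
  assumes "cutoff \<eta>" "tempered_distribution f" "test_fun (\<lambda>\<xi>. of_real (alpha_partition \<eta> \<rho> \<alpha> k \<xi>))"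
  shows "alpha_box \<eta> \<rho> \<alpha> k f = distr_synth f (\<lambda>\<xi>. of_real (fourier_norm TYPE('a)) * of_real (alpha_partition \<eta> \<rho> \<alpha> k \<xi>))"
  unfolding alpha_box_def by (rule frequency_localization[OF assms])

text \<open>The number (2 pi)^d in disguise, computed from one fixed bump that takes the value 1 at
  the origin.\<close>

definition inversion_const :: "(real => real) => 'a::euclidean_space itself => complex" where
  "inversion_const \<eta> _ = (LINT x::'a|lborel. synth (box_bump \<eta> 1 0) x)"

lemma inversion_const_nonzero: "cutoff \<eta> ==> inversion_const \<eta> TYPE('a::euclidean_space) ~= 0"
  unfolding inversion_const_def by (rule inversion_constant_nonzero[OF _ refl])

lemma inversion:
  fixes \<theta> :: "'a::euclidean_space => complex"
  assumes \<eta>: "cutoff \<eta>" and \<theta>: "test_fun \<theta>"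
  shows "(LINT y|lborel. cis (y \<bullet> \<xi>) * synth \<theta> (x - y)) = inversion_const \<eta> TYPE('a) * cis (x \<bullet> \<xi>) * \<theta> \<xi>"
proof -
  have [measurable]: "synth \<theta> \<in> borel_measurable borel" "cis \<in> borel_measurable borel"
    using synth_measurable[OF test_fun_cbounded[OF \<theta>]] by (auto intro!: borel_measurable_continuous_onI continuous_intros)
  have "(LINT y|lborel. cis (y \<bullet> \<xi>) * synth \<theta> (x - y)) = (LINT y|lborel. cis ((x - y) \<bullet> \<xi>) * synth \<theta> (x - (x - y)))"
    by (rule integral_lborel_reflect[symmetric]) measurable
  also have "... = (LINT y|lborel. cis (x \<bullet> \<xi>) * (cis (- (y \<bullet> \<xi>)) * synth \<theta> y))"
    by (intro Bochner_Integration.integral_cong) (auto simp: inner_diff_left cis_mult mult.assoc[symmetric])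
  also have "... = cis (x \<bullet> \<xi>) * (LINT y|lborel. cis (- (y \<bullet> \<xi>)) * synth \<theta> y)" by simp
  also have "(LINT y|lborel. cis (- (y \<bullet> \<xi>)) * synth \<theta> y) = inversion_const \<eta> TYPE('a) * \<theta> \<xi>"
    unfolding inversion_const_def
    by (rule inversion_aux[OF \<theta> test_fun_box_bump[OF \<eta>] box_bump_eq_1[OF \<eta>]]) auto
  finally show ?thesis by simp
qed

text \<open>Move f outside the integral; inside, inversion multiplies the symbol a by \<theta>,
  which is 1 wherever a is nonzero.\<close>

lemma reproducing_formula:
  fixes f :: "'a::euclidean_space distr"
  assumes \<eta>: "cutoff \<eta>" and f: "tempered_distribution f" and a: "test_fun a" and \<theta>: "test_fun \<theta>"
    and one: "\<And>\<xi>. a \<xi> ~= 0 ==> \<theta> \<xi> = 1"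
  shows "integrable lborel (\<lambda>y. synth \<theta> (x - y) * distr_synth f a y)"
    and "(LINT y|lborel. synth \<theta> (x - y) * distr_synth f a y) = inversion_const \<eta> TYPE('a) * distr_synth f a x"
proof -
  note r = schwartz_rapid[OF reflected_synth_schwartz[OF \<theta>, of x]]
  note ic = distr_synth_interchange[OF f a r, of "\<lambda>y. y"]
  show "integrable lborel (\<lambda>y. synth \<theta> (x - y) * distr_synth f a y)"
    by (rule ic) (auto intro: continuous_on_id)
  let ?c = "inversion_const \<eta> TYPE('a)"
  have "(LINT y|lborel. synth \<theta> (x - y) * synth a (y - z)) = ?c * synth a (x - z)" for z
  proof -
    have "(LINT y|lborel. synth \<theta> (x - y) * synth a (y - z))
      = synth (\<lambda>\<xi>. (LINT y|lborel. cis (y \<bullet> \<xi>) * synth \<theta> (x - y)) * a \<xi>) (0 - z)"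
      by (rule superposition_synth(2)[OF r test_fun_cbounded[OF a]]) simp
    also have "... = synth (\<lambda>\<xi>. ?c * (cis (x \<bullet> \<xi>) * a \<xi>)) (0 - z)"
    proof -
      have "\<theta> \<xi> * a \<xi> = a \<xi>" for \<xi> using one[of \<xi>] by (cases "a \<xi> = 0") auto
      then have "(LINT y|lborel. cis (y \<bullet> \<xi>) * synth \<theta> (x - y)) * a \<xi> = ?c * (cis (x \<bullet> \<xi>) * a \<xi>)" for \<xi>
        unfolding inversion[OF \<eta> \<theta>] mult.assoc by metis
      then show ?thesis by (simp only:)
    qed
    also have "... = ?c * synth a (x - z)"
      unfolding synth_cmult by (simp add: synth_def inner_diff_left cis_mult mult.assoc[symmetric])
    finally show ?thesis .
  qed
  then have "(LINT y|lborel. synth \<theta> (x - y) * distr_synth f a y) = f (\<lambda>z. ?c * synth a (x - z))"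
    using ic(2) by (simp add: continuous_on_id)
  also have "... = ?c * distr_synth f a x"
    using tempered_lincomb[OF f reflected_synth_schwartz[OF a, of x] reflected_synth_schwartz[OF a, of x], of ?c 0]
    by (simp add: distr_synth_def)
  finally show "(LINT y|lborel. synth \<theta> (x - y) * distr_synth f a y) = ?c * distr_synth f a x" .
qed

text \<open>Restriction to the hyperplane projects frequencies: at a point (y, 0) the frequency
  (\<xi>, \<tau>) oscillates like \<xi>. Convolving with the kernel of \<theta> therefore multiplies
  a (\<xi>, \<tau>) by a multiple of \<theta> \<xi>.\<close>

lemma trace_frequency_disjoint:
  fixes f :: "('a::euclidean_space \<times> real) distr"
  assumes \<eta>: "cutoff \<eta>" and f: "tempered_distribution f" and a: "test_fun a" and \<theta>: "test_fun \<theta>"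
    and zero: "\<And>\<xi> \<tau>. a (\<xi>, \<tau>) * \<theta> \<xi> = 0"
  shows "(LINT y|lborel. synth \<theta> (x - y) * distr_synth f a (y, 0)) = 0"
proof -
  note r = schwartz_rapid[OF reflected_synth_schwartz[OF \<theta>, of x]]
  let ?\<iota> = "\<lambda>y::'a. (y, 0::real)"
  have \<iota>: "continuous_on UNIV ?\<iota>" by (intro continuous_intros)
  have "(LINT y|lborel. synth \<theta> (x - y) * synth a (?\<iota> y - z)) = 0" for z
  proof -
    have "(LINT y|lborel. synth \<theta> (x - y) * synth a (?\<iota> y - z))
      = synth (\<lambda>\<xi>. (LINT y|lborel. cis (?\<iota> y \<bullet> \<xi>) * synth \<theta> (x - y)) * a \<xi>) (0 - z)"
      using \<iota> by (intro superposition_synth(2)[OF r test_fun_cbounded[OF a]] borel_measurable_continuous_onI)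
    also have "(\<lambda>\<xi>. (LINT y|lborel. cis (?\<iota> y \<bullet> \<xi>) * synth \<theta> (x - y)) * a \<xi>) = (\<lambda>_. 0)"
    proof
      fix \<xi> :: "'a \<times> real"
      have "(LINT y|lborel. cis (?\<iota> y \<bullet> \<xi>) * synth \<theta> (x - y)) = (LINT y|lborel. cis (y \<bullet> fst \<xi>) * synth \<theta> (x - y))"
        by (simp add: inner_prod_def)
      then show "(LINT y|lborel. cis (?\<iota> y \<bullet> \<xi>) * synth \<theta> (x - y)) * a \<xi> = 0"
        using zero[of "fst \<xi>" "snd \<xi>"] by (auto simp: inversion[OF \<eta> \<theta>])
    qed
    finally show ?thesis by (simp add: synth_def)
  qed
  then have "(LINT y|lborel. synth \<theta> (x - y) * distr_synth f a (y, 0)) = f (\<lambda>z. 0)"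
    using distr_synth_interchange(2)[OF f a r \<iota>] by simp
  also have "... = 0" by (rule tempered_zero[OF f reflected_synth_schwartz[OF a]])
  finally show ?thesis .
qed

section \<open>Geometry of the covering and counting of lattice points\<close>

section \<open>The lattice and the covering cubes\<close>

lemma int_lattice_0: "0 \<in> int_lattice"
  and int_lattice_add: "k \<in> int_lattice ==> m \<in> int_lattice ==> k + m \<in> int_lattice"
  and int_lattice_diff: "k \<in> int_lattice ==> m \<in> int_lattice ==> k - m \<in> int_lattice"
  unfolding int_lattice_def by (auto simp: inner_add_left inner_diff_left)

lemma int_lattice_norm_ge_1:
  assumes "k \<in> int_lattice" "k ~= 0" shows "norm k >= 1"
proof -
  obtain b where b: "b \<in> Basis" "k \<bullet> b ~= 0" using assms(2) by (metis euclidean_all_zero_iff)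
  then have "k \<bullet> b \<in> \<int>" using assms(1) unfolding int_lattice_def by blast
  with b(2) have "1 <= \<bar>k \<bullet> b\<bar>" using Ints_nonzero_abs_ge1 by blast
  also have "... <= norm k" by (rule Basis_le_norm[OF b(1)])
  finally show ?thesis .
qed

text \<open>Identifies the lattice points of a cube with a product of integer sets, so that sums of
  products over coordinates factor.\<close>

lemma int_lattice_bij:
  "bij_betw (\<lambda>f. \<Sum>b\<in>Basis. of_int (f b) *\<^sub>R b) (Basis \<rightarrow>\<^sub>E A)
     {k::'a::euclidean_space. k \<in> int_lattice \<and> (\<forall>b\<in>Basis. \<lfloor>k \<bullet> b\<rfloor> \<in> A)}"
proof (rule bij_betw_byWitness[where f' = "\<lambda>k. \<lambda>b\<in>Basis. \<lfloor>k \<bullet> b\<rfloor>"])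
  have inner: "(\<Sum>b\<in>Basis. of_int (f b) *\<^sub>R b) \<bullet> c = of_int (f c)" if "c \<in> Basis" for f and c :: 'a
    using inner_sum_left_Basis[OF that, of "\<lambda>b. of_int (f b)"] by simp
  show "\<forall>f\<in>Basis \<rightarrow>\<^sub>E A. (\<lambda>b\<in>Basis. \<lfloor>(\<Sum>b\<in>Basis. of_int (f b) *\<^sub>R b :: 'a) \<bullet> b\<rfloor>) = f"
    by (auto simp: fun_eq_iff inner PiE_def extensional_def)
  show "\<forall>k\<in>{k::'a. k \<in> int_lattice \<and> (\<forall>b\<in>Basis. \<lfloor>k \<bullet> b\<rfloor> \<in> A)}.
      (\<Sum>b\<in>Basis. of_int ((\<lambda>b\<in>Basis. \<lfloor>k \<bullet> b\<rfloor>) b) *\<^sub>R b) = k"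
  proof
    fix k :: 'a assume "k \<in> {k::'a. k \<in> int_lattice \<and> (\<forall>b\<in>Basis. \<lfloor>k \<bullet> b\<rfloor> \<in> A)}"
    then have "of_int \<lfloor>k \<bullet> b\<rfloor> = k \<bullet> b" if "b \<in> Basis" for b
      using that unfolding int_lattice_def by auto
    then have "(\<Sum>b\<in>Basis. of_int ((\<lambda>b\<in>Basis. \<lfloor>k \<bullet> b\<rfloor>) b) *\<^sub>R b) = (\<Sum>b\<in>Basis. (k \<bullet> b) *\<^sub>R b)"
      by (intro sum.cong) auto
    then show "(\<Sum>b\<in>Basis. of_int ((\<lambda>b\<in>Basis. \<lfloor>k \<bullet> b\<rfloor>) b) *\<^sub>R b) = k"
      by (simp add: euclidean_representation)
  qed
qed (auto simp: int_lattice_def inner_sum_left_Basis PiE_def Pi_def)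

lemma int_lattice_sum_prod:
  fixes g :: "int => real"
  assumes "finite A"
  shows "(\<Sum>k\<in>{k::'a::euclidean_space. k \<in> int_lattice \<and> (\<forall>b\<in>Basis. \<lfloor>k \<bullet> b\<rfloor> \<in> A)}. \<Prod>b\<in>Basis. g \<lfloor>k \<bullet> b\<rfloor>)
     = (\<Sum>t\<in>A. g t) ^ DIM('a)"
proof -
  have "(\<Sum>k\<in>{k::'a. k \<in> int_lattice \<and> (\<forall>b\<in>Basis. \<lfloor>k \<bullet> b\<rfloor> \<in> A)}. \<Prod>b\<in>Basis. g \<lfloor>k \<bullet> b\<rfloor>)
      = (\<Sum>f\<in>Basis \<rightarrow>\<^sub>E A. \<Prod>c\<in>Basis. g \<lfloor>(\<Sum>b\<in>Basis. of_int (f b) *\<^sub>R b :: 'a) \<bullet> c\<rfloor>)"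
    by (rule sum.reindex_bij_betw[OF int_lattice_bij, symmetric])
  also have "... = (\<Sum>f\<in>(Basis::'a set) \<rightarrow>\<^sub>E A. \<Prod>c\<in>Basis. g (f c))"
    by (intro sum.cong prod.cong) (auto simp: inner_sum_left_Basis)
  also have "... = (\<Prod>c\<in>(Basis::'a set). \<Sum>t\<in>A. g t)"
    by (rule prod_sum_PiE[symmetric]) (use assms in auto)
  finally show ?thesis by simp
qed

lemma int_lattice_finite_ball: "finite {k::'a::euclidean_space. k \<in> int_lattice \<and> norm k <= C}"
proof (rule finite_subset)
  let ?A = "{- \<lceil>C\<rceil> .. \<lceil>C\<rceil>}"
  have "\<lfloor>k \<bullet> b\<rfloor> \<in> ?A" if "norm k <= C" "b \<in> Basis" for k b :: 'a
  proof -
    have "\<bar>k \<bullet> b\<bar> <= C" using Basis_le_norm[OF that(2), of k] that(1) by linarith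
    then show ?thesis by (auto simp: le_floor_iff floor_le_iff) linarith+
  qed
  then show "{k::'a. k \<in> int_lattice \<and> norm k <= C} \<subseteq> {k. k \<in> int_lattice \<and> (\<forall>b\<in>Basis. \<lfloor>k \<bullet> b\<rfloor> \<in> ?A)}"
    by blast
  show "finite {k::'a. k \<in> int_lattice \<and> (\<forall>b\<in>Basis. \<lfloor>k \<bullet> b\<rfloor> \<in> ?A)}"
    using bij_betw_finite[OF int_lattice_bij[of ?A, where 'a='a]] by (simp add: finite_PiE)
qed

lemma jbracket_ge: "jbracket x >= 1" "jbracket x >= norm x"
  unfolding jbracket_def by (auto intro!: real_le_rsqrt)

lemma jbracket_pos: "jbracket x > 0"
  using jbracket_ge(1)[of x] by linarith

lemma jbracket_le: "jbracket x <= 1 + norm x"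
  unfolding jbracket_def by (rule real_le_lsqrt) (auto simp: power2_eq_square algebra_simps)

lemma jbracket_le_norm:
  assumes "k \<in> int_lattice" "k ~= 0" shows "jbracket k <= 2 * norm k"
  using jbracket_le[of k] int_lattice_norm_ge_1[OF assms] by linarith

lemma jbracket_triangle: "jbracket (k + j) <= 2 * jbracket k * (1 + norm j)"
proof -
  have "jbracket (k + j) <= 1 + norm k + norm j"
    using jbracket_le[of "k + j"] norm_triangle_ineq[of k j] by linarith
  also have "... <= (1 + norm k) * (1 + norm j)" by (simp add: algebra_simps)
  also have "... <= (2 * jbracket k) * (1 + norm j)"
    using jbracket_ge[of k] by (intro mult_right_mono) auto
  finally show ?thesis .
qed

text \<open>Strong monotonicity of x -> |x|^\<beta> x: pair the difference of the two values with k
  - m. The mixed term has the sign of (p - q)(|k|^2 - |m|^2), which is nonnegative because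
  |x|^\<beta> increases with |x|.\<close>

lemma center_separation:
  fixes k m :: "'a::euclidean_space"
  assumes \<beta>: "\<beta> >= 0"
  shows "(norm k powr \<beta> + norm m powr \<beta>) / 2 * norm (k - m) <= norm (norm k powr \<beta> *\<^sub>R k - norm m powr \<beta> *\<^sub>R m)"
proof -
  define p q where "p = norm k powr \<beta>" and "q = norm m powr \<beta>"
  have mono: "(p - q) * ((norm k)\<^sup>2 - (norm m)\<^sup>2) >= 0"
  proof (cases "norm k <= norm m")
    case True
    then have "p <= q" "(norm k)\<^sup>2 <= (norm m)\<^sup>2" unfolding p_def q_def using \<beta> by (auto intro: powr_mono2 power_mono)
    then show ?thesis by (simp add: mult_nonpos_nonpos)
  next
    case False
    then have "q <= p" "(norm m)\<^sup>2 <= (norm k)\<^sup>2" unfolding p_def q_def using \<beta> by (auto intro: powr_mono2 power_mono)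
    then show ?thesis by simp
  qed
  have "(p *\<^sub>R k - q *\<^sub>R m) \<bullet> (k - m) = (p + q) / 2 * (norm (k - m))\<^sup>2 + (p - q) * ((norm k)\<^sup>2 - (norm m)\<^sup>2) / 2"
    by (simp add: power2_norm_eq_inner inner_diff_left inner_diff_right inner_commute algebra_simps)
       (simp add: field_simps)?
  then have "(p + q) / 2 * (norm (k - m))\<^sup>2 <= (p *\<^sub>R k - q *\<^sub>R m) \<bullet> (k - m)"
    using mono by simp
  also have "... <= norm (p *\<^sub>R k - q *\<^sub>R m) * norm (k - m)" by (rule norm_cauchy_schwarz)
  finally have *: "(p + q) / 2 * norm (k - m) * norm (k - m) <= norm (p *\<^sub>R k - q *\<^sub>R m) * norm (k - m)"
    by (simp add: power2_eq_square mult.assoc)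
  show ?thesis
  proof (cases "k = m")
    case False
    then have "norm (k - m) > 0" by simp
    with * show ?thesis unfolding p_def[symmetric] q_def[symmetric] using mult_right_le_imp_le by blast
  qed simp
qed

text \<open>The covering property depends on the dimension, hence on the type; it is a hypothesis of
  single lemmas, and the locale keeps only what concerns the two numbers.\<close>

locale alpha_covering =
  fixes \<rho> \<alpha> :: real
  assumes \<rho>: "\<rho> > 0" and \<alpha>: "0 <= \<alpha>" "\<alpha> < 1"
begin

abbreviation "radius \<equiv> alpha_radius \<rho> \<alpha>"
abbreviation "center \<equiv> alpha_center \<alpha>"
abbreviation "\<beta> \<equiv> \<alpha> / (1 - \<alpha>)"

lemma \<beta>_nonneg: "\<beta> >= 0" using \<alpha> by simp

lemma radius_pos: "radius k > 0"
  unfolding alpha_radius_def using \<rho> jbracket_pos[of k] by simp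

lemma radius_ratio: "radius (k + j) <= (2 * (1 + norm j)) powr \<beta> * radius k"
proof -
  have "jbracket (k + j) powr \<beta> <= ((2 * (1 + norm j)) * jbracket k) powr \<beta>"
    using jbracket_triangle[of k j] jbracket_pos[of "k + j"] by (intro powr_mono2 \<beta>_nonneg) (auto simp: mult_ac)
  also have "... = (2 * (1 + norm j)) powr \<beta> * jbracket k powr \<beta>"
    using jbracket_pos[of k] by (simp add: powr_mult)
  finally show ?thesis unfolding alpha_radius_def using \<rho> by (simp add: mult.left_commute)
qed

text \<open>Separation of the centers is at least of order (|k|^\<beta> + |m|^\<beta>) |k - m|,
  while the radii sum to the same order without the last factor. The common factor cancels, and only
  boundedly many offsets remain for each cube.\<close>

lemma touching_cubes:
  fixes k m :: "'a::euclidean_space"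
  assumes "k \<in> int_lattice" "m \<in> int_lattice" "C >= 0"
    and c: "norm (center k - center m) <= C * (radius k + radius m)"
  shows "norm (m - k) <= 4 * C * \<rho> * 2 powr \<beta>"
proof (cases "k = 0 \<and> m = 0")
  case True
  then show ?thesis using assms(3) \<rho> by simp
next
  case False
  \<comment> \<open>At the origin \<open>0 powr \<beta>\<close> is 0, even for \<beta> = 0, while
    the Japanese bracket is 1. The other index then has norm at least 1 and makes S at least
    1.\<close>
  define S where "S = norm k powr \<beta> + norm m powr \<beta>"
  have le: "jbracket x powr \<beta> <= 2 powr \<beta> * norm x powr \<beta>" if "x \<in> int_lattice" "x ~= 0" for x :: 'a
  proof -
    have "jbracket x powr \<beta> <= (2 * norm x) powr \<beta>"
      using jbracket_le_norm[OF that] jbracket_pos[of x] by (intro powr_mono2 \<beta>_nonneg) auto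
    then show ?thesis by (simp add: powr_mult)
  qed
  have ge1: "1 <= norm x powr \<beta>" if "x \<in> int_lattice" "x ~= 0" for x :: 'a
    using int_lattice_norm_ge_1[OF that] \<beta>_nonneg by (intro ge_one_powr_ge_zero) auto
  have two: "1 <= 2 powr \<beta>" using \<beta>_nonneg by (intro ge_one_powr_ge_zero) auto
  have j0: "jbracket (0::'a) = 1" by (simp add: jbracket_def)
  have S: "jbracket k powr \<beta> + jbracket m powr \<beta> <= 2 * 2 powr \<beta> * S"
  proof -
    have "jbracket x powr \<beta> <= 2 powr \<beta> * S" if "x = k \<or> x = m" for x
    proof (cases "x = 0")
      case True
      have "1 <= S"
        using False that True assms(1,2) ge1[of k] ge1[of m] powr_ge_zero[of "norm k" \<beta>] powr_ge_zero[of "norm m" \<beta>]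
        unfolding S_def by (cases "k = 0") (auto intro: add_increasing add_increasing2)
      then have "1 * 1 <= 2 powr \<beta> * S" using two by (intro mult_mono) auto
      then show ?thesis using True j0 by simp
    next
      case False
      then have "jbracket x powr \<beta> <= 2 powr \<beta> * norm x powr \<beta>" using that assms le by blast
      also have "... <= 2 powr \<beta> * S" unfolding S_def using that by (intro mult_left_mono) auto
      finally show ?thesis .
    qed
    from this[of k] this[of m] show ?thesis by simp
  qed
  have Spos: "S > 0"
    using False assms(1,2) ge1[of k] ge1[of m] powr_ge_zero[of "norm k" \<beta>] powr_ge_zero[of "norm m" \<beta>]
    unfolding S_def by (cases "k = 0") (auto intro: add_nonneg_pos add_pos_nonneg)
  have "S / 2 * norm (k - m) <= C * (\<rho> * (jbracket k powr \<beta> + jbracket m powr \<beta>))"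
    using order_trans[OF center_separation[OF \<beta>_nonneg, of k m] c[unfolded alpha_center_def alpha_radius_def]]
    unfolding S_def by (simp add: distrib_left)
  also have "... <= C * (\<rho> * (2 * 2 powr \<beta> * S))"
    using S assms(3) \<rho> by (intro mult_left_mono) auto
  finally have "S * norm (k - m) <= S * (4 * C * \<rho> * 2 powr \<beta>)" by (simp add: algebra_simps)
  with Spos show ?thesis by (simp add: norm_minus_commute)
qed

lemma norm_le_componentwise:
  fixes x :: "'a::euclidean_space"
  assumes "\<And>b. b \<in> Basis ==> \<bar>x \<bullet> b\<bar> <= B"
  shows "norm x <= real DIM('a) * B"
  using order_trans[OF norm_le_l1[of x] sum_bounded_above[of Basis, OF assms]] by simp

text \<open>
  The summand \<open>1 - box_bump \<eta> (1 / 2) 0\<close> vanishes on the support of the numerator and keeps the denominator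
  away from zero elsewhere.
\<close>

definition rescaled_partition ::
    "(real => real) => 'a::euclidean_space => 'a => complex" where
  "rescaled_partition \<eta> k u = box_bump \<eta> 1 0 u * inverse
     ((\<Sum>j\<in>{j. j \<in> int_lattice \<and> norm j <= 4 * (4 * real DIM('a)) * \<rho> * 2 powr \<beta>}.
         box_bump \<eta> (radius k / radius (k + j))
           ((1 / radius (k + j)) *\<^sub>R (center k - center (k + j))) u)
      + (1 + (-1) * box_bump \<eta> (1 / 2) 0 u))"

lemma bump_rescale:
  "of_real (alpha_bump \<eta> \<rho> \<alpha> m \<xi>) =
     box_bump \<eta> (radius k / radius m)
           ((1 / radius m) *\<^sub>R (center k - center m))
           ((1 / radius k) *\<^sub>R (\<xi> - center k))"
proof -
  have "(\<xi> \<bullet> b - center m \<bullet> b) / radius m =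
    radius k / radius m * (((1 / radius k) *\<^sub>R (\<xi> - center k)) \<bullet> b)
      + ((1 / radius m) *\<^sub>R (center k - center m)) \<bullet> b" for b
    using radius_pos[of k] radius_pos[of m] by (simp add: inner_diff_left field_simps)
  then show ?thesis unfolding alpha_bump_def box_bump_def by simp
qed

lemma bump_nonneg: "cutoff \<eta> ==> 0 <= alpha_bump \<eta> \<rho> \<alpha> m \<xi>"
  unfolding alpha_bump_def by (auto intro!: prod_nonneg prod_le_1 cutoff_range[of \<eta>])

lemma bump_support:
  assumes "cutoff \<eta>" "alpha_bump \<eta> \<rho> \<alpha> m \<xi> ~= 0" "b \<in> Basis"
  shows "\<bar>(\<xi> - center m) \<bullet> b\<bar> <= 2 * radius m"
proof (rule ccontr)
  assume "\<not> ?thesis"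
  then have "\<bar>(\<xi> \<bullet> b - center m \<bullet> b) / radius m\<bar> >= 2"
    using radius_pos[of m] by (simp add: inner_diff_left field_simps abs_if split: if_splits)
  with assms(2,3) show False
    unfolding alpha_bump_def using cutoff_eq_0[OF assms(1)] by (auto simp: prod_zero_iff)
qed

text \<open>A bump m that is nonzero at \<xi> has its center within 2 radii per coordinate, and
  \<xi> is within 4 radii of the center of k. Per coordinate the centers differ by at most 4 times
  the sum of the radii; passing to the norm costs DIM, so \<open>touching_cubes\<close> applies with
  C = 4 DIM.\<close>

lemma bump_sum_local:
  fixes k \<xi> :: "'a::euclidean_space"
  assumes \<eta>: "cutoff \<eta>" and k: "k \<in> int_lattice"
    and \<xi>: "\<And>b. b \<in> Basis ==> \<bar>(\<xi> - center k) \<bullet> b\<bar> <= 4 * radius k"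
  shows "(\<Sum>\<^sub>\<infinity>m\<in>int_lattice. alpha_bump \<eta> \<rho> \<alpha> m \<xi>)
    = (\<Sum>j\<in>{j. j \<in> int_lattice \<and> norm j <= 4 * (4 * real DIM('a)) * \<rho> * 2 powr \<beta>}. alpha_bump \<eta> \<rho> \<alpha> (k + j) \<xi>)"
    (is "_ = sum _ ?J")
proof -
  have fin: "finite ?J" by (rule int_lattice_finite_ball)
  have inj: "inj_on (\<lambda>j. k + j) ?J" by (auto simp: inj_on_def)
  have "(\<Sum>\<^sub>\<infinity>m\<in>int_lattice. alpha_bump \<eta> \<rho> \<alpha> m \<xi>) = (\<Sum>\<^sub>\<infinity>m\<in>(\<lambda>j. k + j) ` ?J. alpha_bump \<eta> \<rho> \<alpha> m \<xi>)"
  proof (rule infsum_cong_neutral)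
    fix m assume m: "m \<in> int_lattice - (\<lambda>j. k + j) ` ?J"
    show "alpha_bump \<eta> \<rho> \<alpha> m \<xi> = 0"
    proof (rule ccontr)
      assume nz: "alpha_bump \<eta> \<rho> \<alpha> m \<xi> ~= 0"
      have "\<bar>(center k - center m) \<bullet> b\<bar> <= 4 * (radius k + radius m)" if "b \<in> Basis" for b
        using bump_support[OF \<eta> nz that] \<xi>[OF that] radius_pos[of m] by (simp add: inner_diff_left abs_if split: if_splits)
      from norm_le_componentwise[OF this]
      have "norm (m - k) <= 4 * (4 * real DIM('a)) * \<rho> * 2 powr \<beta>"
        using m k by (intro touching_cubes) (auto simp: mult_ac)
      then have "m - k \<in> ?J" using m k by (auto intro: int_lattice_diff)
      then have "k + (m - k) \<in> (\<lambda>j. k + j) ` ?J" by blast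
      with m show False by simp
    qed
  qed (use k in \<open>auto intro: int_lattice_add\<close>)
  also have "... = (\<Sum>m\<in>(\<lambda>j. k + j) ` ?J. alpha_bump \<eta> \<rho> \<alpha> m \<xi>)"
    by (intro infsum_finite finite_imageI fin)
  also have "... = (\<Sum>j\<in>?J. alpha_bump \<eta> \<rho> \<alpha> (k + j) \<xi>)"
    by (subst sum.reindex[OF inj]) simp
  finally show ?thesis .
qed

text \<open>The covering provides a cube containing \<xi>; its bump equals 1 there, and its index
  offset lies in the finite set by the same geometry as for the local sum.\<close>

lemma bump_sum_ge_1:
  fixes k \<xi> :: "'a::euclidean_space"
  assumes \<eta>: "cutoff \<eta>" and k: "k \<in> int_lattice" and adm: "admissible_radius TYPE('a) \<rho> \<alpha>"
    and \<xi>: "\<And>b. b \<in> Basis ==> \<bar>(\<xi> - center k) \<bullet> b\<bar> <= 4 * radius k"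
  shows "1 <= (\<Sum>j\<in>{j. j \<in> int_lattice \<and> norm j <= 4 * (4 * real DIM('a)) * \<rho> * 2 powr \<beta>}. alpha_bump \<eta> \<rho> \<alpha> (k + j) \<xi>)"
    (is "_ <= sum _ ?J")
proof -
  have fin: "finite ?J" by (rule int_lattice_finite_ball)
  have "\<xi> \<in> (\<Union>m\<in>int_lattice. cbox (center m - radius m *\<^sub>R One)
                         (center m + radius m *\<^sub>R One))"
    using adm unfolding admissible_radius_def by simp
  then obtain m where m: "m \<in> int_lattice"
    "\<xi> \<in> cbox (center m - radius m *\<^sub>R One) (center m + radius m *\<^sub>R One)" by blast
  have "\<bar>(\<xi> \<bullet> b - center m \<bullet> b) / radius m\<bar> <= 1" if "b \<in> Basis" for b
    using m(2) that radius_pos[of m] unfolding mem_box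
    by (auto simp: inner_diff_left inner_add_left field_simps abs_le_iff)
  then have one: "alpha_bump \<eta> \<rho> \<alpha> m \<xi> = 1"
    unfolding alpha_bump_def using cutoff_eq_1[OF \<eta>] by (intro prod.neutral) auto
  have "\<bar>(center k - center m) \<bullet> b\<bar> <= 4 * (radius k + radius m)" if "b \<in> Basis" for b
    using bump_support[OF \<eta> _ that, of m \<xi>] one \<xi>[OF that] radius_pos[of m] by (simp add: inner_diff_left abs_if split: if_splits)
  from norm_le_componentwise[OF this]
  have "norm (m - k) <= 4 * (4 * real DIM('a)) * \<rho> * 2 powr \<beta>"
    using m k by (intro touching_cubes) (auto simp: mult_ac)
  then have mk: "m - k \<in> ?J" using m k by (auto intro: int_lattice_diff)
  have "1 = alpha_bump \<eta> \<rho> \<alpha> (k + (m - k)) \<xi>" using one by simp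
  also have "... <= (\<Sum>j\<in>?J. alpha_bump \<eta> \<rho> \<alpha> (k + j) \<xi>)"
    by (intro member_le_sum mk fin bump_nonneg \<eta>)
  finally show ?thesis .
qed

lemma box_bump_real:
  assumes "cutoff \<eta>" shows "box_bump \<eta> A v u = of_real (Re (box_bump \<eta> A v u))" "0 <= Re (box_bump \<eta> A v u)" "Re (box_bump \<eta> A v u) <= 1"
  unfolding box_bump_def using cutoff_range[OF assms]
  by (auto simp del: of_real_prod intro!: prod_nonneg prod_le_1)

text \<open>Where all coordinates of u are at most 4, the bump sum is at least 1. Outside,
  \<open>box_bump \<eta> (1 / 2) 0\<close> vanishes, since 4 is twice the cutoff range 2, and the
  added summand equals 1. Both parts have nonnegative real part everywhere.\<close>

lemma rescaled_denominator:
  fixes k u :: "'a::euclidean_space"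
  assumes \<eta>: "cutoff \<eta>" and k: "k \<in> int_lattice" and adm: "admissible_radius TYPE('a) \<rho> \<alpha>"
  shows "1 <= norm ((\<Sum>j\<in>{j. j \<in> int_lattice \<and> norm j <= 4 * (4 * real DIM('a)) * \<rho> * 2 powr \<beta>}.
         box_bump \<eta> (radius k / radius (k + j))
           ((1 / radius (k + j)) *\<^sub>R (center k - center (k + j))) u)
      + (1 + (-1) * box_bump \<eta> (1 / 2) 0 u))" (is "_ <= norm (sum ?f ?J + _)")
proof -
  let ?\<xi> = "center k + radius k *\<^sub>R u"
  have u: "u = (1 / radius k) *\<^sub>R (?\<xi> - center k)" using radius_pos[of k] by simp
  have f: "?f j = of_real (alpha_bump \<eta> \<rho> \<alpha> (k + j) ?\<xi>)" for j
    unfolding bump_rescale[of \<eta> "k + j" ?\<xi> k] u[symmetric] ..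
  have "1 <= Re (sum ?f ?J + (1 + (-1) * box_bump \<eta> (1 / 2) 0 u))"
  proof (cases "\<forall>b\<in>Basis. \<bar>u \<bullet> b\<bar> <= 4")
    case True
    then have "\<bar>(?\<xi> - center k) \<bullet> b\<bar> <= 4 * radius k" if "b \<in> Basis" for b
      using that radius_pos[of k] by (auto simp: abs_mult mult.commute)
    from bump_sum_ge_1[OF \<eta> k adm this] show ?thesis
      using box_bump_real(3)[OF \<eta>, of "1/2" 0 u] by (simp add: f)
  next
    case False
    then obtain b where b: "b \<in> Basis" "\<bar>u \<bullet> b\<bar> > 4" by auto
    have "box_bump \<eta> (1 / 2) 0 u = 0" by (rule box_bump_eq_0[OF \<eta> b(1)]) (use b(2) in auto)
    then show ?thesis using bump_nonneg[OF \<eta>] by (auto simp: f intro!: sum_nonneg)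
  qed
  also have "... <= norm (sum ?f ?J + (1 + (-1) * box_bump \<eta> (1 / 2) 0 u))" by (rule complex_Re_le_cmod)
  finally show ?thesis .
qed

text \<open>The offsets j run through a finite set that does not depend on k, and the dilations
  \<open>radius k / radius (k + j)\<close> are bounded by a constant depending on j alone. The
  translations vary without control, which uniform smoothness permits.\<close>

lemma rescaled_partition_family:
  assumes \<eta>: "cutoff \<eta>" and adm: "admissible_radius TYPE('a::euclidean_space) \<rho> \<alpha>"
  shows "test_family int_lattice (rescaled_partition \<eta> :: 'a => _)"
proof -
  let ?J = "{j::'a. j \<in> int_lattice \<and> norm j <= 4 * (4 * real DIM('a)) * \<rho> * 2 powr \<beta>}"
  have us: "usmooth m int_lattice (\<lambda>k u. inverse ((\<Sum>j\<in>?J.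
         box_bump \<eta> (radius k / radius (k + j))
           ((1 / radius (k + j)) *\<^sub>R (center k - center (k + j))) u)
      + (1 + (-1) * box_bump \<eta> (1 / 2) 0 u)))" for m
  proof (rule usmooth_inverse[of 1])
    show "usmooth m int_lattice (\<lambda>k u. (\<Sum>j\<in>?J.
         box_bump \<eta> (radius k / radius (k + j))
           ((1 / radius (k + j)) *\<^sub>R (center k - center (k + j))) u)
      + (1 + (-1) * box_bump \<eta> (1 / 2) 0 u))"
    proof (intro usmooth_add usmooth_sum usmooth_mult)
      show "finite ?J" by (rule int_lattice_finite_ball)
      fix j :: 'a assume "j \<in> ?J"
      have "\<bar>radius k / radius (k + j)\<bar> <= (2 * (1 + norm j)) powr \<beta>" for k
        using radius_ratio[of "k + j" "- j"] radius_pos[of k] radius_pos[of "k + j"]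
        by (simp add: divide_le_eq abs_of_pos)
      then show "usmooth m int_lattice (\<lambda>k. box_bump \<eta> (radius k / radius (k + j))
           ((1 / radius (k + j)) *\<^sub>R (center k - center (k + j))))"
        by (intro usmooth_box_bump \<eta>)
    next
      show "usmooth m int_lattice (\<lambda>k::'a. box_bump \<eta> (1 / 2) 0)"
        by (intro usmooth_box_bump[of \<eta> int_lattice "\<lambda>_. 1/2" "1/2" m "\<lambda>_. 0"] \<eta>) auto
    qed (auto intro: usmooth_const[where C=1])
  qed (use rescaled_denominator[OF \<eta> _ adm] in auto)
  have "test_fun (box_bump \<eta> 1 (0::'a))" by (rule test_fun_box_bump[OF \<eta>]) simp
  then have "test_family int_lattice (\<lambda>_::'a. box_bump \<eta> 1 (0::'a))"
    unfolding test_fun_def using test_family_reindex[of UNIV "\<lambda>_. box_bump \<eta> 1 (0::'a)" int_lattice "\<lambda>_. ()"] by simp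
  from test_family_mult(1)[OF this us]
  show ?thesis unfolding rescaled_partition_def[abs_def] .
qed

lemma rescaled_partition_support:
  assumes "cutoff \<eta>" "b \<in> Basis" "\<bar>u \<bullet> b\<bar> >= 2" shows "rescaled_partition \<eta> k u = 0"
  unfolding rescaled_partition_def using box_bump_eq_0[OF assms(1,2), of 1 u 0] assms(3) by simp

lemma partition_rescale:
  fixes k \<xi> :: "'a::euclidean_space"
  assumes \<eta>: "cutoff \<eta>" and k: "k \<in> int_lattice" and adm: "admissible_radius TYPE('a) \<rho> \<alpha>"
  shows "of_real (alpha_partition \<eta> \<rho> \<alpha> k \<xi>)
    = rescaled_partition \<eta> k ((1 / radius k) *\<^sub>R (\<xi> - center k))"
proof -
  let ?u = "(1 / radius k) *\<^sub>R (\<xi> - center k)"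
  let ?J = "{j::'a. j \<in> int_lattice \<and> norm j <= 4 * (4 * real DIM('a)) * \<rho> * 2 powr \<beta>}"
  have b1: "of_real (alpha_bump \<eta> \<rho> \<alpha> k \<xi>) = box_bump \<eta> 1 0 ?u"
    using bump_rescale[of \<eta> k \<xi> k] radius_pos[of k] by simp
  show ?thesis
  proof (cases "alpha_bump \<eta> \<rho> \<alpha> k \<xi> = 0")
    case True
    then have "box_bump \<eta> 1 0 ?u = 0" using b1 by simp
    then show ?thesis using True by (simp add: alpha_partition_def rescaled_partition_def)
  next
    case False
    have sup: "\<bar>(\<xi> - center k) \<bullet> b\<bar> <= 2 * radius k" if "b \<in> Basis" for b
      by (rule bump_support[OF \<eta> False that])
    have one: "box_bump \<eta> (1 / 2) 0 ?u = 1"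
    proof (rule box_bump_eq_1[OF \<eta>])
      fix b :: 'a assume "b \<in> Basis"
      then have s: "\<bar>(\<xi> - center k) \<bullet> b\<bar> <= 2 * radius k" by (rule sup)
      have "\<bar>?u \<bullet> b\<bar> <= 2"
        unfolding inner_scaleR_left abs_mult using s radius_pos[of k] by (simp add: pos_divide_le_eq)
      then show "\<bar>1 / 2 * (?u \<bullet> b) + 0 \<bullet> b\<bar> <= 1" by simp
    qed
    have "\<bar>(\<xi> - center k) \<bullet> b\<bar> <= 4 * radius k" if "b \<in> Basis" for b
      using sup[OF that] radius_pos[of k] by linarith
    from bump_sum_local[OF \<eta> k this]
    have "of_real (alpha_partition \<eta> \<rho> \<alpha> k \<xi>) = box_bump \<eta> 1 0 ?u / (\<Sum>j\<in>?J. of_real (alpha_bump \<eta> \<rho> \<alpha> (k + j) \<xi>))"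
      unfolding alpha_partition_def by (simp add: b1[symmetric])
    also have "... = rescaled_partition \<eta> k ?u"
      unfolding rescaled_partition_def one bump_rescale[of \<eta> "k + _" \<xi> k]
      by (simp add: divide_inverse)
    finally show ?thesis .
  qed
qed

end

section \<open>Kernels of rescaled multipliers\<close>

lemma test_fun_rescale:
  fixes a :: "'a::euclidean_space => complex"
  assumes "test_fun a" "R > 0" shows "test_fun (\<lambda>\<xi>. a ((1 / R) *\<^sub>R (\<xi> - c)))"
proof -
  from assms(1) obtain L where L: "\<And>x. norm x > L ==> a x = 0"
    unfolding test_fun_def test_family_def by auto
  have eq: "(1 / R) *\<^sub>R (\<xi> - c) = (1 / R) *\<^sub>R \<xi> + (- (1 / R) *\<^sub>R c)" for \<xi>
    by (simp add: scaleR_diff_right)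
  have "usmooth m UNIV (\<lambda>_::unit. \<lambda>\<xi>. a ((1 / R) *\<^sub>R (\<xi> - c)))" for m
    unfolding eq using assms usmooth_affine[of UNIV "\<lambda>_. 1 / R" "1 / R" m "\<lambda>_. a" "\<lambda>_. - (1 / R) *\<^sub>R c"]
    by (auto simp: test_fun_def test_family_def)
  moreover have "a ((1 / R) *\<^sub>R (\<xi> - c)) = 0" if "norm \<xi> > R * \<bar>L\<bar> + norm c" for \<xi>
  proof (rule L)
    have "R * \<bar>L\<bar> < norm (\<xi> - c)" using that norm_triangle_sub[of \<xi> c] by linarith
    then have "\<bar>L\<bar> < norm ((1 / R) *\<^sub>R (\<xi> - c))"
      unfolding norm_scaleR using assms(2) by (simp add: pos_less_divide_eq mult.commute)
    then show "L < norm ((1 / R) *\<^sub>R (\<xi> - c))" by linarith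
  qed
  ultimately show ?thesis unfolding test_fun_def test_family_def by blast
qed

lemma synth_rescale:
  fixes a :: "'a::euclidean_space => complex"
  assumes "cbounded a" "R > 0"
  shows "synth (\<lambda>\<xi>. a ((1 / R) *\<^sub>R (\<xi> - c))) x = of_real (R ^ DIM('a)) * cis (x \<bullet> c) * synth a (R *\<^sub>R x)"
proof -
  have [measurable]: "a \<in> borel_measurable borel" "cis \<in> borel_measurable borel"
    using assms(1) by (auto simp: cbounded_def intro!: borel_measurable_continuous_onI continuous_intros)
  have "synth (\<lambda>\<xi>. a ((1 / R) *\<^sub>R (\<xi> - c))) x
     = \<bar>R\<bar> ^ DIM('a) *\<^sub>R (LINT \<xi>|lborel. cis (x \<bullet> (c + R *\<^sub>R \<xi>)) * a ((1 / R) *\<^sub>R (c + R *\<^sub>R \<xi> - c)))"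
    unfolding synth_def by (rule integral_affine) (use assms in auto)
  also have "(LINT \<xi>|lborel. cis (x \<bullet> (c + R *\<^sub>R \<xi>)) * a ((1 / R) *\<^sub>R (c + R *\<^sub>R \<xi> - c)))
     = (LINT \<xi>|lborel. cis (x \<bullet> c) * (cis ((R *\<^sub>R x) \<bullet> \<xi>) * a \<xi>))"
    using assms(2) by (intro Bochner_Integration.integral_cong) (auto simp: inner_add_right cis_mult[symmetric])
  finally show ?thesis
    using assms(2) by (simp add: synth_def scaleR_conv_of_real mult.assoc)
qed

text \<open>Scaling a symbol by R and moving it to c multiplies the kernel by R^d, contracts it by R
  and modulates it by a factor of modulus 1. The constant is thus that of the unscaled
  family.\<close>

lemma kernel_decay:
  fixes F :: "'i => 'a::euclidean_space => complex"
  assumes "test_family I F"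
  obtains C where "C > 0" "\<And>i R c x. i \<in> I ==> R > 0 ==>
    norm (synth (\<lambda>\<xi>. F i ((1 / R) *\<^sub>R (\<xi> - c))) x) <= C * R ^ DIM('a) * decay M R x"
proof -
  obtain N :: nat where N: "M <= real N" using real_arch_simple by blast
  obtain C where C: "\<And>i x. i \<in> I ==> (1 + norm x) ^ N * norm (synth (F i) x) <= C"
    using synth_decay[OF assms, of N] by blast
  have "norm (synth (\<lambda>\<xi>. F i ((1 / R) *\<^sub>R (\<xi> - c))) x) <= max 1 C * R ^ DIM('a) * decay M R x"
    if i: "i \<in> I" and R: "R > 0" for i R c x
  proof -
    have pos: "1 + norm (R *\<^sub>R x) > 0" by (simp add: add_pos_nonneg)
    have "norm (synth (F i) (R *\<^sub>R x)) <= C / (1 + norm (R *\<^sub>R x)) ^ N"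
      using C[OF i, of "R *\<^sub>R x"] zero_less_power[OF pos, of N] by (simp add: pos_le_divide_eq mult.commute)
    also have "... <= max 1 C / (1 + norm (R *\<^sub>R x)) ^ N"
      using pos by (intro divide_right_mono) auto
    also have "... = max 1 C * (1 + norm (R *\<^sub>R x)) powr (- real N)"
      using pos by (simp add: powr_minus powr_realpow divide_inverse)
    also have "... <= max 1 C * (1 + norm (R *\<^sub>R x)) powr (- M)"
      using N by (intro mult_left_mono powr_mono) auto
    finally have "R ^ DIM('a) * norm (synth (F i) (R *\<^sub>R x)) <= R ^ DIM('a) * (max 1 C * decay M R x)"
      using R by (intro mult_left_mono) auto
    then show ?thesis
      using R by (simp add: synth_rescale[OF test_fun_cbounded[OF test_family_member[OF assms i]] R] norm_mult norm_power mult_ac)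
  qed
  then show thesis by (intro that[of "max 1 C"]) auto
qed

section \<open>Lattice sums\<close>

lemma sum_int_interval:
  fixes g :: "nat => real"
  assumes "\<And>j. 0 <= g j"
  shows "(\<Sum>t\<in>{- int n..int n}. g (nat \<bar>t\<bar>)) <= 2 * (\<Sum>j\<le>n. g j)"
proof -
  have "(\<Sum>t\<in>{- int n..int n}. g (nat \<bar>t\<bar>)) <= (\<Sum>t\<in>int ` {..n} \<union> (\<lambda>j. - int j) ` {..n}. g (nat \<bar>t\<bar>))"
  proof (rule sum_mono2)
    show "{- int n..int n} \<subseteq> int ` {..n} \<union> (\<lambda>j. - int j) ` {..n}"
    proof
      fix t assume t: "t \<in> {- int n..int n}"
      show "t \<in> int ` {..n} \<union> (\<lambda>j. - int j) ` {..n}"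
      proof (cases "t >= 0")
        case True
        then have "t = int (nat t)" "nat t \<in> {..n}" using t by auto
        then show ?thesis by blast
      next
        case False
        then have "t = - int (nat (- t))" "nat (- t) \<in> {..n}" using t by auto
        then show ?thesis by blast
      qed
    qed
  qed (use assms in auto)
  also have "... <= (\<Sum>t\<in>int ` {..n}. g (nat \<bar>t\<bar>)) + (\<Sum>t\<in>(\<lambda>j. - int j) ` {..n}. g (nat \<bar>t\<bar>))"
    using assms by (subst sum.union_inter[symmetric]) (auto intro!: sum_nonneg)
  also have "... = 2 * (\<Sum>j\<le>n. g j)"
    by (simp add: sum.reindex inj_on_def)
  finally show ?thesis .
qed

lemma sum_powr_summable:
  assumes "e < -1" shows "\<exists>C>0. \<forall>n. (\<Sum>j\<le>n. (1 + real j) powr e) <= C"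
proof -
  have "summable (\<lambda>n. real n powr e)" using assms by (simp add: summable_real_powr_iff)
  then have s: "summable (\<lambda>n. (1 + real n) powr e)"
    by (subst (asm) summable_Suc_iff[symmetric]) (simp add: add.commute)
  have "(\<Sum>j\<le>n. (1 + real j) powr e) <= (\<Sum>j. (1 + real j) powr e)" for n
    by (rule sum_le_suminf[OF s]) auto
  then show ?thesis
    by (intro exI[of _ "max 1 (\<Sum>j. (1 + real j) powr e)"]) (auto simp: le_max_iff_disj)
qed

text \<open>The increment of x^(1+e) from x to x + 1 is (1 + e) z^e with z below x + 1, hence at
  least (1 + e) (x + 1)^e as e <= 0; these inequalities telescope.\<close>

lemma sum_powr_growth:
  assumes e: "-1 < e" "e <= 0" shows "(\<Sum>j\<le>n. (1 + real j) powr e) <= (1 + real n) powr (1 + e) / (1 + e)"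
proof (induction n)
  case 0
  then show ?case using e by (simp add: field_simps)
next
  case (Suc n)
  let ?x = "1 + real n"
  have "\<exists>z>?x. z < ?x + 1 \<and> (?x + 1) powr (1 + e) - ?x powr (1 + e) = (?x + 1 - ?x) * ((1 + e) * z powr e)"
  proof (rule MVT2)
    fix y assume "?x <= y" "y <= ?x + 1"
    then show "((\<lambda>y. y powr (1 + e)) has_real_derivative (1 + e) * y powr e) (at y)"
      using has_real_derivative_powr[of y "1 + e"] by simp
  qed simp
  then obtain z where z: "?x < z" "z < ?x + 1" "(?x + 1) powr (1 + e) - ?x powr (1 + e) = (1 + e) * z powr e" by auto
  have "(1 + real (Suc n)) powr e <= z powr e"
    using z(1,2) e by (intro powr_mono2') auto
  then have "(1 + e) * (1 + real (Suc n)) powr e <= (1 + e) * z powr e"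
    using e by (intro mult_left_mono) auto
  then have "(1 + e) * (1 + real (Suc n)) powr e <= (1 + real (Suc n)) powr (1 + e) - ?x powr (1 + e)"
    using z(3) by (simp add: add.commute add.left_commute)
  then have "(1 + real (Suc n)) powr e <= ((1 + real (Suc n)) powr (1 + e) - ?x powr (1 + e)) / (1 + e)"
    using e by (simp add: pos_le_divide_eq mult.commute)
  with Suc.IH show ?case by (simp add: diff_divide_distrib)
qed

text \<open>For a <= 0 the power is split evenly over the d coordinates, each of which is dominated
  by the bracket. The product form lets lattice sums factor into one-dimensional ones with exponent
  a / d.\<close>

lemma jbracket_powr_le_prod:
  fixes l :: "'a::euclidean_space"
  assumes l: "l \<in> int_lattice" and a: "a <= 0"
  shows "jbracket l powr a <= 2 powr (- a) * (\<Prod>b\<in>Basis. (1 + real (nat \<bar>\<lfloor>l \<bullet> b\<rfloor>\<bar>)) powr (a / DIM('a)))"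
proof -
  let ?e = "a / DIM('a)"
  have "jbracket l powr a = (\<Prod>b\<in>(Basis::'a set). jbracket l powr ?e)"
    using powr_realpow[of "jbracket l powr ?e" "DIM('a)"] jbracket_pos[of l] by (simp add: powr_powr)
  also have "... <= (\<Prod>b\<in>(Basis::'a set). 2 powr (- ?e) * (1 + real (nat \<bar>\<lfloor>l \<bullet> b\<rfloor>\<bar>)) powr ?e)"
  proof (intro prod_mono conjI powr_ge_zero)
    fix b :: 'a assume b: "b \<in> Basis"
    have "of_int \<lfloor>l \<bullet> b\<rfloor> = l \<bullet> b" using l b unfolding int_lattice_def by auto
    then have "real (nat \<bar>\<lfloor>l \<bullet> b\<rfloor>\<bar>) = \<bar>l \<bullet> b\<bar>" by (metis of_int_abs of_nat_nat abs_ge_zero)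
    then have le: "(1 + real (nat \<bar>\<lfloor>l \<bullet> b\<rfloor>\<bar>)) / 2 <= jbracket l"
      using jbracket_ge[of l] Basis_le_norm[OF b, of l] by simp
    have "jbracket l powr ?e <= ((1 + real (nat \<bar>\<lfloor>l \<bullet> b\<rfloor>\<bar>)) / 2) powr ?e"
      using le a by (intro powr_mono2') (auto simp: divide_nonpos_pos)
    also have "... = 2 powr (- ?e) * (1 + real (nat \<bar>\<lfloor>l \<bullet> b\<rfloor>\<bar>)) powr ?e"
      by (subst powr_divide) (simp_all add: powr_minus_divide)
    finally show "jbracket l powr ?e <= 2 powr (- ?e) * (1 + real (nat \<bar>\<lfloor>l \<bullet> b\<rfloor>\<bar>)) powr ?e" .
  qed
  also have "... = 2 powr (- a) * (\<Prod>b\<in>Basis. (1 + real (nat \<bar>\<lfloor>l \<bullet> b\<rfloor>\<bar>)) powr ?e)"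
  proof -
    have "(2 powr (- ?e)) ^ DIM('a) = 2 powr (- a)"
      by (simp add: powr_realpow[symmetric] powr_powr)
    then show ?thesis by (simp add: prod.distrib)
  qed
  finally show ?thesis .
qed

lemma int_lattice_box:
  fixes F :: "'a::euclidean_space set"
  assumes "\<And>l. l \<in> F ==> l \<in> int_lattice \<and> norm l <= real n"
  shows "F \<subseteq> {l. l \<in> int_lattice \<and> (\<forall>b\<in>Basis. \<lfloor>l \<bullet> b\<rfloor> \<in> {- int n..int n})}" (is "_ \<subseteq> ?B")
    and "finite {l::'a. l \<in> int_lattice \<and> (\<forall>b\<in>Basis. \<lfloor>l \<bullet> b\<rfloor> \<in> {- int n..int n})}"
proof
  fix l assume l: "l \<in> F"
  have "\<lfloor>l \<bullet> b\<rfloor> \<in> {- int n..int n}" if "b \<in> Basis" for b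
  proof -
    have "\<bar>l \<bullet> b\<bar> <= real n" using Basis_le_norm[OF that, of l] assms[OF l] by linarith
    then show ?thesis by (auto simp: le_floor_iff floor_le_iff)
  qed
  with assms[OF l] show "l \<in> ?B" by blast
next
  show "finite ?B" using bij_betw_finite[OF int_lattice_bij[of "{- int n..int n}", where 'a='a]] by (simp add: finite_PiE)
qed

lemma lattice_sum_nonpos:
  fixes F :: "'a::euclidean_space set"
  assumes F: "\<And>l. l \<in> F ==> l \<in> int_lattice \<and> norm l <= real n" and a: "a <= 0"
  shows "(\<Sum>l\<in>F. jbracket l powr a) <= 2 powr (- a) * (2 * (\<Sum>j\<le>n. (1 + real j) powr (a / DIM('a)))) ^ DIM('a)"
proof -
  let ?B = "{l::'a. l \<in> int_lattice \<and> (\<forall>b\<in>Basis. \<lfloor>l \<bullet> b\<rfloor> \<in> {- int n..int n})}"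
  have "(\<Sum>l\<in>F. jbracket l powr a) <= (\<Sum>l\<in>?B. jbracket l powr a)"
    by (rule sum_mono2[OF int_lattice_box(2)[OF F] int_lattice_box(1)[OF F]]) auto
  also have "... <= (\<Sum>l\<in>?B. 2 powr (- a) * (\<Prod>b\<in>Basis. (1 + real (nat \<bar>\<lfloor>l \<bullet> b\<rfloor>\<bar>)) powr (a / DIM('a))))"
    by (intro sum_mono jbracket_powr_le_prod a) auto
  also have "... = 2 powr (- a) * (\<Sum>t\<in>{- int n..int n}. (1 + real (nat \<bar>t\<bar>)) powr (a / DIM('a))) ^ DIM('a)"
    unfolding sum_distrib_left[symmetric]
    by (subst int_lattice_sum_prod[of "{- int n..int n}" "\<lambda>t. (1 + real (nat \<bar>t\<bar>)) powr (a / DIM('a))"]) auto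
  also have "... <= 2 powr (- a) * (2 * (\<Sum>j\<le>n. (1 + real j) powr (a / DIM('a)))) ^ DIM('a)"
    by (intro mult_left_mono power_mono sum_int_interval[of "\<lambda>j. (1 + real j) powr (a / DIM('a))"]) (auto intro!: sum_nonneg)
  finally show ?thesis .
qed

lemma lattice_sum_summable:
  assumes a: "a < - real DIM('a::euclidean_space)"
  shows "\<exists>C>0. \<forall>F::'a set. finite F --> F \<subseteq> int_lattice --> (\<Sum>l\<in>F. jbracket l powr a) <= C"
proof -
  have "a / real DIM('a) < -1" using a by (simp add: divide_less_eq)
  from sum_powr_summable[OF this] obtain C where C: "C > 0" "\<And>n. (\<Sum>j\<le>n. (1 + real j) powr (a / real DIM('a))) <= C" by blast
  have "(\<Sum>l\<in>F. jbracket l powr a) <= 2 powr (- a) * (2 * C) ^ DIM('a)" if F: "finite F" "F \<subseteq> int_lattice" for F :: "'a set"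
  proof -
    obtain n :: nat where n: "(\<Sum>l\<in>F. norm l) <= real n" using real_arch_simple by blast
    have "norm l <= real n" if "l \<in> F" for l
      using member_le_sum[OF that, of norm] F(1) n by auto
    then have "(\<Sum>l\<in>F. jbracket l powr a) <= 2 powr (- a) * (2 * (\<Sum>j\<le>n. (1 + real j) powr (a / DIM('a)))) ^ DIM('a)"
      using F(2) a by (intro lattice_sum_nonpos) (auto intro: order.trans[of _ "- real DIM('a)"])
    also have "... <= 2 powr (- a) * (2 * C) ^ DIM('a)"
      using C by (intro mult_left_mono power_mono) (auto intro!: sum_nonneg)
    finally show ?thesis .
  qed
  moreover have "2 powr (- a) * (2 * C) ^ DIM('a) > 0" using C by simp
  ultimately show ?thesis by blast
qed

text \<open>Translate the ball to the origin and count with the lattice sum of exponent 0.\<close>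

lemma lattice_card_ball:
  fixes l0 :: "'a::euclidean_space"
  assumes "l0 \<in> int_lattice" "X >= 0"
  shows "finite {l\<in>int_lattice. norm (l - l0) <= X}"
    and "real (card {l\<in>int_lattice. norm (l - l0) <= X}) <= (2 * (X + 2)) ^ DIM('a)"
proof -
  define n where "n = nat \<lceil>X\<rceil>"
  have n: "X <= real n" "real n <= X + 1" using assms(2) unfolding n_def by linarith+
  let ?S = "{l\<in>int_lattice. norm (l - l0) <= X}"
  let ?F = "(\<lambda>l. l - l0) ` ?S"
  have F: "l \<in> int_lattice \<and> norm l <= real n" if "l \<in> ?F" for l
    using that n assms(1) by (auto intro: int_lattice_diff)
  have inj: "inj_on (\<lambda>l. l - l0) ?S" by (auto simp: inj_on_def)
  have "finite ?F" using finite_subset[OF int_lattice_box(1)[OF F] int_lattice_box(2)[OF F]] by blast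
  then show "finite ?S" using finite_imageD inj by blast
  have "real (card ?S) = (\<Sum>l\<in>?F. jbracket l powr 0)"
  proof -
    have "jbracket l powr 0 = 1" for l :: 'a using jbracket_pos[of l] by simp
    then show ?thesis by (simp add: card_image[OF inj])
  qed
  also have "... <= (2 * (\<Sum>j\<le>n. (1 + real j) powr 0)) ^ DIM('a)"
    using lattice_sum_nonpos[OF F, where a=0] by simp
  also have "... = (2 * (real n + 1)) ^ DIM('a)"
    by (simp add: add_nonneg_eq_0_iff add.commute)
  also have "... <= (2 * (X + 2)) ^ DIM('a)"
    using n by (intro power_mono) auto
  finally show "real (card ?S) <= (2 * (X + 2)) ^ DIM('a)" .
qed

text \<open>For a <= 0 the one-dimensional sums with exponent a / d > -1 are multiplied. For a > 0
  the number of points times the largest term already has the right order.\<close>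

lemma lattice_sum_growth:
  assumes a: "- real DIM('a::euclidean_space) < a"
  shows "\<exists>C>0. \<forall>X\<ge>1. (\<Sum>l\<in>{l::'a. l \<in> int_lattice \<and> norm l <= X}. jbracket l powr a) <= C * X powr (a + real DIM('a))"
proof (cases "a <= 0")
  case True
  let ?d = "real DIM('a)"
  let ?e = "a / ?d"
  have d: "?d > 0" by simp
  have e: "-1 < ?e" "?e <= 0" using a True by (simp_all add: less_divide_eq divide_nonpos_pos)
  define C where "C = 2 powr (- a) * (2 * (3 powr (1 + ?e) / (1 + ?e))) ^ DIM('a)"
  have C: "C > 0" unfolding C_def using e by simp
  have "(\<Sum>l\<in>{l::'a. l \<in> int_lattice \<and> norm l <= X}. jbracket l powr a) <= C * X powr (a + ?d)" if X: "X >= 1" for X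
  proof -
    define n where "n = nat \<lceil>X\<rceil>"
    have n: "X <= real n" "real n <= X + 1" using X unfolding n_def by linarith+
    have "(\<Sum>l\<in>{l::'a. l \<in> int_lattice \<and> norm l <= X}. jbracket l powr a)
       <= 2 powr (- a) * (2 * (\<Sum>j\<le>n. (1 + real j) powr ?e)) ^ DIM('a)"
      using n True by (intro lattice_sum_nonpos) auto
    also have "... <= 2 powr (- a) * (2 * ((3 * X) powr (1 + ?e) / (1 + ?e))) ^ DIM('a)"
    proof (intro mult_left_mono power_mono)
      have "(\<Sum>j\<le>n. (1 + real j) powr ?e) <= (1 + real n) powr (1 + ?e) / (1 + ?e)" by (rule sum_powr_growth[OF e])
      also have "... <= (3 * X) powr (1 + ?e) / (1 + ?e)"
        using n X e by (intro divide_right_mono powr_mono2) auto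
      finally show "(\<Sum>j\<le>n. (1 + real j) powr ?e) <= (3 * X) powr (1 + ?e) / (1 + ?e)" .
    qed (auto intro!: sum_nonneg)
    also have "... = C * (X powr (1 + ?e)) ^ DIM('a)"
      using X unfolding C_def by (simp add: powr_mult power_mult_distrib power_divide field_simps)
    also have "(X powr (1 + ?e)) ^ DIM('a) = X powr (a + ?d)"
    proof -
      have "(X powr (1 + ?e)) ^ DIM('a) = X powr ((1 + ?e) * ?d)"
        using X by (simp add: powr_realpow[symmetric] powr_powr)
      also have "(1 + ?e) * ?d = a + ?d" by (simp add: distrib_right)
      finally show ?thesis .
    qed
    finally show ?thesis .
  qed
  with C show ?thesis by blast
next
  case False
  let ?d = "real DIM('a)"
  have "(\<Sum>l\<in>{l::'a. l \<in> int_lattice \<and> norm l <= X}. jbracket l powr a) <= (2 powr a * 6 ^ DIM('a)) * X powr (a + ?d)" if X: "X >= 1" for X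
  proof -
    let ?S = "{l::'a. l \<in> int_lattice \<and> norm l <= X}"
    have "(\<Sum>l\<in>?S. jbracket l powr a) <= (\<Sum>l\<in>?S. (2 * X) powr a)"
    proof (intro sum_mono powr_mono2)
      fix l assume "l \<in> ?S"
      then show "jbracket l <= 2 * X" using jbracket_le[of l] X by auto
    qed (use False jbracket_pos less_imp_le in auto)
    also have "... = real (card ?S) * (2 * X) powr a" by simp
    also have "... <= (2 * (X + 2)) ^ DIM('a) * (2 * X) powr a"
      using lattice_card_ball(2)[OF int_lattice_0, of X, where 'a='a] X by (intro mult_right_mono) auto
    also have "... <= (6 * X) ^ DIM('a) * (2 * X) powr a"
      using X by (intro mult_right_mono power_mono) auto
    also have "... = (2 powr a * 6 ^ DIM('a)) * X powr (a + ?d)"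
      using X by (simp add: powr_mult power_mult_distrib powr_add powr_realpow mult_ac)
    finally show ?thesis .
  qed
  moreover have "2 powr a * 6 ^ DIM('a) > (0::real)" by simp
  ultimately show ?thesis by blast
qed

section \<open>Frequency cubes meeting a projected cube\<close>

context alpha_covering
begin

lemma beta_identities: "1 + \<beta> = 1 / (1 - \<alpha>)" "\<beta> * (1 - \<alpha>) = \<alpha>" "(1 + \<beta>) * (1 - \<alpha>) = 1" "\<alpha> * (1 + \<beta>) = \<beta>"
  using \<alpha> by (auto simp: field_simps)

lemma norm_center: "norm (center l) = norm l powr (1 + \<beta>)"
  unfolding alpha_center_def by (cases "l = 0") (auto simp: powr_add)

text \<open>Meant for K the bracket of k and v the projected center of its cube: up to the constant
  C, all l whose cube can meet the projection. K and v are kept separate because the counting only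
  uses the size relation between them.\<close>

definition touching :: "real => real => 'a::euclidean_space => 'a set" where
  "touching C K v = {l\<in>int_lattice. norm (center l - v) <= C * (K powr \<beta> + jbracket l powr \<beta>)}"

text \<open>If l is larger than K, its radius is of order \<open>jbracket l powr \<beta>\<close>
  while its center is farther out by one power of the bracket. The center can then lie near v only
  if that extra power is at most of order K.\<close>

lemma touching_bound:
  fixes v :: "'a::euclidean_space"
  assumes C: "C >= 0" and K: "K >= 1" and v: "norm v <= K powr (1 + \<beta>)" and l: "l \<in> touching C K v"
  shows "jbracket l <= 2 powr (1 + \<beta>) * (1 + 2 * C) * K"
proof -
  have b: "1 <= 2 powr (1 + \<beta>)" using \<beta>_nonneg by (intro ge_one_powr_ge_zero) auto
  have one: "1 <= 2 powr (1 + \<beta>) * (1 + 2 * C)" using mult_mono[OF b, of 1 "1 + 2 * C"] C by simp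
  define L where "L = jbracket l"
  have L: "L >= 1" unfolding L_def by (rule jbracket_ge)
  show ?thesis
  proof (cases "L <= K \<or> l = 0")
    case True
    then have "L <= K" using K unfolding L_def jbracket_def by auto
    also have "... <= 2 powr (1 + \<beta>) * (1 + 2 * C) * K" using mult_right_mono[OF one, of K] K by simp
    finally show ?thesis unfolding L_def .
  next
    case False
    then have LK: "K <= L" by simp
    have li: "l \<in> int_lattice" using l unfolding touching_def by blast
    have KL: "K powr \<beta> <= L powr \<beta>" using LK K \<beta>_nonneg by (intro powr_mono2) auto
    have "norm (center l) <= norm v + norm (center l - v)" by (rule norm_triangle_sub)
    also have "... <= K powr (1 + \<beta>) + C * (K powr \<beta> + L powr \<beta>)"
      using v l unfolding touching_def L_def by simp
    also have "... <= K * L powr \<beta> + C * (2 * L powr \<beta>)"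
      using KL K C by (intro add_mono mult_left_mono) (auto simp: powr_add)
    also have "... <= K * L powr \<beta> + (C * 2) * (K * L powr \<beta>)"
      using K C mult_right_mono[OF K, of "L powr \<beta>"] by (auto intro!: add_left_mono mult_left_mono)
    finally have n: "norm l powr (1 + \<beta>) <= (1 + 2 * C) * K * L powr \<beta>"
      unfolding norm_center by (simp add: algebra_simps)
    have "L powr (1 + \<beta>) <= (2 * norm l) powr (1 + \<beta>)"
      unfolding L_def using False jbracket_le_norm[OF li] jbracket_pos[of l] \<beta>_nonneg by (intro powr_mono2) auto
    also have "... = 2 powr (1 + \<beta>) * norm l powr (1 + \<beta>)" by (simp add: powr_mult)
    also have "... <= 2 powr (1 + \<beta>) * ((1 + 2 * C) * K * L powr \<beta>)" using n by (intro mult_left_mono) auto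
    finally have "L powr \<beta> * L <= L powr \<beta> * (2 powr (1 + \<beta>) * (1 + 2 * C) * K)"
      using L by (simp add: powr_add mult_ac)
    then show ?thesis using L unfolding L_def[symmetric] by (simp add: mult_le_cancel_left_pos)
  qed
qed

lemma touching_finite:
  fixes v :: "'a::euclidean_space"
  assumes "C >= 0" "K >= 1" "norm v <= K powr (1 + \<beta>)"
  shows "finite (touching C K v)"
proof (rule finite_subset[OF _ int_lattice_finite_ball])
  show "touching C K v \<subseteq> {l. l \<in> int_lattice \<and> norm l <= 2 powr (1 + \<beta>) * (1 + 2 * C) * K}"
    using touching_bound[OF assms] jbracket_ge(2) order_trans unfolding touching_def by blast
qed

lemma powr_ratio_bound:
  fixes t a :: real
  assumes "1 / 4 <= t" "t <= 4" shows "t powr a <= 4 powr \<bar>a\<bar>"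
proof (cases "a >= 0")
  case True
  then show ?thesis using assms by (auto intro: powr_mono2)
next
  case False
  then have "t powr a <= (1 / 4) powr a" using assms by (intro powr_mono2') auto
  also have "1 / 4 = (4 :: real) powr (-1)" by (simp only: powr_neg_one)
  also have "(4 powr (-1)) powr a = 4 powr \<bar>a\<bar>" using False by (simp only: powr_powr abs_of_neg not_le) simp
  finally show ?thesis .
qed

text \<open>
  If \<open>v\<close> has at most the size of the cube, the sum extends over \<open>norm l \<lesssim> K\<^bsup>\<alpha>\<^esup>\<close>; otherwise all \<open>norm l\<close> are
  comparable to \<open>norm v\<^bsup>1-\<alpha>\<^esup>\<close>.
\<close>

lemma touching_sum:
  assumes C: "C >= 0" and a: "- real DIM('a::euclidean_space) < a" "a < \<beta> * real DIM('a)"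
  shows "\<exists>B>0. \<forall>K\<ge>1. \<forall>v::'a. norm v <= K powr (1 + \<beta>) -->
    (\<Sum>l\<in>touching C K v. jbracket l powr a) <= B * K powr (\<alpha> * (a + real DIM('a)))"
proof -
  let ?d = "real DIM('a)"
  define A where "A = 2 powr (1 + \<beta>) * (1 + 2 * C)"
  have A: "A > 0" unfolding A_def using C by simp
  \<comment> \<open>By \<open>touching_bound\<close> the bracket of l is at most A K, so the
    distance from the center of l to v is at most D times \<open>K powr \<beta>\<close>; the summand
    1 keeps D at least 1.\<close>
  define D where "D = 1 + C * (1 + A powr \<beta>)"
  have D: "D >= 1" unfolding D_def using C by simp
  obtain G where G: "G > 0" "\<And>X. X >= 1 ==> (\<Sum>l\<in>{l::'a. l \<in> int_lattice \<and> norm l <= X}. jbracket l powr a) <= G * X powr (a + ?d)"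
    using lattice_sum_growth[OF a(1)] by blast
  define B1 where "B1 = G * ((3 * D) powr (1 - \<alpha>)) powr (a + ?d)"
  define B2 where "B2 = 4 powr \<bar>a\<bar> * (2 * (4 * D + 2)) ^ DIM('a)"
  have B: "B1 > 0" "B2 > 0" unfolding B1_def B2_def using G D by auto
  have ad: "a + ?d > 0" using a(1) by simp
  have "(\<Sum>l\<in>touching C K v. jbracket l powr a) <= (B1 + B2) * K powr (\<alpha> * (a + ?d))"
    if K: "K >= 1" and v: "norm v <= K powr (1 + \<beta>)" for K and v :: 'a
  proof -
    have near: "norm (center l - v) <= D * K powr \<beta>" if l: "l \<in> touching C K v" for l
    proof -
      have "jbracket l powr \<beta> <= (A * K) powr \<beta>"
        using touching_bound[OF C K v l] jbracket_pos[of l] \<beta>_nonneg unfolding A_def by (intro powr_mono2) auto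
      also have "... = A powr \<beta> * K powr \<beta>" using A K by (simp add: powr_mult)
      finally have "K powr \<beta> + jbracket l powr \<beta> <= (1 + A powr \<beta>) * K powr \<beta>" by (simp add: distrib_right)
      then have "C * (K powr \<beta> + jbracket l powr \<beta>) <= C * ((1 + A powr \<beta>) * K powr \<beta>)"
        using C by (rule mult_left_mono)
      also have "... <= D * K powr \<beta>" unfolding D_def by (simp add: distrib_right mult.assoc)
      finally show ?thesis using l unfolding touching_def by simp
    qed
    have Kb: "K powr \<beta> >= 1" using K \<beta>_nonneg by (intro ge_one_powr_ge_zero) auto
    have Kpos: "K powr (\<alpha> * (a + ?d)) >= 0" by simp
    show ?thesis
    proof (cases "norm v <= 2 * D * K powr \<beta>")
      case True
      \<comment> \<open>The center of l has norm |l|^(1+\<beta>), here at most 3 D K^\<beta>.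
        Raising to the power 1 - \<alpha> = 1/(1+\<beta>) gives the radius X for l.\<close>
      define X where "X = (3 * D) powr (1 - \<alpha>) * K powr \<alpha>"
      have X: "X >= 1"
        unfolding X_def using D K \<alpha> mult_mono[of 1 "(3 * D) powr (1 - \<alpha>)" 1 "K powr \<alpha>"]
        by (simp add: ge_one_powr_ge_zero)
      have "touching C K v \<subseteq> {l::'a. l \<in> int_lattice \<and> norm l <= X}"
      proof
        fix l assume l: "l \<in> touching C K v"
        have "norm (center l) <= norm v + norm (center l - v)" by (rule norm_triangle_sub)
        also have "... <= 3 * D * K powr \<beta>" using True near[OF l] by simp
        finally have "norm l powr (1 + \<beta>) <= 3 * D * K powr \<beta>" unfolding norm_center .
        then have "(norm l powr (1 + \<beta>)) powr (1 - \<alpha>) <= (3 * D * K powr \<beta>) powr (1 - \<alpha>)"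
          using \<alpha> by (intro powr_mono2) auto
        then have "norm l <= X"
        proof -
          have "(3 * D * K powr \<beta>) powr (1 - \<alpha>) = (3 * D) powr (1 - \<alpha>) * (K powr \<beta>) powr (1 - \<alpha>)"
            using D K by (simp add: powr_mult)
          also have "... = X" unfolding X_def powr_powr beta_identities(2) ..
          finally show ?thesis
            using \<open>(norm l powr (1 + \<beta>)) powr (1 - \<alpha>) <= _\<close> unfolding powr_powr beta_identities(3) by simp
        qed
        then show "l \<in> {l::'a. l \<in> int_lattice \<and> norm l <= X}" using l unfolding touching_def by simp
      qed
      then have "(\<Sum>l\<in>touching C K v. jbracket l powr a) <= (\<Sum>l\<in>{l::'a. l \<in> int_lattice \<and> norm l <= X}. jbracket l powr a)"
        by (intro sum_mono2 int_lattice_finite_ball) auto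
      also have "... <= G * X powr (a + ?d)" by (rule G(2)[OF X])
      also have "... = B1 * K powr (\<alpha> * (a + ?d))"
        unfolding X_def B1_def using D K by (simp add: powr_mult powr_powr)
      also have "... <= (B1 + B2) * K powr (\<alpha> * (a + ?d))"
        using B Kpos by (intro mult_right_mono) auto
      finally show ?thesis .
    next
      case False
      define V where "V = norm v"
      have V: "V > 2 * D * K powr \<beta>" using False unfolding V_def by simp
      have DK: "D * K powr \<beta> >= 1" using mult_mono[of 1 D 1 "K powr \<beta>"] D Kb by simp
      have V0: "V > 0" "V >= 1" using V DK by auto
      have l_size: "V / 2 <= norm l powr (1 + \<beta>)" "norm l powr (1 + \<beta>) <= 2 * V" if l: "l \<in> touching C K v" for l
      proof -
        have "norm v <= norm (center l) + norm (center l - v)"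
          using norm_triangle_sub[of v "center l"] by (simp add: norm_minus_commute)
        then show "V / 2 <= norm l powr (1 + \<beta>)" using near[OF l] V unfolding norm_center V_def by simp
        have "norm (center l) <= norm v + norm (center l - v)" by (rule norm_triangle_sub)
        then show "norm l powr (1 + \<beta>) <= 2 * V" using near[OF l] V V0 unfolding norm_center V_def by simp
      qed
      have l_norm: "(1 / 2) * V powr (1 - \<alpha>) <= norm l" "norm l <= 2 * V powr (1 - \<alpha>)" if l: "l \<in> touching C K v" for l
      proof -
        have id: "(norm l powr (1 + \<beta>)) powr (1 - \<alpha>) = norm l" by (simp only: powr_powr beta_identities(3)) simp
        have h: "(1 / 2) powr 1 <= (1 / 2 :: real) powr (1 - \<alpha>)" using \<alpha> by (intro powr_mono') auto
        have "(V / 2) powr (1 - \<alpha>) <= (norm l powr (1 + \<beta>)) powr (1 - \<alpha>)"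
          using l_size[OF l] V0 \<alpha> by (intro powr_mono2) auto
        moreover have "(V / 2) powr (1 - \<alpha>) = (1 / 2) powr (1 - \<alpha>) * V powr (1 - \<alpha>)"
          using V0 by (simp add: powr_divide)
        ultimately show "(1 / 2) * V powr (1 - \<alpha>) <= norm l"
          unfolding id using h mult_right_mono[OF h, of "V powr (1 - \<alpha>)"] by simp
        have t: "(2::real) powr (1 - \<alpha>) <= 2 powr 1" using \<alpha> by (intro powr_mono) auto
        have "(norm l powr (1 + \<beta>)) powr (1 - \<alpha>) <= (2 * V) powr (1 - \<alpha>)"
          using l_size[OF l] V0 \<alpha> by (intro powr_mono2) auto
        also have "... = 2 powr (1 - \<alpha>) * V powr (1 - \<alpha>)" using V0 by (simp add: powr_mult)
        also have "... <= 2 * V powr (1 - \<alpha>)" using mult_right_mono[OF t, of "V powr (1 - \<alpha>)"] by simp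
        finally show "norm l <= 2 * V powr (1 - \<alpha>)" unfolding id .
      qed
      have weight: "jbracket l powr a <= 4 powr \<bar>a\<bar> * V powr ((1 - \<alpha>) * a)" if l: "l \<in> touching C K v" for l
      proof -
        have Vp: "V powr (1 - \<alpha>) > 0" using V0 by simp
        have "l ~= 0" using l_norm(1)[OF l] Vp by auto
        then have "jbracket l <= 4 * V powr (1 - \<alpha>)"
          using jbracket_le_norm[of l] l l_norm(2)[OF l] unfolding touching_def by auto
        moreover have "V powr (1 - \<alpha>) / 4 <= jbracket l" using l_norm(1)[OF l] jbracket_ge(2)[of l] jbracket_pos[of l] by simp
        ultimately have "(jbracket l / V powr (1 - \<alpha>)) powr a <= 4 powr \<bar>a\<bar>"
          using Vp by (intro powr_ratio_bound) (auto simp: field_simps)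
        then have "jbracket l powr a / (V powr (1 - \<alpha>)) powr a <= 4 powr \<bar>a\<bar>"
          using jbracket_pos[of l] by (simp add: powr_divide)
        then show ?thesis using Vp by (simp add: powr_powr pos_divide_le_eq)
      qed
      \<comment> \<open>Ratio of the size K^\<beta> of the projected cube to the spacing of the
        centers near v, which is |l|^\<beta>, of order V^\<alpha>. About Y^d indices l fit
        in.\<close>
      define Y where "Y = K powr \<beta> / V powr \<alpha>"
      have Y: "Y >= 1"
      proof -
        have "V powr \<alpha> <= (K powr (1 + \<beta>)) powr \<alpha>" using v V0 \<alpha> unfolding V_def by (intro powr_mono2) auto
        also have "... = K powr \<beta>" by (simp only: powr_powr mult.commute[of _ \<alpha>] beta_identities(4))
        finally show ?thesis unfolding Y_def using V0 by simp
      qed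
      have card: "real (card (touching C K v)) <= ((2 * (4 * D + 2)) * Y) ^ DIM('a)"
      proof (cases "touching C K v = {}")
        case True
        then show ?thesis using D Y by (simp add: zero_power)
      next
        case ne: False
        then obtain l0 where l0: "l0 \<in> touching C K v" by blast
        then have l0i: "l0 \<in> int_lattice" unfolding touching_def by blast
        have "norm (l - l0) <= 4 * D * Y" if l: "l \<in> touching C K v" for l
        proof -
          have low: "(1 / 2) * V powr \<alpha> <= norm l powr \<beta>" if l: "l \<in> touching C K v" for l
          proof -
            have "(V / 2) powr \<alpha> <= (norm l powr (1 + \<beta>)) powr \<alpha>"
              using l_size[OF l] V0 \<alpha> by (intro powr_mono2) auto
            also have "... = norm l powr \<beta>" by (simp only: powr_powr mult.commute[of _ \<alpha>] beta_identities(4))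
            finally have 1: "(1 / 2) powr \<alpha> * V powr \<alpha> <= norm l powr \<beta>" using V0 by (simp add: powr_divide)
            have h: "(1 / 2) powr 1 <= (1 / 2 :: real) powr \<alpha>" using \<alpha> by (intro powr_mono') auto
            from mult_right_mono[OF h, of "V powr \<alpha>"] 1 show ?thesis by simp
          qed
          have "(norm l powr \<beta> + norm l0 powr \<beta>) / 2 * norm (l - l0) <= norm (center l - center l0)"
            unfolding alpha_center_def by (rule center_separation[OF \<beta>_nonneg])
          also have "... <= 2 * D * K powr \<beta>"
            using norm_triangle_ineq4[of "center l - v" "center l0 - v"] near[OF l] near[OF l0] by simp
          finally have up: "(norm l powr \<beta> + norm l0 powr \<beta>) / 2 * norm (l - l0) <= 2 * D * K powr \<beta>" .
          have "(1 / 2) * V powr \<alpha> * norm (l - l0) <= (norm l powr \<beta> + norm l0 powr \<beta>) / 2 * norm (l - l0)"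
            using low[OF l] low[OF l0] by (intro mult_right_mono) auto
          with up have "V powr \<alpha> * norm (l - l0) <= 4 * D * K powr \<beta>" by simp
          then show ?thesis unfolding Y_def using V0 by (simp add: field_simps)
        qed
        then have "touching C K v \<subseteq> {l\<in>int_lattice. norm (l - l0) <= 4 * D * Y}" unfolding touching_def by blast
        then have "real (card (touching C K v)) <= real (card {l\<in>int_lattice. norm (l - l0) <= 4 * D * Y})"
          using D Y by (intro of_nat_mono card_mono lattice_card_ball(1)[OF l0i]) auto
        also have "... <= (2 * (4 * D * Y + 2)) ^ DIM('a)"
          using D Y by (intro lattice_card_ball(2)[OF l0i]) auto
        also have "... <= ((2 * (4 * D + 2)) * Y) ^ DIM('a)"
          using D Y by (intro power_mono) (auto simp: algebra_simps)
        finally show ?thesis .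
      qed
      have "(\<Sum>l\<in>touching C K v. jbracket l powr a) <= (\<Sum>l\<in>touching C K v. 4 powr \<bar>a\<bar> * V powr ((1 - \<alpha>) * a))"
        by (intro sum_mono weight)
      also have "... = real (card (touching C K v)) * (4 powr \<bar>a\<bar> * V powr ((1 - \<alpha>) * a))" by simp
      also have "... <= ((2 * (4 * D + 2)) * Y) ^ DIM('a) * (4 powr \<bar>a\<bar> * V powr ((1 - \<alpha>) * a))"
        using card by (intro mult_right_mono) auto
      also have "... = B2 * (Y ^ DIM('a) * V powr ((1 - \<alpha>) * a))"
        unfolding B2_def by (simp add: power_mult_distrib mult_ac)
      also have "Y ^ DIM('a) * V powr ((1 - \<alpha>) * a) = K powr (\<beta> * ?d) * V powr ((1 - \<alpha>) * a - \<alpha> * ?d)"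
      proof -
        have "Y ^ DIM('a) = K powr (\<beta> * ?d) / V powr (\<alpha> * ?d)"
          unfolding Y_def power_divide using K V0 by (simp add: powr_realpow[symmetric] powr_powr)
        then show ?thesis by (simp add: powr_diff)
      qed
      \<comment> \<open>This is where a < \<beta> d enters, the upper bound imposed on s: the
        exponent of V is then at most 0, so the worst position is the smallest V, of order
        K^\<beta>.\<close>
      also have "B2 * (K powr (\<beta> * ?d) * V powr ((1 - \<alpha>) * a - \<alpha> * ?d))
         <= B2 * (K powr (\<beta> * ?d) * (K powr \<beta>) powr ((1 - \<alpha>) * a - \<alpha> * ?d))"
      proof (intro mult_left_mono powr_mono2')
        have "(1 - \<alpha>) * a <= (1 - \<alpha>) * (\<beta> * ?d)" using a(2) \<alpha> by (intro mult_left_mono) auto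
        also have "... = \<alpha> * ?d" using beta_identities(2) by (metis mult.commute mult.assoc)
        finally show "(1 - \<alpha>) * a - \<alpha> * ?d <= 0" by simp
        have "1 * K powr \<beta> <= (2 * D) * K powr \<beta>" using D by (intro mult_right_mono) auto
        then show "K powr \<beta> <= V" using V by simp
        show "0 < K powr \<beta>" using K by simp
      qed (use B in auto)
      also have "... = B2 * K powr (\<alpha> * (a + ?d))"
      proof -
        have "c * ?d + c * ((1 - \<alpha>) * a - \<alpha> * ?d) = (c * (1 - \<alpha>)) * (a + ?d)" for c
          by (simp add: algebra_simps)
        from this[of \<beta>] have "\<beta> * ?d + \<beta> * ((1 - \<alpha>) * a - \<alpha> * ?d) = (\<beta> * (1 - \<alpha>)) * (a + ?d)" .
        also have "... = \<alpha> * (a + ?d)" unfolding beta_identities(2) ..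
        finally show ?thesis by (simp only: powr_powr powr_add[symmetric])
      qed
      also have "... <= (B1 + B2) * K powr (\<alpha> * (a + ?d))"
        using B Kpos by (intro mult_right_mono) auto
      finally show ?thesis .
    qed
  qed
  moreover have "B1 + B2 > 0" using B by simp
  ultimately show ?thesis by blast
qed

end

section \<open>Mean value and trace inequalities for all exponents\<close>

section \<open>Powers of extended nonnegative reals\<close>

lemma ennreal_powr_ennreal: "x >= 0 ==> ennreal_powr (ennreal x) r = ennreal (x powr r)"
  by (simp add: ennreal_powr_def)

lemma ennreal_powr_top [simp]: "ennreal_powr \<infinity> r = \<infinity>" "ennreal_powr top r = top"
  by (simp_all add: ennreal_powr_def)

lemma ennreal_powr_0 [simp]: "ennreal_powr 0 r = 0"
  by (simp add: ennreal_powr_def)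

lemma ennreal_powr_mono: "x <= y ==> r >= 0 ==> ennreal_powr x r <= ennreal_powr y r"
  by (cases x; cases y) (auto simp: ennreal_powr_ennreal top_unique intro!: ennreal_leI powr_mono2)

lemma ennreal_powr_cmult:
  assumes "c > 0" shows "ennreal_powr (ennreal c * x) r = ennreal (c powr r) * ennreal_powr x r"
proof (cases x)
  case (real t)
  then show ?thesis using assms by (simp add: ennreal_mult[symmetric] ennreal_powr_ennreal powr_mult)
next
  case top
  then show ?thesis using assms by (simp add: ennreal_mult_top)
qed

lemma ennreal_powr_powr: "ennreal_powr (ennreal_powr x r) s = ennreal_powr x (r * s)"
  by (cases x) (auto simp: ennreal_powr_ennreal powr_powr)

lemma ennreal_powr_one [simp]: "ennreal_powr x 1 = x"
  by (cases x) (auto simp: ennreal_powr_ennreal)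

lemma ennreal_powr_less_top: "ennreal_powr x r < \<infinity> \<longleftrightarrow> x < \<infinity>"
  by (cases x) (auto simp: ennreal_powr_ennreal)

lemma ennreal_powr_measurable [measurable]:
  assumes "f \<in> borel_measurable M" shows "(\<lambda>x. ennreal_powr (f x) r) \<in> borel_measurable M"
proof -
  have "(\<lambda>y. enn2real y powr r) \<in> borel_measurable borel"
    by measurable
  then have "(\<lambda>y. ennreal_powr y r) \<in> borel_measurable borel"
    unfolding ennreal_powr_def by (intro measurable_If) simp_all
  from measurable_compose[OF assms this] show ?thesis .
qed

lemma power_split_le:
  fixes u L P :: real
  assumes "0 <= u" "0 < L" "1 <= P" shows "u <= L + L powr (1 - P) * u powr P"
proof (cases "u <= L")
  case False
  then have "u powr (1 - P) <= L powr (1 - P)" using assms by (intro powr_mono2') auto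
  then have "u powr (1 - P) * u powr P <= L powr (1 - P) * u powr P" by (rule mult_right_mono) simp
  moreover have "u powr (1 - P) * u powr P = u" using False assms by (simp add: powr_add[symmetric])
  ultimately show ?thesis using assms by simp
qed (use assms in \<open>auto intro: add_increasing2\<close>)

text \<open>Truncate at a level L: u is at most L where it is small, and at most L^(1-P) u^P where
  it is large. Integrating and balancing the two terms costs the factor 2^P. As the measure space is
  arbitrary, the inequality serves Lebesgue measure and counting measure alike.\<close>

lemma weighted_jensen:
  fixes u :: "'x => real" and w :: "'x => ennreal"
  assumes [measurable]: "u \<in> borel_measurable M" "w \<in> borel_measurable M"
    and u: "\<And>x. u x >= 0" and P: "P >= 1" and W: "W > 0" "(\<integral>\<^sup>+x. w x \<partial>M) <= ennreal W"
  shows "ennreal_powr (\<integral>\<^sup>+x. ennreal (u x) * w x \<partial>M) P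
    <= ennreal (2 powr P * W powr (P - 1)) * (\<integral>\<^sup>+x. ennreal (u x powr P) * w x \<partial>M)"
proof -
  have main: "(\<integral>\<^sup>+x. ennreal (u x) * w x \<partial>M) <= ennreal (2 * W * L)"
    if L: "L > 0" and B: "(\<integral>\<^sup>+x. ennreal (u x powr P) * w x \<partial>M) <= ennreal (W * L powr P)" for L
  proof -
    have "(\<integral>\<^sup>+x. ennreal (u x) * w x \<partial>M)
        <= (\<integral>\<^sup>+x. ennreal L * w x + ennreal (L powr (1 - P)) * (ennreal (u x powr P) * w x) \<partial>M)"
    proof (rule nn_integral_mono)
      fix x
      have "ennreal (u x) <= ennreal L + ennreal (L powr (1 - P)) * ennreal (u x powr P)"
        using power_split_le[OF u[of x] L P] L
        by (simp add: ennreal_mult[symmetric] ennreal_plus[symmetric] ennreal_leI del: ennreal_plus)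
      from mult_right_mono[OF this, of "w x"]
      show "ennreal (u x) * w x <= ennreal L * w x + ennreal (L powr (1 - P)) * (ennreal (u x powr P) * w x)"
        by (simp add: distrib_right mult.assoc)
    qed
    also have "... = ennreal L * (\<integral>\<^sup>+x. w x \<partial>M) + ennreal (L powr (1 - P)) * (\<integral>\<^sup>+x. ennreal (u x powr P) * w x \<partial>M)"
      by (simp add: nn_integral_add nn_integral_cmult)
    also have "... <= ennreal L * ennreal W + ennreal (L powr (1 - P)) * ennreal (W * L powr P)"
      by (intro add_mono mult_left_mono W B) auto
    also have "... = ennreal (L * W + L powr (1 - P) * (W * L powr P))"
      using L W by (simp add: ennreal_mult[symmetric] ennreal_plus[symmetric] del: ennreal_plus)
    also have "L powr (1 - P) * (W * L powr P) = W * L"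
    proof -
      have "L powr (1 - P) * L powr P = L" using L by (simp add: powr_add[symmetric])
      then show ?thesis by (metis mult.left_commute)
    qed
    finally show ?thesis by (simp add: mult_ac)
  qed
  show ?thesis
  proof (cases "(\<integral>\<^sup>+x. ennreal (u x powr P) * w x \<partial>M)")
    case top
    then show ?thesis using W by (simp add: ennreal_mult_top)
  next
    case (real B)
    show ?thesis
    proof (cases "B = 0")
      case True
      \<comment> \<open>With a vanishing right side every level L is admissible, and the small
        levels force the left side to be 0.\<close>
      have "(\<integral>\<^sup>+x. ennreal (u x) * w x \<partial>M) <= 0 + ennreal e" if e: "e > 0" for e
        using main[of "e / (2 * W)"] real(2) e W True by simp
      then have "(\<integral>\<^sup>+x. ennreal (u x) * w x \<partial>M) <= 0" by (rule ennreal_le_epsilon)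
      then show ?thesis by simp
    next
      case False
      \<comment> \<open>The level at which the two terms of the splitting have the same bound W
        L.\<close>
      define L where "L = (B / W) powr (1 / P)"
      have L: "L > 0" unfolding L_def using False real(1) W by simp
      have LP: "L powr P = B / W" unfolding L_def using real(1) W P by (simp add: powr_powr)
      have "(\<integral>\<^sup>+x. ennreal (u x) * w x \<partial>M) <= ennreal (2 * W * L)"
        by (rule main[OF L]) (use real(2) W LP in simp)
      then have "ennreal_powr (\<integral>\<^sup>+x. ennreal (u x) * w x \<partial>M) P <= ennreal_powr (ennreal (2 * W * L)) P"
        using P by (intro ennreal_powr_mono) auto
      also have "... = ennreal (2 powr P * W powr (P - 1) * B)"
        using L W by (simp add: ennreal_powr_ennreal powr_mult LP powr_diff)
      also have "... = ennreal (2 powr P * W powr (P - 1)) * ennreal B"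
        using real(1) by (simp add: ennreal_mult)
      finally show ?thesis unfolding real(2) .
    qed
  qed
qed

text \<open>Every single term has u^r at most the total T, hence u = u^(1-r) u^r is at most
  T^(1/r-1) u^r; summing gives T^(1/r).\<close>

lemma power_subadditive:
  fixes u :: "'x => real"
  assumes u: "\<And>x. x \<in> I ==> u x >= 0" and r: "0 < r" "r <= 1"
  shows "ennreal_powr (\<integral>\<^sup>+x. ennreal (u x) \<partial>count_space I) r <= (\<integral>\<^sup>+x. ennreal (u x powr r) \<partial>count_space I)"
proof (cases "(\<integral>\<^sup>+x. ennreal (u x powr r) \<partial>count_space I)")
  case (real T)
  have le: "u x <= T powr (1 / r - 1) * u x powr r" if x: "x \<in> I" for x
  proof (cases "u x = 0")
    case False
    then have pos: "u x > 0" using u[OF x] by simp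
    have "ennreal (u x powr r) = (\<integral>\<^sup>+y. ennreal (u y powr r) * indicator {x} y \<partial>count_space I)"
      using x by (simp add: nn_integral_count_space_indicator[symmetric] nn_integral_indicator_finite)
    also have "... <= ennreal T"
      unfolding real(2)[symmetric] by (intro nn_integral_mono) (auto simp: indicator_def)
    finally have "u x powr r <= T" using real(1) by simp
    then have "(u x powr r) powr (1 / r - 1) <= T powr (1 / r - 1)"
      using r by (intro powr_mono2) auto
    then have "(u x powr r) powr (1 / r - 1) * u x powr r <= T powr (1 / r - 1) * u x powr r"
      by (rule mult_right_mono) simp
    moreover have "(u x powr r) powr (1 / r - 1) * u x powr r = u x"
      using pos r by (simp add: powr_powr powr_add[symmetric] right_diff_distrib)
    ultimately show ?thesis by simp
  qed simp
  have "(\<integral>\<^sup>+x. ennreal (u x) \<partial>count_space I) <= (\<integral>\<^sup>+x. ennreal (T powr (1 / r - 1)) * ennreal (u x powr r) \<partial>count_space I)"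
    by (intro nn_integral_mono) (use le in \<open>auto simp: ennreal_mult[symmetric] intro!: ennreal_leI\<close>)
  also have "... = ennreal (T powr (1 / r - 1) * T)"
    using real by (simp add: nn_integral_cmult ennreal_mult)
  also have "T powr (1 / r - 1) * T = T powr (1 / r)"
    using real(1) by (cases "T = 0") (auto simp: powr_diff)
  finally have "ennreal_powr (\<integral>\<^sup>+x. ennreal (u x) \<partial>count_space I) r <= ennreal_powr (ennreal (T powr (1 / r))) r"
    using r by (intro ennreal_powr_mono) auto
  then show ?thesis using real r by (simp add: ennreal_powr_ennreal powr_powr)
qed simp

section \<open>Mean value inequalities for band-limited functions\<close>

text \<open>The added 1 makes the number positive for every M. It bounds the integral only if that
  integral is finite, that is, for M above the dimension; otherwise \<open>enn2real\<close> has sent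
  infinity to 0.\<close>

definition decay_mass :: "'a::euclidean_space itself => real => real" where
  "decay_mass _ M = enn2real (\<integral>\<^sup>+(x::'a). ennreal ((1 + norm x) powr (- M)) \<partial>lborel) + 1"

lemma decay_mass_pos: "decay_mass TYPE('a::euclidean_space) M > 0"
  unfolding decay_mass_def by (simp add: add_nonneg_pos)

lemma nn_integral_decay:
  fixes x :: "'a::euclidean_space"
  assumes R: "R > 0" and M: "M > real DIM('a)"
  shows "(\<integral>\<^sup>+y. ennreal (decay M R (x - y)) \<partial>lborel) <= ennreal (decay_mass TYPE('a) M / R ^ DIM('a))"
    and "(\<integral>\<^sup>+y. ennreal (decay M R (y - x)) \<partial>lborel) <= ennreal (decay_mass TYPE('a) M / R ^ DIM('a))"
proof -
  let ?I = "\<integral>\<^sup>+(y::'a). ennreal ((1 + norm y) powr (- M)) \<partial>lborel"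
  have fin: "?I < \<infinity>" by (rule nn_integral_decay_finite[OF M])
  have "(\<integral>\<^sup>+y. ennreal (decay M R (x - y)) \<partial>lborel)
    = ennreal (\<bar>1 / R\<bar> ^ DIM('a)) * (\<integral>\<^sup>+(y::'a). ennreal ((1 + R * norm (x - (x + (1 / R) *\<^sub>R y))) powr (- M)) \<partial>lborel)"
    by (rule nn_integral_affine) (use R in auto)
  also have "... = ennreal (1 / R ^ DIM('a)) * ?I"
    using R by (simp add: power_divide)
  also have "... = ennreal (1 / R ^ DIM('a)) * ennreal (enn2real ?I)"
    using fin by simp
  also have "... <= ennreal (1 / R ^ DIM('a)) * ennreal (decay_mass TYPE('a) M)"
    unfolding decay_mass_def by (intro mult_left_mono ennreal_leI) auto
  also have "... = ennreal (decay_mass TYPE('a) M / R ^ DIM('a))"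
    using R decay_mass_pos[of M, where 'a='a] by (subst ennreal_mult[symmetric]) auto
  finally show 1: "(\<integral>\<^sup>+y. ennreal (decay M R (x - y)) \<partial>lborel) <= ennreal (decay_mass TYPE('a) M / R ^ DIM('a))" .
  then show "(\<integral>\<^sup>+y. ennreal (decay M R (y - x)) \<partial>lborel) <= ennreal (decay_mass TYPE('a) M / R ^ DIM('a))"
    by (simp add: norm_minus_commute)
qed

lemma decay_weight_submult:
  fixes x y z :: "'a::real_normed_vector"
  assumes "R >= 0" "M >= 0"
  shows "decay M R (y - z) * decay M R (x - y) <= decay M R (x - z)"
proof -
  have "norm (x - z) <= norm (x - y) + norm (y - z)" using norm_triangle_ineq[of "x - y" "y - z"] by simp
  then have "R * norm (x - z) <= R * norm (x - y) + R * norm (y - z)"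
    using mult_left_mono[of "norm (x - z)" "norm (x - y) + norm (y - z)" R] assms(1) by (simp add: distrib_left)
  moreover have "0 <= R * norm (y - z) * (R * norm (x - y))" using assms by simp
  ultimately have "1 + R * norm (x - z) <= (1 + R * norm (y - z)) * (1 + R * norm (x - y))"
    by (simp add: algebra_simps)
  moreover have "0 < 1 + R * norm (x - z)" using assms by (simp add: add_pos_nonneg)
  ultimately have "((1 + R * norm (y - z)) * (1 + R * norm (x - y))) powr (- M) <= decay M R (x - z)"
    using assms by (intro powr_mono2') auto
  then show ?thesis using assms by (simp add: powr_mult)
qed

text \<open>All that the estimates keep of a frequency support in a cube of size R: a self-improving
  bound at scale 1/R for every decay exponent, with one C for all cubes, and the growth that starts
  the bootstrap.\<close>

definition reproducible :: "(real => real) => real => ('a::euclidean_space => complex) => bool" where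
  "reproducible C R g \<longleftrightarrow> continuous_on UNIV g \<and> (\<exists>A N. \<forall>x. norm (g x) <= A * (1 + norm x) ^ N) \<and>
    (\<forall>M x. ennreal (norm (g x)) <= ennreal (C M * R ^ DIM('a)) *
       (\<integral>\<^sup>+y. ennreal (norm (g y) * decay M R (x - y)) \<partial>lborel))"

text \<open>Peetre's maximal function: its finiteness is bootstrapped from polynomial growth.\<close>

lemma peetre_step:
  fixes g :: "'a::euclidean_space => complex"
  assumes g: "reproducible C R g" and C: "C M > 0" and R: "R > 0" and p: "0 < p" "p <= 1" and M: "M >= 0"
    and bdd: "\<And>y. norm (g y) * decay M R (x - y) <= S0"
  shows "ennreal (norm (g x) powr p) <= ennreal (C M * R ^ DIM('a)) *
      (\<integral>\<^sup>+y. ennreal (norm (g y) powr p * (1 + R * norm (x - y)) powr (- M * p)) \<partial>lborel)"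
proof -
  have [measurable]: "g \<in> borel_measurable borel" using g unfolding reproducible_def by (blast intro: borel_measurable_continuous_onI)
  define T where "T y = norm (g y) * decay M R (x - y)" for y
  have [measurable]: "T \<in> borel_measurable borel" unfolding T_def by measurable
  have T0: "T y >= 0" for y unfolding T_def by simp
  define S where "S = (SUP y. T y)"
  have bT: "bdd_above (range T)" using bdd unfolding T_def bdd_above_def by blast
  have TS: "T y <= S" for y unfolding S_def by (rule cSUP_upper[OF _ bT]) simp
  have Tp: "T y powr p = norm (g y) powr p * (1 + R * norm (x - y)) powr (- M * p)" for y
    using R by (simp add: T_def powr_mult powr_powr)
  let ?K = "C M * R ^ DIM('a)"
  have K: "?K > 0" using C R by simp
  show ?thesis
  proof (cases "\<integral>\<^sup>+y. ennreal (T y powr p) \<partial>lborel")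
    case top
    then show ?thesis using K C R by (simp add: Tp ennreal_mult_top)
  next
    case (real J)
    show ?thesis
    proof (cases "S <= 0")
      case True
      then have "T x = 0" using TS[of x] T0[of x] by simp
      then have "g x = 0" by (simp add: T_def)
      then show ?thesis by simp
    next
      case False
      then have S: "S > 0" by simp
      have "T y <= ?K * (S powr (1 - p) * J)" for y
      proof -
        have "ennreal (T y) = ennreal (norm (g y)) * ennreal (decay M R (x - y))"
          unfolding T_def by (simp add: ennreal_mult)
        also have "... <= (ennreal ?K * (\<integral>\<^sup>+z. ennreal (norm (g z) * decay M R (y - z)) \<partial>lborel)) * ennreal (decay M R (x - y))"
          using g unfolding reproducible_def by (intro mult_right_mono) auto
        also have "... = ennreal ?K * (\<integral>\<^sup>+z. ennreal (norm (g z) * decay M R (y - z)) * ennreal (decay M R (x - y)) \<partial>lborel)"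
          by (simp add: nn_integral_multc mult.assoc)
        also have "... <= ennreal ?K * (\<integral>\<^sup>+z. ennreal (S powr (1 - p)) * ennreal (T z powr p) \<partial>lborel)"
        proof (intro mult_left_mono nn_integral_mono)
          fix z
          have "norm (g z) * decay M R (y - z) * decay M R (x - y) <= T z"
            unfolding T_def mult.assoc using R M by (intro mult_left_mono decay_weight_submult) auto
          \<comment> \<open>The factor T^(1-p) is traded for its supremum; only the p-th power stays
            under the integral.\<close>
          also have "T z <= S powr (1 - p) * T z powr p"
          proof (cases "T z = 0")
            case False
            then have "T z > 0" using T0[of z] by simp
            then have "T z = T z powr (1 - p) * T z powr p" by (simp add: powr_add[symmetric])
            also have "... <= S powr (1 - p) * T z powr p"
              using TS[of z] T0[of z] p by (intro mult_right_mono powr_mono2) auto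
            finally show ?thesis .
          qed simp
          finally show "ennreal (norm (g z) * decay M R (y - z)) * ennreal (decay M R (x - y))
              <= ennreal (S powr (1 - p)) * ennreal (T z powr p)"
            by (simp add: ennreal_mult[symmetric] ennreal_leI)
        qed simp
        also have "... = ennreal (?K * (S powr (1 - p) * J))"
          using real K by (simp add: nn_integral_cmult ennreal_mult)
        finally show ?thesis using real(1) K by (subst (asm) ennreal_le_iff) auto
      qed
      then have "S <= ?K * (S powr (1 - p) * J)" unfolding S_def by (intro cSUP_least) auto
      also have "... = S powr (1 - p) * (?K * J)" by (simp add: mult_ac)
      finally have le: "S <= S powr (1 - p) * (?K * J)" .
      \<comment> \<open>S is finite by the hypothesis \<open>bdd\<close> and positive in this case,
        so S^(1-p) may be cancelled. Without finiteness the inequality for S would be empty.\<close>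
      have eqS: "S powr (1 - p) * S powr p = S" using S by (simp add: powr_add[symmetric])
      have "S powr (1 - p) * S powr p <= S powr (1 - p) * (?K * J)" unfolding eqS by (rule le)
      then have "S powr p <= ?K * J" using S by (subst (asm) mult_le_cancel_left_pos) auto
      moreover have "norm (g x) powr p <= S powr p"
        using TS[of x] p unfolding T_def by (intro powr_mono2) auto
      ultimately have "ennreal (norm (g x) powr p) <= ennreal (?K * J)" by (intro ennreal_leI) simp
      also have "... = ennreal ?K * ennreal J" using K real(1) by (intro ennreal_mult) auto
      finally show ?thesis unfolding real(2)[symmetric] Tp .
    qed
  qed
qed

text \<open>For p <= 1 the Peetre step is used twice: with the growth exponent of g it turns finite
  p-mass into boundedness, and for bounded g it applies with any weight, which gives the decay M
  with a constant that is independent of the growth of g. For p > 1 Jensen suffices.\<close>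

lemma sub_mean_value:
  assumes p: "p > 0" and C: "\<And>M. C M > 0"
  shows "\<exists>K>0. \<forall>R>0. \<forall>g::'a::euclidean_space => complex. reproducible C R g -->
    Lp_mass p g < \<infinity> -->
    (\<forall>x. ennreal (norm (g x) powr p) <= ennreal (K * R ^ DIM('a)) *
       (\<integral>\<^sup>+y. ennreal (norm (g y) powr p * decay M R (x - y)) \<partial>lborel))"
proof (cases "p <= 1")
  case True
  \<comment> \<open>The weight is raised to the power p in the Peetre step, so M' p has to reach
    M.\<close>
  define M' where "M' = max 0 M / p"
  have M': "M' >= 0" "M <= M' * p" unfolding M'_def using p by (auto simp: divide_nonneg_pos)
  show ?thesis
  proof (intro exI[of _ "C M'"] conjI allI impI C)
    fix R :: real and g :: "'a => complex" and x :: 'a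
    assume R: "R > 0" and g: "reproducible C R g" and fin: "Lp_mass p g < \<infinity>"
    obtain A N where AN: "\<And>y. norm (g y) <= A * (1 + norm y) ^ N" using g unfolding reproducible_def by blast
    have A: "A >= 0" using order_trans[OF norm_ge_zero AN[of 0]] by simp
    have b1: "norm (g x) powr p <= C (real N) * R ^ DIM('a) * enn2real (Lp_mass p g)" for x
    proof -
      let ?c = "(1 + norm x) * (1 + 1 / R)"
      have c: "?c >= 0" using R by simp
      have "norm (g y) * (1 + R * norm (x - y)) powr (- real N) <= A * ?c ^ N" for y
      proof -
        have pos: "1 + R * norm (x - y) > 0" using R by (simp add: add_pos_nonneg)
        have "1 + norm y <= (1 + norm x) * (1 + norm (x - y))"
          using shift_weight[of y 1 x] by simp
        also have "... <= (1 + norm x) * ((1 + 1 / R) * (1 + R * norm (x - y)))"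
          using R by (intro mult_left_mono) (auto simp: algebra_simps)
        finally have "1 + norm y <= ?c * (1 + R * norm (x - y))" by (simp only: mult.assoc)
        then have "(1 + norm y) ^ N <= (?c * (1 + R * norm (x - y))) ^ N" by (intro power_mono) auto
        then have "norm (g y) <= A * (?c ^ N * (1 + R * norm (x - y)) ^ N)"
          using A by (intro order_trans[OF AN] mult_left_mono) (auto simp: power_mult_distrib)
        then have "norm (g y) * (1 + R * norm (x - y)) powr (- real N)
            <= A * (?c ^ N * (1 + R * norm (x - y)) ^ N) * (1 + R * norm (x - y)) powr (- real N)"
          by (rule mult_right_mono) simp
        also have "... = A * ?c ^ N * ((1 + R * norm (x - y)) ^ N * (1 + R * norm (x - y)) powr (- real N))"
          by (simp only: mult.assoc)
        also have "(1 + R * norm (x - y)) ^ N * (1 + R * norm (x - y)) powr (- real N) = 1"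
          using pos by (simp add: powr_minus powr_realpow)
        finally show ?thesis by simp
      qed
      from peetre_step[OF g C R p True _ this]
      have "ennreal (norm (g x) powr p) <= ennreal (C (real N) * R ^ DIM('a)) *
         (\<integral>\<^sup>+y. ennreal (norm (g y) powr p * (1 + R * norm (x - y)) powr (- real N * p)) \<partial>lborel)" by simp
      also have "... <= ennreal (C (real N) * R ^ DIM('a)) * Lp_mass p g"
      proof (intro mult_left_mono nn_integral_mono ennreal_leI)
        fix y
        have "(1 + R * norm (x - y)) powr (- real N * p) <= 1 powr (- real N * p)"
          using R p by (intro powr_mono2') auto
        then show "norm (g y) powr p * (1 + R * norm (x - y)) powr (- real N * p) <= norm (g y) powr p"
          using mult_left_mono[of "(1 + R * norm (x - y)) powr (- real N * p)" 1 "norm (g y) powr p"] by simp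
      qed simp
      also have "... = ennreal (C (real N) * R ^ DIM('a) * enn2real (Lp_mass p g))"
        using fin C[of N] R by (subst ennreal_mult) (auto simp: less_imp_le)
      finally show ?thesis using C[of N] R by (subst (asm) ennreal_le_iff) (auto simp: less_imp_le)
    qed
    define B where "B = (C (real N) * R ^ DIM('a) * enn2real (Lp_mass p g)) powr (1 / p)"
    have b2: "norm (g y) <= B" for y
    proof -
      have "(norm (g y) powr p) powr (1 / p) <= B"
        unfolding B_def using p b1 by (intro powr_mono2) auto
      then show ?thesis using p by (simp add: powr_powr)
    qed
    have "norm (g y) * (1 + R * norm (x - y)) powr (- M') <= B" for y
    proof -
      have "(1 + R * norm (x - y)) powr (- M') <= 1 powr (- M')" using R M' by (intro powr_mono2') auto
      then have "norm (g y) * (1 + R * norm (x - y)) powr (- M') <= norm (g y) * 1" by (intro mult_left_mono) auto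
      then show ?thesis using b2[of y] by simp
    qed
    from peetre_step[OF g C R p True M'(1) this]
    have "ennreal (norm (g x) powr p) <= ennreal (C M' * R ^ DIM('a)) *
         (\<integral>\<^sup>+y. ennreal (norm (g y) powr p * (1 + R * norm (x - y)) powr (- M' * p)) \<partial>lborel)" .
    also have "... <= ennreal (C M' * R ^ DIM('a)) *
         (\<integral>\<^sup>+y. ennreal (norm (g y) powr p * decay M R (x - y)) \<partial>lborel)"
      using R M' by (intro mult_left_mono nn_integral_mono ennreal_leI powr_mono) auto
    finally show "ennreal (norm (g x) powr p) <= ennreal (C M' * R ^ DIM('a)) *
         (\<integral>\<^sup>+y. ennreal (norm (g y) powr p * decay M R (x - y)) \<partial>lborel)" .
  qed
next
  case False
  \<comment> \<open>Jensen asks for a weight of finite mass, hence a decay beyond the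
    dimension.\<close>
  define M' where "M' = max M (real DIM('a) + 1)"
  let ?W = "decay_mass TYPE('a) M'"
  have M': "M' > real DIM('a)" "M <= M'" unfolding M'_def by auto
  have W: "?W > 0" by (rule decay_mass_pos)
  define K where "K = (C M') powr p * 2 powr p * ?W powr (p - 1)"
  have K: "K > 0" unfolding K_def using C[of M'] W by simp
  show ?thesis
  proof (intro exI[of _ K] conjI allI impI K)
    fix R :: real and g :: "'a => complex" and x :: 'a
    assume R: "R > 0" and g: "reproducible C R g"
    have [measurable]: "g \<in> borel_measurable borel" using g unfolding reproducible_def by (blast intro: borel_measurable_continuous_onI)
    let ?w = "\<lambda>y. ennreal ((1 + R * norm (x - y)) powr (- M'))"
    have c: "C M' * R ^ DIM('a) > 0" using C R by simp
    have "ennreal (norm (g x)) <= ennreal (C M' * R ^ DIM('a)) * (\<integral>\<^sup>+y. ennreal (norm (g y)) * ?w y \<partial>lborel)"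
      using g unfolding reproducible_def by (simp add: ennreal_mult)
    then have "ennreal_powr (ennreal (norm (g x))) p <= ennreal_powr (ennreal (C M' * R ^ DIM('a)) * (\<integral>\<^sup>+y. ennreal (norm (g y)) * ?w y \<partial>lborel)) p"
      using p by (intro ennreal_powr_mono) auto
    also have "... = ennreal ((C M' * R ^ DIM('a)) powr p) * ennreal_powr (\<integral>\<^sup>+y. ennreal (norm (g y)) * ?w y \<partial>lborel) p"
      by (rule ennreal_powr_cmult[OF c])
    also have "... <= ennreal ((C M' * R ^ DIM('a)) powr p) *
       (ennreal (2 powr p * (?W / R ^ DIM('a)) powr (p - 1)) * (\<integral>\<^sup>+y. ennreal (norm (g y) powr p) * ?w y \<partial>lborel))"
      using False W R by (intro mult_left_mono weighted_jensen nn_integral_decay M') auto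
    also have "... = ennreal (K * R ^ DIM('a)) * (\<integral>\<^sup>+y. ennreal (norm (g y) powr p) * ?w y \<partial>lborel)"
    proof -
      have "(C M' * R ^ DIM('a)) powr p * (2 powr p * (?W / R ^ DIM('a)) powr (p - 1))
        = K * ((R ^ DIM('a)) powr p / (R ^ DIM('a)) powr (p - 1))"
        unfolding K_def using C[of M'] W R by (simp add: powr_mult powr_divide less_imp_le)
      also have "(R ^ DIM('a)) powr p / (R ^ DIM('a)) powr (p - 1) = R ^ DIM('a)"
        using R by (simp add: powr_diff[symmetric])
      finally show ?thesis by (simp add: mult.assoc[symmetric] ennreal_mult[symmetric])
    qed
    also have "... <= ennreal (K * R ^ DIM('a)) *
       (\<integral>\<^sup>+y. ennreal (norm (g y) powr p * decay M R (x - y)) \<partial>lborel)"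
      using M'(2) R by (intro mult_left_mono nn_integral_mono) (auto simp: ennreal_mult[symmetric] intro!: ennreal_leI mult_left_mono powr_mono)
    finally show "ennreal (norm (g x) powr p) <= ennreal (K * R ^ DIM('a)) *
       (\<integral>\<^sup>+y. ennreal (norm (g y) powr p * decay M R (x - y)) \<partial>lborel)"
      by (simp add: ennreal_powr_ennreal)
  qed
qed

section \<open>Traces of band-limited functions\<close>

lemma ennreal_mult_middle:
  "a >= 0 ==> b >= 0 ==> c >= 0 ==> ennreal a * ((ennreal b * X) * ennreal c) = ennreal (a * b * c) * X"
  by (simp add: ennreal_mult mult_ac)

lemma nn_integral_swap:
  fixes f :: "'a::euclidean_space => 'b::euclidean_space => ennreal"
  assumes "case_prod f \<in> borel_measurable (borel \<Otimes>\<^sub>M borel)"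
  shows "(\<integral>\<^sup>+x. (\<integral>\<^sup>+y. f x y \<partial>lborel) \<partial>lborel) = (\<integral>\<^sup>+y. (\<integral>\<^sup>+x. f x y \<partial>lborel) \<partial>lborel)"
proof -
  have "sets (lborel \<Otimes>\<^sub>M lborel) = sets (borel \<Otimes>\<^sub>M borel :: ('a \<times> 'b) measure)"
    by (intro sets_pair_measure_cong) auto
  then have "case_prod f \<in> borel_measurable (lborel \<Otimes>\<^sub>M lborel)"
    using assms by (simp cong: measurable_cong_sets)
  from lborel_pair.Fubini'[OF this] show ?thesis by simp
qed

text \<open>Substitute for Young's inequality when p <= 1. The mean value inequality bounds both the
  supremum and the integral of (G v)^p by the same quantity, and G v = (G v)^(1-p) (G v)^p combines
  them. The weight v may vary by a polynomial factor of order M2, which the surplus decay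
  \<open>M2 * p\<close> absorbs.\<close>

lemma weighted_sum_bound:
  fixes G v :: "'a::euclidean_space => real" and H :: "'a => ennreal"
  assumes [measurable]: "G \<in> borel_measurable borel" "v \<in> borel_measurable borel" "H \<in> borel_measurable borel"
    and G: "\<And>y. G y >= 0" and v: "\<And>y. v y > 0" and p: "0 < p" "p <= 1" and R: "R > 0"
    and C1: "C1 > 0" and A: "A > 0"
    and slow: "\<And>y z. v y <= A * v z * (1 + R * norm (y - z)) powr M2"
    and mean: "\<And>y. ennreal (G y powr p) <= ennreal (C1 * R ^ DIM('a)) *
       (\<integral>\<^sup>+z. H z * ennreal ((1 + R * norm (y - z)) powr (- (M2 * p + (real DIM('a) + 1)))) \<partial>lborel)"
  shows "ennreal_powr (\<integral>\<^sup>+y. ennreal (G y * v y) \<partial>lborel) p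
    <= ennreal (C1 * A powr p * decay_mass TYPE('a) (real DIM('a) + 1) powr p * (R ^ DIM('a)) powr (1 - p)) *
       (\<integral>\<^sup>+z. H z * ennreal (v z powr p) \<partial>lborel)"
proof -
  let ?d = "real DIM('a)" and ?W = "decay_mass TYPE('a) (real DIM('a) + 1)"
  define C' where "C' = C1 * A powr p"
  have C': "C' > 0" unfolding C'_def using C1 A by simp
  have W: "?W > 0" by (rule decay_mass_pos)
  let ?om = "\<lambda>y z. ennreal (decay (?d + 1) R (y - z))"
  have claim1: "ennreal ((G y * v y) powr p) <= ennreal (C' * R ^ DIM('a)) * (\<integral>\<^sup>+z. H z * ennreal (v z powr p) * ?om y z \<partial>lborel)" for y
  proof -
    have "ennreal ((G y * v y) powr p) = ennreal (G y powr p) * ennreal (v y powr p)"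
      using G[of y] v[of y] by (simp add: powr_mult ennreal_mult)
    also have "... <= (ennreal (C1 * R ^ DIM('a)) *
       (\<integral>\<^sup>+z. H z * ennreal (decay (M2 * p + (?d + 1)) R (y - z)) \<partial>lborel)) * ennreal (v y powr p)"
      by (intro mult_right_mono mean) auto
    also have "... = ennreal (C1 * R ^ DIM('a)) *
       (\<integral>\<^sup>+z. H z * ennreal (decay (M2 * p + (?d + 1)) R (y - z)) * ennreal (v y powr p) \<partial>lborel)"
    proof -
      have "(\<integral>\<^sup>+z. H z * ennreal (decay (M2 * p + (?d + 1)) R (y - z)) * ennreal (v y powr p) \<partial>lborel)
        = (\<integral>\<^sup>+z. H z * ennreal (decay (M2 * p + (?d + 1)) R (y - z)) \<partial>lborel) * ennreal (v y powr p)"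
        by (rule nn_integral_multc) measurable
      then show ?thesis by (simp only: mult.assoc)
    qed
    also have "... <= ennreal (C1 * R ^ DIM('a)) *
       (\<integral>\<^sup>+z. ennreal (A powr p) * (H z * ennreal (v z powr p) * ?om y z) \<partial>lborel)"
    proof (intro mult_left_mono nn_integral_mono)
      fix z
      let ?o = "1 + R * norm (y - z)"
      have o: "?o > 0" using R by (simp add: add_pos_nonneg)
      have "v y powr p <= (A * v z * ?o powr M2) powr p"
        using slow[of y z] v[of y] p by (intro powr_mono2) auto
      also have "... = A powr p * v z powr p * ?o powr (M2 * p)"
        using A v[of z] o by (simp add: powr_mult powr_powr)
      finally have "?o powr (- (M2 * p + (?d + 1))) * v y powr p
          <= ?o powr (- (M2 * p + (?d + 1))) * (A powr p * v z powr p * ?o powr (M2 * p))"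
        by (intro mult_left_mono) auto
      also have "... = A powr p * v z powr p * (?o powr (- (M2 * p + (?d + 1))) * ?o powr (M2 * p))"
        by simp
      also have "?o powr (- (M2 * p + (?d + 1))) * ?o powr (M2 * p) = ?o powr (- (?d + 1))"
        by (simp add: powr_add[symmetric])
      finally have "ennreal (?o powr (- (M2 * p + (?d + 1)))) * ennreal (v y powr p)
          <= ennreal (A powr p) * (ennreal (v z powr p) * ennreal (?o powr (- (?d + 1))))"
        by (simp add: ennreal_mult[symmetric] ennreal_leI mult.assoc)
      from mult_left_mono[OF this, of "H z"]
      show "H z * ennreal (?o powr (- (M2 * p + (?d + 1)))) * ennreal (v y powr p)
          <= ennreal (A powr p) * (H z * ennreal (v z powr p) * ?om y z)"
        by (simp add: mult_ac)
    qed auto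
    also have "... = ennreal (C' * R ^ DIM('a)) * (\<integral>\<^sup>+z. H z * ennreal (v z powr p) * ?om y z \<partial>lborel)"
    proof -
      have "(\<integral>\<^sup>+z. ennreal (A powr p) * (H z * ennreal (v z powr p) * ?om y z) \<partial>lborel)
        = ennreal (A powr p) * (\<integral>\<^sup>+z. H z * ennreal (v z powr p) * ?om y z \<partial>lborel)"
        by (rule nn_integral_cmult) measurable
      moreover have "ennreal (C' * R ^ DIM('a)) = ennreal (C1 * R ^ DIM('a)) * ennreal (A powr p)"
        using C1 R unfolding C'_def by (subst ennreal_mult[symmetric]) (auto simp: mult_ac)
      ultimately show ?thesis by (simp only: mult.assoc)
    qed
    finally show ?thesis .
  qed
  show ?thesis
  proof (cases "\<integral>\<^sup>+z. H z * ennreal (v z powr p) \<partial>lborel")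
    case top
    then show ?thesis using C1 A W R by (simp add: ennreal_mult_top)
  next
    case (real q)
    \<comment> \<open>Supremum of (G v)^p, from dropping the decay in the mean value bound. It
      carries the factor R^d whose power 1 - p survives in the result.\<close>
    define s where "s = C' * R ^ DIM('a) * q"
    have s: "s >= 0" unfolding s_def using C' R real(1) by simp
    have sup: "(G y * v y) powr p <= s" for y
    proof -
      have "(\<integral>\<^sup>+z. H z * ennreal (v z powr p) * ?om y z \<partial>lborel) <= (\<integral>\<^sup>+z. H z * ennreal (v z powr p) \<partial>lborel)"
      proof (intro nn_integral_mono)
        fix z
        have "decay (?d + 1) R (y - z) <= 1 powr (- (?d + 1))" using R by (intro powr_mono2') auto
        then have "?om y z <= 1" by (simp add: ennreal_leI)
        from mult_left_mono[OF this] show "H z * ennreal (v z powr p) * ?om y z <= H z * ennreal (v z powr p)" by simp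
      qed
      then have "ennreal ((G y * v y) powr p) <= ennreal (C' * R ^ DIM('a)) * ennreal q"
        unfolding real(2) by (intro order_trans[OF claim1] mult_left_mono) auto
      also have "... = ennreal s" unfolding s_def using C' R real(1) by (intro ennreal_mult[symmetric]) auto
      finally show ?thesis using s by simp
    qed
    have int: "(\<integral>\<^sup>+y. ennreal ((G y * v y) powr p) \<partial>lborel) <= ennreal (C' * ?W * q)"
    proof -
      have "(\<integral>\<^sup>+y. ennreal ((G y * v y) powr p) \<partial>lborel)
        <= (\<integral>\<^sup>+y. ennreal (C' * R ^ DIM('a)) * (\<integral>\<^sup>+z. H z * ennreal (v z powr p) * ?om y z \<partial>lborel) \<partial>lborel)"
        by (intro nn_integral_mono claim1)
      also have "... = ennreal (C' * R ^ DIM('a)) * (\<integral>\<^sup>+y. (\<integral>\<^sup>+z. H z * ennreal (v z powr p) * ?om y z \<partial>lborel) \<partial>lborel)"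
        by (rule nn_integral_cmult) measurable
      also have "(\<integral>\<^sup>+y. (\<integral>\<^sup>+z. H z * ennreal (v z powr p) * ?om y z \<partial>lborel) \<partial>lborel)
         = (\<integral>\<^sup>+z. (\<integral>\<^sup>+y. H z * ennreal (v z powr p) * ?om y z \<partial>lborel) \<partial>lborel)"
        by (rule nn_integral_swap) measurable
      also have "... = (\<integral>\<^sup>+z. H z * ennreal (v z powr p) * (\<integral>\<^sup>+y. ?om y z \<partial>lborel) \<partial>lborel)"
        by (intro nn_integral_cong nn_integral_cmult) measurable
      also have "... <= (\<integral>\<^sup>+z. H z * ennreal (v z powr p) * ennreal (?W / R ^ DIM('a)) \<partial>lborel)"
        by (intro nn_integral_mono mult_left_mono nn_integral_decay R) auto
      also have "... = ennreal q * ennreal (?W / R ^ DIM('a))"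
        by (simp add: nn_integral_multc real(2))
      also have "ennreal (C' * R ^ DIM('a)) * (ennreal q * ennreal (?W / R ^ DIM('a))) = ennreal (C' * ?W * q)"
        using C' W R real(1) by (simp add: ennreal_mult[symmetric] mult_ac)
      finally show ?thesis by (simp add: mult_left_mono)
    qed
    have "(\<integral>\<^sup>+y. ennreal (G y * v y) \<partial>lborel) <= (\<integral>\<^sup>+y. ennreal (s powr ((1 - p) / p)) * ennreal ((G y * v y) powr p) \<partial>lborel)"
    proof (intro nn_integral_mono)
      fix y
      let ?x = "G y * v y"
      have x: "?x >= 0" using G[of y] v[of y] by simp
      have "?x <= s powr ((1 - p) / p) * ?x powr p"
      proof (cases "?x = 0")
        case False
        then have x: "?x > 0" using x by (metis order_le_less)
        have "(?x powr p) powr ((1 - p) / p) <= s powr ((1 - p) / p)"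
          using sup[of y] p by (intro powr_mono2) auto
        then have "?x powr (1 - p) <= s powr ((1 - p) / p)" using p by (simp add: powr_powr)
        from mult_right_mono[OF this, of "?x powr p"] show ?thesis using x by (simp add: powr_add[symmetric])
      next
        case True
        show ?thesis unfolding True by simp
      qed
      then show "ennreal ?x <= ennreal (s powr ((1 - p) / p)) * ennreal (?x powr p)"
        by (simp add: ennreal_mult[symmetric] ennreal_leI)
    qed
    also have "... = ennreal (s powr ((1 - p) / p)) * (\<integral>\<^sup>+y. ennreal ((G y * v y) powr p) \<partial>lborel)"
      by (rule nn_integral_cmult) measurable
    also have "... <= ennreal (s powr ((1 - p) / p)) * ennreal (C' * ?W * q)"
      by (intro mult_left_mono int) auto
    also have "... = ennreal (s powr ((1 - p) / p) * (C' * ?W * q))"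
      using C' W real(1) by (intro ennreal_mult[symmetric]) auto
    finally have "ennreal_powr (\<integral>\<^sup>+y. ennreal (G y * v y) \<partial>lborel) p <= ennreal_powr (ennreal (s powr ((1 - p) / p) * (C' * ?W * q))) p"
      using p by (intro ennreal_powr_mono) auto
    also have "... = ennreal ((s powr ((1 - p) / p) * (C' * ?W * q)) powr p)"
      using C' W real(1) by (intro ennreal_powr_ennreal) auto
    also have "(s powr ((1 - p) / p) * (C' * ?W * q)) powr p = (C' * ?W powr p * (R ^ DIM('a)) powr (1 - p)) * q"
    proof (cases "q = 0")
      case False
      then have q: "q > 0" using real(1) by simp
      have "(s powr ((1 - p) / p) * (C' * ?W * q)) powr p = s powr (1 - p) * (C' powr p * ?W powr p * q powr p)"
        using p C' W q by (simp add: powr_mult powr_powr)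
      also have "s powr (1 - p) = C' powr (1 - p) * (R ^ DIM('a)) powr (1 - p) * q powr (1 - p)"
        unfolding s_def using C' R q by (simp add: powr_mult)
      also have "C' powr (1 - p) * (R ^ DIM('a)) powr (1 - p) * q powr (1 - p) * (C' powr p * ?W powr p * q powr p)
        = (C' powr (1 - p) * C' powr p) * ?W powr p * (R ^ DIM('a)) powr (1 - p) * (q powr (1 - p) * q powr p)"
        by (simp only: mult_ac)
      also have "C' powr (1 - p) * C' powr p = C'" using C' by (simp add: powr_add[symmetric])
      also have "q powr (1 - p) * q powr p = q" using q by (simp add: powr_add[symmetric])
      finally show ?thesis .
    qed (use p in simp)
    also have "ennreal ((C' * ?W powr p * (R ^ DIM('a)) powr (1 - p)) * q) = ennreal (C' * ?W powr p * (R ^ DIM('a)) powr (1 - p)) * ennreal q"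
      using C' W R real(1) by (intro ennreal_mult) auto
    finally show ?thesis unfolding real(2) C'_def .
  qed
qed

text \<open>The p-mass on the normal line through z. The factor R is the share of the normal
  direction in the R^(d+1) of the mean value inequality.\<close>

definition slice_mass :: "real => real => ('a::euclidean_space \<times> real => complex) => 'a => ennreal" where
  "slice_mass R p g z = ennreal R * (\<integral>\<^sup>+t. ennreal (norm (g (z, t)) powr p) \<partial>lborel)"

lemma slice_integral_measurable:
  fixes g :: "'a::euclidean_space \<times> real => complex"
  assumes [measurable]: "g \<in> borel_measurable borel"
  shows "(\<lambda>z. \<integral>\<^sup>+t. ennreal (norm (g (z, t)) powr p) \<partial>lborel) \<in> borel_measurable borel"
proof -
  have "(\<lambda>x. ennreal (norm (g x) powr p)) \<in> borel_measurable (borel \<Otimes>\<^sub>M lborel)"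
    using assms by (subst measurable_cong_sets[of _ borel _ borel])
      (auto simp: borel_prod[symmetric] intro!: sets_pair_measure_cong)
  from lborel.borel_measurable_nn_integral_fst[OF this] show ?thesis by simp
qed

lemma slice_mass_measurable:
  fixes g :: "'a::euclidean_space \<times> real => complex"
  assumes "g \<in> borel_measurable borel"
  shows "slice_mass R p g \<in> borel_measurable borel"
  using slice_integral_measurable[OF assms] unfolding slice_mass_def[abs_def] by measurable

lemma nn_integral_slice:
  fixes F :: "'a::euclidean_space \<times> real => ennreal"
  assumes "F \<in> borel_measurable borel"
  shows "(\<integral>\<^sup>+x. F x \<partial>lborel) = (\<integral>\<^sup>+z. (\<integral>\<^sup>+t. F (z, t) \<partial>lborel) \<partial>lborel)"
proof -
  have "F \<in> borel_measurable (lborel \<Otimes>\<^sub>M lborel)" using assms by (simp add: lborel_prod)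
  from lborel.nn_integral_fst[OF this] show ?thesis by (simp add: lborel_prod)
qed

lemma slice_mass_integral:
  fixes g :: "'a::euclidean_space \<times> real => complex"
  assumes [measurable]: "g \<in> borel_measurable borel"
  shows "(\<integral>\<^sup>+z. slice_mass R p g z \<partial>lborel) = ennreal R * Lp_mass p g"
proof -
  have "(\<lambda>z. \<integral>\<^sup>+t. ennreal (norm (g (z, t)) powr p) \<partial>lborel) \<in> borel_measurable lborel"
    using slice_integral_measurable[OF assms] by simp
  then show ?thesis unfolding slice_mass_def
    by (subst nn_integral_slice) (auto simp: nn_integral_cmult)
qed

text \<open>The mean value inequality in d + 1 dimensions, taken at the point (y, 0). Discarding the
  normal part of the distance only enlarges the weight, after which the normal variable integrates
  out.\<close>

lemma trace_mean_value:
  fixes C :: "real => real"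
  assumes p: "p > 0" and C: "\<And>M. C M > 0" and M: "M >= 0"
  shows "\<exists>K>0. \<forall>R>0. \<forall>g::'a::euclidean_space \<times> real => complex. reproducible C R g -->
    Lp_mass p g < \<infinity> -->
    (\<forall>y. ennreal (norm (g (y, 0)) powr p) <= ennreal (K * R ^ DIM('a)) *
       (\<integral>\<^sup>+z. slice_mass R p g z * ennreal (decay M R (y - z)) \<partial>lborel))"
proof -
  obtain K where K: "K > 0" "\<And>R (g::'a \<times> real => complex) x. R > 0 ==> reproducible C R g ==>
    Lp_mass p g < \<infinity> ==>
    ennreal (norm (g x) powr p) <= ennreal (K * R ^ DIM('a \<times> real)) *
       (\<integral>\<^sup>+y. ennreal (norm (g y) powr p * decay M R (x - y)) \<partial>lborel)"
    using sub_mean_value[where C=C and 'a="'a \<times> real" and M=M, OF p C] by blast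
  have "ennreal (norm (g (y, 0)) powr p) <= ennreal (K * R ^ DIM('a)) *
       (\<integral>\<^sup>+z. slice_mass R p g z * ennreal (decay M R (y - z)) \<partial>lborel)"
    if R: "R > 0" and g: "reproducible C R g" and fin: "Lp_mass p g < \<infinity>"
    for R and g :: "'a \<times> real => complex" and y
  proof -
    have [measurable]: "g \<in> borel_measurable borel" using g unfolding reproducible_def by (blast intro: borel_measurable_continuous_onI)
    let ?F = "\<lambda>x. ennreal (norm (g x) powr p * decay M R (y - fst x))"
    have mfst: "fst \<in> borel_measurable (borel :: ('a \<times> real) measure)"
      by (intro borel_measurable_continuous_onI continuous_intros)
    have mF: "?F \<in> borel_measurable borel" using mfst by measurable
    have "ennreal (norm (g (y, 0)) powr p) <= ennreal (K * R ^ DIM('a \<times> real)) *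
       (\<integral>\<^sup>+x. ennreal (norm (g x) powr p * (1 + R * norm ((y, 0) - x)) powr (- M)) \<partial>lborel)"
      by (rule K(2)[OF R g fin])
    also have "... <= ennreal (K * R ^ DIM('a \<times> real)) * (\<integral>\<^sup>+x. ?F x \<partial>lborel)"
    proof (intro mult_left_mono nn_integral_mono ennreal_leI powr_mono2')
      fix x :: "'a \<times> real"
      have "norm (y - fst x) <= norm ((y, 0) - x)" using norm_fst_le[of "y - fst x" "- snd x"] by (cases x) simp
      then show "1 + R * norm (y - fst x) <= 1 + R * norm ((y, 0) - x)" using R by simp
    qed (use R M in \<open>auto simp: add_pos_nonneg\<close>)
    also have "(\<integral>\<^sup>+x. ?F x \<partial>lborel) = (\<integral>\<^sup>+z. (\<integral>\<^sup>+t. ?F (z, t) \<partial>lborel) \<partial>lborel)"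
      by (rule nn_integral_slice[OF mF])
    also have "... = (\<integral>\<^sup>+z. (\<integral>\<^sup>+t. ennreal (norm (g (z, t)) powr p) \<partial>lborel) * ennreal (decay M R (y - z)) \<partial>lborel)"
    proof (intro nn_integral_cong)
      fix z
      have "(\<lambda>t. g (z, t)) \<in> borel_measurable borel"
        by (rule measurable_compose[OF _ \<open>g \<in> borel_measurable borel\<close>])
           (intro borel_measurable_continuous_onI continuous_intros)
      then show "(\<integral>\<^sup>+t. ?F (z, t) \<partial>lborel) = (\<integral>\<^sup>+t. ennreal (norm (g (z, t)) powr p) \<partial>lborel) * ennreal (decay M R (y - z))"
        by (simp add: ennreal_mult nn_integral_multc)
    qed
    also have "ennreal (K * R ^ DIM('a \<times> real)) * ... = ennreal (K * R ^ DIM('a)) *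
       (\<integral>\<^sup>+z. slice_mass R p g z * ennreal (decay M R (y - z)) \<partial>lborel)"
    proof -
      have "(\<integral>\<^sup>+z. slice_mass R p g z * ennreal (decay M R (y - z)) \<partial>lborel)
         = ennreal R * (\<integral>\<^sup>+z. (\<integral>\<^sup>+t. ennreal (norm (g (z, t)) powr p) \<partial>lborel) * ennreal (decay M R (y - z)) \<partial>lborel)"
      proof -
        note [measurable] = slice_integral_measurable[OF \<open>g \<in> borel_measurable borel\<close>]
        show ?thesis unfolding slice_mass_def mult.assoc by (rule nn_integral_cmult) measurable
      qed
      moreover have "ennreal (K * R ^ DIM('a \<times> real)) = ennreal (K * R ^ DIM('a)) * ennreal R"
        using K(1) R by (simp add: ennreal_mult[symmetric] mult_ac)
      ultimately show ?thesis by (simp add: mult.assoc)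
    qed
    finally show ?thesis .
  qed
  with K(1) show ?thesis by blast
qed

text \<open>The kernel is replaced by its polynomial weight at scale 1/r, which varies slowly at
  scale 1/R because r is at most A R. The p-th power of its height contributes r^(dp) and the final
  integration r^(-d); with R^(d(1-p)) from the weighted sum this is (R/r)^(d(1-p)), and the slice
  contributes R.\<close>

lemma trace_convolution_le_1:
  fixes C C2 :: "real => real"
  assumes p: "0 < p" "p <= 1" and C: "\<And>M. C M > 0" and C2: "\<And>M. C2 M > 0" and A: "A >= 1"
  shows "\<exists>K>0. \<forall>R r (g::'a::euclidean_space \<times> real => complex) (\<kappa>::'a => complex).
    R > 0 --> r > 0 --> r <= A * R --> reproducible C R g --> \<kappa> \<in> borel_measurable borel -->
    kernel_bound C2 r \<kappa> -->
    Lp_mass p g < \<infinity> -->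
    (\<integral>\<^sup>+x. ennreal_powr (trace_conv g \<kappa> x) p \<partial>lborel)
     <= ennreal (K * (R / r) powr (real DIM('a) * (1 - p)) * R) * Lp_mass p g"
proof -
  let ?d = "real DIM('a)" and ?W = "decay_mass TYPE('a) (real DIM('a) + 1)"
  \<comment> \<open>Chosen so that the p-th power of the kernel weight decays like d + 1 and is
    integrable over the hyperplane.\<close>
  define M2 where "M2 = (?d + 1) / p"
  have M2: "M2 >= 0" "M2 * p = ?d + 1" unfolding M2_def using p by auto
  define M where "M = M2 * p + (?d + 1)"
  have W: "?W > 0" by (rule decay_mass_pos)
  have "M >= 0" unfolding M_def M2 by simp
  from trace_mean_value[where C=C and 'a='a, OF p(1) C this] obtain K1 where K1_pos: "K1 > 0" and
    K1_mean: "\<forall>R>0. \<forall>g::'a \<times> real => complex. reproducible C R g --> Lp_mass p g < \<infinity> -->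
     (\<forall>y. ennreal (norm (g (y, 0)) powr p) <= ennreal (K1 * R ^ DIM('a)) *
       (\<integral>\<^sup>+z. slice_mass R p g z * ennreal (decay M R (y - z)) \<partial>lborel))" by (elim exE conjE)
  note K1 = K1_pos K1_mean[rule_format]
  \<comment> \<open>The price of comparing scales: 1 + r t is at most A (1 + R t), raised to the
    power M2.\<close>
  define A' where "A' = A powr M2"
  have A': "A' > 0" unfolding A'_def using A by simp
  define K where "K = (C2 M2) powr p * (K1 * A' powr p * ?W powr p) * ?W"
  have K: "K > 0" unfolding K_def using C2[of M2] K1(1) A' W by simp
  have "(\<integral>\<^sup>+x. ennreal_powr (trace_conv g \<kappa> x) p \<partial>lborel)
     <= ennreal (K * (R / r) powr (?d * (1 - p)) * R) * Lp_mass p g"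
    if R: "R > 0" and r: "r > 0" "r <= A * R" and g: "reproducible C R g" and \<kappa>m: "\<kappa> \<in> borel_measurable borel"
      and \<kappa>: "kernel_bound C2 r \<kappa>"
      and fin: "Lp_mass p g < \<infinity>"
    for R r and g :: "'a \<times> real => complex" and \<kappa> :: "'a => complex"
  proof -
    have gm [measurable]: "g \<in> borel_measurable borel" using g unfolding reproducible_def by (blast intro: borel_measurable_continuous_onI)
    have [measurable]: "slice_mass R p g \<in> borel_measurable borel" by (rule slice_mass_measurable[OF gm])
    have [measurable]: "(\<lambda>y. g (y, 0)) \<in> borel_measurable borel"
      by (rule measurable_compose[OF _ gm]) (intro borel_measurable_continuous_onI continuous_intros)
    let ?v = "\<lambda>x y. decay M2 r (x - y)"
    let ?c = "C2 M2 * r ^ DIM('a)"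
    have c: "?c > 0" using C2 r by simp
    let ?L = "K1 * A' powr p * ?W powr p * (R ^ DIM('a)) powr (1 - p)"
    have L: "?L > 0" using K1 A' W R by simp
    have step: "ennreal_powr (trace_conv g \<kappa> x) p
      <= ennreal (?c powr p * ?L) * (\<integral>\<^sup>+z. slice_mass R p g z * ennreal (decay (?d + 1) r (x - z)) \<partial>lborel)" for x
    proof -
      have "trace_conv g \<kappa> x
        <= (\<integral>\<^sup>+y. ennreal ?c * ennreal (norm (g (y, 0)) * ?v x y) \<partial>lborel)"
      proof (intro nn_integral_mono)
        fix y
        have "norm (g (y, 0)) * norm (\<kappa> (x - y)) <= norm (g (y, 0)) * (?c * ?v x y)"
          using \<kappa> by (intro mult_left_mono) auto
        then show "ennreal (norm (g (y, 0)) * norm (\<kappa> (x - y))) <= ennreal ?c * ennreal (norm (g (y, 0)) * ?v x y)"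
          using c by (simp add: ennreal_mult[symmetric] ennreal_leI mult_ac)
      qed
      also have "... = ennreal ?c * (\<integral>\<^sup>+y. ennreal (norm (g (y, 0)) * ?v x y) \<partial>lborel)"
        by (rule nn_integral_cmult) measurable
      finally have "ennreal_powr (trace_conv g \<kappa> x) p
         <= ennreal_powr (ennreal ?c * (\<integral>\<^sup>+y. ennreal (norm (g (y, 0)) * ?v x y) \<partial>lborel)) p"
        using p by (intro ennreal_powr_mono) auto
      also have "... = ennreal (?c powr p) * ennreal_powr (\<integral>\<^sup>+y. ennreal (norm (g (y, 0)) * ?v x y) \<partial>lborel) p"
        by (rule ennreal_powr_cmult[OF c])
      also have "... <= ennreal (?c powr p) * (ennreal ?L * (\<integral>\<^sup>+z. slice_mass R p g z * ennreal (?v x z powr p) \<partial>lborel))"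
      proof (intro mult_left_mono weighted_sum_bound)
        show "?v x y > 0" for y using r by (simp add: add_pos_nonneg less_imp_neq[symmetric])
        show "?v x y <= A' * ?v x z * (1 + R * norm (y - z)) powr M2" for y z
        proof -
          let ?o = "1 + r * norm (y - z)"
          have o: "?o > 0" using r by (simp add: add_pos_nonneg)
          have "?o powr (- M2) * ?v x y <= ?v x z" using r M2 by (intro decay_weight_submult) auto
          then have "?o powr M2 * (?o powr (- M2) * ?v x y) <= ?o powr M2 * ?v x z" by (intro mult_left_mono) auto
          then have 1: "?v x y <= ?o powr M2 * ?v x z"
            using o by (simp add: mult.assoc[symmetric] powr_add[symmetric])
          have "r * norm (y - z) <= A * (R * norm (y - z))" using r(2) by (simp add: mult_right_mono mult.assoc[symmetric])
          then have "?o <= A * (1 + R * norm (y - z))" using A by (simp add: distrib_left)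
          then have "?o powr M2 <= (A * (1 + R * norm (y - z))) powr M2" using o M2 by (intro powr_mono2) auto
          also have "... = A' * (1 + R * norm (y - z)) powr M2"
            unfolding A'_def using A R by (simp add: powr_mult)
          finally have "?o powr M2 * ?v x z <= A' * (1 + R * norm (y - z)) powr M2 * ?v x z" by (intro mult_right_mono) auto
          with 1 show ?thesis by (simp add: mult_ac)
        qed
        show "ennreal (norm (g (y, 0)) powr p) <= ennreal (K1 * R ^ DIM('a)) *
          (\<integral>\<^sup>+z. slice_mass R p g z * ennreal (decay (M2 * p + (?d + 1)) R (y - z)) \<partial>lborel)" for y
          using K1(2)[OF R g fin] unfolding M_def .
      qed (use p R K1 A' in auto)
      also have "... = ennreal (?c powr p * ?L) * (\<integral>\<^sup>+z. slice_mass R p g z * ennreal (decay (?d + 1) r (x - z)) \<partial>lborel)"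
      proof -
        have "?v x z powr p = decay (?d + 1) r (x - z)" for z
          unfolding powr_powr using M2(2) by simp
        then show ?thesis using L by (simp add: ennreal_mult mult.assoc)
      qed
      finally show ?thesis .
    qed
    have "(\<integral>\<^sup>+x. ennreal_powr (trace_conv g \<kappa> x) p \<partial>lborel)
       <= (\<integral>\<^sup>+x. ennreal (?c powr p * ?L) * (\<integral>\<^sup>+z. slice_mass R p g z * ennreal (decay (?d + 1) r (x - z)) \<partial>lborel) \<partial>lborel)"
      by (intro nn_integral_mono step)
    also have "... = ennreal (?c powr p * ?L) * (\<integral>\<^sup>+x. (\<integral>\<^sup>+z. slice_mass R p g z * ennreal (decay (?d + 1) r (x - z)) \<partial>lborel) \<partial>lborel)"
      by (rule nn_integral_cmult) measurable
    also have "(\<integral>\<^sup>+x. (\<integral>\<^sup>+z. slice_mass R p g z * ennreal (decay (?d + 1) r (x - z)) \<partial>lborel) \<partial>lborel)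
       = (\<integral>\<^sup>+z. (\<integral>\<^sup>+x. slice_mass R p g z * ennreal (decay (?d + 1) r (x - z)) \<partial>lborel) \<partial>lborel)"
      by (rule nn_integral_swap) measurable
    also have "... = (\<integral>\<^sup>+z. slice_mass R p g z * (\<integral>\<^sup>+x. ennreal (decay (?d + 1) r (x - z)) \<partial>lborel) \<partial>lborel)"
      by (intro nn_integral_cong nn_integral_cmult) measurable
    also have "... <= (\<integral>\<^sup>+z. slice_mass R p g z * ennreal (?W / r ^ DIM('a)) \<partial>lborel)"
      using r by (intro nn_integral_mono mult_left_mono nn_integral_decay) auto
    also have "... = (ennreal R * Lp_mass p g) * ennreal (?W / r ^ DIM('a))"
      by (simp add: nn_integral_multc slice_mass_integral[OF gm])
    also have "ennreal (?c powr p * ?L) * ((ennreal R * Lp_mass p g) * ennreal (?W / r ^ DIM('a)))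
      = ennreal (?c powr p * ?L * R * (?W / r ^ DIM('a))) * Lp_mass p g"
      using c L R W r by (intro ennreal_mult_middle) auto
    also have "?c powr p * ?L * R * (?W / r ^ DIM('a)) = K * (R / r) powr (?d * (1 - p)) * R"
    proof -
      have rp: "(r ^ DIM('a)) powr p / r ^ DIM('a) = r powr (- (?d * (1 - p)))"
      proof -
        have "(r ^ DIM('a)) powr p / r ^ DIM('a) = r powr (?d * p) / r powr ?d"
          using r by (simp add: powr_realpow[symmetric] powr_powr)
        also have "... = r powr (?d * p - ?d)" by (rule powr_diff[symmetric])
        also have "?d * p - ?d = - (?d * (1 - p))" by (simp add: algebra_simps)
        finally show ?thesis .
      qed
      have Rp: "(R ^ DIM('a)) powr (1 - p) = R powr (?d * (1 - p))"
        using R by (simp add: powr_realpow[symmetric] powr_powr)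
      have "?c powr p = (C2 M2) powr p * (r ^ DIM('a)) powr p" using C2[of M2] r by (simp add: powr_mult)
      then have "?c powr p * ?L * R * (?W / r ^ DIM('a))
        = K * ((r ^ DIM('a)) powr p / r ^ DIM('a)) * (R ^ DIM('a)) powr (1 - p) * R"
        unfolding K_def by simp
      also have "... = K * (R powr (?d * (1 - p)) * r powr (- (?d * (1 - p)))) * R"
        unfolding rp Rp by simp
      also have "R powr (?d * (1 - p)) * r powr (- (?d * (1 - p))) = (R / r) powr (?d * (1 - p))"
          using R r by (subst powr_divide) (simp_all add: powr_minus_divide)
      finally show ?thesis .
    qed
    finally show ?thesis by (simp add: mult_left_mono)
  qed
  with K show ?thesis by blast
qed

lemma kernel_mass:
  fixes \<kappa> :: "'a::euclidean_space => complex"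
  assumes r: "r > 0" and C2: "C2 > 0"
    and \<kappa>: "\<And>x. norm (\<kappa> x) <= C2 * r ^ DIM('a) * decay (real DIM('a) + 1) r x"
  shows "(\<integral>\<^sup>+y. ennreal (norm (\<kappa> (x - y))) \<partial>lborel) <= ennreal (C2 * decay_mass TYPE('a) (real DIM('a) + 1))"
    and "(\<integral>\<^sup>+y. ennreal (norm (\<kappa> (y - x))) \<partial>lborel) <= ennreal (C2 * decay_mass TYPE('a) (real DIM('a) + 1))"
proof -
  let ?M = "real DIM('a) + 1"
  let ?W = "decay_mass TYPE('a) ?M"
  have c: "C2 * r ^ DIM('a) > 0" using C2 r by simp
  have W: "?W > 0" by (rule decay_mass_pos)
  have eq: "ennreal (C2 * r ^ DIM('a)) * ennreal (?W / r ^ DIM('a)) = ennreal (C2 * ?W)"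
    using c W r C2 by (subst ennreal_mult[symmetric]) auto
  have "(\<integral>\<^sup>+y. ennreal (norm (\<kappa> (x - y))) \<partial>lborel)
    <= (\<integral>\<^sup>+y. ennreal (C2 * r ^ DIM('a)) * ennreal (decay ?M r (x - y)) \<partial>lborel)"
    using c \<kappa> by (intro nn_integral_mono) (auto simp: ennreal_mult[symmetric] intro!: ennreal_leI)
  also have "... = ennreal (C2 * r ^ DIM('a)) * (\<integral>\<^sup>+y. ennreal (decay ?M r (x - y)) \<partial>lborel)"
    by (rule nn_integral_cmult) measurable
  also have "... <= ennreal (C2 * r ^ DIM('a)) * ennreal (?W / r ^ DIM('a))"
    using r by (intro mult_left_mono nn_integral_decay(1)) auto
  finally show "(\<integral>\<^sup>+y. ennreal (norm (\<kappa> (x - y))) \<partial>lborel) <= ennreal (C2 * ?W)" unfolding eq .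
  have "(\<integral>\<^sup>+y. ennreal (norm (\<kappa> (y - x))) \<partial>lborel)
    <= (\<integral>\<^sup>+y. ennreal (C2 * r ^ DIM('a)) * ennreal (decay ?M r (y - x)) \<partial>lborel)"
    using c \<kappa> by (intro nn_integral_mono) (auto simp: ennreal_mult[symmetric] intro!: ennreal_leI)
  also have "... = ennreal (C2 * r ^ DIM('a)) * (\<integral>\<^sup>+y. ennreal (decay ?M r (y - x)) \<partial>lborel)"
    by (rule nn_integral_cmult) measurable
  also have "... <= ennreal (C2 * r ^ DIM('a)) * ennreal (?W / r ^ DIM('a))"
    using r by (intro mult_left_mono nn_integral_decay(2)) auto
  finally show "(\<integral>\<^sup>+y. ennreal (norm (\<kappa> (y - x))) \<partial>lborel) <= ennreal (C2 * ?W)" unfolding eq .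
qed

lemma reproducible_measurable: "reproducible C R g ==> g \<in> borel_measurable borel"
  unfolding reproducible_def by (blast intro: borel_measurable_continuous_onI)

lemma trace_section_measurable:
  fixes g :: "'a::euclidean_space \<times> real => complex"
  assumes "g \<in> borel_measurable borel" shows "(\<lambda>y. g (y, 0)) \<in> borel_measurable borel"
  by (rule measurable_compose[OF _ assms]) (intro borel_measurable_continuous_onI continuous_intros)

text \<open>Integrating the mean value inequality over y consumes the factor R^d against the mass of
  the weight; what is left is the R of the normal direction.\<close>

lemma trace_Lp:
  fixes C :: "real => real"
  assumes p: "p > 0" and C: "\<And>M. C M > 0"
  shows "\<exists>K>0. \<forall>R>0. \<forall>g::'a::euclidean_space \<times> real => complex. reproducible C R g -->
    Lp_mass p g < \<infinity> -->
    (\<integral>\<^sup>+y. ennreal (norm (g (y, 0)) powr p) \<partial>lborel) <= ennreal (K * R) * Lp_mass p g"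
proof -
  let ?M = "real DIM('a) + 1"
  let ?W = "decay_mass TYPE('a) ?M"
  have M0: "?M >= 0" by simp
  from trace_mean_value[where C=C and 'a='a, OF p C M0] obtain K1 where K1: "K1 > 0" and
    mean: "\<forall>R>0. \<forall>g::'a \<times> real => complex. reproducible C R g --> Lp_mass p g < \<infinity> -->
     (\<forall>y. ennreal (norm (g (y, 0)) powr p) <= ennreal (K1 * R ^ DIM('a)) *
       (\<integral>\<^sup>+z. slice_mass R p g z * ennreal (decay ?M R (y - z)) \<partial>lborel))" by (elim exE conjE)
  have W: "?W > 0" by (rule decay_mass_pos)
  have "(\<integral>\<^sup>+y. ennreal (norm (g (y, 0)) powr p) \<partial>lborel) <= ennreal (K1 * ?W * R) * Lp_mass p g"
    if R: "R > 0" and g: "reproducible C R g" and fin: "Lp_mass p g < \<infinity>"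
    for R and g :: "'a \<times> real => complex"
  proof -
    have gm [measurable]: "g \<in> borel_measurable borel" by (rule reproducible_measurable[OF g])
    note [measurable] = slice_mass_measurable[OF gm]
    have "(\<integral>\<^sup>+y. ennreal (norm (g (y, 0)) powr p) \<partial>lborel)
      <= (\<integral>\<^sup>+y. ennreal (K1 * R ^ DIM('a)) * (\<integral>\<^sup>+z. slice_mass R p g z * ennreal (decay ?M R (y - z)) \<partial>lborel) \<partial>lborel)"
      by (intro nn_integral_mono mean[rule_format, OF R g fin])
    also have "... = ennreal (K1 * R ^ DIM('a)) * (\<integral>\<^sup>+y. (\<integral>\<^sup>+z. slice_mass R p g z * ennreal (decay ?M R (y - z)) \<partial>lborel) \<partial>lborel)"
      by (rule nn_integral_cmult) measurable
    also have "(\<integral>\<^sup>+y. (\<integral>\<^sup>+z. slice_mass R p g z * ennreal (decay ?M R (y - z)) \<partial>lborel) \<partial>lborel)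
       = (\<integral>\<^sup>+z. (\<integral>\<^sup>+y. slice_mass R p g z * ennreal (decay ?M R (y - z)) \<partial>lborel) \<partial>lborel)"
      by (rule nn_integral_swap) measurable
    also have "... = (\<integral>\<^sup>+z. slice_mass R p g z * (\<integral>\<^sup>+y. ennreal (decay ?M R (y - z)) \<partial>lborel) \<partial>lborel)"
      by (intro nn_integral_cong nn_integral_cmult) measurable
    also have "... <= (\<integral>\<^sup>+z. slice_mass R p g z * ennreal (?W / R ^ DIM('a)) \<partial>lborel)"
      using R by (intro nn_integral_mono mult_left_mono nn_integral_decay) auto
    also have "... = (ennreal R * Lp_mass p g) * ennreal (?W / R ^ DIM('a))"
      by (simp add: nn_integral_multc slice_mass_integral[OF gm])
    also have "ennreal (K1 * R ^ DIM('a)) * ((ennreal R * Lp_mass p g) * ennreal (?W / R ^ DIM('a)))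
      = ennreal (K1 * R ^ DIM('a) * R * (?W / R ^ DIM('a))) * Lp_mass p g"
      using K1 R W by (intro ennreal_mult_middle) auto
    also have "K1 * R ^ DIM('a) * R * (?W / R ^ DIM('a)) = K1 * ?W * R" using R by simp
    finally show ?thesis by (simp add: mult_left_mono)
  qed
  moreover have "K1 * ?W > 0" using K1 W by simp
  ultimately show ?thesis by blast
qed

text \<open>For p >= 1 this is Young's inequality, obtained from Jensen with the kernel as weight:
  its L1 norm has a bound that does not depend on r, hence no ratio of scales appears.\<close>

lemma trace_convolution_ge_1:
  fixes C C2 :: "real => real"
  assumes p: "1 <= p" and C: "\<And>M. C M > 0" and C2: "\<And>M. C2 M > 0"
  shows "\<exists>K>0. \<forall>R r (g::'a::euclidean_space \<times> real => complex) (\<kappa>::'a => complex).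
    R > 0 --> r > 0 --> reproducible C R g --> \<kappa> \<in> borel_measurable borel -->
    kernel_bound C2 r \<kappa> -->
    Lp_mass p g < \<infinity> -->
    (\<integral>\<^sup>+x. ennreal_powr (trace_conv g \<kappa> x) p \<partial>lborel)
     <= ennreal (K * R) * Lp_mass p g"
proof -
  let ?M = "real DIM('a) + 1"
  define V where "V = C2 ?M * decay_mass TYPE('a) ?M"
  have V: "V > 0" unfolding V_def using C2[of ?M] decay_mass_pos[of ?M, where 'a='a] by simp
  have p0: "p > 0" using p by simp
  from trace_Lp[where C=C and 'a='a, OF p0 C] obtain K1 where K1: "K1 > 0" and
    tr: "\<forall>R>0. \<forall>g::'a \<times> real => complex. reproducible C R g -->
    Lp_mass p g < \<infinity> -->
    (\<integral>\<^sup>+y. ennreal (norm (g (y, 0)) powr p) \<partial>lborel) <= ennreal (K1 * R) * Lp_mass p g"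
    by (elim exE conjE)
  define K where "K = 2 powr p * V powr (p - 1) * V * K1"
  have K: "K > 0" unfolding K_def using V K1 by simp
  have "(\<integral>\<^sup>+x. ennreal_powr (trace_conv g \<kappa> x) p \<partial>lborel)
     <= ennreal (K * R) * Lp_mass p g"
    if R: "R > 0" and r: "r > 0" and g: "reproducible C R g" and \<kappa>m[measurable]: "\<kappa> \<in> borel_measurable borel"
      and \<kappa>: "kernel_bound C2 r \<kappa>"
      and fin: "Lp_mass p g < \<infinity>"
    for R r and g :: "'a \<times> real => complex" and \<kappa> :: "'a => complex"
  proof -
    have gm [measurable]: "g \<in> borel_measurable borel" by (rule reproducible_measurable[OF g])
    note [measurable] = trace_section_measurable[OF gm]
    note mass = kernel_mass[OF r C2, of \<kappa>, OF \<kappa>[rule_format], folded V_def]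
    have "(\<integral>\<^sup>+x. ennreal_powr (trace_conv g \<kappa> x) p \<partial>lborel)
      <= (\<integral>\<^sup>+x. ennreal (2 powr p * V powr (p - 1)) * (\<integral>\<^sup>+y. ennreal (norm (g (y, 0)) powr p) * ennreal (norm (\<kappa> (x - y))) \<partial>lborel) \<partial>lborel)"
    proof (intro nn_integral_mono)
      fix x
      show "ennreal_powr (trace_conv g \<kappa> x) p
        <= ennreal (2 powr p * V powr (p - 1)) * (\<integral>\<^sup>+y. ennreal (norm (g (y, 0)) powr p) * ennreal (norm (\<kappa> (x - y))) \<partial>lborel)"
        unfolding ennreal_mult[OF norm_ge_zero norm_ge_zero]
        by (rule weighted_jensen[OF _ _ _ p V mass(1)]) auto
    qed
    also have "... = ennreal (2 powr p * V powr (p - 1)) * (\<integral>\<^sup>+x. (\<integral>\<^sup>+y. ennreal (norm (g (y, 0)) powr p) * ennreal (norm (\<kappa> (x - y))) \<partial>lborel) \<partial>lborel)"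
      by (rule nn_integral_cmult) measurable
    also have "(\<integral>\<^sup>+x. (\<integral>\<^sup>+y. ennreal (norm (g (y, 0)) powr p) * ennreal (norm (\<kappa> (x - y))) \<partial>lborel) \<partial>lborel)
      = (\<integral>\<^sup>+y. (\<integral>\<^sup>+x. ennreal (norm (g (y, 0)) powr p) * ennreal (norm (\<kappa> (x - y))) \<partial>lborel) \<partial>lborel)"
      by (rule nn_integral_swap) measurable
    also have "... = (\<integral>\<^sup>+y. ennreal (norm (g (y, 0)) powr p) * (\<integral>\<^sup>+x. ennreal (norm (\<kappa> (x - y))) \<partial>lborel) \<partial>lborel)"
      by (intro nn_integral_cong nn_integral_cmult) measurable
    also have "... <= (\<integral>\<^sup>+y. ennreal (norm (g (y, 0)) powr p) * ennreal V \<partial>lborel)"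
      by (intro nn_integral_mono mult_left_mono mass(2)) auto
    also have "... = (\<integral>\<^sup>+y. ennreal (norm (g (y, 0)) powr p) \<partial>lborel) * ennreal V"
      by (rule nn_integral_multc) measurable
    also have "... <= (ennreal (K1 * R) * Lp_mass p g) * ennreal V"
      by (intro mult_right_mono tr[rule_format] R g fin) auto
    also have "ennreal (2 powr p * V powr (p - 1)) * ... = ennreal (2 powr p * V powr (p - 1) * (K1 * R) * V) * Lp_mass p g"
      using V K1 R by (intro ennreal_mult_middle) auto
    also have "2 powr p * V powr (p - 1) * (K1 * R) * V = K * R" unfolding K_def by simp
    finally show ?thesis by (simp add: mult_left_mono)
  qed
  with K show ?thesis by blast
qed

text \<open>A Bernstein inequality from p-mass to L1 on the hyperplane: the weighted sum with
  constant weight 1, which varies with order M2 = 0.\<close>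

lemma trace_L1_le_1:
  fixes C :: "real => real"
  assumes p: "0 < p" "p <= 1" and C: "\<And>M. C M > 0"
  shows "\<exists>K>0. \<forall>R>0. \<forall>g::'a::euclidean_space \<times> real => complex. reproducible C R g -->
    Lp_mass p g < \<infinity> -->
    ennreal_powr (\<integral>\<^sup>+y. ennreal (norm (g (y, 0))) \<partial>lborel) p
      <= ennreal (K * R powr (real DIM('a) * (1 - p) + 1)) * Lp_mass p g"
proof -
  let ?M = "real DIM('a) + 1"
  let ?W = "decay_mass TYPE('a) ?M"
  have M0: "?M >= 0" by simp
  from trace_mean_value[where C=C and 'a='a, OF p(1) C M0] obtain K1 where K1: "K1 > 0" and
    mean: "\<forall>R>0. \<forall>g::'a \<times> real => complex. reproducible C R g --> Lp_mass p g < \<infinity> -->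
     (\<forall>y. ennreal (norm (g (y, 0)) powr p) <= ennreal (K1 * R ^ DIM('a)) *
       (\<integral>\<^sup>+z. slice_mass R p g z * ennreal (decay ?M R (y - z)) \<partial>lborel))" by (elim exE conjE)
  have W: "?W > 0" by (rule decay_mass_pos)
  have "ennreal_powr (\<integral>\<^sup>+y. ennreal (norm (g (y, 0))) \<partial>lborel) p
      <= ennreal (K1 * ?W powr p * R powr (real DIM('a) * (1 - p) + 1)) * Lp_mass p g"
    if R: "R > 0" and g: "reproducible C R g" and fin: "Lp_mass p g < \<infinity>"
    for R and g :: "'a \<times> real => complex"
  proof -
    have gm [measurable]: "g \<in> borel_measurable borel" by (rule reproducible_measurable[OF g])
    note [measurable] = slice_mass_measurable[OF gm] trace_section_measurable[OF gm]
    have "ennreal_powr (\<integral>\<^sup>+y. ennreal (norm (g (y, 0)) * 1) \<partial>lborel) p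
      <= ennreal (K1 * 1 powr p * ?W powr p * (R ^ DIM('a)) powr (1 - p)) *
       (\<integral>\<^sup>+z. slice_mass R p g z * ennreal (1 powr p) \<partial>lborel)"
    proof (rule weighted_sum_bound[where ?M2.0=0])
      show "ennreal (norm (g (y, 0)) powr p) <= ennreal (K1 * R ^ DIM('a)) *
          (\<integral>\<^sup>+z. slice_mass R p g z * ennreal (decay (0 * p + ?M) R (y - z)) \<partial>lborel)" for y
        using mean[rule_format, OF R g fin, of y] by simp
      show "1 <= 1 * 1 * (1 + R * norm (y - z)) powr 0" for y z :: 'a
      proof -
        have "1 + R * norm (y - z) > 0" using R by (simp add: add_pos_nonneg)
        then show ?thesis by simp
      qed
    qed (use p R K1 in auto)
    also have "... = ennreal (K1 * ?W powr p * (R ^ DIM('a)) powr (1 - p)) * (ennreal R * Lp_mass p g)"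
      by (simp add: slice_mass_integral[OF gm])
    also have "... = ennreal (K1 * ?W powr p * (R ^ DIM('a)) powr (1 - p) * R) * Lp_mass p g"
      using K1 W R by (subst mult.assoc[symmetric], subst ennreal_mult[symmetric]) auto
    also have "K1 * ?W powr p * (R ^ DIM('a)) powr (1 - p) * R = K1 * ?W powr p * R powr (real DIM('a) * (1 - p) + 1)"
      using R by (simp add: powr_add powr_realpow[symmetric] powr_powr)
    finally show ?thesis by simp
  qed
  moreover have "K1 * ?W powr p > 0" using K1 W by simp
  ultimately show ?thesis by blast
qed

section \<open>Trace estimates for all exponents\<close>

lemma ennreal_exponent_cases:
  assumes "0 < (p::ennreal)"
  obtains "p = \<infinity>" "enn2real (1 / p) = 0" "enn2real (min p 1) = 1"
  | t where "t > 0" "p = ennreal t" "enn2real p = t" "enn2real (1 / p) = 1 / t" "enn2real (min p 1) = min t 1" "p ~= \<infinity>"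
proof (cases p)
  case (real t)
  then have t: "t > 0" using assms by (simp add: ennreal_less_zero_iff)
  have "1 / p = ennreal (1 / t)" using t real divide_ennreal[of 1 t] by simp
  moreover have "min p 1 = ennreal (min t 1)" using t real by (simp add: min_def ennreal_le_1)
  ultimately show thesis using that(2)[of t] t real by simp
next
  case top
  have "min top 1 = (1::ennreal)" by (rule min_absorb2) simp
  then show thesis using that(1) top by simp
qed

lemma Lp_norm_ennreal:
  assumes "t > 0"
  shows "Lp_norm (ennreal t) g = ennreal_powr (Lp_mass t g) (1 / t)"
  using assms by (simp add: Lp_norm_def)

lemma norm_le_esssup:
  fixes g :: "'a::euclidean_space => complex"
  assumes "continuous_on UNIV g"
  shows "ennreal (norm (g x)) <= Lp_norm \<infinity> g"
proof (cases "Lp_norm \<infinity> g")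
  case (real e)
  have "AE x in lborel. ennreal (norm (g x)) <= Lp_norm \<infinity> g"
    unfolding Lp_norm_def using esssup_AE[of "\<lambda>x. ennreal (norm (g x))" lborel] by simp
  then have "AE x in lborel. norm (g x) <= e"
    unfolding real(2) using real(1) by simp
  then have "AE x in lborel. complex_of_real (max 0 (norm (g x) - e)) = 0"
    by (auto elim!: eventually_mono simp: max_def)
  moreover have "continuous_on UNIV (\<lambda>x. complex_of_real (max 0 (norm (g x) - e)))"
    using assms by (intro continuous_intros continuous_on_max)
  ultimately have "complex_of_real (max 0 (norm (g x) - e)) = 0"
    using continuous_AE_zero by blast
  then have "norm (g x) <= e" by (simp add: max_def split: if_splits)
  then show ?thesis unfolding real(2) by (rule ennreal_leI)
qed simp

text \<open>Unifies the ranges of p. Taking the root of order p turns d(1-p) into d(1/p-1), which is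
  s_p for p <= 1; for larger p and for infinite p the exponent is 0. A majorised u takes the place
  of the convolution because the pieces are only bounded by it.\<close>

lemma trace_convolution_Lp:
  fixes C C2 :: "real => real"
  assumes p: "0 < (p::ennreal)" and C: "\<And>M. C M > 0" and C2: "\<And>M. C2 M > 0" and A: "A >= 1"
  shows "\<exists>K>0. \<forall>R r (g::'a::euclidean_space \<times> real => complex) (\<kappa>::'a => complex) (u::'a => complex).
    R > 0 --> r > 0 --> r <= A * R --> reproducible C R g --> \<kappa> \<in> borel_measurable borel -->
    kernel_bound C2 r \<kappa> -->
    Lp_norm p g < \<infinity> --> u \<in> borel_measurable borel -->
    (\<forall>x. ennreal (norm (u x)) <= trace_conv g \<kappa> x) -->
    Lp_norm p u <= ennreal (K * R powr enn2real (1 / p) * (R / r) powr crit_gap TYPE('a) p) * Lp_norm p g"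
  using p
proof (cases rule: ennreal_exponent_cases)
  case 1
  let ?M = "real DIM('a) + 1"
  define V where "V = C2 ?M * decay_mass TYPE('a) ?M"
  have V: "V > 0" unfolding V_def using C2[of ?M] decay_mass_pos[of ?M, where 'a='a] by simp
  have "Lp_norm p u <= ennreal (V * R powr enn2real (1 / p) * (R / r) powr crit_gap TYPE('a) p) * Lp_norm p g"
    if R: "R > 0" and r: "r > 0" and g: "reproducible C R g" and \<kappa>m[measurable]: "\<kappa> \<in> borel_measurable borel"
      and \<kappa>: "kernel_bound C2 r \<kappa>"
      and u: "u \<in> borel_measurable borel" "\<forall>x. ennreal (norm (u x)) <= trace_conv g \<kappa> x"
    for R r and g :: "'a \<times> real => complex" and \<kappa> u :: "'a => complex"
  proof -
    have gc: "continuous_on UNIV g" using g unfolding reproducible_def by blast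
    note mass = kernel_mass(1)[OF r C2, of \<kappa>, OF \<kappa>[rule_format], folded V_def]
    have "ennreal (norm (u x)) <= ennreal V * Lp_norm p g" for x
    proof -
      have "ennreal (norm (u x)) <= (\<integral>\<^sup>+y. Lp_norm p g * ennreal (norm (\<kappa> (x - y))) \<partial>lborel)"
        unfolding 1(1) using norm_le_esssup[OF gc]
        by (intro order_trans[OF u(2)[rule_format]] nn_integral_mono) (auto simp: ennreal_mult intro!: mult_right_mono)
      also have "... = Lp_norm p g * (\<integral>\<^sup>+y. ennreal (norm (\<kappa> (x - y))) \<partial>lborel)"
        by (rule nn_integral_cmult) measurable
      also have "... <= Lp_norm p g * ennreal V" by (intro mult_left_mono mass) auto
      finally show ?thesis by (simp add: mult.commute)
    qed
    then have "Lp_norm p u <= ennreal V * Lp_norm p g"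
      unfolding 1(1) Lp_norm_def[of _ u] using u(1) by (auto intro!: esssup_I)
    then show ?thesis using R r V 1 by simp
  qed
  with V show ?thesis by blast
next
  case (2 t)
  define x where "x = real DIM('a) * (1 - min t 1)"
  have "\<exists>K>0. \<forall>R r (g::'a \<times> real => complex) (\<kappa>::'a => complex).
    R > 0 --> r > 0 --> r <= A * R --> reproducible C R g --> \<kappa> \<in> borel_measurable borel -->
    kernel_bound C2 r \<kappa> -->
    Lp_mass t g < \<infinity> -->
    (\<integral>\<^sup>+x. ennreal_powr (trace_conv g \<kappa> x) t \<partial>lborel)
     <= ennreal (K * (R / r) powr x * R) * Lp_mass t g"
  proof (cases "t <= 1")
    case True
    then have "x = real DIM('a) * (1 - t)" unfolding x_def by simp
    then show ?thesis using trace_convolution_le_1[where C=C and ?C2.0=C2 and 'a='a, OF 2(1) True C C2 A] by simp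
  next
    case False
    then have x: "x = 0" and t: "1 <= t" unfolding x_def by auto
    have "(R / r) powr x = 1" if "R > 0" "r > 0" for R r :: real unfolding x using that by simp
    with trace_convolution_ge_1[where C=C and ?C2.0=C2 and 'a='a, OF t C C2] show ?thesis
      by (elim exE conjE) (intro exI conjI, assumption, simp)
  qed
  then obtain K where K: "K > 0" and conv: "\<forall>R r (g::'a \<times> real => complex) (\<kappa>::'a => complex).
    R > 0 --> r > 0 --> r <= A * R --> reproducible C R g --> \<kappa> \<in> borel_measurable borel -->
    kernel_bound C2 r \<kappa> -->
    Lp_mass t g < \<infinity> -->
    (\<integral>\<^sup>+x. ennreal_powr (trace_conv g \<kappa> x) t \<partial>lborel)
     <= ennreal (K * (R / r) powr x * R) * Lp_mass t g"
    by (elim exE conjE)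
  have "Lp_norm p u <= ennreal (K powr (1 / t) * R powr enn2real (1 / p) * (R / r) powr crit_gap TYPE('a) p) * Lp_norm p g"
    if R: "R > 0" and r: "r > 0" "r <= A * R" and g: "reproducible C R g" and \<kappa>m: "\<kappa> \<in> borel_measurable borel"
      and \<kappa>: "kernel_bound C2 r \<kappa>" and fin: "Lp_norm p g < \<infinity>"
      and u: "u \<in> borel_measurable borel" "\<forall>x. ennreal (norm (u x)) <= trace_conv g \<kappa> x"
    for R r and g :: "'a \<times> real => complex" and \<kappa> u :: "'a => complex"
  proof -
    have fin': "Lp_mass t g < \<infinity>"
      using fin 2 by (simp add: Lp_norm_ennreal ennreal_powr_less_top[unfolded infinity_ennreal_def])
    have pos: "K * (R / r) powr x * R > 0" using K R r by simp
    have "Lp_mass t u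
      <= (\<integral>\<^sup>+x. ennreal_powr (trace_conv g \<kappa> x) t \<partial>lborel)"
    proof (intro nn_integral_mono)
      fix x
      show "ennreal (norm (u x) powr t) <= ennreal_powr (trace_conv g \<kappa> x) t"
        using ennreal_powr_mono[OF u(2)[rule_format, of x], of t] 2(1) by (simp add: ennreal_powr_ennreal)
    qed
    also have "... <= ennreal (K * (R / r) powr x * R) * Lp_mass t g"
      by (rule conv[rule_format]) (use R r g \<kappa>m \<kappa> fin' in auto)
    finally have "Lp_norm p u <= ennreal_powr (ennreal (K * (R / r) powr x * R) * Lp_mass t g) (1 / t)"
      using 2 by (auto simp: Lp_norm_ennreal intro!: ennreal_powr_mono)
    also have "... = ennreal ((K * (R / r) powr x * R) powr (1 / t)) * Lp_norm p g"
      using 2 by (simp add: ennreal_powr_cmult[OF pos] Lp_norm_ennreal)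
    also have "(K * (R / r) powr x * R) powr (1 / t) = K powr (1 / t) * R powr enn2real (1 / p) * (R / r) powr crit_gap TYPE('a) p"
    proof -
      have xt: "x * (1 / t) = real DIM('a) * (1 / min t 1 - 1)"
        unfolding x_def using 2(1) by (auto simp: min_def field_simps)
      have "(K * (R / r) powr x * R) powr (1 / t) = K powr (1 / t) * ((R / r) powr x) powr (1 / t) * R powr (1 / t)"
        using K R r by (simp add: powr_mult)
      then show ?thesis unfolding powr_powr xt 2(4) 2(5) by simp
    qed
    finally show ?thesis .
  qed
  moreover have "K powr (1 / t) > 0" using K by simp
  ultimately show ?thesis by blast
qed

text \<open>One number F bounds the test function both in supremum and in L1, so p < 1, p >= 1 and
  infinite p are served at once. It yields convergence of the trace series and the vanishing of
  pieces whose source has norm 0.\<close>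

lemma trace_pairing:
  fixes C :: "real => real"
  assumes p: "0 < (p::ennreal)" and C: "\<And>M. C M > 0"
  shows "\<exists>K>0. \<forall>R F (g::'a::euclidean_space \<times> real => complex) (\<phi>::'a => complex).
    R > 0 --> F > 0 --> reproducible C R g --> Lp_norm p g < \<infinity> --> \<phi> \<in> borel_measurable borel -->
    (\<forall>y. norm (\<phi> y) <= F) --> L1_mass \<phi> <= ennreal F -->
    trace_pair g \<phi>
     <= ennreal (K * F * R powr (enn2real (1 / p) + crit_gap TYPE('a) p)) * Lp_norm p g"
  using p
proof (cases rule: ennreal_exponent_cases)
  case 1
  have "trace_pair g \<phi>
     <= ennreal (1 * F * R powr (enn2real (1 / p) + crit_gap TYPE('a) p)) * Lp_norm p g"
    if R: "R > 0" and g: "reproducible C R g" and \<phi>[measurable]: "\<phi> \<in> borel_measurable borel"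
      and mass: "L1_mass \<phi> <= ennreal F"
    for R F and g :: "'a \<times> real => complex" and \<phi> :: "'a => complex"
  proof -
    have gc: "continuous_on UNIV g" using g unfolding reproducible_def by blast
    have "trace_pair g \<phi> <= (\<integral>\<^sup>+y. Lp_norm p g * ennreal (norm (\<phi> y)) \<partial>lborel)"
      unfolding 1(1) using norm_le_esssup[OF gc] by (intro nn_integral_mono) (auto simp: ennreal_mult intro!: mult_right_mono)
    also have "... = Lp_norm p g * L1_mass \<phi>" by (rule nn_integral_cmult) measurable
    also have "... <= Lp_norm p g * ennreal F" by (intro mult_left_mono mass) auto
    finally show ?thesis using R 1 by (simp add: mult.commute)
  qed
  then show ?thesis by (intro exI[of _ 1]) auto
next
  case (2 t)
  define x where "x = 1 + real DIM('a) * (1 - min t 1)"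
  have xt: "x * (1 / t) = enn2real (1 / p) + crit_gap TYPE('a) p"
    unfolding x_def 2(4) 2(5) using 2(1) by (auto simp: min_def field_simps)
  have "\<exists>K>0. \<forall>R F (g::'a \<times> real => complex) (\<phi>::'a => complex).
    R > 0 --> F > 0 --> reproducible C R g --> Lp_mass t g < \<infinity> --> \<phi> \<in> borel_measurable borel -->
    (\<forall>y. norm (\<phi> y) <= F) --> L1_mass \<phi> <= ennreal F -->
    ennreal_powr (trace_pair g \<phi>) t
     <= ennreal (K * F powr t * R powr x) * Lp_mass t g"
  proof (cases "t <= 1")
    case True
    then have x: "x = real DIM('a) * (1 - t) + 1" unfolding x_def by simp
    from trace_L1_le_1[where C=C and 'a='a, OF 2(1) True C] obtain K where K: "K > 0" and
      L1: "\<forall>R>0. \<forall>g::'a \<times> real => complex. reproducible C R g -->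
        Lp_mass t g < \<infinity> -->
        ennreal_powr (\<integral>\<^sup>+y. ennreal (norm (g (y, 0))) \<partial>lborel) t
          <= ennreal (K * R powr (real DIM('a) * (1 - t) + 1)) * Lp_mass t g"
      by (elim exE conjE)
    have "ennreal_powr (trace_pair g \<phi>) t
     <= ennreal (K * F powr t * R powr x) * Lp_mass t g"
      if R: "R > 0" and F: "F > 0" and g: "reproducible C R g" and fin: "Lp_mass t g < \<infinity>"
        and \<phi>: "\<forall>y. norm (\<phi> y) <= F"
      for R F and g :: "'a \<times> real => complex" and \<phi> :: "'a => complex"
    proof -
      note [measurable] = trace_section_measurable[OF reproducible_measurable[OF g]]
      have "trace_pair g \<phi> <= (\<integral>\<^sup>+y. ennreal F * ennreal (norm (g (y, 0))) \<partial>lborel)"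
        using F \<phi> by (intro nn_integral_mono) (auto simp: ennreal_mult[symmetric] mult.commute[of F] intro!: ennreal_leI mult_left_mono)
      also have "... = ennreal F * (\<integral>\<^sup>+y. ennreal (norm (g (y, 0))) \<partial>lborel)" by (rule nn_integral_cmult) measurable
      finally have "ennreal_powr (trace_pair g \<phi>) t
         <= ennreal_powr (ennreal F * (\<integral>\<^sup>+y. ennreal (norm (g (y, 0))) \<partial>lborel)) t"
        using 2(1) by (intro ennreal_powr_mono) auto
      also have "... = ennreal (F powr t) * ennreal_powr (\<integral>\<^sup>+y. ennreal (norm (g (y, 0))) \<partial>lborel) t"
        by (rule ennreal_powr_cmult[OF F])
      also have "... <= ennreal (F powr t) * (ennreal (K * R powr x) * Lp_mass t g)"
        unfolding x by (intro mult_left_mono L1[rule_format] R g fin) auto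
      also have "... = ennreal (K * F powr t * R powr x) * Lp_mass t g"
        using K by (subst mult.assoc[symmetric], subst ennreal_mult[symmetric]) (auto simp: mult_ac)
      finally show ?thesis .
    qed
    with K show ?thesis by blast
  next
    case False
    then have x: "x = 1" and t: "1 <= t" unfolding x_def by auto
    from trace_Lp[where C=C and 'a='a, OF 2(1) C] obtain K1 where K1: "K1 > 0" and
      tr: "\<forall>R>0. \<forall>g::'a \<times> real => complex. reproducible C R g -->
      Lp_mass t g < \<infinity> -->
      (\<integral>\<^sup>+y. ennreal (norm (g (y, 0)) powr t) \<partial>lborel) <= ennreal (K1 * R) * Lp_mass t g"
      by (elim exE conjE)
    have "ennreal_powr (trace_pair g \<phi>) t
     <= ennreal ((2 powr t * K1) * F powr t * R powr x) * Lp_mass t g"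
      if R: "R > 0" and F: "F > 0" and g: "reproducible C R g" and fin: "Lp_mass t g < \<infinity>"
        and [measurable]: "\<phi> \<in> borel_measurable borel"
        and \<phi>: "\<forall>y. norm (\<phi> y) <= F" and mass: "L1_mass \<phi> <= ennreal F"
      for R F and g :: "'a \<times> real => complex" and \<phi> :: "'a => complex"
    proof -
      note [measurable] = trace_section_measurable[OF reproducible_measurable[OF g]]
      have "ennreal_powr (trace_pair g \<phi>) t
        <= ennreal (2 powr t * F powr (t - 1)) * (\<integral>\<^sup>+y. ennreal (norm (g (y, 0)) powr t) * ennreal (norm (\<phi> y)) \<partial>lborel)"
        unfolding ennreal_mult[OF norm_ge_zero norm_ge_zero]
        by (rule weighted_jensen[OF _ _ _ t F mass]) auto
      also have "... <= ennreal (2 powr t * F powr (t - 1)) * (\<integral>\<^sup>+y. ennreal (norm (g (y, 0)) powr t) * ennreal F \<partial>lborel)"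
        using \<phi> by (intro mult_left_mono nn_integral_mono ennreal_leI) auto
      also have "(\<integral>\<^sup>+y. ennreal (norm (g (y, 0)) powr t) * ennreal F \<partial>lborel) = (\<integral>\<^sup>+y. ennreal (norm (g (y, 0)) powr t) \<partial>lborel) * ennreal F"
        by (rule nn_integral_multc) measurable
      also have "ennreal (2 powr t * F powr (t - 1)) * ...
         <= ennreal (2 powr t * F powr (t - 1)) * ((ennreal (K1 * R) * Lp_mass t g) * ennreal F)"
        by (intro mult_left_mono mult_right_mono tr[rule_format] R g fin) auto
      also have "... = ennreal (2 powr t * F powr (t - 1) * (K1 * R) * F) * Lp_mass t g"
        using K1 R F by (intro ennreal_mult_middle) auto
      also have "2 powr t * F powr (t - 1) * (K1 * R) * F = (2 powr t * K1) * F powr t * R powr x"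
        unfolding x using R F by (simp add: powr_diff)
      finally show ?thesis .
    qed
    moreover have "2 powr t * K1 > 0" using K1 by simp
    ultimately show ?thesis by blast
  qed
  then obtain K where K: "K > 0" and pr: "\<forall>R F (g::'a \<times> real => complex) (\<phi>::'a => complex).
    R > 0 --> F > 0 --> reproducible C R g --> Lp_mass t g < \<infinity> --> \<phi> \<in> borel_measurable borel -->
    (\<forall>y. norm (\<phi> y) <= F) --> L1_mass \<phi> <= ennreal F -->
    ennreal_powr (trace_pair g \<phi>) t
     <= ennreal (K * F powr t * R powr x) * Lp_mass t g"
    by (elim exE conjE)
  have "trace_pair g \<phi>
     <= ennreal (K powr (1 / t) * F * R powr (enn2real (1 / p) + crit_gap TYPE('a) p)) * Lp_norm p g"
    if R: "R > 0" and F: "F > 0" and g: "reproducible C R g" and fin: "Lp_norm p g < \<infinity>"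
      and \<phi>: "\<phi> \<in> borel_measurable borel" "\<forall>y. norm (\<phi> y) <= F" "L1_mass \<phi> <= ennreal F"
    for R F and g :: "'a \<times> real => complex" and \<phi> :: "'a => complex"
  proof -
    have fin': "Lp_mass t g < \<infinity>"
      using fin 2 by (simp add: Lp_norm_ennreal ennreal_powr_less_top[unfolded infinity_ennreal_def])
    have pos: "K * F powr t * R powr x > 0" using K R F by simp
    have "ennreal_powr (trace_pair g \<phi>) t
     <= ennreal (K * F powr t * R powr x) * Lp_mass t g"
      by (rule pr[rule_format]) (use R F g fin' \<phi> in auto)
    then have "ennreal_powr (ennreal_powr (trace_pair g \<phi>) t) (1 / t)
      <= ennreal_powr (ennreal (K * F powr t * R powr x) * Lp_mass t g) (1 / t)"
      using 2(1) by (intro ennreal_powr_mono) auto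
    then have "trace_pair g \<phi>
      <= ennreal ((K * F powr t * R powr x) powr (1 / t)) * Lp_norm p g"
      using 2 by (simp add: ennreal_powr_powr ennreal_powr_cmult[OF pos] Lp_norm_ennreal)
    moreover have "(K * F powr t * R powr x) powr (1 / t) = K powr (1 / t) * F * R powr (enn2real (1 / p) + crit_gap TYPE('a) p)"
    proof -
      have "(K * F powr t * R powr x) powr (1 / t) = K powr (1 / t) * (F powr t) powr (1 / t) * (R powr x) powr (1 / t)"
        using K F R by (simp add: powr_mult)
      then show ?thesis unfolding powr_powr xt using 2(1) F by simp
    qed
    ultimately show ?thesis by simp
  qed
  moreover have "K powr (1 / t) > 0" using K by simp
  ultimately show ?thesis by blast
qed

section \<open>Summation over cubes and bookkeeping of exponents\<close>

section \<open>Sums over the lattice\<close>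

lemma countable_int_lattice: "countable (int_lattice :: 'a::euclidean_space set)"
proof -
  have "(int_lattice :: 'a set) \<subseteq> (\<Union>n::nat. {k::'a. k \<in> int_lattice \<and> norm k <= real n})"
  proof
    fix k :: 'a assume k: "k \<in> int_lattice"
    obtain n :: nat where "norm k <= real n" using real_arch_simple[of "norm k"] by auto
    with k show "k \<in> (\<Union>n::nat. {k::'a. k \<in> int_lattice \<and> norm k <= real n})" by auto
  qed
  moreover have "countable (\<Union>n::nat. {k::'a. k \<in> int_lattice \<and> norm k <= real n})"
    using int_lattice_finite_ball by (auto intro: countable_finite)
  ultimately show ?thesis by (rule countable_subset)
qed

text \<open>Turns the lattice sums of the definitions into integrals for counting measure, so that
  Jensen and Fubini apply to them as to Lebesgue integrals.\<close>

lemma infsum_ennreal_eq_nn_integral: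
  fixes f :: "'i => ennreal"
  assumes "countable I" shows "infsum f I = (\<integral>\<^sup>+i. f i \<partial>count_space I)"
proof (cases "finite I")
  case True
  then show ?thesis by (simp add: nn_integral_count_space_finite)
next
  case False
  note bij = bij_betw_from_nat_into[OF assms False]
  have "infsum f I = infsum (\<lambda>n. f (from_nat_into I n)) UNIV"
    by (rule infsum_reindex_bij_betw[OF bij, symmetric])
  also have "... = (\<Sum>n. f (from_nat_into I n))"
  proof -
    have "((\<lambda>n. f (from_nat_into I n)) has_sum infsum (\<lambda>n. f (from_nat_into I n)) UNIV) UNIV"
      by (rule has_sum_infsum) (rule nonneg_summable_on_complete, simp)
    from has_sum_imp_sums[OF this] show ?thesis by (simp add: sums_iff)
  qed
  also have "... = (\<integral>\<^sup>+n. f (from_nat_into I n) \<partial>count_space UNIV)"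
    by (rule nn_integral_count_space_nat[symmetric])
  also have "... = (\<integral>\<^sup>+i. f i \<partial>count_space I)"
    by (rule nn_integral_bij_count_space[OF bij])
  finally show ?thesis .
qed

lemma summable_on_of_nn_integral:
  fixes c :: "'i => complex"
  assumes "(\<integral>\<^sup>+i. ennreal (norm (c i)) \<partial>count_space I) < \<infinity>"
  shows "c summable_on I" and "ennreal (norm (infsum c I)) <= (\<integral>\<^sup>+i. ennreal (norm (c i)) \<partial>count_space I)"
proof -
  obtain B where B: "B >= 0" "(\<integral>\<^sup>+i. ennreal (norm (c i)) \<partial>count_space I) = ennreal B"
    using assms by (cases "(\<integral>\<^sup>+i. ennreal (norm (c i)) \<partial>count_space I)") auto
  have le: "(\<Sum>i\<in>F. norm (c i)) <= B" if F: "finite F" "F \<subseteq> I" for F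
  proof -
    have "ennreal (\<Sum>i\<in>F. norm (c i)) = (\<integral>\<^sup>+i. ennreal (norm (c i)) \<partial>count_space F)"
      using F by (simp add: nn_integral_count_space_finite)
    also have "... = (\<integral>\<^sup>+i. ennreal (norm (c i)) * indicator F i \<partial>count_space I)"
      using nn_integral_count_space'[of F I "\<lambda>i. ennreal (norm (c i)) * indicator F i"] F
      by (simp add: nn_integral_count_space_finite)
    also have "... <= (\<integral>\<^sup>+i. ennreal (norm (c i)) \<partial>count_space I)"
      by (intro nn_integral_mono) (auto simp: indicator_def)
    finally show ?thesis using B by simp
  qed
  have abs: "(\<lambda>i. norm (c i)) summable_on I"
    by (rule nonneg_bdd_above_summable_on) (use le in \<open>auto simp: bdd_above_def\<close>)
  then show "c summable_on I" by (rule abs_summable_summable)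
  have "norm (infsum c I) <= infsum (\<lambda>i. norm (c i)) I" by (rule norm_infsum_bound[OF abs])
  also have "... <= B" by (rule infsum_le_finite_sums[OF abs le])
  finally show "ennreal (norm (infsum c I)) <= (\<integral>\<^sup>+i. ennreal (norm (c i)) \<partial>count_space I)"
    unfolding B(2) by (rule ennreal_leI)
qed

text \<open>
  The \<open>r\<close>-triangle inequality moves the power inside; Jensen's inequality for the weights \<open>\<nu> k powr r\<close> then raises
  the exponent from \<open>r\<close> to \<open>p\<close> without a loss depending on the number of terms.
\<close>

lemma Lp_norm_sum_bound:
  fixes u :: "'k => 'a::euclidean_space => real" and \<nu> :: "'k => real" and U :: "'a => complex"
  assumes I: "countable I" and r: "0 < r" "r <= 1" and p: "ennreal r <= p"
    and um [measurable]: "\<And>k. u k \<in> borel_measurable borel" and u: "\<And>k x. u k x >= 0"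
    and \<nu>: "\<And>k. \<nu> k >= 0" and Lp: "\<And>k. k \<in> I ==> Lp_norm p (\<lambda>x. of_real (u k x)) <= ennreal (\<nu> k)"
    and zero: "\<And>k x. k \<in> I ==> \<nu> k = 0 ==> u k x = 0"
    and Um: "U \<in> borel_measurable borel" and U: "\<And>x. ennreal (norm (U x)) <= (\<integral>\<^sup>+k. ennreal (u k x) \<partial>count_space I)"
    and \<Theta>: "\<Theta> > 0" "(\<integral>\<^sup>+k. ennreal (\<nu> k powr r) \<partial>count_space I) <= ennreal \<Theta>"
  shows "Lp_norm p U <= ennreal ((2 * \<Theta>) powr (1 / r))"
proof -
  have "0 < ennreal r" using r by simp
  then have "0 < p" using p by (rule order.strict_trans2)
  then show ?thesis
  proof (cases rule: ennreal_exponent_cases)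
    case 1
    have "ennreal_powr (\<integral>\<^sup>+k. ennreal (\<nu> k) \<partial>count_space I) r <= ennreal \<Theta>"
      using power_subadditive[of I \<nu> r] \<nu> r \<Theta>(2) by (meson order_trans)
    then have "ennreal_powr (ennreal_powr (\<integral>\<^sup>+k. ennreal (\<nu> k) \<partial>count_space I) r) (1 / r) <= ennreal_powr (ennreal \<Theta>) (1 / r)"
      using r by (intro ennreal_powr_mono) auto
    then have sum: "(\<integral>\<^sup>+k. ennreal (\<nu> k) \<partial>count_space I) <= ennreal (\<Theta> powr (1 / r))"
      using r \<Theta>(1) by (simp add: ennreal_powr_powr ennreal_powr_ennreal)
    have "AE x in lborel. ennreal (u k x) <= ennreal (\<nu> k)" if "k \<in> I" for k
    proof -
      have "AE x in lborel. ennreal (norm (complex_of_real (u k x))) <= Lp_norm p (\<lambda>x. complex_of_real (u k x))"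
        unfolding 1 Lp_norm_def using esssup_AE[of "\<lambda>x. ennreal (norm (complex_of_real (u k x)))" lborel] by simp
      then show ?thesis
        using Lp[OF that] u by (auto elim!: eventually_mono intro: order_trans)
    qed
    then have "AE x in lborel. \<forall>k\<in>I. ennreal (u k x) <= ennreal (\<nu> k)"
      by (simp add: AE_ball_countable[OF I])
    then have "AE x in lborel. ennreal (norm (U x)) <= ennreal (\<Theta> powr (1 / r))"
    proof (rule eventually_mono)
      fix x assume "\<forall>k\<in>I. ennreal (u k x) <= ennreal (\<nu> k)"
      then have "(\<integral>\<^sup>+k. ennreal (u k x) \<partial>count_space I) <= (\<integral>\<^sup>+k. ennreal (\<nu> k) \<partial>count_space I)"
        by (intro nn_integral_mono) auto
      with U[of x] sum show "ennreal (norm (U x)) <= ennreal (\<Theta> powr (1 / r))" by (meson order_trans)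
    qed
    then have "Lp_norm p U <= ennreal (\<Theta> powr (1 / r))"
      unfolding 1 Lp_norm_def using Um by (auto intro!: esssup_I)
    also have "... <= ennreal ((2 * \<Theta>) powr (1 / r))"
      using \<Theta>(1) r by (intro ennreal_leI powr_mono2) auto
    finally show ?thesis .
  next
    case (2 t)
    have rt: "r <= t" using p 2 r by (simp add: ennreal_le_iff)
    define P where "P = t / r"
    have P: "P >= 1" unfolding P_def using rt r by simp
    have rP: "r * P = t" unfolding P_def using r by simp
    have uint: "(\<integral>\<^sup>+x. ennreal (u k x powr t) \<partial>lborel) <= ennreal (\<nu> k powr t)" if k: "k \<in> I" for k
    proof -
      have "Lp_norm p (\<lambda>x. complex_of_real (u k x)) = ennreal_powr (\<integral>\<^sup>+x. ennreal (u k x powr t) \<partial>lborel) (1 / t)"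
        unfolding 2(2) Lp_norm_ennreal[OF 2(1)] using u by simp
      then have "ennreal_powr (ennreal_powr (\<integral>\<^sup>+x. ennreal (u k x powr t) \<partial>lborel) (1 / t)) t <= ennreal_powr (ennreal (\<nu> k)) t"
        using Lp[OF k] 2(1) by (intro ennreal_powr_mono) auto
      then show ?thesis using 2(1) \<nu>[of k] by (simp add: ennreal_powr_powr ennreal_powr_ennreal)
    qed
    let ?w = "\<lambda>k. ennreal (\<nu> k powr r)"
    have pt: "ennreal (norm (U x) powr t) <= ennreal (2 powr P * \<Theta> powr (P - 1)) *
        (\<integral>\<^sup>+k. ennreal (\<nu> k powr (r - t)) * ennreal (u k x powr t) \<partial>count_space I)" for x
    proof -
      have "ennreal_powr (\<integral>\<^sup>+k. ennreal (u k x) \<partial>count_space I) r <= (\<integral>\<^sup>+k. ennreal (u k x powr r) \<partial>count_space I)"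
        using u r by (intro power_subadditive) auto
      \<comment> \<open>Where \<nu> k = 0 the division yields 0, which is correct because u k x
        vanishes there by \<open>zero\<close>.\<close>
      also have "... = (\<integral>\<^sup>+k. ennreal (u k x powr r / \<nu> k powr r) * ?w k \<partial>count_space I)"
        using zero r by (intro nn_integral_cong) (auto simp: ennreal_mult[symmetric])
      finally have le: "ennreal_powr (\<integral>\<^sup>+k. ennreal (u k x) \<partial>count_space I) r
          <= (\<integral>\<^sup>+k. ennreal (u k x powr r / \<nu> k powr r) * ?w k \<partial>count_space I)" .
      have "ennreal (norm (U x) powr t) = ennreal_powr (ennreal (norm (U x))) t"
        by (simp add: ennreal_powr_ennreal)
      also have "... <= ennreal_powr (\<integral>\<^sup>+k. ennreal (u k x) \<partial>count_space I) t"
        using 2(1) by (intro ennreal_powr_mono U) auto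
      also have "... = ennreal_powr (ennreal_powr (\<integral>\<^sup>+k. ennreal (u k x) \<partial>count_space I) r) P"
        by (simp add: ennreal_powr_powr rP)
      also have "... <= ennreal_powr (\<integral>\<^sup>+k. ennreal (u k x powr r / \<nu> k powr r) * ?w k \<partial>count_space I) P"
        using P by (intro ennreal_powr_mono le) auto
      also have "... <= ennreal (2 powr P * \<Theta> powr (P - 1)) * (\<integral>\<^sup>+k. ennreal ((u k x powr r / \<nu> k powr r) powr P) * ?w k \<partial>count_space I)"
        by (rule weighted_jensen[OF _ _ _ P \<Theta>]) auto
      also have "(\<integral>\<^sup>+k. ennreal ((u k x powr r / \<nu> k powr r) powr P) * ?w k \<partial>count_space I)
          = (\<integral>\<^sup>+k. ennreal (\<nu> k powr (r - t)) * ennreal (u k x powr t) \<partial>count_space I)"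
      proof (rule nn_integral_cong)
        fix k assume "k \<in> space (count_space I)"
        show "ennreal ((u k x powr r / \<nu> k powr r) powr P) * ?w k = ennreal (\<nu> k powr (r - t)) * ennreal (u k x powr t)"
        proof (cases "\<nu> k = 0")
          case False
          then have "\<nu> k > 0" using \<nu>[of k] by simp
          then have "(u k x powr r / \<nu> k powr r) powr P * \<nu> k powr r = \<nu> k powr (r - t) * u k x powr t"
            using u[of k x] by (simp add: powr_divide powr_powr rP powr_diff)
          then show ?thesis by (simp add: ennreal_mult[symmetric])
        qed simp
      qed
      finally show ?thesis .
    qed
    have "Lp_mass t U <= (\<integral>\<^sup>+x. ennreal (2 powr P * \<Theta> powr (P - 1)) *
        (\<integral>\<^sup>+k. ennreal (\<nu> k powr (r - t)) * ennreal (u k x powr t) \<partial>count_space I) \<partial>lborel)"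
      by (intro nn_integral_mono pt)
    also have "... = ennreal (2 powr P * \<Theta> powr (P - 1)) *
        (\<integral>\<^sup>+x. (\<integral>\<^sup>+k. ennreal (\<nu> k powr (r - t)) * ennreal (u k x powr t) \<partial>count_space I) \<partial>lborel)"
    proof (rule nn_integral_cmult)
      \<comment> \<open>Measurability in x of a counting integral in k is read off from the
        enumeration of I as a series.\<close>
      have "(\<lambda>x. \<Sum>\<^sub>\<infinity>k\<in>I. ennreal (\<nu> k powr (r - t)) * ennreal (u k x powr t)) \<in> borel_measurable borel"
      proof (cases "finite I")
        case True
        then show ?thesis by simp
      next
        case False
        have "(\<Sum>\<^sub>\<infinity>k\<in>I. ennreal (\<nu> k powr (r - t)) * ennreal (u k x powr t))
            = (\<Sum>n. ennreal (\<nu> (from_nat_into I n) powr (r - t)) * ennreal (u (from_nat_into I n) x powr t))" for x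
          using infsum_ennreal_eq_nn_integral[OF I]
            nn_integral_bij_count_space[OF bij_betw_from_nat_into[OF I False], symmetric]
          by (simp add: nn_integral_count_space_nat)
        then show ?thesis by simp
      qed
      then show "(\<lambda>x. \<integral>\<^sup>+k. ennreal (\<nu> k powr (r - t)) * ennreal (u k x powr t) \<partial>count_space I) \<in> borel_measurable lborel"
        by (simp add: infsum_ennreal_eq_nn_integral[OF I])
    qed
    also have "(\<integral>\<^sup>+x. (\<integral>\<^sup>+k. ennreal (\<nu> k powr (r - t)) * ennreal (u k x powr t) \<partial>count_space I) \<partial>lborel)
      = (\<integral>\<^sup>+k. (\<integral>\<^sup>+x. ennreal (\<nu> k powr (r - t)) * ennreal (u k x powr t) \<partial>lborel) \<partial>count_space I)"
      by (rule nn_integral_count_space_nn_integral[OF I]) simp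
    also have "... <= (\<integral>\<^sup>+k. ennreal (\<nu> k powr r) \<partial>count_space I)"
    proof (rule nn_integral_mono)
      fix k assume "k \<in> space (count_space I)"
      then have k: "k \<in> I" by simp
      have "(\<integral>\<^sup>+x. ennreal (\<nu> k powr (r - t)) * ennreal (u k x powr t) \<partial>lborel)
        = ennreal (\<nu> k powr (r - t)) * (\<integral>\<^sup>+x. ennreal (u k x powr t) \<partial>lborel)"
        by (rule nn_integral_cmult) simp
      also have "... <= ennreal (\<nu> k powr (r - t)) * ennreal (\<nu> k powr t)"
        by (intro mult_left_mono uint k) auto
      also have "... = ennreal (\<nu> k powr r)"
        by (simp add: ennreal_mult[symmetric] powr_add[symmetric])
      finally show "(\<integral>\<^sup>+x. ennreal (\<nu> k powr (r - t)) * ennreal (u k x powr t) \<partial>lborel) <= ennreal (\<nu> k powr r)" .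
    qed
    also have "... <= ennreal \<Theta>" by (rule \<Theta>(2))
    also have "ennreal (2 powr P * \<Theta> powr (P - 1)) * ennreal \<Theta> = ennreal ((2 * \<Theta>) powr P)"
      using \<Theta>(1) by (simp add: ennreal_mult[symmetric] powr_mult powr_diff)
    finally have "Lp_mass t U <= ennreal ((2 * \<Theta>) powr P)"
      by (simp add: mult_left_mono)
    then have "Lp_norm p U <= ennreal_powr (ennreal ((2 * \<Theta>) powr P)) (1 / t)"
      unfolding 2(2) Lp_norm_ennreal[OF 2(1)] using 2(1) by (intro ennreal_powr_mono) auto
    also have "... = ennreal ((2 * \<Theta>) powr (1 / r))"
      using 2(1) r by (simp add: ennreal_powr_ennreal powr_powr P_def)
    finally show ?thesis .
  qed
qed

definition lq_norm :: "ennreal => 'l set => ('l => ennreal) => ennreal" where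
  "lq_norm q L N = (if q = \<infinity> then (SUP l\<in>L. N l)
     else ennreal_powr (\<integral>\<^sup>+l. ennreal_powr (N l) (enn2real q) \<partial>count_space L) (1 / enn2real q))"

text \<open>B is the matrix from source coefficients a to target terms N. Jensen in k with the
  weights a^r raises the exponent from r to q; after exchanging the sums only the column sums over l
  for fixed k occur, and these are bounded by C. The bound on N is stated for every admissible
  \<Theta> because it comes from a quasi-norm estimate that demands a positive one.\<close>

lemma lq_norm_sum_bound:
  fixes a :: "'k => real" and B :: "'l => 'k => real"
  assumes I: "countable I" and L: "countable L" and r: "0 < r" "r <= 1" and q: "ennreal r <= q"
    and a: "\<And>k. a k >= 0" and B: "\<And>l k. B l k >= 0" and A: "A > 0" "(\<integral>\<^sup>+k. ennreal (a k powr r) \<partial>count_space I) <= ennreal A"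
    and N: "\<And>l \<Theta>. l \<in> L ==> \<Theta> > 0 ==> (\<integral>\<^sup>+k. ennreal ((B l k * a k) powr r) \<partial>count_space I) <= ennreal \<Theta> ==>
        N l <= ennreal ((2 * \<Theta>) powr (1 / r))"
    and C: "C > 0"
    and Bq: "\<And>k. k \<in> I ==> q ~= \<infinity> ==> (\<integral>\<^sup>+l. ennreal (B l k powr enn2real q) \<partial>count_space L) <= ennreal (C powr enn2real q)"
    and Binf: "\<And>l k. l \<in> L ==> k \<in> I ==> q = \<infinity> ==> B l k <= C"
  shows "lq_norm q L N <= ennreal (4 powr (1 / r) * C * A powr (1 / r))"
proof -
  have "0 < ennreal r" using r by simp
  then have "0 < q" using q by (rule order.strict_trans2)
  then show ?thesis
  proof (cases rule: ennreal_exponent_cases)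
    case 1
    have "N l <= ennreal (4 powr (1 / r) * C * A powr (1 / r))" if l: "l \<in> L" for l
    proof -
      have "(\<integral>\<^sup>+k. ennreal ((B l k * a k) powr r) \<partial>count_space I) <= (\<integral>\<^sup>+k. ennreal (C powr r) * ennreal (a k powr r) \<partial>count_space I)"
      proof (rule nn_integral_mono)
        fix k assume "k \<in> space (count_space I)"
        then have "(B l k * a k) powr r <= (C * a k) powr r"
          using Binf[OF l _ 1(1), of k] a[of k] B[of l k] r by (intro powr_mono2 mult_right_mono) auto
        then show "ennreal ((B l k * a k) powr r) <= ennreal (C powr r) * ennreal (a k powr r)"
          using C a[of k] by (simp add: powr_mult ennreal_mult[symmetric] ennreal_leI)
      qed
      also have "... = ennreal (C powr r) * (\<integral>\<^sup>+k. ennreal (a k powr r) \<partial>count_space I)"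
        by (rule nn_integral_cmult) simp
      also have "... <= ennreal (C powr r) * ennreal A" by (intro mult_left_mono A) auto
      also have "... = ennreal (C powr r * A)" using A by (simp add: ennreal_mult)
      finally have "N l <= ennreal ((2 * (C powr r * A)) powr (1 / r))"
        using C A by (intro N[OF l]) auto
      also have "(2 * (C powr r * A)) powr (1 / r) = 2 powr (1 / r) * C * A powr (1 / r)"
        using C A r by (simp add: powr_mult powr_powr)
      also have "... <= 4 powr (1 / r) * C * A powr (1 / r)"
        using C r by (intro mult_right_mono powr_mono2) auto
      finally show ?thesis by (simp add: ennreal_leI)
    qed
    then show ?thesis unfolding lq_norm_def 1 by (auto intro: SUP_least)
  next
    case (2 t)
    have rt: "r <= t" using q 2 r by (simp add: ennreal_le_iff)
    define P where "P = t / r"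
    have P: "P >= 1" unfolding P_def using rt r by simp
    have rP: "r * P = t" unfolding P_def using r by simp
    have Nl: "ennreal_powr (N l) t <= ennreal (2 powr P * (2 powr P * A powr (P - 1))) *
        (\<integral>\<^sup>+k. ennreal (B l k powr t) * ennreal (a k powr r) \<partial>count_space I)" if l: "l \<in> L" for l
    proof -
      let ?T = "\<integral>\<^sup>+k. ennreal ((B l k * a k) powr r) \<partial>count_space I"
      have Teq: "?T = (\<integral>\<^sup>+k. ennreal (B l k powr r) * ennreal (a k powr r) \<partial>count_space I)"
        using a B by (intro nn_integral_cong) (simp add: powr_mult ennreal_mult)
      have jens: "ennreal_powr ?T P <= ennreal (2 powr P * A powr (P - 1)) * (\<integral>\<^sup>+k. ennreal (B l k powr t) * ennreal (a k powr r) \<partial>count_space I)"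
        using weighted_jensen[of "\<lambda>k. B l k powr r" "count_space I" "\<lambda>k. ennreal (a k powr r)" P A, OF _ _ _ P A]
        unfolding Teq by (simp add: powr_powr rP)
      have "ennreal_powr (N l) t <= ennreal (2 powr P) * ennreal_powr ?T P"
      proof (cases ?T)
        case top
        then show ?thesis by (simp add: ennreal_mult_top)
      next
        case (real T)
        show ?thesis
        proof (cases "T = 0")
          case False
          then have "N l <= ennreal ((2 * T) powr (1 / r))" using real by (intro N[OF l]) auto
          then have "ennreal_powr (N l) t <= ennreal_powr (ennreal ((2 * T) powr (1 / r))) t"
            using 2(1) by (intro ennreal_powr_mono) auto
          also have "... = ennreal ((2 * T) powr P)" by (simp add: ennreal_powr_ennreal powr_powr P_def)
          also have "... = ennreal (2 powr P) * ennreal_powr ?T P"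
            using real by (simp add: powr_mult ennreal_mult ennreal_powr_ennreal)
          finally show ?thesis .
        next
          case True
          \<comment> \<open>A vanishing sum is reached through the positive values \<Theta> = e^r /
            2 with arbitrary e.\<close>
          have "N l <= 0 + ennreal e" if e: "e > 0" for e
          proof -
            have "N l <= ennreal ((2 * (e powr r / 2)) powr (1 / r))"
              using e real True by (intro N[OF l]) auto
            then show ?thesis using e r by (simp add: powr_powr)
          qed
          then have "N l <= 0" by (rule ennreal_le_epsilon)
          then show ?thesis by simp
        qed
      qed
      also have "... <= ennreal (2 powr P) * (ennreal (2 powr P * A powr (P - 1)) * (\<integral>\<^sup>+k. ennreal (B l k powr t) * ennreal (a k powr r) \<partial>count_space I))"
        by (intro mult_left_mono jens) auto
      also have "... = ennreal (2 powr P * (2 powr P * A powr (P - 1))) * (\<integral>\<^sup>+k. ennreal (B l k powr t) * ennreal (a k powr r) \<partial>count_space I)"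
        by (simp add: mult.assoc[symmetric] ennreal_mult[symmetric])
      finally show ?thesis .
    qed
    have "(\<integral>\<^sup>+l. ennreal_powr (N l) t \<partial>count_space L)
      <= (\<integral>\<^sup>+l. ennreal (2 powr P * (2 powr P * A powr (P - 1))) *
        (\<integral>\<^sup>+k. ennreal (B l k powr t) * ennreal (a k powr r) \<partial>count_space I) \<partial>count_space L)"
      by (intro nn_integral_mono Nl) simp
    also have "... = ennreal (2 powr P * (2 powr P * A powr (P - 1))) *
        (\<integral>\<^sup>+l. (\<integral>\<^sup>+k. ennreal (B l k powr t) * ennreal (a k powr r) \<partial>count_space I) \<partial>count_space L)"
      by (rule nn_integral_cmult) simp
    also have "(\<integral>\<^sup>+l. (\<integral>\<^sup>+k. ennreal (B l k powr t) * ennreal (a k powr r) \<partial>count_space I) \<partial>count_space L)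
       = (\<integral>\<^sup>+k. (\<integral>\<^sup>+l. ennreal (B l k powr t) * ennreal (a k powr r) \<partial>count_space L) \<partial>count_space I)"
      by (rule nn_integral_count_space_nn_integral[OF I]) simp
    also have "... <= (\<integral>\<^sup>+k. ennreal (C powr t) * ennreal (a k powr r) \<partial>count_space I)"
    proof (rule nn_integral_mono)
      fix k assume "k \<in> space (count_space I)"
      then have k: "k \<in> I" by simp
      have "(\<integral>\<^sup>+l. ennreal (B l k powr t) * ennreal (a k powr r) \<partial>count_space L)
         = (\<integral>\<^sup>+l. ennreal (B l k powr t) \<partial>count_space L) * ennreal (a k powr r)"
        by (rule nn_integral_multc) simp
      also have "... <= ennreal (C powr t) * ennreal (a k powr r)"
        using Bq[OF k] 2 by (intro mult_right_mono) auto
      finally show "(\<integral>\<^sup>+l. ennreal (B l k powr t) * ennreal (a k powr r) \<partial>count_space L) <= ennreal (C powr t) * ennreal (a k powr r)" .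
    qed
    also have "... = ennreal (C powr t) * (\<integral>\<^sup>+k. ennreal (a k powr r) \<partial>count_space I)"
      by (rule nn_integral_cmult) simp
    also have "... <= ennreal (C powr t) * ennreal A" by (intro mult_left_mono A) auto
    also have "ennreal (2 powr P * (2 powr P * A powr (P - 1))) * (ennreal (C powr t) * ennreal A) = ennreal (4 powr P * C powr t * A powr P)"
    proof -
      have "2 powr P * (2 powr P * A powr (P - 1)) * (C powr t * A) = 4 powr P * C powr t * A powr P"
        using A(1) powr_mult[of 2 2 P] by (simp add: powr_diff)
      then show ?thesis using A(1) by (simp add: ennreal_mult[symmetric])
    qed
    finally have "(\<integral>\<^sup>+l. ennreal_powr (N l) t \<partial>count_space L) <= ennreal (4 powr P * C powr t * A powr P)"
      by (simp add: mult_left_mono)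
    then have "lq_norm q L N <= ennreal_powr (ennreal (4 powr P * C powr t * A powr P)) (1 / t)"
      unfolding lq_norm_def 2(3) using 2(1) 2(6) by (auto intro!: ennreal_powr_mono)
    also have "... = ennreal (4 powr (1 / r) * C * A powr (1 / r))"
      using 2(1) C A(1) r by (simp add: ennreal_powr_ennreal powr_mult powr_powr P_def)
    finally show ?thesis .
  qed
qed

lemma modulation_norm_eq:
  "modulation_norm \<eta> \<rho> \<alpha> s p q f =
     lq_norm q int_lattice (\<lambda>k. ennreal (jbracket k powr (s / (1 - \<alpha>))) * Lp_norm p (alpha_box \<eta> \<rho> \<alpha> k f))"
proof (cases "q = \<infinity>")
  case False
  have "ennreal (jbracket k powr (enn2real q * s / (1 - \<alpha>))) * ennreal_powr X (enn2real q)
    = ennreal_powr (ennreal (jbracket k powr (s / (1 - \<alpha>))) * X) (enn2real q)" for k :: 'a and X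
  proof -
    have "jbracket k powr (s / (1 - \<alpha>)) > 0" using jbracket_pos[of k] by simp
    from ennreal_powr_cmult[OF this, of X "enn2real q"] show ?thesis
      by (simp add: powr_powr mult.commute)
  qed
  then show ?thesis
    using False unfolding modulation_norm_def lq_norm_def
    by (simp add: infsum_ennreal_eq_nn_integral[OF countable_int_lattice])
qed (simp add: modulation_norm_def lq_norm_def)

section \<open>The exponents\<close>

text \<open>The column condition of the summation lemma for the entries K^a <l>^b, with K standing
  for the bracket of k, uniformly in all admissible positions v of the projected center.\<close>

definition (in alpha_covering) exponent_bound ::
    "'a::euclidean_space itself => ennreal => real => real => real => real => bool" where
  "exponent_bound _ q C0 a b C \<longleftrightarrow> (\<forall>K\<ge>1. \<forall>v::'a. norm v <= K powr (1 + \<beta>) -->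
     (q ~= \<infinity> --> (\<Sum>l\<in>touching C0 K v. (K powr a * jbracket l powr b) powr enn2real q) <= C powr enn2real q) \<and>
     (q = \<infinity> --> (\<forall>l\<in>touching C0 K v. K powr a * jbracket l powr b <= C)))"

text \<open>The place where the three cases of the loss are decided. The lower bound on s' is what
  makes the trace series converge; the column bound is what the target norm asks for.\<close>

lemma (in alpha_covering) exponent_sum:
  fixes q :: ennreal and s \<epsilon> sp e C0 :: real
  assumes n: "DIM('a::euclidean_space) = n - 1" "n >= 2" and q: "0 < q" and \<epsilon>: "\<epsilon> > 0" and C0: "C0 >= 0"
    and sp: "sp = s_crit n p" and e: "e = enn2real (1 / p)"
    and s: "s < \<alpha> * (real n - 1) * enn2real (1 / q) + \<alpha> * s_crit n p"
    and s': "s' = s + trace_loss n \<alpha> p q s \<epsilon>"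
  shows "\<alpha> * (e + sp) <= s'"
    and "\<exists>C>0. exponent_bound TYPE('a) q C0 (\<beta> * (e + sp) - s' / (1 - \<alpha>)) (s / (1 - \<alpha>) - \<beta> * sp) C" (is "\<exists>C>0. ?B C")
proof -
  let ?d = "real DIM('a)"
  have d: "real n - 1 = ?d" using n by simp
  have a1: "1 - \<alpha> > 0" using \<alpha> by simp
  have "\<alpha> * (e + sp) <= s' \<and> (\<exists>C>0. ?B C)"
    using q
  proof (cases rule: ennreal_exponent_cases)
    case 1
    \<comment> \<open>For infinite q the term with 1/q is 0, so the hypothesis on s already forces
      the negative case of the loss.\<close>
    have neg: "s - \<alpha> * sp < 0" using s unfolding 1(2) sp by simp
    then have s'0: "s' = \<alpha> * (e + sp)"
      unfolding s' trace_loss_def trace_sign_def e sp using 1 by (simp add: algebra_simps)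
    have exp0: "\<beta> * (e + sp) - s' / (1 - \<alpha>) = 0" unfolding s'0 by simp
    have expneg: "s / (1 - \<alpha>) - \<beta> * sp <= 0"
      using neg a1 by (simp add: diff_divide_distrib[symmetric] divide_nonpos_pos)
    have "K powr (\<beta> * (e + sp) - s' / (1 - \<alpha>)) * jbracket l powr (s / (1 - \<alpha>) - \<beta> * sp) <= 1" if "K >= 1" for K and l :: 'a
    proof -
      have "jbracket l powr (s / (1 - \<alpha>) - \<beta> * sp) <= 1 powr (s / (1 - \<alpha>) - \<beta> * sp)"
        using expneg jbracket_ge(1)[of l] by (intro powr_mono2') auto
      then show ?thesis unfolding exp0 using that by simp
    qed
    then show ?thesis unfolding exponent_bound_def using s'0 1 by (intro conjI exI[of _ 1]) auto
  next
    case (2 t)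
    \<comment> \<open>The exponent of the bracket of l in the q-th power of a matrix entry. The sign
      expression of the statement is (1 - \<alpha>)(a + d), so its cases are those of the lattice
      sum.\<close>
    define a where "a = t * (s / (1 - \<alpha>) - \<beta> * sp)"
    have "a * (1 - \<alpha>) = t * (s / (1 - \<alpha>) * (1 - \<alpha>) - sp * (\<beta> * (1 - \<alpha>)))" unfolding a_def by (simp only: algebra_simps)
    also have "s / (1 - \<alpha>) * (1 - \<alpha>) = s" using a1 by simp
    also have "t * (s - sp * (\<beta> * (1 - \<alpha>))) = t * s - t * \<alpha> * sp" unfolding beta_identities(2) using \<alpha> by (simp add: algebra_simps del: times_divide_eq_left)
    finally have a_eq: "a * (1 - \<alpha>) = t * s - t * \<alpha> * sp" .
    have sign: "trace_sign n \<alpha> p q s = (a + ?d) * (1 - \<alpha>)"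
      unfolding trace_sign_def 2(3) d sp[symmetric] using 2(6) a_eq by (simp add: algebra_simps)
    have a_less: "a < \<beta> * ?d"
    proof -
      have "s < \<alpha> * ?d * (1 / t) + \<alpha> * sp" using s unfolding d 2(4) sp[symmetric] .
      then have "t * s < t * (\<alpha> * ?d * (1 / t) + \<alpha> * sp)" using 2(1) by (intro mult_strict_left_mono) auto
      then have "a * (1 - \<alpha>) < \<alpha> * ?d" unfolding a_eq using 2(1) by (simp add: algebra_simps)
      then show ?thesis using a1 by (simp add: field_simps)
    qed
    \<comment> \<open>The excess of s' over the threshold \<alpha>(1/p + s_p), in the scale of the
      bracket of k; it is the power of K available to absorb growth.\<close>
    define b where "b = (s' - \<alpha> * (e + sp)) / (1 - \<alpha>)"
    have b: "\<beta> * (e + sp) - s' / (1 - \<alpha>) = - b" unfolding b_def by (simp add: diff_divide_distrib)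
    have powq: "(K powr (\<beta> * (e + sp) - s' / (1 - \<alpha>)) * jbracket l powr (s / (1 - \<alpha>) - \<beta> * sp)) powr t
        = K powr (- (t * b)) * jbracket l powr a" if "K >= 1" for K and l :: 'a
      unfolding b a_def using that jbracket_pos[of l] by (simp add: powr_mult powr_powr mult.commute)
    have goal: ?thesis
      if b0: "b >= 0" and C: "C > 0" and sum: "\<And>K (v::'a). K >= 1 ==> norm v <= K powr (1 + \<beta>) ==>
        (\<Sum>l\<in>touching C0 K v. jbracket l powr a) <= C * K powr (t * b)" for C
    proof (intro conjI)
      show "\<alpha> * (e + sp) <= s'" using b0 a1 unfolding b_def by (simp add: zero_le_divide_iff)
      have "(\<Sum>l\<in>touching C0 K v. (K powr (\<beta> * (e + sp) - s' / (1 - \<alpha>)) * jbracket l powr (s / (1 - \<alpha>) - \<beta> * sp)) powr t) <= (C powr (1 / t)) powr t"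
        if K: "K >= 1" and v: "norm v <= K powr (1 + \<beta>)" for K and v :: 'a
      proof -
        have "(\<Sum>l\<in>touching C0 K v. (K powr (\<beta> * (e + sp) - s' / (1 - \<alpha>)) * jbracket l powr (s / (1 - \<alpha>) - \<beta> * sp)) powr t)
            = K powr (- (t * b)) * (\<Sum>l\<in>touching C0 K v. jbracket l powr a)"
          by (simp only: powq[OF K] sum_distrib_left)
        also have "... <= K powr (- (t * b)) * (C * K powr (t * b))"
          by (intro mult_left_mono sum K v) auto
        also have "... = C * (K powr (- (t * b)) * K powr (t * b))" by (simp only: mult.left_commute)
        also have "... = C" using K by (simp add: powr_add[symmetric])
        finally show ?thesis using C 2(1) by (simp add: powr_powr)
      qed
      moreover have "C powr (1 / t) > 0" using C by simp
      ultimately show "\<exists>C>0. ?B C"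
        unfolding exponent_bound_def 2(3) using 2(6) by blast
    qed
    show ?thesis
    proof (cases "a + ?d" "0::real" rule: linorder_cases)
      case greater
      have sgn: "trace_sign n \<alpha> p q s > 0" unfolding sign using greater a1 by simp
      have "s' = s + (\<alpha> * e + (1 - \<alpha>) * (\<alpha> * ?d * (1 / t) + \<alpha> * sp - s))"
        unfolding s' trace_loss_def using sgn by (simp add: e sp d 2(4))
      then have "t * (s' - \<alpha> * (e + sp)) = \<alpha> * (t * s - t * \<alpha> * sp) + \<alpha> * ?d * (1 - \<alpha>)"
        using 2(1) by (simp add: field_simps)
      also have "... = (1 - \<alpha>) * (\<alpha> * (a + ?d))" unfolding a_eq[symmetric] by (simp add: algebra_simps)
      \<comment> \<open>The loss of the first case is tuned to this equality: the gain K^(tb)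
        matches the growth K^(\<alpha>(a+d)) of the sum exactly.\<close>
      finally have tb: "t * b = \<alpha> * (a + ?d)" unfolding b_def using a1 by simp
      have "t * b >= 0" unfolding tb using greater \<alpha> by simp
      then have b0: "b >= 0" using 2(1) by (simp add: zero_le_mult_iff)
      have "- ?d < a" using greater by simp
      from touching_sum[OF C0 this a_less] obtain D where "D > 0" "\<And>K (v::'a). K >= 1 ==> norm v <= K powr (1 + \<beta>) ==>
        (\<Sum>l\<in>touching C0 K v. jbracket l powr a) <= D * K powr (\<alpha> * (a + ?d))" by blast
      then show ?thesis using goal[OF b0, of D] unfolding tb by blast
    next
      case less
      have sgn: "trace_sign n \<alpha> p q s < 0" unfolding sign using less a1 by (simp add: mult_less_0_iff)
      have "s' = \<alpha> * (e + sp)"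
        unfolding s' trace_loss_def using sgn by (simp add: e sp algebra_simps)
      \<comment> \<open>With a < -d the lattice sum converges, so nothing has to be absorbed and s'
        sits at the threshold.\<close>
      then have b0: "b = 0" unfolding b_def by simp
      have "a < - ?d" using less by simp
      from lattice_sum_summable[OF this] obtain D where D: "D > 0"
        "\<And>F::'a set. finite F ==> F \<subseteq> int_lattice ==> (\<Sum>l\<in>F. jbracket l powr a) <= D" by blast
      have "(\<Sum>l\<in>touching C0 K v. jbracket l powr a) <= D * K powr (t * b)"
        if "K >= 1" "norm v <= K powr (1 + \<beta>)" for K and v :: 'a
        using D(2)[OF touching_finite[OF C0 that]] that unfolding b0 touching_def by auto
      with D(1) show ?thesis using goal[of D] b0 by auto
    next
      case equal
      have sgn: "trace_sign n \<alpha> p q s = 0" unfolding sign using equal by simp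
      have "s' = \<alpha> * (e + sp) + \<epsilon>"
        unfolding s' trace_loss_def using sgn by (simp add: e sp algebra_simps)
      then have b_eq: "b = \<epsilon> / (1 - \<alpha>)" unfolding b_def by simp
      then have b0: "b > 0" using \<epsilon> a1 by simp
      \<comment> \<open>The logarithm of the borderline case is avoided by a power: the bracket of l
        is at most A K, so <l>^\<delta> is paid by K^\<delta>, and the remaining exponent a -
        \<delta> is summable.\<close>
      define \<delta> where "\<delta> = t * b"
      have \<delta>: "\<delta> > 0" unfolding \<delta>_def using b0 2(1) by simp
      have "a - \<delta> < - ?d" using equal \<delta> by simp
      from lattice_sum_summable[OF this] obtain D where D: "D > 0"
        "\<And>F::'a set. finite F ==> F \<subseteq> int_lattice ==> (\<Sum>l\<in>F. jbracket l powr (a - \<delta>)) <= D" by blast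
      define A where "A = 2 powr (1 + \<beta>) * (1 + 2 * C0)"
      have A: "A > 0" unfolding A_def using C0 by simp
      have "(\<Sum>l\<in>touching C0 K v. jbracket l powr a) <= (A powr \<delta> * D) * K powr (t * b)"
        if K: "K >= 1" and v: "norm v <= K powr (1 + \<beta>)" for K and v :: 'a
      proof -
        have "(\<Sum>l\<in>touching C0 K v. jbracket l powr a) <= (\<Sum>l\<in>touching C0 K v. (A * K) powr \<delta> * jbracket l powr (a - \<delta>))"
        proof (rule sum_mono)
          fix l assume l: "l \<in> touching C0 K v"
          have "jbracket l powr a = jbracket l powr \<delta> * jbracket l powr (a - \<delta>)"
            using jbracket_pos[of l] by (simp add: powr_add[symmetric])
          also have "... <= (A * K) powr \<delta> * jbracket l powr (a - \<delta>)"
            using touching_bound[OF C0 K v l] jbracket_pos[of l] \<delta> unfolding A_def by (intro mult_right_mono powr_mono2) auto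
          finally show "jbracket l powr a <= (A * K) powr \<delta> * jbracket l powr (a - \<delta>)" .
        qed
        also have "... = (A * K) powr \<delta> * (\<Sum>l\<in>touching C0 K v. jbracket l powr (a - \<delta>))" by (simp only: sum_distrib_left)
        also have "... <= (A * K) powr \<delta> * D"
          using D(2)[OF touching_finite[OF C0 K v]] unfolding touching_def by (intro mult_left_mono) auto
        also have "... = (A powr \<delta> * D) * K powr (t * b)" using A K unfolding \<delta>_def by (simp add: powr_mult)
        finally show ?thesis .
      qed
      moreover have "A powr \<delta> * D > 0" using A D by simp
      ultimately show ?thesis using goal[of "A powr \<delta> * D"] b0 by auto
    qed
  qed
  then show "\<alpha> * (e + sp) <= s'" and "\<exists>C>0. ?B C" by (rule conjunct1, rule conjunct2)
qed

section \<open>Application to the pieces of a distribution and to its trace\<close>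

section \<open>The frequency-localized pieces\<close>

definition box_symbol :: "(real => real) => real => real => 'a::euclidean_space => 'a => complex" where
  "box_symbol \<eta> \<rho> \<alpha> k \<xi> = of_real (fourier_norm TYPE('a)) * of_real (alpha_partition \<eta> \<rho> \<alpha> k \<xi>)"

context alpha_covering
begin

lemma box_symbol_rescale:
  fixes k :: "'a::euclidean_space"
  assumes "cutoff \<eta>" "k \<in> int_lattice" "admissible_radius TYPE('a) \<rho> \<alpha>"
  shows "box_symbol \<eta> \<rho> \<alpha> k = (\<lambda>\<xi>. of_real (fourier_norm TYPE('a)) *
    rescaled_partition \<eta> k ((1 / radius k) *\<^sub>R (\<xi> - center k)))"
  by (rule ext) (simp only: box_symbol_def partition_rescale[OF assms])

lemma scaled_partition_family:
  assumes "cutoff \<eta>" "admissible_radius TYPE('a::euclidean_space) \<rho> \<alpha>"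
  shows "test_family int_lattice (\<lambda>(k::'a) u. of_real (fourier_norm TYPE('a)) * rescaled_partition \<eta> k u)"
  by (rule test_family_scale[OF rescaled_partition_family[OF assms], where c = "\<lambda>_. of_real (fourier_norm TYPE('a))"]) (rule order_refl)

lemma test_fun_box_symbol:
  fixes k :: "'a::euclidean_space"
  assumes \<eta>: "cutoff \<eta>" and k: "k \<in> int_lattice" and adm: "admissible_radius TYPE('a) \<rho> \<alpha>"
  shows "test_fun (box_symbol \<eta> \<rho> \<alpha> k)"
  unfolding box_symbol_rescale[OF \<eta> k adm]
  using test_fun_rescale[OF test_family_member[OF scaled_partition_family[OF \<eta> adm] k] radius_pos] .

lemma alpha_box_distr_synth:
  fixes f :: "'a::euclidean_space distr"
  assumes \<eta>: "cutoff \<eta>" and k: "k \<in> int_lattice" and adm: "admissible_radius TYPE('a) \<rho> \<alpha>"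
    and f: "tempered_distribution f"
  shows "alpha_box \<eta> \<rho> \<alpha> k f = distr_synth f (box_symbol \<eta> \<rho> \<alpha> k)"
proof -
  have "test_fun (\<lambda>\<xi>. of_real (alpha_partition \<eta> \<rho> \<alpha> k \<xi>))"
    unfolding partition_rescale[OF \<eta> k adm]
    using test_fun_rescale[OF test_family_member[OF rescaled_partition_family[OF \<eta> adm] k] radius_pos] .
  from alpha_box_eq[OF \<eta> f this] show ?thesis unfolding box_symbol_def[abs_def] .
qed

lemma box_symbol_support:
  fixes k :: "'a::euclidean_space"
  assumes \<eta>: "cutoff \<eta>" and k: "k \<in> int_lattice" and adm: "admissible_radius TYPE('a) \<rho> \<alpha>"
    and nz: "box_symbol \<eta> \<rho> \<alpha> k \<xi> ~= 0" and b: "b \<in> Basis"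
  shows "\<bar>(\<xi> - center k) \<bullet> b\<bar> < 2 * radius k"
proof -
  have "\<bar>((1 / radius k) *\<^sub>R (\<xi> - center k)) \<bullet> b\<bar> < 2"
    using nz rescaled_partition_support[OF \<eta> b, of "(1 / radius k) *\<^sub>R (\<xi> - center k)" k]
    unfolding box_symbol_rescale[OF \<eta> k adm] by (auto simp: not_le[symmetric])
  moreover have "((1 / radius k) *\<^sub>R (\<xi> - center k)) \<bullet> b = ((\<xi> - center k) \<bullet> b) / radius k"
    by (simp only: inner_scaleR_left times_divide_eq_left mult_1)
  ultimately show ?thesis using radius_pos[of k] by (simp add: abs_divide pos_divide_less_eq)
qed

lemma box_kernel_decay:
  assumes \<eta>: "cutoff \<eta>" and adm: "admissible_radius TYPE('a::euclidean_space) \<rho> \<alpha>"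
  shows "\<exists>C. (\<forall>M. C M > 0) \<and> (\<forall>k\<in>int_lattice. \<forall>M (x::'a). norm (synth (box_symbol \<eta> \<rho> \<alpha> k) x)
    <= C M * radius k ^ DIM('a) * (1 + radius k * norm x) powr (- M))"
proof -
  have "\<forall>M. \<exists>C>0. \<forall>k\<in>int_lattice. \<forall>x::'a. norm (synth (box_symbol \<eta> \<rho> \<alpha> k) x)
    <= C * radius k ^ DIM('a) * (1 + radius k * norm x) powr (- M)"
  proof
    fix M
    obtain C where C: "C > 0" "\<And>(k::'a) R c x. k \<in> int_lattice ==> R > 0 ==>
      norm (synth (\<lambda>\<xi>. of_real (fourier_norm TYPE('a)) * rescaled_partition \<eta> k ((1 / R) *\<^sub>R (\<xi> - c))) x)
        <= C * R ^ DIM('a) * decay M R x"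
      by (rule kernel_decay[OF scaled_partition_family[OF \<eta> adm], of M]) (rule that)
    have "norm (synth (box_symbol \<eta> \<rho> \<alpha> k) x)
        <= C * radius k ^ DIM('a) * (1 + radius k * norm x) powr (- M)"
      if k: "k \<in> int_lattice" for k x :: 'a
      unfolding box_symbol_rescale[OF \<eta> k adm] by (rule C(2)[OF k radius_pos])
    with C(1) show "\<exists>C>0. \<forall>k\<in>int_lattice. \<forall>x::'a. norm (synth (box_symbol \<eta> \<rho> \<alpha> k) x)
      <= C * radius k ^ DIM('a) * (1 + radius k * norm x) powr (- M)" by blast
  qed
  then obtain C where "\<forall>M. C M > 0 \<and> (\<forall>k\<in>int_lattice. \<forall>x::'a. norm (synth (box_symbol \<eta> \<rho> \<alpha> k) x)
      <= C M * radius k ^ DIM('a) * (1 + radius k * norm x) powr (- M))"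
    unfolding choice_iff by (elim exE)
  then show ?thesis by (intro exI[of _ C]) simp
qed

text \<open>After rescaling, every symbol lives where the coordinates are below 2, and
  \<open>box_bump \<eta> (1 / 2) 0\<close> is 1 there. Its kernel therefore reproduces the piece up
  to the inversion constant, whose modulus is divided out. One bump serves all k, which makes C
  uniform.\<close>

lemma box_reproducible:
  assumes \<eta>: "cutoff \<eta>" and adm: "admissible_radius TYPE('a::euclidean_space) \<rho> \<alpha>"
  shows "\<exists>C. (\<forall>M. C M > 0) \<and> (\<forall>k\<in>int_lattice. \<forall>f::'a distr. tempered_distribution f -->
    reproducible C (radius k) (alpha_box \<eta> \<rho> \<alpha> k f))"
proof -
  let ?B = "box_bump \<eta> (1 / 2) 0 :: 'a => complex"
  let ?\<iota> = "inversion_const \<eta> TYPE('a)"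
  have \<iota>: "norm ?\<iota> > 0" using inversion_const_nonzero[OF \<eta>] by simp
  have B: "test_fun ?B" by (rule test_fun_box_bump[OF \<eta>]) simp
  have "\<forall>M. \<exists>C>0. \<forall>R c (x::'a). R > 0 -->
    norm (synth (\<lambda>\<xi>. ?B ((1 / R) *\<^sub>R (\<xi> - c))) x) <= C * R ^ DIM('a) * decay M R x"
  proof
    fix M
    obtain C where "C > 0" "\<And>(i::unit) R c x. i \<in> UNIV ==> R > 0 ==>
      norm (synth (\<lambda>\<xi>. ?B ((1 / R) *\<^sub>R (\<xi> - c))) x) <= C * R ^ DIM('a) * decay M R x"
      by (rule kernel_decay[OF B[unfolded test_fun_def], of M]) (rule that)
    then show "\<exists>C>0. \<forall>R c (x::'a). R > 0 -->
      norm (synth (\<lambda>\<xi>. ?B ((1 / R) *\<^sub>R (\<xi> - c))) x) <= C * R ^ DIM('a) * decay M R x" by blast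
  qed
  then obtain C0 where C0: "\<And>M. C0 M > 0" "\<And>M R c x. R > 0 ==>
      norm (synth (\<lambda>\<xi>. ?B ((1 / R) *\<^sub>R (\<xi> - c))) x) <= C0 M * R ^ DIM('a) * decay M R x"
    unfolding choice_iff by blast
  define C where "C M = C0 M / norm ?\<iota>" for M
  have "reproducible C (radius k) (alpha_box \<eta> \<rho> \<alpha> k f)"
    if k: "k \<in> int_lattice" and f: "tempered_distribution f" for k :: 'a and f
  proof -
    define R where "R = radius k"
    have R: "R > 0" unfolding R_def by (rule radius_pos)
    define a where "a = box_symbol \<eta> \<rho> \<alpha> k"
    have a: "test_fun a" unfolding a_def by (rule test_fun_box_symbol[OF \<eta> k adm])
    let ?g = "distr_synth f a"
    have gm [measurable]: "?g \<in> borel_measurable borel"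
      by (rule borel_measurable_continuous_onI[OF distr_synth_continuous[OF f a]])
    define \<theta> where "\<theta> \<xi> = ?B ((1 / R) *\<^sub>R (\<xi> - center k))" for \<xi>
    have \<theta>: "test_fun \<theta>" unfolding \<theta>_def[abs_def] by (rule test_fun_rescale[OF B R])
    have one: "\<theta> \<xi> = 1" if "a \<xi> ~= 0" for \<xi>
      unfolding \<theta>_def
    proof (rule box_bump_eq_1[OF \<eta>])
      fix b :: 'a assume "b \<in> Basis"
      from box_symbol_support[OF \<eta> k adm that[unfolded a_def] this]
      have "\<bar>(\<xi> - center k) \<bullet> b\<bar> <= 2 * R" unfolding R_def by simp
      moreover have "((1 / R) *\<^sub>R (\<xi> - center k)) \<bullet> b = ((\<xi> - center k) \<bullet> b) / R"
        by (simp only: inner_scaleR_left times_divide_eq_left mult_1)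
      ultimately show "\<bar>1 / 2 * (((1 / R) *\<^sub>R (\<xi> - center k)) \<bullet> b) + 0 \<bullet> b\<bar> <= 1"
        using R by (simp add: abs_divide pos_divide_le_eq)
    qed
    have \<theta>b: "norm (synth \<theta> x) <= C0 M * R ^ DIM('a) * decay M R x" for M x
      unfolding \<theta>_def[abs_def] by (rule C0(2)[OF R])
    have "ennreal (norm (?g x)) <= ennreal (C M * R ^ DIM('a)) *
         (\<integral>\<^sup>+y. ennreal (norm (?g y) * decay M R (x - y)) \<partial>lborel)" for M x
    proof -
      have rf: "integrable lborel (\<lambda>y. synth \<theta> (x - y) * ?g y)" "(LINT y|lborel. synth \<theta> (x - y) * ?g y) = ?\<iota> * ?g x"
        by (rule reproducing_formula[OF \<eta> f a \<theta>], erule one)+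
      have "ennreal (norm ?\<iota>) * ennreal (norm (?g x)) = ennreal (norm (LINT y|lborel. synth \<theta> (x - y) * ?g y))"
        unfolding rf(2) by (simp add: norm_mult ennreal_mult)
      also have "... <= (\<integral>\<^sup>+y. ennreal (norm (synth \<theta> (x - y) * ?g y)) \<partial>lborel)"
        by (rule integral_norm_bound_ennreal[OF rf(1)])
      also have "... <= (\<integral>\<^sup>+y. ennreal (C0 M * R ^ DIM('a)) * ennreal (norm (?g y) * decay M R (x - y)) \<partial>lborel)"
      proof (rule nn_integral_mono)
        fix y
        have "norm (synth \<theta> (x - y) * ?g y) <= C0 M * R ^ DIM('a) * decay M R (x - y) * norm (?g y)"
          unfolding norm_mult by (intro mult_right_mono \<theta>b) simp
        then have "norm (synth \<theta> (x - y) * ?g y) <= C0 M * R ^ DIM('a) * (norm (?g y) * decay M R (x - y))"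
          by (simp only: ac_simps)
        then show "ennreal (norm (synth \<theta> (x - y) * ?g y))
            <= ennreal (C0 M * R ^ DIM('a)) * ennreal (norm (?g y) * decay M R (x - y))"
          using C0(1)[of M] R by (simp add: ennreal_mult[symmetric] ennreal_leI)
      qed
      also have "... = ennreal (C0 M * R ^ DIM('a)) * (\<integral>\<^sup>+y. ennreal (norm (?g y) * decay M R (x - y)) \<partial>lborel)"
        by (rule nn_integral_cmult) measurable
      finally have "ennreal (1 / norm ?\<iota>) * (ennreal (norm ?\<iota>) * ennreal (norm (?g x)))
         <= ennreal (1 / norm ?\<iota>) * (ennreal (C0 M * R ^ DIM('a)) * (\<integral>\<^sup>+y. ennreal (norm (?g y) * decay M R (x - y)) \<partial>lborel))"
        by (rule mult_left_mono) simp
      moreover have "ennreal (1 / norm ?\<iota>) * (ennreal (norm ?\<iota>) * ennreal (norm (?g x))) = ennreal (norm (?g x))"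
        using \<iota> by (simp add: ennreal_mult[symmetric])
      moreover have "ennreal (1 / norm ?\<iota>) * (ennreal (C0 M * R ^ DIM('a)) * X) = ennreal (C M * R ^ DIM('a)) * X" for X
        using C0(1)[of M] R unfolding C_def by (simp add: mult.assoc[symmetric] ennreal_mult[symmetric])
      ultimately show ?thesis by simp
    qed
    moreover have "\<exists>A N. \<forall>x. norm (?g x) <= A * (1 + norm x) ^ N"
      by (rule distr_synth_growth[OF f a]) blast
    ultimately show ?thesis
      unfolding alpha_box_distr_synth[OF \<eta> k adm f] a_def[symmetric] R_def[symmetric] reproducible_def
      using distr_synth_continuous[OF f a] by blast
  qed
  moreover have "C M > 0" for M unfolding C_def using C0(1)[of M] \<iota> by simp
  ultimately show ?thesis by blast
qed

end

section \<open>The trace\<close>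

text \<open>Decay of order d + 1 controls supremum and L1 norm by the same seminorm, which is the
  form both the pairing estimate and temperedness of the trace call for.\<close>

lemma schwartz_mass:
  fixes \<phi> :: "'a::euclidean_space => complex"
  assumes \<phi>: "\<phi> \<in> schwartz"
  defines "F \<equiv> (decay_mass TYPE('a) (real DIM('a) + 1) + 1) * schwartz_seminorm (DIM('a) + 1) \<phi>"
  shows "norm (\<phi> y) <= F" and "L1_mass \<phi> <= ennreal F" and "F >= 0"
proof -
  let ?\<sigma> = "schwartz_seminorm (DIM('a) + 1) \<phi>" and ?W = "decay_mass TYPE('a) (real DIM('a) + 1)"
  have dec: "(1 + norm y) ^ (DIM('a) + 1) * norm (\<phi> y) <= ?\<sigma>" for y
    using le_schwartz_seminorm[OF \<phi>, of "[]" "DIM('a) + 1" y] by (simp add: iter_partial_deriv_def)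
  have "norm (\<phi> y) <= (1 + norm y) ^ (DIM('a) + 1) * norm (\<phi> y)" for y
    using one_le_power[of "1 + norm y" "DIM('a) + 1"] mult_right_mono[of 1 "(1 + norm y) ^ (DIM('a) + 1)" "norm (\<phi> y)"] by simp
  then have n\<sigma>: "norm (\<phi> y) <= ?\<sigma>" for y using dec[of y] by (meson order_trans)
  then have \<sigma>: "?\<sigma> >= 0" using norm_ge_zero order_trans by blast
  show F: "F >= 0" unfolding F_def using \<sigma> decay_mass_pos[where 'a='a, of "real DIM('a) + 1"] by simp
  show "norm (\<phi> y) <= F" unfolding F_def
    using n\<sigma>[of y] mult_nonneg_nonneg[of ?W ?\<sigma>, OF less_imp_le[OF decay_mass_pos] \<sigma>] by (simp add: distrib_right)
  have "L1_mass \<phi> <= (\<integral>\<^sup>+(y::'a). ennreal ?\<sigma> * ennreal ((1 + 1 * norm (0 - y)) powr (- (real DIM('a) + 1))) \<partial>lborel)"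
  proof (rule nn_integral_mono)
    fix y :: 'a
    have pos: "1 + norm y > 0" using norm_ge_zero[of y] by linarith
    have "(1 + norm y) powr (- (real DIM('a) + 1)) = inverse ((1 + norm y) powr real (DIM('a) + 1))"
      by (simp only: powr_minus of_nat_add of_nat_1)
    also have "... = inverse ((1 + norm y) ^ (DIM('a) + 1))" using pos by (simp only: powr_realpow)
    finally have "norm (\<phi> y) <= ?\<sigma> * (1 + norm y) powr (- (real DIM('a) + 1))"
      using dec[of y] zero_less_power[OF pos, of "DIM('a) + 1"]
      by (simp only: divide_inverse[symmetric] pos_le_divide_eq mult.commute)
    then show "ennreal (norm (\<phi> y)) <= ennreal ?\<sigma> * ennreal ((1 + 1 * norm (0 - y)) powr (- (real DIM('a) + 1)))"
      using \<sigma> by (simp add: ennreal_mult[symmetric] ennreal_leI)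
  qed
  also have "... = ennreal ?\<sigma> * (\<integral>\<^sup>+(y::'a). ennreal ((1 + 1 * norm (0 - y)) powr (- (real DIM('a) + 1))) \<partial>lborel)"
    by (rule nn_integral_cmult) measurable
  also have "... <= ennreal ?\<sigma> * ennreal (?W / 1 ^ DIM('a))"
    by (intro mult_left_mono nn_integral_decay) auto
  also have "... = ennreal (?\<sigma> * ?W)" using \<sigma> decay_mass_pos[where 'a='a, of "real DIM('a) + 1"] by (simp add: ennreal_mult)
  also have "... <= ennreal F" unfolding F_def using \<sigma> by (intro ennreal_leI) (simp add: algebra_simps)
  finally show "L1_mass \<phi> <= ennreal F" .
qed

text \<open>A finite source quasi-norm makes every single piece finite in L^p, so the coefficients
  become real numbers and the powers of the Japanese bracket can be rearranged freely.\<close>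

lemma source_coefficients:
  fixes f :: "'a::euclidean_space distr"
  assumes r: "r > 0" and f: "modulation_norm \<eta> \<rho> \<alpha> s p (ennreal r) f < \<infinity>"
  obtains a L where "\<And>k. a k >= 0" "\<And>k. L k >= 0" "\<And>k. k \<in> int_lattice ==> Lp_norm p (alpha_box \<eta> \<rho> \<alpha> k f) = ennreal (L k)"
    "\<And>k. a k = jbracket k powr (s / (1 - \<alpha>)) * L k"
    "(\<integral>\<^sup>+k. ennreal (a k powr r) \<partial>count_space int_lattice) < \<infinity>"
    "modulation_norm \<eta> \<rho> \<alpha> s p (ennreal r) f
      = ennreal_powr (\<integral>\<^sup>+k. ennreal (a k powr r) \<partial>count_space int_lattice) (1 / r)"
proof -
  define N where "N k = ennreal (jbracket k powr (s / (1 - \<alpha>))) * Lp_norm p (alpha_box \<eta> \<rho> \<alpha> k f)" for k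
  define L where "L k = enn2real (Lp_norm p (alpha_box \<eta> \<rho> \<alpha> k f))" for k
  define a where "a k = jbracket k powr (s / (1 - \<alpha>)) * L k" for k
  have Lnn: "L k >= 0" for k unfolding L_def by simp
  have norm_eq: "modulation_norm \<eta> \<rho> \<alpha> s p (ennreal r) f = ennreal_powr (\<integral>\<^sup>+k. ennreal_powr (N k) r \<partial>count_space int_lattice) (1 / r)"
    unfolding modulation_norm_eq lq_norm_def N_def using r by simp
  then have fin: "(\<integral>\<^sup>+k. ennreal_powr (N k) r \<partial>count_space int_lattice) < \<infinity>"
    using f ennreal_powr_less_top by simp
  have Lp: "Lp_norm p (alpha_box \<eta> \<rho> \<alpha> k f) = ennreal (L k)" if k: "k \<in> int_lattice" for k
  proof -
    have "ennreal_powr (N k) r <= (\<integral>\<^sup>+k. ennreal_powr (N k) r \<partial>count_space int_lattice)"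
      by (rule nn_integral_ge_point[OF k])
    then have "ennreal_powr (N k) r < \<infinity>" using fin by (rule order.strict_trans1)
    then have "N k < \<infinity>" by (simp only: ennreal_powr_less_top)
    moreover have "jbracket k powr (s / (1 - \<alpha>)) > 0" using jbracket_pos[of k] by simp
    ultimately have "Lp_norm p (alpha_box \<eta> \<rho> \<alpha> k f) < \<infinity>"
      unfolding N_def by (auto simp: ennreal_mult_less_top)
    then show ?thesis unfolding L_def by simp
  qed
  have "ennreal_powr (N k) r = ennreal (a k powr r)" if k: "k \<in> int_lattice" for k
    using Lnn[of k] unfolding N_def a_def Lp[OF k] by (simp add: ennreal_mult[symmetric] ennreal_powr_ennreal)
  then have "(\<integral>\<^sup>+k. ennreal_powr (N k) r \<partial>count_space int_lattice) = (\<integral>\<^sup>+k. ennreal (a k powr r) \<partial>count_space int_lattice)"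
    by (intro nn_integral_cong) simp
  with norm_eq fin show ?thesis
    using Lp by (intro that[of a L]) (auto simp: a_def L_def)
qed

text \<open>The parameter \<open>dom\<close> only fixes the type of the hyperplane.\<close>

locale alpha_trace =
  fixes \<eta> :: "real => real" and \<rho>1 \<rho>2 \<alpha> :: real and dom :: "'a::euclidean_space itself"
  assumes \<eta>: "cutoff \<eta>" and \<alpha>: "0 <= \<alpha>" "\<alpha> < 1"
    and adm1: "admissible_radius TYPE('a \<times> real) \<rho>1 \<alpha>" and adm2: "admissible_radius TYPE('a) \<rho>2 \<alpha>"
begin

sublocale c1: alpha_covering \<rho>1 \<alpha>
  using adm1 \<alpha> unfolding admissible_radius_def by unfold_locales auto

sublocale c2: alpha_covering \<rho>2 \<alpha>
  using adm2 \<alpha> unfolding admissible_radius_def by unfold_locales auto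

abbreviation "\<beta> \<equiv> \<alpha> / (1 - \<alpha>)"

text \<open>If the l-th cube and the projected k-th cube share a frequency, the centers differ per
  coordinate by less than twice the sum of the radii; passing to the norm costs DIM, and the two
  radii constants are bounded by their sum.\<close>

abbreviation contact :: "'a \<times> real => 'a set" where
  "contact k \<equiv> c2.touching (2 * real DIM('a) * (\<rho>1 + \<rho>2)) (jbracket k) (fst (alpha_center \<alpha> k) :: 'a)"

definition piece :: "('a \<times> real) distr => 'a \<times> real => 'a => 'a => complex" where
  "piece f k l x = (LINT z|lborel. trace_term \<eta> \<rho>1 \<alpha> f k z * synth (box_symbol \<eta> \<rho>2 \<alpha> l) (x - z))"

lemma norm_center_fst:
  fixes k :: "'a \<times> real"
  shows "norm (fst (alpha_center \<alpha> k) :: 'a) <= jbracket k powr (1 + \<beta>)"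
proof -
  have "norm (fst (alpha_center \<alpha> k) :: 'a) <= norm (alpha_center \<alpha> k)"
    by (metis norm_fst_le prod.collapse)
  also have "... = norm k powr (1 + \<beta>)" by (rule c1.norm_center)
  also have "... <= jbracket k powr (1 + \<beta>)"
    using c1.\<beta>_nonneg jbracket_ge(2)[of k] by (intro powr_mono2) auto
  finally show ?thesis .
qed

lemma trace_term_eq:
  fixes f :: "('a \<times> real) distr"
  assumes "tempered_distribution f" "k \<in> int_lattice"
  shows "trace_term \<eta> \<rho>1 \<alpha> f k = (\<lambda>y. distr_synth f (box_symbol \<eta> \<rho>1 \<alpha> k) (y, 0))"
  unfolding trace_term_def[abs_def] c1.alpha_box_distr_synth[OF \<eta> assms(2) adm1 assms(1)] ..

lemma trace_term_integrable:
  fixes \<phi> :: "'a => complex" and f :: "('a \<times> real) distr"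
  assumes f: "tempered_distribution f" and k: "k \<in> int_lattice" and \<phi>: "\<phi> \<in> schwartz"
  shows "integrable lborel (\<lambda>x. trace_term \<eta> \<rho>1 \<alpha> f k x * \<phi> x)"
proof -
  have "continuous_on UNIV (\<lambda>y::'a. (y, 0::real))" by (intro continuous_intros)
  from distr_synth_interchange(1)[OF f c1.test_fun_box_symbol[OF \<eta> k adm1] schwartz_rapid[OF \<phi>] this]
  show ?thesis unfolding trace_term_eq[OF f k] by (simp add: norm_Pair mult.commute)
qed

lemma piece_eq_0:
  fixes l x :: 'a
  assumes f: "tempered_distribution f" and k: "k \<in> int_lattice" and l: "l \<in> int_lattice" "l \<notin> contact k"
  shows "piece f k l x = 0"
proof -
  have "box_symbol \<eta> \<rho>1 \<alpha> k (\<xi>, \<tau>) * box_symbol \<eta> \<rho>2 \<alpha> l \<xi> = 0" for \<xi> \<tau>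
  proof (rule ccontr)
    assume nz: "\<not> ?thesis"
    let ?B = "2 * alpha_radius \<rho>1 \<alpha> k + 2 * alpha_radius \<rho>2 \<alpha> l"
    have "norm (alpha_center \<alpha> l - fst (alpha_center \<alpha> k) :: 'a) <= real DIM('a) * ?B"
    proof (rule c2.norm_le_componentwise)
      fix b :: 'a assume b: "b \<in> Basis"
      then have b0: "(b, 0) \<in> (Basis :: ('a \<times> real) set)" by (simp add: Basis_prod_def)
      have "\<bar>((\<xi>, \<tau>) - alpha_center \<alpha> k) \<bullet> (b, 0)\<bar> < 2 * alpha_radius \<rho>1 \<alpha> k"
        using nz by (intro c1.box_symbol_support[OF \<eta> k adm1 _ b0]) auto
      moreover have "((\<xi>, \<tau>) - alpha_center \<alpha> k) \<bullet> (b, 0) = (\<xi> - fst (alpha_center \<alpha> k)) \<bullet> b"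
        by (simp add: inner_Pair_0 inner_prod_def)
      moreover have "\<bar>(\<xi> - alpha_center \<alpha> l) \<bullet> b\<bar> < 2 * alpha_radius \<rho>2 \<alpha> l"
        using nz by (intro c2.box_symbol_support[OF \<eta> l(1) adm2 _ b]) auto
      ultimately show "\<bar>(alpha_center \<alpha> l - fst (alpha_center \<alpha> k)) \<bullet> b\<bar> <= ?B"
        by (simp add: inner_diff_left)
    qed
    also have "... <= 2 * real DIM('a) * (\<rho>1 + \<rho>2) * (jbracket k powr \<beta> + jbracket l powr \<beta>)"
    proof -
      have "\<rho>1 * jbracket k powr \<beta> + \<rho>2 * jbracket l powr \<beta> <= (\<rho>1 + \<rho>2) * (jbracket k powr \<beta> + jbracket l powr \<beta>)"
        using c1.\<rho> c2.\<rho> by (simp add: algebra_simps)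
      then have "2 * real DIM('a) * (\<rho>1 * jbracket k powr \<beta> + \<rho>2 * jbracket l powr \<beta>)
         <= 2 * real DIM('a) * ((\<rho>1 + \<rho>2) * (jbracket k powr \<beta> + jbracket l powr \<beta>))"
        by (rule mult_left_mono) simp
      then show ?thesis unfolding alpha_radius_def by (simp add: algebra_simps)
    qed
    finally show False using l unfolding c2.touching_def by simp
  qed
  from trace_frequency_disjoint[OF \<eta> f c1.test_fun_box_symbol[OF \<eta> k adm1] c2.test_fun_box_symbol[OF \<eta> l(1) adm2] this]
  show ?thesis unfolding piece_def trace_term_eq[OF f k] by (simp add: mult.commute)
qed

lemma trace_term_measurable:
  fixes f :: "('a \<times> real) distr"
  assumes "tempered_distribution f" "k \<in> int_lattice"
  shows "trace_term \<eta> \<rho>1 \<alpha> f k \<in> borel_measurable borel"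
  unfolding trace_term_eq[OF assms]
  by (rule trace_section_measurable[OF borel_measurable_continuous_onI[OF distr_synth_continuous[OF assms(1) c1.test_fun_box_symbol[OF \<eta> assms(2) adm1]]]])

lemma piece_measurable:
  fixes l :: 'a
  assumes "tempered_distribution f" "k \<in> int_lattice" "l \<in> int_lattice"
  shows "piece f k l \<in> borel_measurable borel"
proof -
  note [measurable] = trace_term_measurable[OF assms(1,2)]
    synth_measurable[OF test_fun_cbounded[OF c2.test_fun_box_symbol[OF \<eta> assms(3) adm2]]]
  show ?thesis unfolding piece_def[abs_def] by measurable
qed

lemma piece_norm_le:
  fixes l :: 'a
  assumes f: "tempered_distribution f" and k: "k \<in> int_lattice" and l: "l \<in> int_lattice"
  shows "ennreal (norm (piece f k l x))
    <= (\<integral>\<^sup>+y. ennreal (norm (trace_term \<eta> \<rho>1 \<alpha> f k y) * norm (synth (box_symbol \<eta> \<rho>2 \<alpha> l) (x - y))) \<partial>lborel)"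
  using integral_norm_bound_ennreal[OF trace_term_integrable[OF f k reflected_synth_schwartz[OF c2.test_fun_box_symbol[OF \<eta> l adm2]]], of x]
  unfolding piece_def norm_mult .

text \<open>A name for the pairing estimate in terms of weighted source coefficients; it is used
  both for the convergence of the trace and for the vanishing of single pieces.\<close>

definition pairing_const :: "ennreal => real => real => bool" where
  "pairing_const p s' K \<longleftrightarrow> K > 0 \<and> (\<forall>(f :: ('a \<times> real) distr) k F (\<phi> :: 'a => complex) L. tempered_distribution f --> k \<in> int_lattice --> Lp_norm p (alpha_box \<eta> \<rho>1 \<alpha> k f) = ennreal L -->
    F > 0 --> L >= 0 --> \<phi> \<in> borel_measurable borel --> (\<forall>y. norm (\<phi> y) <= F) --> L1_mass \<phi> <= ennreal F -->
    (\<integral>\<^sup>+y. ennreal (norm (trace_term \<eta> \<rho>1 \<alpha> f k y) * norm (\<phi> y))  \<partial>lborel)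
      <= ennreal (K * F * (jbracket k powr (s' / (1 - \<alpha>)) * L)))"

text \<open>The pairing costs R_k^{1/p + s_p}, which is a constant times the power \<beta>(1/p +
  s_p) of the bracket of k. The assumption on s' says that the source weight dominates this
  power.\<close>

lemma trace_term_pairing:
  assumes p: "p > 0" and s': "\<alpha> * (enn2real (1 / p) + crit_gap TYPE('a) p) <= s'"
  shows "\<exists>K. pairing_const p s' K"
proof -
  obtain C where C: "\<And>M. C M > 0" and rep: "\<And>k f. k \<in> int_lattice ==> tempered_distribution f ==>
    reproducible C (alpha_radius \<rho>1 \<alpha> k) (alpha_box \<eta> \<rho>1 \<alpha> k f :: 'a \<times> real => complex)"
    using c1.box_reproducible[OF \<eta> adm1] by blast
  let ?E = "enn2real (1 / p) + crit_gap TYPE('a) p"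
  from trace_pairing[where C=C and 'a='a, OF p C] obtain K0 where K0: "K0 > 0" and
    pair: "\<forall>R F (g::'a \<times> real => complex) (\<phi>::'a => complex).
    R > 0 --> F > 0 --> reproducible C R g --> Lp_norm p g < \<infinity> --> \<phi> \<in> borel_measurable borel -->
    (\<forall>y. norm (\<phi> y) <= F) --> L1_mass \<phi> <= ennreal F -->
    trace_pair g \<phi>
     <= ennreal (K0 * F * R powr ?E) * Lp_norm p g"
    by (elim exE conjE)
  have main: "(\<integral>\<^sup>+y. ennreal (norm (trace_term \<eta> \<rho>1 \<alpha> f k y) * norm (\<phi> y)) \<partial>lborel)
      <= ennreal (K0 * \<rho>1 powr ?E * F * (jbracket k powr (s' / (1 - \<alpha>)) * L))"
    if f: "tempered_distribution f" and k: "k \<in> int_lattice" and L: "Lp_norm p (alpha_box \<eta> \<rho>1 \<alpha> k f) = ennreal L" "L >= 0"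
      and F: "F > 0" and \<phi>: "\<phi> \<in> borel_measurable borel" "\<forall>y. norm (\<phi> y) <= F" "L1_mass \<phi> <= ennreal F"
    for f :: "('a \<times> real) distr" and k F L and \<phi> :: "'a => complex"
  proof -
    have "(\<integral>\<^sup>+y. ennreal (norm (trace_term \<eta> \<rho>1 \<alpha> f k y) * norm (\<phi> y)) \<partial>lborel)
      <= ennreal (K0 * F * alpha_radius \<rho>1 \<alpha> k powr ?E) * ennreal L"
      using pair[rule_format, OF c1.radius_pos F rep[OF k f] _ \<phi>(1) _ \<phi>(3)] \<phi>(2) unfolding L(1) trace_term_def by simp
    also have "... = ennreal (K0 * F * alpha_radius \<rho>1 \<alpha> k powr ?E * L)"
      using K0 F L by (simp add: ennreal_mult)
    also have "... <= ennreal (K0 * \<rho>1 powr ?E * F * (jbracket k powr (s' / (1 - \<alpha>)) * L))"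
    proof (rule ennreal_leI)
      have "\<beta> * ?E <= s' / (1 - \<alpha>)" using s' \<alpha> by (simp add: divide_right_mono)
      then have "jbracket k powr (\<beta> * ?E) <= jbracket k powr (s' / (1 - \<alpha>))"
        using jbracket_ge(1)[of k] by (intro powr_mono) auto
      then have "K0 * \<rho>1 powr ?E * F * L * jbracket k powr (\<beta> * ?E) <= K0 * \<rho>1 powr ?E * F * L * jbracket k powr (s' / (1 - \<alpha>))"
        using K0 F L by (intro mult_left_mono) auto
      moreover have "alpha_radius \<rho>1 \<alpha> k powr ?E = \<rho>1 powr ?E * jbracket k powr (\<beta> * ?E)"
        unfolding alpha_radius_def using c1.\<rho> jbracket_pos[of k] by (simp add: powr_mult powr_powr)
      ultimately show "K0 * F * alpha_radius \<rho>1 \<alpha> k powr ?E * L <= K0 * \<rho>1 powr ?E * F * (jbracket k powr (s' / (1 - \<alpha>)) * L)"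
        by (simp only: ac_simps)
    qed
    finally show ?thesis .
  qed
  have "K0 * \<rho>1 powr ?E > 0" using K0 c1.\<rho> by simp
  then show ?thesis
    unfolding pairing_const_def by (intro exI[of _ "K0 * \<rho>1 powr ?E"] conjI allI impI main) simp_all
qed

end

context alpha_trace
begin

text \<open>Paired with a test function, the terms of the trace series are dominated by a summable
  sequence times one Schwartz seminorm. This gives unconditional convergence and continuity at
  once.\<close>

lemma trace_tempered:
  fixes f :: "('a \<times> real) distr"
  assumes p: "p > 0" and s': "\<alpha> * (enn2real (1 / p) + crit_gap TYPE('a) p) <= s'"
    and f: "tempered_distribution f" and L: "\<And>k. L k >= 0"
      "\<And>k. k \<in> int_lattice ==> Lp_norm p (alpha_box \<eta> \<rho>1 \<alpha> k f) = ennreal (L k)"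
    and a: "\<And>k. a k = jbracket k powr (s' / (1 - \<alpha>)) * L k"
    and fin: "(\<integral>\<^sup>+k. ennreal (a k) \<partial>count_space int_lattice) < \<infinity>"
  shows "trace_converges \<eta> \<rho>1 \<alpha> f" and "tempered_distribution (trace_distr \<eta> \<rho>1 \<alpha> f)"
proof -
  obtain K where "pairing_const p s' K" using trace_term_pairing[OF p s'] by blast
  then have K: "K > 0" and pair: "pairing_const p s' K" unfolding pairing_const_def by blast+
  note pair = pair[unfolded pairing_const_def, THEN conjunct2, rule_format, OF f]
  obtain S where S: "S >= 0" "(\<integral>\<^sup>+k. ennreal (a k) \<partial>count_space int_lattice) = ennreal S"
    using fin by (cases "\<integral>\<^sup>+k. ennreal (a k) \<partial>count_space int_lattice") auto
  let ?t = "\<lambda>\<phi> k. LINT x|lborel. trace_term \<eta> \<rho>1 \<alpha> f k x * \<phi> x"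
  let ?T = "trace_distr \<eta> \<rho>1 \<alpha> f"
  have bound: "(\<integral>\<^sup>+k. ennreal (norm (?t \<phi> k)) \<partial>count_space int_lattice) <= ennreal (K * F * S)"
    if \<phi>: "\<phi> \<in> schwartz" and F: "F > 0" "\<And>y. norm (\<phi> y) <= F" "L1_mass \<phi> <= ennreal F" for \<phi> F
  proof -
    have \<phi>m: "\<phi> \<in> borel_measurable borel" using schwartz_rapid[OF \<phi>] unfolding rapid_def by simp
    have "(\<integral>\<^sup>+k. ennreal (norm (?t \<phi> k)) \<partial>count_space int_lattice)
      <= (\<integral>\<^sup>+k. ennreal (K * F) * ennreal (a k) \<partial>count_space int_lattice)"
    proof (rule nn_integral_mono)
      fix k :: "'a \<times> real" assume "k \<in> space (count_space int_lattice)"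
      then have k: "k \<in> int_lattice" by simp
      have "ennreal (norm (?t \<phi> k)) <= (\<integral>\<^sup>+y. ennreal (norm (trace_term \<eta> \<rho>1 \<alpha> f k y) * norm (\<phi> y)) \<partial>lborel)"
        using integral_norm_bound_ennreal[OF trace_term_integrable[OF f k \<phi>]] unfolding norm_mult .
      also have "... <= ennreal (K * F * (jbracket k powr (s' / (1 - \<alpha>)) * L k))"
        by (rule pair[OF k L(2)[OF k] F(1) L(1) \<phi>m F(2,3)])
      also have "... = ennreal (K * F) * ennreal (a k)"
        unfolding a using K F L(1)[of k] by (simp add: ennreal_mult)
      finally show "ennreal (norm (?t \<phi> k)) <= ennreal (K * F) * ennreal (a k)" .
    qed
    also have "... = ennreal (K * F) * ennreal S" unfolding S(2)[symmetric] by (rule nn_integral_cmult) simp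
    also have "... = ennreal (K * F * S)" using K F S by (simp add: ennreal_mult)
    finally show ?thesis .
  qed
  have sum: "?t \<phi> summable_on int_lattice" if \<phi>: "\<phi> \<in> schwartz" for \<phi>
  proof -
    \<comment> \<open>The summand 1 makes the bound positive, as the pairing estimate
      requires.\<close>
    let ?F = "(decay_mass TYPE('a) (real DIM('a) + 1) + 1) * schwartz_seminorm (DIM('a) + 1) \<phi> + 1"
    have "(\<integral>\<^sup>+k. ennreal (norm (?t \<phi> k)) \<partial>count_space int_lattice) <= ennreal (K * ?F * S)"
      using schwartz_mass[OF \<phi>] by (intro bound[OF \<phi>]) (auto intro: order_trans[OF _ ennreal_leI] add_increasing2)
    also have "... < \<infinity>" by simp
    finally show ?thesis by (rule summable_on_of_nn_integral(1))
  qed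
  show "trace_converges \<eta> \<rho>1 \<alpha> f"
    unfolding trace_converges_def using sum trace_term_integrable[OF f] by blast
  show "tempered_distribution ?T"
    unfolding tempered_distribution_def
  proof (intro conjI ballI allI exI)
    fix \<phi> \<psi> :: "'a => complex" assume \<phi>: "\<phi> \<in> schwartz" and \<psi>: "\<psi> \<in> schwartz"
    have "?T (\<lambda>x. \<phi> x + \<psi> x) = (\<Sum>\<^sub>\<infinity>k\<in>int_lattice. ?t \<phi> k + ?t \<psi> k)"
      unfolding trace_distr_def
      by (intro infsum_cong) (simp add: distrib_left trace_term_integrable[OF f _ \<phi>] trace_term_integrable[OF f _ \<psi>])
    then show "?T (\<lambda>x. \<phi> x + \<psi> x) = ?T \<phi> + ?T \<psi>"
      unfolding trace_distr_def by (simp only: infsum_add[OF sum[OF \<phi>] sum[OF \<psi>]])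
  next
    fix c and \<phi> :: "'a => complex" assume \<phi>: "\<phi> \<in> schwartz"
    have "?T (\<lambda>x. c * \<phi> x) = (\<Sum>\<^sub>\<infinity>k\<in>int_lattice. c * ?t \<phi> k)"
      unfolding trace_distr_def by (simp add: mult.left_commute)
    then show "?T (\<lambda>x. c * \<phi> x) = c * ?T \<phi>"
      unfolding trace_distr_def by (simp only: infsum_cmult_right[OF sum[OF \<phi>]])
  next
    fix \<phi> :: "'a => complex" assume \<phi>: "\<phi> \<in> schwartz"
    let ?F = "(decay_mass TYPE('a) (real DIM('a) + 1) + 1) * schwartz_seminorm (DIM('a) + 1) \<phi>"
    show "norm (?T \<phi>) <= (K * S * (decay_mass TYPE('a) (real DIM('a) + 1) + 1)) * schwartz_seminorm (DIM('a) + 1) \<phi>"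
    proof (cases "?F = 0")
      \<comment> \<open>A vanishing seminorm bound means \<phi> = 0. The pairing estimate, which
        asks for a positive F, covers the other case; here no 1 may be added, since the bound must
        be a multiple of the seminorm.\<close>
      case True
      then have "\<phi> y = 0" for y using schwartz_mass(1)[OF \<phi>, of y] unfolding True by simp
      then have "?T \<phi> = 0" unfolding trace_distr_def by simp
      then show ?thesis using True by (auto simp: mult.assoc)
    next
      case False
      then have F: "?F > 0" using schwartz_mass(3)[OF \<phi>] by linarith
      note b = bound[OF \<phi> F schwartz_mass(1,2)[OF \<phi>]]
      have "ennreal (norm (?T \<phi>)) <= (\<integral>\<^sup>+k. ennreal (norm (?t \<phi> k)) \<partial>count_space int_lattice)"
        unfolding trace_distr_def by (rule summable_on_of_nn_integral(2)) (rule order.strict_trans1[OF b], simp)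
      also note b
      finally have "norm (?T \<phi>) <= K * ?F * S" using K F S by (simp add: ennreal_le_iff)
      then show ?thesis by (simp only: ac_simps)
    qed
  qed
qed

text \<open>A frequency piece of the trace is the trace tested against a reflected translate of the
  l-th kernel, and the trace is defined as a series in k; the terms of that series are the
  pieces.\<close>

lemma box_trace_le:
  fixes f :: "('a \<times> real) distr" and l :: 'a
  assumes f: "tempered_distribution (trace_distr \<eta> \<rho>1 \<alpha> f)" and l: "l \<in> int_lattice"
  shows "ennreal (norm (alpha_box \<eta> \<rho>2 \<alpha> l (trace_distr \<eta> \<rho>1 \<alpha> f) x))
    <= (\<integral>\<^sup>+k. ennreal (norm (piece f k l x)) \<partial>count_space int_lattice)"
proof (cases "(\<integral>\<^sup>+k. ennreal (norm (piece f k l x)) \<partial>count_space int_lattice) < \<infinity>")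
  case True
  have "alpha_box \<eta> \<rho>2 \<alpha> l (trace_distr \<eta> \<rho>1 \<alpha> f) x = (\<Sum>\<^sub>\<infinity>k\<in>int_lattice. piece f k l x)"
    unfolding c2.alpha_box_distr_synth[OF \<eta> l adm2 f] distr_synth_def piece_def by (simp only: trace_distr_def)
  then show ?thesis using summable_on_of_nn_integral(2)[OF True] by simp
next
  case False
  then have "(\<integral>\<^sup>+k. ennreal (norm (piece f k l x)) \<partial>count_space int_lattice) = \<infinity>"
    by (simp add: not_less top_unique)
  then show ?thesis by simp
qed

lemma piece_Lp:
  assumes p: "p > 0"
  shows "\<exists>K>0. \<forall>(f :: ('a \<times> real) distr) k l L. tempered_distribution f --> k \<in> int_lattice --> l \<in> contact k -->
    L >= 0 --> Lp_norm p (alpha_box \<eta> \<rho>1 \<alpha> k f) = ennreal L -->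
    Lp_norm p (\<lambda>x. of_real (norm (piece f k l x))) <=
      ennreal (K * (jbracket k powr (\<beta> * (enn2real (1 / p) + crit_gap TYPE('a) p)) *
        jbracket l powr (- (\<beta> * crit_gap TYPE('a) p)) * L))"
proof -
  let ?e = "enn2real (1 / p)" and ?sp = "crit_gap TYPE('a) p"
  obtain C where C: "\<And>M. C M > 0" and rep: "\<And>k f. k \<in> int_lattice ==> tempered_distribution f ==>
    reproducible C (alpha_radius \<rho>1 \<alpha> k) (alpha_box \<eta> \<rho>1 \<alpha> k f :: 'a \<times> real => complex)"
    using c1.box_reproducible[OF \<eta> adm1] by blast
  obtain C2 where C2: "\<And>M. C2 M > 0" and ker: "\<And>l M (x::'a). l \<in> int_lattice ==> norm (synth (box_symbol \<eta> \<rho>2 \<alpha> l) x)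
    <= C2 M * alpha_radius \<rho>2 \<alpha> l ^ DIM('a) * (1 + alpha_radius \<rho>2 \<alpha> l * norm x) powr (- M)"
    using c2.box_kernel_decay[OF \<eta> adm2] by blast
  let ?C0 = "2 * real DIM('a) * (\<rho>1 + \<rho>2)"
  have C0: "?C0 >= 0" using c1.\<rho> c2.\<rho> by simp
  define b where "b = 2 powr (1 + \<beta>) * (1 + 2 * ?C0)"
  have b: "b > 0" proof -
    have "1 + 2 * ?C0 > 0" using C0 by linarith
    then show ?thesis unfolding b_def by (intro mult_pos_pos) auto
  qed
  \<comment> \<open>On contact the bracket of l is at most b times that of k, so this A bounds the
    ratio of the two radii, including their constants.\<close>
  define A where "A = max 1 (\<rho>2 * b powr \<beta> / \<rho>1)"
  have A: "A >= 1" unfolding A_def by simp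
  from trace_convolution_Lp[where C=C and ?C2.0=C2 and 'a='a, OF p C C2 A] obtain K0 where K0: "K0 > 0" and
    conv: "\<forall>R r (g::'a \<times> real => complex) (\<kappa>::'a => complex) (u::'a => complex).
    R > 0 --> r > 0 --> r <= A * R --> reproducible C R g --> \<kappa> \<in> borel_measurable borel -->
    kernel_bound C2 r \<kappa> -->
    Lp_norm p g < \<infinity> --> u \<in> borel_measurable borel -->
    (\<forall>x. ennreal (norm (u x)) <= trace_conv g \<kappa> x) -->
    Lp_norm p u <= ennreal (K0 * R powr ?e * (R / r) powr ?sp) * Lp_norm p g"
    by (elim exE conjE)
  let ?K = "K0 * (\<rho>1 powr ?e * (\<rho>1 / \<rho>2) powr ?sp)"
  have main: "Lp_norm p (\<lambda>x. of_real (norm (piece f k l x)))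
    <= ennreal (?K * (jbracket k powr (\<beta> * (?e + ?sp)) * jbracket l powr (- (\<beta> * ?sp)) * L))"
    if f: "tempered_distribution f" and k: "k \<in> int_lattice" and lk: "l \<in> contact k"
      and L: "L >= 0" "Lp_norm p (alpha_box \<eta> \<rho>1 \<alpha> k f) = ennreal L"
    for f :: "('a \<times> real) distr" and k l L
  proof -
    let ?R = "alpha_radius \<rho>1 \<alpha> k" and ?r = "alpha_radius \<rho>2 \<alpha> l"
    have l: "l \<in> int_lattice" using lk unfolding c2.touching_def by simp
    have R: "?R > 0" by (rule c1.radius_pos)
    have r: "?r > 0" by (rule c2.radius_pos)
    have "jbracket l <= b * jbracket k"
      unfolding b_def using c2.touching_bound[OF C0 jbracket_ge(1) norm_center_fst lk] .
    then have "jbracket l powr \<beta> <= (b * jbracket k) powr \<beta>"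
      using jbracket_pos[of l] c1.\<beta>_nonneg by (intro powr_mono2) auto
    then have "?r <= \<rho>2 * (b powr \<beta> * jbracket k powr \<beta>)"
      unfolding alpha_radius_def using c2.\<rho> b jbracket_pos[of k] by (simp add: powr_mult)
    also have "... = (\<rho>2 * b powr \<beta> / \<rho>1) * ?R" unfolding alpha_radius_def using c1.\<rho> by simp
    also have "... <= A * ?R" unfolding A_def using R by (intro mult_right_mono) auto
    finally have rR: "?r <= A * ?R" .
    have \<kappa>: "synth (box_symbol \<eta> \<rho>2 \<alpha> l) \<in> borel_measurable borel"
      by (rule synth_measurable[OF test_fun_cbounded[OF c2.test_fun_box_symbol[OF \<eta> l adm2]]])
    have um: "(\<lambda>x. complex_of_real (norm (piece f k l x))) \<in> borel_measurable borel"
      using piece_measurable[OF f k l] by measurable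
    have ule: "ennreal (norm (complex_of_real (norm (piece f k l x)))) <=
       (\<integral>\<^sup>+y. ennreal (norm (alpha_box \<eta> \<rho>1 \<alpha> k f (y, 0)) * norm (synth (box_symbol \<eta> \<rho>2 \<alpha> l) (x - y))) \<partial>lborel)" for x
      using piece_norm_le[OF f k l, of x] unfolding trace_term_def by simp
    have Lfin: "Lp_norm p (alpha_box \<eta> \<rho>1 \<alpha> k f) < \<infinity>" unfolding L(2) by simp
    have "Lp_norm p (\<lambda>x. of_real (norm (piece f k l x))) <= ennreal (K0 * ?R powr ?e * (?R / ?r) powr ?sp) * ennreal L"
      unfolding L(2)[symmetric] by (rule conv[rule_format, OF R r rR rep[OF k f] \<kappa> ker[OF l] Lfin um ule])
    also have "... = ennreal (K0 * ?R powr ?e * (?R / ?r) powr ?sp * L)" using K0 L(1) by (simp add: ennreal_mult)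
    also have "K0 * ?R powr ?e * (?R / ?r) powr ?sp * L = ?K * (jbracket k powr (\<beta> * (?e + ?sp)) * jbracket l powr (- (\<beta> * ?sp)) * L)"
    proof -
      \<comment> \<open>From here radii become powers of brackets: R_k gives the exponent
        \<beta>(1/p + s_p) for k, and R_l enters only through the ratio, with exponent -\<beta> s_p
        for l.\<close>
      have Re: "?R powr ?e = \<rho>1 powr ?e * jbracket k powr (\<beta> * ?e)"
        unfolding alpha_radius_def using c1.\<rho> jbracket_pos[of k] by (simp add: powr_mult powr_powr)
      have "?R / ?r = (\<rho>1 / \<rho>2) * (jbracket k powr \<beta> * jbracket l powr (- \<beta>))"
        unfolding alpha_radius_def by (simp add: powr_minus divide_inverse)
      moreover have "(x * (y * z)) powr t = x powr t * (y powr t * z powr t)" if "x > 0" "y > 0" "z > 0" for x y z t :: real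
        using that by (simp add: powr_mult)
      ultimately have "(?R / ?r) powr ?sp = (\<rho>1 / \<rho>2) powr ?sp * (jbracket k powr (\<beta> * ?sp) * jbracket l powr (- (\<beta> * ?sp)))"
        using c1.\<rho> c2.\<rho> jbracket_pos[of k] jbracket_pos[of l] by (simp only: divide_pos_pos powr_gt_zero powr_powr minus_mult_left)
      moreover have "jbracket k powr (\<beta> * (?e + ?sp)) = jbracket k powr (\<beta> * ?e) * jbracket k powr (\<beta> * ?sp)"
        unfolding distrib_left by (rule powr_add)
      ultimately show ?thesis unfolding Re by (simp only: ac_simps)
    qed
    finally show ?thesis .
  qed
  have "?K > 0" using K0 c1.\<rho> c2.\<rho> by simp
  then show ?thesis by (intro exI[of _ ?K] conjI allI impI main) simp_all
qed

text \<open>The pairing bound with L = 0, applied to the translated kernel, vanishes at every x. The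
  pointwise statement is what permits division by the coefficients in the summation lemma.\<close>

lemma piece_eq_0_of_Lp:
  fixes f :: "('a \<times> real) distr"
  assumes p: "p > 0" and f: "tempered_distribution f" and k: "k \<in> int_lattice" and l: "l \<in> int_lattice"
    and L: "Lp_norm p (alpha_box \<eta> \<rho>1 \<alpha> k f) = 0"
  shows "piece f k l x = 0"
proof -
  let ?s = "\<alpha> * (enn2real (1 / p) + crit_gap TYPE('a) p)"
  obtain K where "pairing_const p ?s K" using trace_term_pairing[OF p order_refl] by blast
  note K = this[unfolded pairing_const_def, THEN conjunct2, rule_format]
  define \<phi> where "\<phi> y = synth (box_symbol \<eta> \<rho>2 \<alpha> l) (x - y)" for y
  have \<phi>: "\<phi> \<in> schwartz" unfolding \<phi>_def by (rule reflected_synth_schwartz[OF c2.test_fun_box_symbol[OF \<eta> l adm2]])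
  then have \<phi>m: "\<phi> \<in> borel_measurable borel" using schwartz_rapid unfolding rapid_def by blast
  define F where "F = (decay_mass TYPE('a) (real DIM('a) + 1) + 1) * schwartz_seminorm (DIM('a) + 1) \<phi> + 1"
  have F: "F > 0" "\<And>y. norm (\<phi> y) <= F" "L1_mass \<phi> <= ennreal F"
    using schwartz_mass[OF \<phi>] unfolding F_def by (auto intro: order_trans[OF _ ennreal_leI] add_increasing2)
  have L0: "Lp_norm p (alpha_box \<eta> \<rho>1 \<alpha> k f) = ennreal 0" using L by simp
  have "ennreal (norm (piece f k l x)) <= (\<integral>\<^sup>+y. ennreal (norm (trace_term \<eta> \<rho>1 \<alpha> f k y) * norm (\<phi> y)) \<partial>lborel)"
    unfolding \<phi>_def by (rule piece_norm_le[OF f k l])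
  also have "... <= ennreal (K * F * (jbracket k powr (?s / (1 - \<alpha>)) * 0))"
    by (rule K[OF f k L0 F(1) order_refl \<phi>m F(2,3)])
  finally show ?thesis by simp
qed

end

text \<open>Separates analysis from exponents: any real r in (0, 1] below p and q and any s' with a
  column bound will do, so the cases of the loss stay outside.\<close>

lemma (in alpha_trace) trace_bound:
  fixes p q :: ennreal and s s' r C1 :: real
  defines "e \<equiv> enn2real (1 / p)" and "sp \<equiv> crit_gap TYPE('a) p"
  assumes p: "p > 0" and r: "0 < r" "r <= 1" "ennreal r <= p" "ennreal r <= q"
    and s': "\<alpha> * (e + sp) <= s'" and C1: "C1 > 0"
    and sum: "c2.exponent_bound TYPE('a) q (2 * real DIM('a) * (\<rho>1 + \<rho>2)) (\<beta> * (e + sp) - s' / (1 - \<alpha>)) (s / (1 - \<alpha>) - \<beta> * sp) C1"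
  shows "\<exists>C>0. \<forall>f :: ('a \<times> real) distr.
           f \<in> modulation_space \<eta> \<rho>1 \<alpha> s' p (ennreal r) -->
             trace_converges \<eta> \<rho>1 \<alpha> f \<and>
             trace_distr \<eta> \<rho>1 \<alpha> f \<in> modulation_space \<eta> \<rho>2 \<alpha> s p q \<and>
             modulation_norm \<eta> \<rho>2 \<alpha> s p q (trace_distr \<eta> \<rho>1 \<alpha> f)
               <= ennreal C * modulation_norm \<eta> \<rho>1 \<alpha> s' p (ennreal r) f"
proof -
  from piece_Lp[OF p] obtain K where K: "K > 0" and "\<forall>(f :: ('a \<times> real) distr) k l L. tempered_distribution f --> k \<in> int_lattice --> l \<in> contact k -->
    L >= 0 --> Lp_norm p (alpha_box \<eta> \<rho>1 \<alpha> k f) = ennreal L -->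
    Lp_norm p (\<lambda>x. of_real (norm (piece f k l x))) <=
      ennreal (K * (jbracket k powr (\<beta> * (e + sp)) * jbracket l powr (- (\<beta> * sp)) * L))"
    unfolding e_def sp_def by (elim exE conjE)
  note pieceLp = this(2)[rule_format]
  define C where "C = 4 powr (1 / r) * (K * C1)"
  have C: "C > 0" unfolding C_def using K C1 by simp
  \<comment> \<open>Matrix entry from weighted source to weighted target: the source weight of k is
    divided out because it sits in a k, and the target weight of l is included. It is 0 off contact,
    where the piece vanishes.\<close>
  define B where "B l k = (if l \<in> contact k then K * (jbracket k powr (\<beta> * (e + sp) - s' / (1 - \<alpha>)) * jbracket l powr (s / (1 - \<alpha>) - \<beta> * sp)) else 0)" for l :: 'a and k
  have B0: "B l k >= 0" for l k unfolding B_def using K by simp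
  have C0: "2 * real DIM('a) * (\<rho>1 + \<rho>2) >= 0" using c1.\<rho> c2.\<rho> by simp
  note bound = sum[unfolded c2.exponent_bound_def, rule_format, OF jbracket_ge(1) norm_center_fst]
  have Bq: "(\<integral>\<^sup>+l. ennreal (B l k powr enn2real q) \<partial>count_space int_lattice) <= ennreal ((K * C1) powr enn2real q)"
    if q: "q ~= \<infinity>" for k
  proof -
    let ?b = "\<lambda>l. jbracket k powr (\<beta> * (e + sp) - s' / (1 - \<alpha>)) * jbracket l powr (s / (1 - \<alpha>) - \<beta> * sp)"
    have fin: "finite (contact k)" by (rule c2.touching_finite[OF C0 jbracket_ge(1) norm_center_fst])
    have "(\<integral>\<^sup>+l. ennreal (B l k powr enn2real q) \<partial>count_space int_lattice) = (\<Sum>l\<in>contact k. ennreal (B l k powr enn2real q))"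
      using fin by (intro nn_integral_count_space') (auto simp: B_def c2.touching_def)
    also have "... = (\<Sum>l\<in>contact k. ennreal (K powr enn2real q * ?b l powr enn2real q))"
      using K by (intro sum.cong) (auto simp: B_def powr_mult)
    also have "... = ennreal (K powr enn2real q * (\<Sum>l\<in>contact k. ?b l powr enn2real q))"
      by (subst sum_ennreal) (auto simp: sum_distrib_left)
    also have "... <= ennreal (K powr enn2real q * C1 powr enn2real q)"
      by (intro ennreal_leI mult_left_mono conjunct1[OF bound, rule_format, OF q]) auto
    also have "... = ennreal ((K * C1) powr enn2real q)" using K C1 by (simp add: powr_mult)
    finally show ?thesis .
  qed
  have Binf: "B l k <= K * C1" if q: "q = \<infinity>" for l k
    using conjunct2[OF bound[of k], rule_format, OF q, of l] K C1 unfolding B_def by (auto intro: mult_left_mono)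
  have main: "trace_converges \<eta> \<rho>1 \<alpha> f \<and> trace_distr \<eta> \<rho>1 \<alpha> f \<in> modulation_space \<eta> \<rho>2 \<alpha> s p q \<and>
       modulation_norm \<eta> \<rho>2 \<alpha> s p q (trace_distr \<eta> \<rho>1 \<alpha> f) <= ennreal C * modulation_norm \<eta> \<rho>1 \<alpha> s' p (ennreal r) f"
    if f: "f \<in> modulation_space \<eta> \<rho>1 \<alpha> s' p (ennreal r)" for f :: "('a \<times> real) distr"
  proof -
    let ?T = "trace_distr \<eta> \<rho>1 \<alpha> f"
    have ft: "tempered_distribution f" and fm: "modulation_norm \<eta> \<rho>1 \<alpha> s' p (ennreal r) f < \<infinity>"
      using f unfolding modulation_space_def by auto
    obtain a L where a0: "\<And>k. a k >= 0" and L0: "\<And>k. L k >= 0"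
      and Lp: "\<And>k. k \<in> int_lattice ==> Lp_norm p (alpha_box \<eta> \<rho>1 \<alpha> k f) = ennreal (L k)"
      and a: "\<And>k. a k = jbracket k powr (s' / (1 - \<alpha>)) * L k"
      and fin: "(\<integral>\<^sup>+k. ennreal (a k powr r) \<partial>count_space int_lattice) < \<infinity>"
      and src: "modulation_norm \<eta> \<rho>1 \<alpha> s' p (ennreal r) f
        = ennreal_powr (\<integral>\<^sup>+k. ennreal (a k powr r) \<partial>count_space int_lattice) (1 / r)"
      by (rule source_coefficients[OF r(1) fm]) (rule that)
    have "ennreal_powr (\<integral>\<^sup>+k. ennreal (a k) \<partial>count_space int_lattice) r <= (\<integral>\<^sup>+k. ennreal (a k powr r) \<partial>count_space int_lattice)"
      by (rule power_subadditive[OF a0 r(1,2)])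
    then have "ennreal_powr (\<integral>\<^sup>+k. ennreal (a k) \<partial>count_space int_lattice) r < \<infinity>" using fin by (rule order.strict_trans1)
    then have fin1: "(\<integral>\<^sup>+k. ennreal (a k) \<partial>count_space int_lattice) < \<infinity>" by (simp only: ennreal_powr_less_top)
    have conv: "trace_converges \<eta> \<rho>1 \<alpha> f"
      by (rule trace_tempered(1)[where L = L and a = a, OF p s'[unfolded e_def sp_def] ft L0 Lp a fin1])
    have Tt: "tempered_distribution ?T"
      by (rule trace_tempered(2)[where L = L and a = a, OF p s'[unfolded e_def sp_def] ft L0 Lp a fin1])
    define N where "N l = ennreal (jbracket l powr (s / (1 - \<alpha>))) * Lp_norm p (alpha_box \<eta> \<rho>2 \<alpha> l ?T)" for l
    have N: "N l <= ennreal ((2 * \<Theta>) powr (1 / r))"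
      if l: "l \<in> int_lattice" and \<Theta>: "\<Theta> > 0" "(\<integral>\<^sup>+k. ennreal ((B l k * a k) powr r) \<partial>count_space int_lattice) <= ennreal \<Theta>" for l \<Theta>
    proof -
      define J where "J = jbracket l powr (s / (1 - \<alpha>))"
      have J: "J > 0" unfolding J_def using jbracket_pos[of l] by simp
      \<comment> \<open>Removing the target weight J leaves the bound for the L^p norm of a single
        piece.\<close>
      define \<nu> where "\<nu> k = (B l k * a k) / J" for k
      have \<nu>0: "\<nu> k >= 0" for k unfolding \<nu>_def using B0[of l k] a0[of k] J by simp
      have \<nu>_eq: "\<nu> k = K * (jbracket k powr (\<beta> * (e + sp)) * jbracket l powr (- (\<beta> * sp)) * L k)" if "l \<in> contact k" for k
      proof -
        have "jbracket k powr (\<beta> * (e + sp) - s' / (1 - \<alpha>)) * jbracket k powr (s' / (1 - \<alpha>)) = jbracket k powr (\<beta> * (e + sp))"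
          using jbracket_pos[of k] by (simp only: powr_add[symmetric]) simp
        moreover have "jbracket l powr (s / (1 - \<alpha>) - \<beta> * sp) = J * jbracket l powr (- (\<beta> * sp))"
          unfolding J_def using jbracket_pos[of l] by (simp only: powr_add[symmetric]) simp
        ultimately have "B l k * a k = J * (K * (jbracket k powr (\<beta> * (e + sp)) * jbracket l powr (- (\<beta> * sp)) * L k))"
          unfolding B_def a using that by (simp add: ac_simps)
        then show ?thesis unfolding \<nu>_def using J by simp
      qed
      have um: "(\<lambda>x. if k \<in> int_lattice then norm (piece f k l x) else 0) \<in> borel_measurable borel" for k
        using piece_measurable[OF ft _ l, of k] by (cases "k \<in> int_lattice") auto
      have Lpu: "Lp_norm p (\<lambda>x. of_real (if k \<in> int_lattice then norm (piece f k l x) else 0)) <= ennreal (\<nu> k)"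
        if k: "k \<in> int_lattice" for k
      proof (cases "l \<in> contact k")
        case True
        show ?thesis using pieceLp[OF ft k True L0 Lp[OF k]] k unfolding \<nu>_eq[OF True] by simp
      next
        case False
        have "esssup lborel (\<lambda>x::'a. 0 :: ennreal) <= 0" by (rule esssup_I) simp_all
        then have "Lp_norm p (\<lambda>x::'a. 0) = 0" unfolding Lp_norm_def by simp
        then show ?thesis using piece_eq_0[OF ft k l False] k by simp
      qed
      have zero: "(if k \<in> int_lattice then norm (piece f k l x) else 0) = 0" if k: "k \<in> int_lattice" and "\<nu> k = 0" for k x
      proof (cases "l \<in> contact k")
        case True
        then have "L k = 0"
          using \<open>\<nu> k = 0\<close> K jbracket_pos[of k] jbracket_pos[of l] unfolding \<nu>_eq[OF True] by simp
        then have "Lp_norm p (alpha_box \<eta> \<rho>1 \<alpha> k f) = 0" using Lp[OF k] by simp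
        from piece_eq_0_of_Lp[OF p ft k l this] show ?thesis by simp
      qed (use piece_eq_0[OF ft k l] in simp)
      have Um: "alpha_box \<eta> \<rho>2 \<alpha> l ?T \<in> borel_measurable borel"
        unfolding c2.alpha_box_distr_synth[OF \<eta> l adm2 Tt]
        by (rule borel_measurable_continuous_onI[OF distr_synth_continuous[OF Tt c2.test_fun_box_symbol[OF \<eta> l adm2]]])
      have U: "ennreal (norm (alpha_box \<eta> \<rho>2 \<alpha> l ?T x))
          <= (\<integral>\<^sup>+k. ennreal (if k \<in> int_lattice then norm (piece f k l x) else 0) \<partial>count_space int_lattice)" for x
      proof -
        have "(\<integral>\<^sup>+k. ennreal (if k \<in> int_lattice then norm (piece f k l x) else 0) \<partial>count_space int_lattice)
          = (\<integral>\<^sup>+k. ennreal (norm (piece f k l x)) \<partial>count_space int_lattice)"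
          by (intro nn_integral_cong) simp
        then show ?thesis using box_trace_le[OF Tt l] by simp
      qed
      define \<Theta>' where "\<Theta>' = \<Theta> / J powr r"
      have \<Theta>': "\<Theta>' > 0" unfolding \<Theta>'_def using \<Theta> J by simp
      have "(\<integral>\<^sup>+k. ennreal (\<nu> k powr r) \<partial>count_space int_lattice)
          = (\<integral>\<^sup>+k. ennreal (1 / J powr r) * ennreal ((B l k * a k) powr r) \<partial>count_space int_lattice)"
        using B0 a0 J by (intro nn_integral_cong) (simp add: \<nu>_def powr_divide ennreal_mult[symmetric])
      also have "... = ennreal (1 / J powr r) * (\<integral>\<^sup>+k. ennreal ((B l k * a k) powr r) \<partial>count_space int_lattice)"
        by (rule nn_integral_cmult) simp
      also have "... <= ennreal (1 / J powr r) * ennreal \<Theta>" by (intro mult_left_mono \<Theta>) simp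
      also have "... = ennreal \<Theta>'" unfolding \<Theta>'_def using \<Theta> by (simp add: ennreal_mult[symmetric])
      finally have \<Theta>'2: "(\<integral>\<^sup>+k. ennreal (\<nu> k powr r) \<partial>count_space int_lattice) <= ennreal \<Theta>'" .
      have "Lp_norm p (alpha_box \<eta> \<rho>2 \<alpha> l ?T) <= ennreal ((2 * \<Theta>') powr (1 / r))"
        by (rule Lp_norm_sum_bound[OF countable_int_lattice r(1,2,3) um _ \<nu>0 Lpu zero Um U \<Theta>' \<Theta>'2]) simp_all
      then have "N l <= ennreal J * ennreal ((2 * \<Theta>') powr (1 / r))" unfolding N_def J_def by (rule mult_left_mono) simp
      also have "... = ennreal (J * (2 * \<Theta>') powr (1 / r))" using J by (simp add: ennreal_mult)
      also have "J * (2 * \<Theta>') powr (1 / r) = (2 * \<Theta>) powr (1 / r)"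
        unfolding \<Theta>'_def using J \<Theta>(1) r(1) by (simp add: powr_divide powr_powr)
      finally show ?thesis .
    qed
    have bound: "modulation_norm \<eta> \<rho>2 \<alpha> s p q ?T <= ennreal (C * A powr (1 / r))"
      if A: "A > 0" "(\<integral>\<^sup>+k. ennreal (a k powr r) \<partial>count_space int_lattice) <= ennreal A" for A
    proof -
      have "K * C1 > 0" using K C1 by simp
      from lq_norm_sum_bound[OF countable_int_lattice countable_int_lattice r(1,2,4) a0 B0 A N this Bq Binf]
      show ?thesis unfolding modulation_norm_eq N_def[symmetric] C_def .
    qed
    obtain A0 where A0: "A0 >= 0" "(\<integral>\<^sup>+k. ennreal (a k powr r) \<partial>count_space int_lattice) = ennreal A0"
      using fin by (cases "\<integral>\<^sup>+k. ennreal (a k powr r) \<partial>count_space int_lattice") auto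
    have "modulation_norm \<eta> \<rho>2 \<alpha> s p q ?T <= ennreal (C * A0 powr (1 / r))"
    proof (cases "A0 = 0")
      case False
      then show ?thesis using A0 by (intro bound) auto
    next
      case True
      \<comment> \<open>If all source coefficients vanish, the bound is applied with A = (\<delta> /
        C)^r, so that the target norm is at most \<delta> for every \<delta> > 0.\<close>
      have "modulation_norm \<eta> \<rho>2 \<alpha> s p q ?T <= 0 + ennreal \<delta>" if \<delta>: "\<delta> > 0" for \<delta>
      proof -
        have "modulation_norm \<eta> \<rho>2 \<alpha> s p q ?T <= ennreal (C * ((\<delta> / C) powr r) powr (1 / r))"
          using \<delta> C A0 True by (intro bound) auto
        also have "C * ((\<delta> / C) powr r) powr (1 / r) = \<delta>" using \<delta> C r(1) by (simp add: powr_powr)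
        finally show ?thesis by simp
      qed
      then have "modulation_norm \<eta> \<rho>2 \<alpha> s p q ?T <= 0" by (rule ennreal_le_epsilon)
      then show ?thesis by simp
    qed
    also have "... = ennreal C * modulation_norm \<eta> \<rho>1 \<alpha> s' p (ennreal r) f"
      unfolding src A0(2) using C A0(1) by (simp add: ennreal_powr_ennreal ennreal_mult)
    finally have le: "modulation_norm \<eta> \<rho>2 \<alpha> s p q ?T <= ennreal C * modulation_norm \<eta> \<rho>1 \<alpha> s' p (ennreal r) f" .
    also have "... < \<infinity>" using fm by (simp add: ennreal_mult_less_top)
    finally have "?T \<in> modulation_space \<eta> \<rho>2 \<alpha> s p q" unfolding modulation_space_def using Tt by simp
    with conv le show ?thesis by blast
  qed
  show ?thesis by (intro exI[of _ C] conjI[OF C] allI impI main)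
qed

theorem mainTheorem6:
  fixes n :: nat
    and \<alpha> s \<epsilon> \<rho>1 \<rho>2 :: real
    and p q :: ennreal
    and \<eta> :: "real \<Rightarrow> real"
  assumes "n \<ge> 2" and "DIM('a::euclidean_space) = n - 1"
    and "0 \<le> \<alpha>" and "\<alpha> < 1"
    and "0 < p" and "0 < q"
    and "s < \<alpha> * (real n - 1) * enn2real (1 / q) + \<alpha> * s_crit n p"
    and "\<epsilon> > 0"
    and "cutoff \<eta>"
    and "admissible_radius TYPE('a \<times> real) \<rho>1 \<alpha>"
    and "admissible_radius TYPE('a) \<rho>2 \<alpha>"
  shows "\<exists>C>0. \<forall>f :: ('a \<times> real) distr.
           f \<in> modulation_space \<eta> \<rho>1 \<alpha> (s + trace_loss n \<alpha> p q s \<epsilon>) p (min p (min q 1)) \<longrightarrow>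
             trace_converges \<eta> \<rho>1 \<alpha> f \<and>
             trace_distr \<eta> \<rho>1 \<alpha> f \<in> modulation_space \<eta> \<rho>2 \<alpha> s p q \<and>
             modulation_norm \<eta> \<rho>2 \<alpha> s p q (trace_distr \<eta> \<rho>1 \<alpha> f)
               \<le> ennreal C * modulation_norm \<eta> \<rho>1 \<alpha> (s + trace_loss n \<alpha> p q s \<epsilon>) p (min p (min q 1)) f"
proof -
  interpret alpha_trace \<eta> \<rho>1 \<rho>2 \<alpha> "TYPE('a)"
    by (rule alpha_trace.intro[OF assms(9,3,4,10,11)])
  have "real DIM('a) = real n - 1" using assms(1,2) by simp
  then have sp: "crit_gap TYPE('a) p = s_crit n p" unfolding s_crit_def by simp
  \<comment> \<open>The third index is finite because of the 1 in the minimum and positive because p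
    and q are, hence a real number to which the r-triangle inequality applies.\<close>
  define r where "r = enn2real (min p (min q 1))"
  have "min p (min q 1) <= 1" by (meson min.cobounded2 order_trans)
  then have "min p (min q 1) < top" using ennreal_one_less_top by (rule order.strict_trans1)
  then have r_eq: "ennreal r = min p (min q 1)" unfolding r_def by simp
  have "0 < ennreal r" unfolding r_eq using assms(5,6) by simp
  then have r0: "0 < r" by simp
  have r1: "r <= 1" using \<open>min p (min q 1) <= 1\<close> unfolding r_eq[symmetric] by simp
  have rp: "ennreal r <= p" "ennreal r <= q" unfolding r_eq by (auto intro: min.coboundedI1 min.coboundedI2)
  have C0: "2 * real DIM('a) * (\<rho>1 + \<rho>2) >= 0" using c1.\<rho> c2.\<rho> by simp
  note ex = c2.exponent_sum[OF assms(2,1,6,8) C0 refl refl assms(7) refl, unfolded sp[symmetric]]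
  show ?thesis
    unfolding r_eq[symmetric]
    using ex(2) by (elim exE conjE) (rule trace_bound[OF assms(5) r0 r1 rp ex(1)])
qed

end
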